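(* Let $b\in\mathbb R$, $a>0$ with $2a(a+b)=1$. Let $X=X_1(z_1)\cdots X_n(z_n)$ be the product of fields $X_j\in\mathcal F_{(b)}=\mathcal F_{(b)}(\mathbb H,\infty)$ at distinct points $z_j\in\mathbb H$. Then, in the identity chart of $\mathbb H$, for $\xi\in\mathbb R$, $$\frac1{2a^2}\,\partial_\xi^2\,\widehat{\mathbf E}_\xi X=\widehat{\mathbf E}_\xi[\mathcal L_{v_\xi}X],\qquad v_\xi(z)=\frac1{\xi-z},$$ where $\partial_\xi=\partial+\bar\partial$ is differentiation with respect to the real variable $\xi$.
   Context: Correlation functionals. Let $D=\mathbb H$, $q=\infty$, $G(\zeta,z)=\log|(\zeta-\bar z)/(\zeta-z)|$, and let $\Phi_{(0)}$ be the (formal) Gaussian free field. Functionals are finite linear combinations of commutative Wick products $\odot$ of $1$, of $\partial^j\bar\partial^k\Phi_{(0)}(z)$ and of $e^{\odot\alpha\Phi_{(0)}(z)}=\sum_n\alpha^n\Phi_{(0)}^{\odot n}(z)/n!$; the points $z$ are the nodes. $\mathbf E$ is linear, $\mathbf E[1]=1$, and $\mathbf E$ of a Wick product of one or more derivatives of $\Phi_{(0)}$ is $0$. The product of functionals with disjoint node sets is given by Wick's formula: the sum over all partial pairings of the factors with no pair inside one functional, of the product of pair expectations $\mathbf E[\partial^j\bar\partial^k\Phi_{(0)}(\zeta)\partial^l\bar\partial^m\Phi_{(0)}(z)]=2\,\partial_\zeta^j\bar\partial_\zeta^k\partial_z^l\bar\partial_z^mG(\zeta,z)$ times the Wick product of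 unpaired factors. Equalities and limits are understood in correlations with functionals having other nodes. Fields. A non-random conformal field assigns to each local chart $\phi$ a smooth function $(f\|\phi)$. A Fock space field is a linear combination, with non-random conformal fields as coefficients, of Wick products of derivatives (in local charts) and Wick exponentials of $\Phi_{(0)}$. The operator product expansion of $X$ and $Y$ is the asymptotic expansion of $X(\zeta)Y(z)$ as $\zeta\to z$ (in correlations, same chart at both points, in powers of $\zeta-z$, $\bar\zeta-\bar z$, $|\zeta-z|$ and of $\log|\zeta-z|$); the OPE product $X*Y$ is the coefficient of $1$ (when defined). With $w:(\mathbb H,\infty)\to(\mathbb H,\infty)$ conformal, written $w\circ\phi^{-1}$ in a chart $\phi$, put $\Phi_{(b)}=\Phi_{(0)}-2b\arg w'$. $\mathcal F_{(b)}$ is the algebra over $\mathbb C$ spanned by the generators $1$, $\partial^j\bar\partial^k\Phi_{(b)}$, $\partial^j\bar\partial^ke^{*\alpha\Phi_{(b)}}$ ($\alpha\in\mathbb C$, $e^{*\alpha\Phi_{(b)}}=\sum_n\alpha^n\Phi_{(b)}^{*n}/n!$) under OPE multiplication. Lie derivative. For a vector field ($(-1,0)$-differential) $v$ holomorphic near the nodes with local flow $\psi_t$, $\mathcal L_v[X_1(z_1)\cdots X_n(z_n)]=\frac d{dt}|_{t=0}\prod_j(X_j\,\|\,\phi_j\circ\psi_{-t})(z_j)$, where $\phi_j$ is the chart used at the $j$-th node. Insertion. For $\xi\in\mathbb R$ let $\Phi^+_{(0)}(\xi)=\int_{-\infty}^{\xi}\partial\Phi_{(0)}(\zeta)\,d\zeta$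 along the half-line $(-\infty,\xi)$; its correlation with the field is $\mathbf E[\Phi^+_{(0)}(\xi)\Phi_{(0)}(z)]=\log\frac{\xi-\bar z}{\xi-z}=-2i\arg(z-\xi)$, $\arg\in(0,\pi)$. Define $$\widehat{\mathbf E}_\xi X=\mathbf E\big[e^{\odot ia\Phi^+_{(0)}(\xi)}X\big],$$ computed by Wick's formula. Equivalently, $\widehat{\mathbf E}_\xi X$ is the expectation of the product obtained from $X$ (as a functional) by replacing $\Phi_{(0)}(z)$ by $\Phi_{(0)}(z)+2a\arg(z-\xi)$, and correspondingly for derivatives and Wick products. *)

theory Defs
  imports "HOL-Complex_Analysis.Complex_Analysis" "HOL-Library.Poly_Mapping" "HOL-Library.Multiset"
begin

section \<open>Wirtinger derivatives and smooth functions\<close>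

definition dz :: "(complex \<Rightarrow> complex) \<Rightarrow> complex \<Rightarrow> complex" where
  "dz f z = (frechet_derivative f (at z) 1 - \<i> * frechet_derivative f (at z) \<i>) / 2"

definition dzbar :: "(complex \<Rightarrow> complex) \<Rightarrow> complex \<Rightarrow> complex" where
  "dzbar f z = (frechet_derivative f (at z) 1 + \<i> * frechet_derivative f (at z) \<i>) / 2"

definition wirt :: "nat \<Rightarrow> nat \<Rightarrow> (complex \<Rightarrow> complex) \<Rightarrow> complex \<Rightarrow> complex" where
  "wirt j k f = (dz ^^ j) ((dzbar ^^ k) f)"

text \<open>For open \<open>S\<close> this is \<open>C\<^sup>\<infinity>\<close> in the real sense.\<close>

definition smooth_fun_on :: "complex set \<Rightarrow> (complex \<Rightarrow> complex) \<Rightarrow> bool" where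
  "smooth_fun_on S f \<longleftrightarrow> (\<forall>j k. \<forall>z\<in>S. wirt j k f differentiable (at z))"


section \<open>Correlation functionals\<close>

definition upper_half_plane :: "complex set" ("\<H>") where
  "\<H> = {z. Im z > 0}"

definition green :: "complex \<Rightarrow> complex \<Rightarrow> real" where
  "green \<zeta> z = ln (cmod ((\<zeta> - cnj z) / (\<zeta> - z)))"

text \<open>
  \<open>Jet h j k \<zeta>\<close> stands for the derivative of type \<open>(j, k)\<close> at \<open>\<zeta>\<close> of the composition of the
  Gaussian free field with \<open>h\<close>. With \<open>h = id\<close> this is the derivative of the field at the node \<open>\<zeta>\<close>
  itself; with \<open>h = \<phi>\<^sup>-\<^sup>1\<close> it is the derivative in the local chart \<open>\<phi>\<close>, with node \<open>h \<zeta>\<close>.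
  \<open>Bdry \<xi>\<close> is the boundary insertion at \<open>\<xi>\<close>, the integral of the current along \<open>(-\<infinity>, \<xi>)\<close>.
\<close>

datatype gvar = Jet "complex \<Rightarrow> complex" nat nat complex | Bdry real

text \<open>
  Pair expectations. The insertion is never paired with itself, so the last value is irrelevant.
  \<open>Arg\<close> takes values in \<open>(0, pi)\<close> on the upper half-plane.
\<close>

fun pair_exp :: "gvar \<Rightarrow> gvar \<Rightarrow> complex" where
  "pair_exp (Jet h j k \<zeta>) (Jet h' l m z) =
     2 * wirt j k (\<lambda>x. wirt l m (\<lambda>y. complex_of_real (green (h x) (h' y))) z) \<zeta>"
| "pair_exp (Jet h j k \<zeta>) (Bdry \<xi>) =
     wirt j k (\<lambda>x. - 2 * \<i> * complex_of_real (Arg (h x - complex_of_real \<xi>))) \<zeta>"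
| "pair_exp (Bdry \<xi>) (Jet h j k \<zeta>) =
     wirt j k (\<lambda>x. - 2 * \<i> * complex_of_real (Arg (h x - complex_of_real \<xi>))) \<zeta>"
| "pair_exp (Bdry \<xi>) (Bdry \<eta>) = 0"

text \<open>
  A Wick monomial \<open>(A, \<alpha>)\<close> is the Wick product of all members of \<open>A\<close> (with multiplicity) and of the
  Wick exponentials of \<open>\<alpha>(g) g\<close> for \<open>g \<in> Poly_Mapping.keys \<alpha>\<close>. Multiplying Wick monomials adds both components,
  so functionals form a monoid algebra: \<open>+\<close> and \<open>*\<close> of \<open>functional\<close> are the sum and
  the Wick product (not the product of functionals).
\<close>

type_synonym wmono = "gvar multiset \<times> (gvar \<Rightarrow>\<^sub>0 complex)"
type_synonym functional = "wmono \<Rightarrow>\<^sub>0 complex"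

definition scal :: "complex \<Rightarrow> functional" where
  "scal c = Poly_Mapping.single 0 c"

definition gauss :: "gvar \<Rightarrow> functional" where
  "gauss g = Poly_Mapping.single ({#g#}, 0) 1"

definition wick_exp :: "complex \<Rightarrow> gvar \<Rightarrow> functional" where
  "wick_exp \<alpha> g = Poly_Mapping.single (0, Poly_Mapping.single g \<alpha>) 1"

text \<open>\<open>functional_on S F\<close>: \<open>F\<close> is a correlation functional all of whose nodes lie in \<open>S\<close>.\<close>

definition functional_on :: "complex set \<Rightarrow> functional \<Rightarrow> bool" where
  "functional_on S F \<longleftrightarrow> (\<forall>p\<in>Poly_Mapping.keys F.
     (\<forall>g\<in>#fst p. \<exists>j k z. z \<in> S \<and> g = Jet id j k z) \<and>
     (\<forall>g\<in>Poly_Mapping.keys (snd p). \<exists>z\<in>S. g = Jet id 0 0 z))"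

definition expect :: "functional \<Rightarrow> complex" where
  "expect F = (\<Sum>p\<in>Poly_Mapping.keys F. if fst p = {#} then Poly_Mapping.lookup F p else 0)"


subsection \<open>The product of functionals (Wick's formula)\<close>

definition partial_pairings :: "'i set \<Rightarrow> 'j set \<Rightarrow> ('i \<times> 'j) set set" where
  "partial_pairings I J = {P. P \<subseteq> I \<times> J \<and> inj_on fst P \<and> inj_on snd P}"

definition enumeration :: "'a multiset \<Rightarrow> 'a list" where
  "enumeration A = (SOME xs. mset xs = A)"

definition exponent_sum :: "(gvar \<Rightarrow>\<^sub>0 complex) \<Rightarrow> (gvar \<Rightarrow> complex) \<Rightarrow> complex" where
  "exponent_sum \<alpha> f = (\<Sum>g\<in>Poly_Mapping.keys \<alpha>. Poly_Mapping.lookup \<alpha> g * f g)"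

text \<open>
  Wick's formula for two Wick monomials. The sum is over the partial pairings \<open>P\<close> between the
  factors \<open>xs\<close> of the first and the factors \<open>ys\<close> of the second one. The exponentials, being power
  series of Wick powers, are summed in closed form. A factor \<open>x\<close> outside \<open>P\<close> stays unpaired or is
  paired with one of the \<open>n\<close> factors \<open>g\<close> of a term \<open>\<beta>\<^sup>n g\<^sup>n / n!\<close> of an exponential, which gives
  \<open>x + \<beta> E[x g]\<close> times the same exponential; pairing \<open>k\<close> factors of the exponential of \<open>\<alpha> g\<close> with \<open>k\<close>
  factors of that of \<open>\<beta> g'\<close> contributes \<open>(\<alpha> \<beta> E[g g'])\<^sup>k / k!\<close>, and the sum over \<open>k\<close> is the leading
  exponential below. Theorem \<open>wick_exp_sums\<close> below confirms that, in correlations, the Wick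
  exponential is the sum of its power series.
\<close>

definition wick_formula :: "wmono \<Rightarrow> wmono \<Rightarrow> functional" where
  "wick_formula p q =
    (let xs = enumeration (fst p); ys = enumeration (fst q); \<alpha> = snd p; \<beta> = snd q;
         I = {..<length xs}; J = {..<length ys}
     in scal (exp (exponent_sum \<alpha> (\<lambda>g. exponent_sum \<beta> (pair_exp g)))) * Poly_Mapping.single (0, \<alpha> + \<beta>) 1 *
        (\<Sum>P\<in>partial_pairings I J.
           scal (\<Prod>(i, j)\<in>P. pair_exp (xs ! i) (ys ! j)) *
           (\<Prod>i\<in>I - fst ` P. gauss (xs ! i) + scal (exponent_sum \<beta> (pair_exp (xs ! i)))) *
           (\<Prod>j\<in>J - snd ` P. gauss (ys ! j) + scal (exponent_sum \<alpha> (\<lambda>g. pair_exp g (ys ! j))))))"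

definition fprod :: "functional \<Rightarrow> functional \<Rightarrow> functional" (infixr "\<star>" 70) where
  "F \<star> G = (\<Sum>p\<in>Poly_Mapping.keys F. \<Sum>q\<in>Poly_Mapping.keys G.
     scal (Poly_Mapping.lookup F p * Poly_Mapping.lookup G q) * wick_formula p q)"

definition fprod_list :: "functional list \<Rightarrow> functional" where
  "fprod_list Fs = foldr (\<star>) Fs 1"

definition insertion_expect :: "real \<Rightarrow> real \<Rightarrow> functional \<Rightarrow> complex" where
  "insertion_expect a \<xi> F = expect (wick_exp (\<i> * complex_of_real a) (Bdry \<xi>) \<star> F)"


subsection \<open>Wick exponentials as power series\<close>

definition pairing_sum ::
  "('i \<Rightarrow> 'j \<Rightarrow> complex) \<Rightarrow> ('i \<Rightarrow> complex) \<Rightarrow> ('j \<Rightarrow> complex) \<Rightarrow> 'i set \<Rightarrow> 'j set \<Rightarrow> complex" where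
  "pairing_sum K c d I J = (\<Sum>P\<in>partial_pairings I J.
     (\<Prod>(i, j)\<in>P. K i j) * (\<Prod>i\<in>I - fst ` P. c i) * (\<Prod>j\<in>J - snd ` P. d j))"

lemma finite_partial_pairings:
  assumes "finite I" "finite J"
  shows "finite (partial_pairings I J)"
  by (rule finite_subset[of _ "Pow (I \<times> J)"]) (use assms in \<open>auto simp: partial_pairings_def\<close>)

lemma partial_pairings_empty [simp]: "partial_pairings {} J = {{}}"
  by (auto simp: partial_pairings_def)

lemma partial_pairings_remove:
  "partial_pairings I (J - {j}) = {P \<in> partial_pairings I J. j \<notin> snd ` P}"
proof -
  have "P \<subseteq> I \<times> (J - {j}) \<longleftrightarrow> P \<subseteq> I \<times> J \<and> j \<notin> snd ` P" for P
    by force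
  then show ?thesis by (auto simp: partial_pairings_def)
qed

lemma partial_pairings_insert:
  assumes "i \<notin> I"
  shows "partial_pairings (insert i I) J =
           partial_pairings I J \<union> (\<Union>j\<in>J. insert (i, j) ` partial_pairings I (J - {j}))"
    (is "?L = ?R")
proof (intro equalityI subsetI)
  fix P assume P: "P \<in> ?L"
  show "P \<in> ?R"
  proof (cases "i \<in> fst ` P")
    case False
    then have "P \<subseteq> I \<times> J \<longleftrightarrow> P \<subseteq> insert i I \<times> J" by force
    then have "P \<in> partial_pairings I J" using P by (simp add: partial_pairings_def)
    then show ?thesis by blast
  next
    case True
    then obtain j where j: "(i, j) \<in> P" by force
    define Q where "Q = P - {(i, j)}"
    have inj: "inj_on fst P" "inj_on snd P" and sub: "P \<subseteq> insert i I \<times> J"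
      using P by (auto simp: partial_pairings_def)
    have "Q \<subseteq> I \<times> (J - {j})"
    proof
      fix x assume x: "x \<in> Q"
      then have "x \<in> P" "x \<noteq> (i, j)" by (auto simp: Q_def)
      then have "fst x \<noteq> i" "snd x \<noteq> j"
        using inj_onD[OF inj(1), of x "(i, j)"] inj_onD[OF inj(2), of x "(i, j)"] j by auto
      then show "x \<in> I \<times> (J - {j})" using \<open>x \<in> P\<close> sub by (cases x) auto
    qed
    then have "Q \<in> partial_pairings I (J - {j})"
      using inj by (auto simp: partial_pairings_def Q_def intro: inj_on_diff)
    moreover have "P = insert (i, j) Q" "j \<in> J" using j sub by (auto simp: Q_def)
    ultimately show ?thesis by blast
  qed
next
  fix P assume "P \<in> ?R"
  then consider "P \<in> partial_pairings I J"
    | j Q where "j \<in> J" "Q \<in> partial_pairings I (J - {j})" "P = insert (i, j) Q" by blast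
  then show "P \<in> ?L"
  proof cases
    case 1
    then show ?thesis by (auto simp: partial_pairings_def)
  next
    case 2
    then have "Q \<subseteq> I \<times> (J - {j})" by (auto simp: partial_pairings_def)
    then have "i \<notin> fst ` Q" "j \<notin> snd ` Q" using assms by auto
    with 2 show ?thesis by (auto simp: partial_pairings_def)
  qed
qed

lemma pairing_sum_insert:
  assumes "finite I" "finite J" "i \<notin> I"
  shows "pairing_sum K c d (insert i I) J =
           c i * pairing_sum K c d I J + (\<Sum>j\<in>J. K i j * pairing_sum K c d I (J - {j}))"
proof -
  let ?f = "\<lambda>I J P. (\<Prod>(i, j)\<in>P. K i j) * (\<Prod>i\<in>I - fst ` P. c i) * (\<Prod>j\<in>J - snd ` P. d j)"
  let ?p = "partial_pairings"
  have fin: "finite (?p I J')" if "J' \<subseteq> J" for J'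
    using finite_partial_pairings[OF assms(1)] assms(2) that finite_subset by blast
  have notin: "i \<notin> fst ` P" if "P \<in> ?p I J'" for P J'
    using that assms(3) by (auto simp: partial_pairings_def)
  have disj1: "?p I J \<inter> (\<Union>j\<in>J. insert (i, j) ` ?p I (J - {j})) = {}"
    using notin by (fastforce simp: image_iff)
  have disj2: "insert (i, j) ` ?p I (J - {j}) \<inter> insert (i, j') ` ?p I (J - {j'}) = {}"
    if "j \<noteq> j'" for j j'
    using notin that by (fastforce simp: image_iff)
  have inj: "inj_on (insert (i, j)) (?p I (J - {j}))" for j
  proof (rule inj_onI)
    fix P Q assume "P \<in> ?p I (J - {j})" "Q \<in> ?p I (J - {j})" "insert (i, j) P = insert (i, j) Q"
    moreover from this have "(i, j) \<notin> P" "(i, j) \<notin> Q" using notin by force+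
    ultimately show "P = Q" by (meson insert_ident)
  qed
  have e1: "?f (insert i I) J P = c i * ?f I J P" if P: "P \<in> ?p I J" for P
  proof -
    have "insert i I - fst ` P = insert i (I - fst ` P)" using notin[OF P] by auto
    then show ?thesis using assms by simp
  qed
  have e2: "?f (insert i I) J (insert (i, j) P) = K i j * ?f I (J - {j}) P"
    if P: "P \<in> ?p I (J - {j})" for P j
  proof -
    have "finite P" using P assms finite_subset by (fastforce simp: partial_pairings_def)
    moreover have "(i, j) \<notin> P" using notin[OF P] by force
    moreover have "insert i I - fst ` insert (i, j) P = I - fst ` P" using notin[OF P] assms(3) by auto
    moreover have "J - snd ` insert (i, j) P = J - {j} - snd ` P" by auto
    ultimately show ?thesis by simp
  qed
  have "pairing_sum K c d (insert i I) J =
          sum (?f (insert i I) J) (?p I J) +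
          sum (?f (insert i I) J) (\<Union>j\<in>J. insert (i, j) ` ?p I (J - {j}))"
    unfolding pairing_sum_def partial_pairings_insert[OF assms(3)]
    by (rule sum.union_disjoint) (use fin assms disj1 in auto)
  also have "sum (?f (insert i I) J) (?p I J) = c i * pairing_sum K c d I J"
    unfolding pairing_sum_def sum_distrib_left by (rule sum.cong[OF refl e1])
  also have "sum (?f (insert i I) J) (\<Union>j\<in>J. insert (i, j) ` ?p I (J - {j})) =
               (\<Sum>j\<in>J. sum (?f (insert i I) J) (insert (i, j) ` ?p I (J - {j})))"
    by (rule sum.UNION_disjoint) (use fin assms disj2 in auto)
  also have "\<dots> = (\<Sum>j\<in>J. K i j * pairing_sum K c d I (J - {j}))"
  proof (rule sum.cong[OF refl])
    fix j
    show "sum (?f (insert i I) J) (insert (i, j) ` ?p I (J - {j})) =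
            K i j * pairing_sum K c d I (J - {j})"
      unfolding sum.reindex[OF inj] o_def pairing_sum_def sum_distrib_left
      by (rule sum.cong[OF refl e2])
  qed
  finally show ?thesis .
qed

lemma pairing_sum_mset_cong:
  fixes x :: "'i \<Rightarrow> 'g" and x' :: "'k \<Rightarrow> 'g"
  assumes "finite I" "finite I'" "finite J"
    and "image_mset x (mset_set I) = image_mset x' (mset_set I')"
  shows "pairing_sum (\<lambda>i. K (x i)) (\<lambda>i. c (x i)) d I J =
           pairing_sum (\<lambda>i. K (x' i)) (\<lambda>i. c (x' i)) d I' J"
  using assms
proof (induction I arbitrary: I' J rule: finite_induct)
  case empty
  then have "I' = {}" by (auto simp: mset_set_empty_iff)
  then show ?case by (simp add: pairing_sum_def)
next
  case (insert i I)
  then have "x i \<in># image_mset x' (mset_set I')"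
    by (metis image_mset_add_mset mset_set.insert union_single_eq_member)
  then obtain i' where i': "i' \<in> I'" "x' i' = x i" using insert.prems by auto
  define I'' where "I'' = I' - {i'}"
  have I': "I' = insert i' I''" "i' \<notin> I''" "finite I''" using i' insert.prems by (auto simp: I''_def)
  have "image_mset x (mset_set I) = image_mset x' (mset_set I'')"
    using insert.prems insert.hyps I' i' by simp
  then have IH: "pairing_sum (\<lambda>i. K (x i)) (\<lambda>i. c (x i)) d I J' =
           pairing_sum (\<lambda>i. K (x' i)) (\<lambda>i. c (x' i)) d I'' J'" if "finite J'" for J'
    using insert.IH I' that by blast
  show ?case
    unfolding I'(1) pairing_sum_insert[OF insert.hyps(1) insert.prems(2) insert.hyps(2)]
      pairing_sum_insert[OF I'(3) insert.prems(2) I'(2)]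
    using IH insert.prems i' by simp
qed

lemma pairing_sum_has_field_derivative:
  fixes K :: "'i \<Rightarrow> 'j \<Rightarrow> complex" and I :: "'i set" and J :: "'j set"
  assumes "finite I" "finite J"
  shows "((\<lambda>t. pairing_sum K c (\<lambda>j. d j + t * e j) I J) has_field_derivative
           (\<Sum>j\<in>J. e j * pairing_sum K c (\<lambda>j. d j + t * e j) I (J - {j}))) (at t)"
proof -
  let ?p = "partial_pairings I J"
  let ?a = "\<lambda>P :: ('i \<times> 'j) set. (\<Prod>(i, j)\<in>P. K i j) * (\<Prod>i\<in>I - fst ` P. c i)"
  let ?d = "\<lambda>t j. d j + t * e j"
  have fin: "finite ?p" using finite_partial_pairings[OF assms] .
  have *: "((\<lambda>t. pairing_sum K c (?d t) I J) has_field_derivative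
          (\<Sum>P\<in>?p. ?a P * (\<Sum>j\<in>J - snd ` P. e j * (\<Prod>l\<in>J - snd ` P - {j}. ?d t l)))) (at t)"
    unfolding pairing_sum_def
    by (rule DERIV_sum DERIV_cmult has_field_derivative_prod | rule derivative_eq_intros refl | simp)+
  have "(\<Sum>P\<in>?p. ?a P * (\<Sum>j\<in>J - snd ` P. e j * (\<Prod>l\<in>J - snd ` P - {j}. ?d t l))) =
        (\<Sum>P\<in>?p. \<Sum>j | j \<in> J \<and> j \<notin> snd ` P. e j * (?a P * (\<Prod>l\<in>J - {j} - snd ` P. ?d t l)))"
    unfolding sum_distrib_left
  proof (intro sum.cong refl)
    fix P :: "('i \<times> 'j) set" and j
    have "J - snd ` P - {j} = J - {j} - snd ` P" by auto
    then show "?a P * (e j * (\<Prod>l\<in>J - snd ` P - {j}. ?d t l)) =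
                 e j * (?a P * (\<Prod>l\<in>J - {j} - snd ` P. ?d t l))" by simp
  qed auto
  also have "\<dots> = (\<Sum>j\<in>J. \<Sum>P | P \<in> ?p \<and> j \<notin> snd ` P. e j * (?a P * (\<Prod>l\<in>J - {j} - snd ` P. ?d t l)))"
    by (rule sum.swap_restrict[OF fin assms(2)])
  also have "\<dots> = (\<Sum>j\<in>J. e j * pairing_sum K c (?d t) I (J - {j}))"
    by (simp add: pairing_sum_def partial_pairings_remove sum_distrib_left)
  finally show ?thesis using * by simp
qed

lemma expect_eq_sum:
  assumes "finite S" "Poly_Mapping.keys F \<subseteq> S"
  shows "expect F = (\<Sum>p\<in>S. if fst p = {#} then Poly_Mapping.lookup F p else 0)"
  unfolding expect_def
  by (rule sum.mono_neutral_left) (use assms in \<open>auto simp: in_keys_iff\<close>)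

lemma expect_add: "expect (F + G) = expect F + expect G"
proof -
  let ?S = "Poly_Mapping.keys F \<union> Poly_Mapping.keys G"
  have "expect (F + G) = (\<Sum>p\<in>?S. if fst p = {#} then Poly_Mapping.lookup (F + G) p else 0)"
    by (rule expect_eq_sum) (use Poly_Mapping.keys_add[of F G] in auto)
  also have "\<dots> = expect F + expect G"
    by (auto simp: expect_eq_sum[of ?S] lookup_add simp flip: sum.distrib intro!: sum.cong)
  finally show ?thesis .
qed

lemma expect_zero [simp]: "expect 0 = 0"
  by (simp add: expect_def)

lemma expect_sum: "expect (sum f A) = (\<Sum>x\<in>A. expect (f x))"
  by (induction A rule: infinite_finite_induct) (auto simp: expect_add)

lemma expect_single: "expect (Poly_Mapping.single p r) = (if fst p = {#} then r else 0)"
  by (simp add: expect_def)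

lemma functional_expand:
  "(F :: functional) =
     (\<Sum>p\<in>Poly_Mapping.keys F. Poly_Mapping.single p (Poly_Mapping.lookup F p))"
  by (rule poly_mapping_eqI) (auto simp: lookup_sum lookup_single when_def in_keys_iff)

lemma expect_mult: "expect (F * G) = expect F * expect G"
proof -
  have "expect (F * G) = expect (\<Sum>p\<in>Poly_Mapping.keys F. \<Sum>q\<in>Poly_Mapping.keys G.
          Poly_Mapping.single (p + q) (Poly_Mapping.lookup F p * Poly_Mapping.lookup G q))"
    by (subst functional_expand[of F], subst functional_expand[of G])
      (simp add: sum_product mult_single)
  also have "\<dots> = (\<Sum>p\<in>Poly_Mapping.keys F. \<Sum>q\<in>Poly_Mapping.keys G.
      (if fst p = {#} then Poly_Mapping.lookup F p else 0) *
      (if fst q = {#} then Poly_Mapping.lookup G q else 0))"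
    unfolding expect_sum by (intro sum.cong refl) (simp add: expect_single)
  finally show ?thesis by (simp add: expect_def sum_product)
qed

lemma expect_one [simp]: "expect 1 = 1"
  by (simp add: expect_single flip: single_one)

lemma expect_prod: "expect (prod f A) = (\<Prod>x\<in>A. expect (f x))"
  by (induction A rule: infinite_finite_induct) (auto simp: expect_mult)

lemma expect_scal [simp]: "expect (scal c) = c"
  by (simp add: expect_single scal_def)

lemma expect_gauss [simp]: "expect (gauss g) = 0"
  by (simp add: expect_single gauss_def)

lemma expect_wick_formula:
  "expect (wick_formula p q) = exp (exponent_sum (snd p) (\<lambda>g. exponent_sum (snd q) (pair_exp g))) *
     pairing_sum (\<lambda>i j. pair_exp (enumeration (fst p) ! i) (enumeration (fst q) ! j))
       (\<lambda>i. exponent_sum (snd q) (pair_exp (enumeration (fst p) ! i)))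
       (\<lambda>j. exponent_sum (snd p) (\<lambda>g. pair_exp g (enumeration (fst q) ! j)))
       {..<length (enumeration (fst p))} {..<length (enumeration (fst q))}"
  by (simp add: wick_formula_def Let_def expect_mult expect_sum expect_prod expect_add
      expect_single pairing_sum_def)

lemma mset_enumeration: "mset (enumeration A) = A"
  unfolding enumeration_def by (rule someI_ex) (rule ex_mset)

lemma image_mset_enumeration:
  "image_mset ((!) (enumeration A)) (mset_set {..<length (enumeration A)}) = A"
proof -
  let ?xs = "enumeration A"
  have "image_mset ((!) ?xs) (mset_set {..<length ?xs}) = mset (map ((!) ?xs) [0..<length ?xs])"
    by (simp only: mset_map mset_upt lessThan_atLeast0)
  then show ?thesis by (simp only: map_nth mset_enumeration)
qed

lemma exponent_sum_eq:
  assumes "finite S" "Poly_Mapping.keys \<beta> \<subseteq> S"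
  shows "exponent_sum \<beta> f = (\<Sum>g\<in>S. Poly_Mapping.lookup \<beta> g * f g)"
  unfolding exponent_sum_def
  by (rule sum.mono_neutral_left) (use assms in \<open>auto simp: in_keys_iff\<close>)

lemma exponent_sum_add_single:
  "exponent_sum (\<beta> + Poly_Mapping.single g r) f = exponent_sum \<beta> f + r * f g"
proof -
  let ?S = "insert g (Poly_Mapping.keys \<beta>)"
  have "exponent_sum (\<beta> + Poly_Mapping.single g r) f =
          (\<Sum>h\<in>?S. Poly_Mapping.lookup (\<beta> + Poly_Mapping.single g r) h * f h)"
    by (rule exponent_sum_eq)
      (use Poly_Mapping.keys_add[of \<beta> "Poly_Mapping.single g r"] in \<open>auto split: if_splits\<close>)
  also have "\<dots> = (\<Sum>h\<in>?S. Poly_Mapping.lookup \<beta> h * f h) + (\<Sum>h\<in>?S. if h = g then r * f g else 0)"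
    by (simp only: sum.distrib[symmetric])
      (intro sum.cong refl, auto simp: lookup_add lookup_single algebra_simps when_def)
  also have "(\<Sum>h\<in>?S. Poly_Mapping.lookup \<beta> h * f h) = exponent_sum \<beta> f"
    by (rule exponent_sum_eq[symmetric]) auto
  finally show ?thesis by simp
qed

lemma wick_formula_exp_sums:
  "(\<lambda>n. r ^ n / fact n * expect (wick_formula (A + replicate_mset n g, \<alpha>) (B, \<beta>))) sums
     expect (wick_formula (A, \<alpha> + Poly_Mapping.single g r) (B, \<beta>))"
proof -
  define y where "y = (!) (enumeration B)"
  define J0 where "J0 = {..<length (enumeration B)}"
  define K where "K = (\<lambda>x j. pair_exp x (y j))"
  define c where "c = (\<lambda>x. exponent_sum \<beta> (pair_exp x))"
  define d where "d = (\<lambda>j. exponent_sum \<alpha> (\<lambda>h. pair_exp h (y j)))"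
  define E where "E = exp (exponent_sum \<alpha> (\<lambda>h. exponent_sum \<beta> (pair_exp h)))"
  define M where "M = (\<lambda>n. A + replicate_mset n g)"
  define x where "x = (\<lambda>n. (!) (enumeration (M n)))"
  define I where "I = (\<lambda>n. {..<length (enumeration (M n))})"
  define T where
    "T = (\<lambda>n J t. pairing_sum (\<lambda>i. K (x n i)) (\<lambda>i. c (x n i)) (\<lambda>j. d j + t * K g j) (I n) J)"
  define U where "U = (\<lambda>n J t. E * exp (t * c g) * T n J t)"
  have finI [simp]: "finite (I n)" for n by (simp add: I_def)
  have img: "image_mset (x n) (mset_set (I n)) = M n" for n
    by (simp add: x_def I_def image_mset_enumeration)
  have T_Suc: "T (Suc n) J t = c g * T n J t + (\<Sum>j\<in>J. K g j * T n (J - {j}) t)"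
    if J: "finite J" for n J t
  proof -
    define i0 where "i0 = Suc (Max (insert 0 (I n)))"
    have i0: "i0 \<notin> I n"
    proof
      assume "i0 \<in> I n"
      then have "i0 \<le> Max (insert 0 (I n))" by (intro Max_ge) auto
      then show False by (simp add: i0_def)
    qed
    define x' where "x' = (x n)(i0 := g)"
    have same: "x' i = x n i" if "i \<in> I n" for i using that i0 by (auto simp: x'_def)
    have "image_mset x' (mset_set (insert i0 (I n))) = add_mset g (image_mset x' (mset_set (I n)))"
      using i0 by (simp add: x'_def)
    also have "image_mset x' (mset_set (I n)) = M n"
      unfolding img[symmetric] by (rule image_mset_cong) (simp add: same)
    finally have *: "image_mset x' (mset_set (insert i0 (I n))) = image_mset (x (Suc n)) (mset_set (I (Suc n)))"
      by (simp add: img) (simp add: M_def)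
    have n': "pairing_sum (\<lambda>i. K (x' i)) (\<lambda>i. c (x' i)) D (I n) J' =
              pairing_sum (\<lambda>i. K (x n i)) (\<lambda>i. c (x n i)) D (I n) J'" if "finite J'" for D J'
      by (rule pairing_sum_mset_cong[OF finI finI that]) (rule image_mset_cong, simp add: same)
    have "T (Suc n) J t =
        pairing_sum (\<lambda>i. K (x' i)) (\<lambda>i. c (x' i)) (\<lambda>j. d j + t * K g j) (insert i0 (I n)) J"
      unfolding T_def by (rule pairing_sum_mset_cong) (use * J in auto)
    also have "\<dots> = c g * T n J t + (\<Sum>j\<in>J. K g j * T n (J - {j}) t)"
      unfolding pairing_sum_insert[OF finI J i0] T_def using J by (simp add: n') (simp add: x'_def)
    finally show ?thesis .
  qed
  have deriv_U: "(U n J has_field_derivative U (Suc n) J t) (at t)" if J: "finite J" for n J t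
  proof -
    have "(T n J has_field_derivative (\<Sum>j\<in>J. K g j * T n (J - {j}) t)) (at t)"
      unfolding T_def by (rule pairing_sum_has_field_derivative) (use J in auto)
    moreover have "((\<lambda>t. E * exp (t * c g)) has_field_derivative E * exp (t * c g) * c g) (at t)"
      by (auto intro!: derivative_eq_intros)
    ultimately have "(U n J has_field_derivative E * exp (t * c g) * c g * T n J t +
        (\<Sum>j\<in>J. K g j * T n (J - {j}) t) * (E * exp (t * c g))) (at t)"
      unfolding U_def by (intro DERIV_mult)
    then show ?thesis using T_Suc[OF J, of n t] by (simp add: U_def algebra_simps)
  qed
  have J0: "finite J0" by (simp add: J0_def)
  have "deriv (U n J0) = U (Suc n) J0" for n
    by (rule ext) (rule DERIV_imp_deriv[OF deriv_U[OF J0]])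
  then have higher: "(deriv ^^ n) (U 0 J0) = U n J0" for n
    by (induction n) auto
  have "U 0 J0 holomorphic_on ball 0 (cmod r + 1)"
    using deriv_U[OF J0] holomorphic_on_open by blast
  then have "(\<lambda>n. (deriv ^^ n) (U 0 J0) 0 / fact n * (r - 0) ^ n) sums U 0 J0 r"
    by (rule holomorphic_power_series) auto
  then have sums: "(\<lambda>n. r ^ n / fact n * U n J0 0) sums U 0 J0 r"
    by (simp add: higher mult.commute)
  have "expect (wick_formula (A + replicate_mset n g, \<alpha>) (B, \<beta>)) = U n J0 0" for n
    by (simp add: expect_wick_formula U_def T_def E_def K_def c_def d_def x_def I_def M_def J0_def y_def)
  moreover have "expect (wick_formula (A, \<alpha> + Poly_Mapping.single g r) (B, \<beta>)) = U 0 J0 r"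
    by (simp add: expect_wick_formula U_def T_def E_def K_def c_def d_def x_def I_def M_def J0_def
        y_def exponent_sum_add_single exp_add)
  ultimately show ?thesis using sums by simp
qed

lemma scal_zero [simp]: "scal 0 = 0"
  by (simp add: scal_def)

lemma scal_add: "scal (r + s) = scal r + scal s"
  by (simp add: scal_def single_add)

lemma fprod_eq_sum:
  assumes "finite S" "Poly_Mapping.keys F \<subseteq> S"
  shows "F \<star> G = (\<Sum>p\<in>S. \<Sum>q\<in>Poly_Mapping.keys G.
    scal (Poly_Mapping.lookup F p * Poly_Mapping.lookup G q) * wick_formula p q)"
  unfolding fprod_def
proof (rule sum.mono_neutral_left[OF assms], rule ballI)
  fix p assume "p \<in> S - Poly_Mapping.keys F"
  then have "Poly_Mapping.lookup F p = 0" by (simp add: in_keys_iff)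
  then show "(\<Sum>q\<in>Poly_Mapping.keys G.
      scal (Poly_Mapping.lookup F p * Poly_Mapping.lookup G q) * wick_formula p q) = 0"
    by simp
qed

lemma fprod_add_left: "(F + F') \<star> G = F \<star> G + F' \<star> G"
proof -
  define S where "S = Poly_Mapping.keys F \<union> Poly_Mapping.keys F'"
  have S: "finite S" "Poly_Mapping.keys (F + F') \<subseteq> S" "Poly_Mapping.keys F \<subseteq> S" "Poly_Mapping.keys F' \<subseteq> S"
    using Poly_Mapping.keys_add[of F F'] by (auto simp: S_def)
  show ?thesis
    unfolding fprod_eq_sum[OF S(1,2)] fprod_eq_sum[OF S(1,3)] fprod_eq_sum[OF S(1,4)]
      lookup_add distrib_right scal_add sum.distrib ..
qed

lemma fprod_sum_left: "(\<Sum>x\<in>A. f x) \<star> G = (\<Sum>x\<in>A. f x \<star> G)"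
proof (induction A rule: infinite_finite_induct)
  case (insert x A)
  then show ?case by (simp add: fprod_add_left)
qed (simp_all add: fprod_def)

lemma expect_single_fprod:
  "expect (Poly_Mapping.single p r \<star> G) =
     (\<Sum>q\<in>Poly_Mapping.keys G. r * Poly_Mapping.lookup G q * expect (wick_formula p q))"
  by (subst fprod_eq_sum[of "{p}"]) (simp_all add: expect_sum expect_mult)

lemma gauss_power: "gauss g ^ n = Poly_Mapping.single (replicate_mset n g, 0) 1"
proof (induction n)
  case 0
  have "(Poly_Mapping.single ({#}, 0) 1 :: functional) = Poly_Mapping.single 0 1"
    by (simp only: zero_prod_def zero_multiset_def)
  then show ?case by simp
next
  case (Suc n)
  then show ?case by (simp add: gauss_def mult_single)
qed

text \<open>In correlations, the Wick exponential is the sum of its power series.\<close>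

theorem wick_exp_sums:
  "(\<lambda>n. r ^ n / fact n * expect ((gauss g ^ n * F) \<star> G)) sums expect ((wick_exp r g * F) \<star> G)"
proof -
  have *: "(\<lambda>n. r ^ n / fact n * expect ((gauss g ^ n * Poly_Mapping.single p u) \<star> G)) sums
             expect ((wick_exp r g * Poly_Mapping.single p u) \<star> G)" for p u
  proof -
    obtain A \<alpha> where p: "p = (A, \<alpha>)" by (cases p)
    have q: "(\<lambda>n. r ^ n / fact n * expect (wick_formula (A + replicate_mset n g, \<alpha>) q)) sums
               expect (wick_formula (A, \<alpha> + Poly_Mapping.single g r) q)" for q
      using wick_formula_exp_sums by (cases q) blast
    have "(\<lambda>n. \<Sum>q\<in>Poly_Mapping.keys G. u * Poly_Mapping.lookup G q *
              (r ^ n / fact n * expect (wick_formula (A + replicate_mset n g, \<alpha>) q))) sums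
            (\<Sum>q\<in>Poly_Mapping.keys G. u * Poly_Mapping.lookup G q *
              expect (wick_formula (A, \<alpha> + Poly_Mapping.single g r) q))"
      by (intro sums_sum sums_mult q)
    then show ?thesis
      by (simp add: p gauss_power wick_exp_def mult_single expect_single_fprod sum_distrib_left
          add.commute mult_ac)
  qed
  have "(\<lambda>n. \<Sum>p\<in>Poly_Mapping.keys F. r ^ n / fact n *
            expect ((gauss g ^ n * Poly_Mapping.single p (Poly_Mapping.lookup F p)) \<star> G)) sums
          (\<Sum>p\<in>Poly_Mapping.keys F.
            expect ((wick_exp r g * Poly_Mapping.single p (Poly_Mapping.lookup F p)) \<star> G))"
    by (intro sums_sum *)
  moreover have "expect ((U * F) \<star> G) = (\<Sum>p\<in>Poly_Mapping.keys F.
      expect ((U * Poly_Mapping.single p (Poly_Mapping.lookup F p)) \<star> G))" for U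
  proof -
    have "U * F = (\<Sum>p\<in>Poly_Mapping.keys F. U * Poly_Mapping.single p (Poly_Mapping.lookup F p))"
      unfolding sum_distrib_left[symmetric] functional_expand[symmetric] ..
    then show ?thesis by (simp only: fprod_sum_left expect_sum)
  qed
  ultimately show ?thesis by (simp only: sum_distrib_left)
qed


section \<open>Charts and Fock space fields\<close>

definition conformal_fixing_infinity :: "(complex \<Rightarrow> complex) \<Rightarrow> bool" where
  "conformal_fixing_infinity w \<longleftrightarrow>
     w holomorphic_on \<H> \<and> bij_betw w \<H> \<H> \<and> filterlim w at_infinity (inf at_infinity (principal \<H>))"

text \<open>
  A local chart \<open>\<phi>\<close> is given by its inverse \<open>chart_par = \<phi>\<^sup>-\<^sup>1\<close>, defined on \<open>chart_dom\<close> (the image of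
  \<open>\<phi>\<close>). As \<open>arg w'\<close> is multivalued in a chart, a chart comes with a branch
  \<open>chart_log\<close> of the logarithm of the derivative of \<open>w \<circ> \<phi>\<^sup>-\<^sup>1\<close>.
\<close>

datatype chart =
  Chart (chart_dom: "complex set") (chart_par: "complex \<Rightarrow> complex") (chart_log: "complex \<Rightarrow> complex")

definition is_chart :: "(complex \<Rightarrow> complex) \<Rightarrow> chart \<Rightarrow> bool" where
  "is_chart w c \<longleftrightarrow>
     open (chart_dom c) \<and> chart_par c holomorphic_on chart_dom c \<and>
     inj_on (chart_par c) (chart_dom c) \<and> chart_par c ` chart_dom c \<subseteq> \<H> \<and>
     chart_log c holomorphic_on chart_dom c \<and>
     (\<forall>\<zeta>\<in>chart_dom c. exp (chart_log c \<zeta>) = deriv (w \<circ> chart_par c) \<zeta>)"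

definition id_chart :: "(complex \<Rightarrow> complex) \<Rightarrow> chart" where
  "id_chart w = Chart \<H> id (\<lambda>\<zeta>. Ln (deriv w \<zeta>))"

text \<open>
  \<open>X c \<zeta>\<close> is the value of the field \<open>X\<close> in the chart \<open>c\<close> at the point with coordinate \<open>\<zeta>\<close>; a basis
  element \<open>(M, \<alpha>)\<close> is the Wick product of the derivatives of type \<open>(j, k)\<close> in the chart \<open>c\<close>, for
  \<open>(j, k)\<close> in \<open>M\<close>, and of the Wick exponential with parameter \<open>\<alpha>\<close>. The coefficients are the
  non-random fields.
\<close>

type_synonym field_mono = "(nat \<times> nat) multiset \<times> complex"
type_synonym field = "chart \<Rightarrow> complex \<Rightarrow> (field_mono \<Rightarrow>\<^sub>0 complex)"

definition fock_field :: "(complex \<Rightarrow> complex) \<Rightarrow> field \<Rightarrow> bool" where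
  "fock_field w X \<longleftrightarrow>
     (\<exists>S. finite S \<and> (\<forall>c. is_chart w c \<longrightarrow> (\<forall>\<zeta>\<in>chart_dom c. Poly_Mapping.keys (X c \<zeta>) \<subseteq> S))) \<and>
     (\<forall>c m. is_chart w c \<longrightarrow> smooth_fun_on (chart_dom c) (\<lambda>\<zeta>. Poly_Mapping.lookup (X c \<zeta>) m))"

definition field_at :: "field \<Rightarrow> chart \<Rightarrow> complex \<Rightarrow> functional" where
  "field_at X c \<zeta> = (\<Sum>m\<in>Poly_Mapping.keys (X c \<zeta>).
     Poly_Mapping.single
       (image_mset (\<lambda>(j, k). Jet (chart_par c) j k \<zeta>) (fst m),
        Poly_Mapping.single (Jet id 0 0 (chart_par c \<zeta>)) (snd m))
       (Poly_Mapping.lookup (X c \<zeta>) m))"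

text \<open>\<open>Y\<close> is the derivative of type \<open>(j, k)\<close> of \<open>X\<close>, in correlations with functionals having other
  nodes.\<close>

definition is_field_deriv ::
  "(complex \<Rightarrow> complex) \<Rightarrow> nat \<Rightarrow> nat \<Rightarrow> field \<Rightarrow> field \<Rightarrow> bool" where
  "is_field_deriv w j k X Y \<longleftrightarrow> fock_field w Y \<and>
     (\<forall>c \<zeta> \<Y>. is_chart w c \<longrightarrow> \<zeta> \<in> chart_dom c \<longrightarrow> functional_on (\<H> - {chart_par c \<zeta>}) \<Y> \<longrightarrow>
        expect (field_at Y c \<zeta> \<star> \<Y>) = wirt j k (\<lambda>\<eta>. expect (field_at X c \<eta> \<star> \<Y>)) \<zeta>)"


subsection \<open>Operator product expansion\<close>

text \<open>
  The functions of \<open>u = \<zeta> - z\<close> occurring in operator product expansions, in the normal form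
  \<open>u\<^sup>m |u|\<^sup>s (log |u|)\<^sup>k\<close>: powers of the conjugate of \<open>u\<close> are covered, since it equals \<open>|u|\<^sup>2 / u\<close>. In
  this form the index \<open>(0, 0, 0)\<close> is the only one of the constant function 1.
\<close>

type_synonym ope_index = "int \<times> complex \<times> nat"

fun ope_fun :: "ope_index \<Rightarrow> complex \<Rightarrow> complex" where
  "ope_fun (m, s, k) u =
     (u powi m) * (complex_of_real (cmod u) powr s) * complex_of_real (ln (cmod u)) ^ k"

fun ope_order :: "ope_index \<Rightarrow> real" where
  "ope_order (m, s, k) = real_of_int m + Re s"

definition has_ope ::
  "(complex \<Rightarrow> complex) \<Rightarrow> field \<Rightarrow> field \<Rightarrow> (ope_index \<Rightarrow> field) \<Rightarrow> bool" where
  "has_ope w X Y C \<longleftrightarrow>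
     (\<forall>i. fock_field w (C i)) \<and>
     (\<forall>N. finite {i. ope_order i \<le> N \<and> C i \<noteq> (\<lambda>c \<zeta>. 0)}) \<and>
     (\<forall>c z \<Y> N. is_chart w c \<longrightarrow> z \<in> chart_dom c \<longrightarrow> functional_on (\<H> - {chart_par c z}) \<Y> \<longrightarrow>
        ((\<lambda>\<zeta>. (expect (field_at X c \<zeta> \<star> field_at Y c z \<star> \<Y>) -
               (\<Sum>i | ope_order i \<le> N \<and> C i \<noteq> (\<lambda>c \<zeta>. 0).
                  expect (field_at (C i) c z \<star> \<Y>) * ope_fun i (\<zeta> - z))) /
              complex_of_real (cmod (\<zeta> - z) powr N)) \<longlongrightarrow> 0) (at z))"

definition is_ope_product :: "(complex \<Rightarrow> complex) \<Rightarrow> field \<Rightarrow> field \<Rightarrow> field \<Rightarrow> bool" where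
  "is_ope_product w X Y Z \<longleftrightarrow> (\<exists>C. has_ope w X Y C \<and> Z = C (0, 0, 0))"

text \<open>\<open>V\<close> is the sum over \<open>n\<close> of \<open>\<alpha>\<^sup>n / n!\<close> times the \<open>n\<close>-th OPE power of \<open>X\<close>, in correlations.\<close>

definition is_ope_exp :: "(complex \<Rightarrow> complex) \<Rightarrow> complex \<Rightarrow> field \<Rightarrow> field \<Rightarrow> bool" where
  "is_ope_exp w \<alpha> X V \<longleftrightarrow> fock_field w V \<and>
     (\<exists>P. P 0 = (\<lambda>c \<zeta>. 1) \<and> (\<forall>n. is_ope_product w X (P n) (P (Suc n))) \<and>
       (\<forall>c \<zeta> \<Y>. is_chart w c \<longrightarrow> \<zeta> \<in> chart_dom c \<longrightarrow> functional_on (\<H> - {chart_par c \<zeta>}) \<Y> \<longrightarrow>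
          (\<lambda>n. \<alpha> ^ n / fact n * expect (field_at (P n) c \<zeta> \<star> \<Y>)) sums
            expect (field_at V c \<zeta> \<star> \<Y>)))"


subsection \<open>The OPE family\<close>

definition phi_b :: "real \<Rightarrow> field" where
  "phi_b b = (\<lambda>c \<zeta>. Poly_Mapping.single ({#(0, 0)#}, 0) 1 +
                Poly_Mapping.single 0 (complex_of_real (- 2 * b * Im (chart_log c \<zeta>))))"

inductive_set ope_family :: "(complex \<Rightarrow> complex) \<Rightarrow> real \<Rightarrow> field set"
  for w :: "complex \<Rightarrow> complex" and b :: real where
  one: "(\<lambda>c \<zeta>. 1) \<in> ope_family w b"
| deriv_phi: "is_field_deriv w j k (phi_b b) Y \<Longrightarrow> Y \<in> ope_family w b"
| deriv_exp: "is_ope_exp w \<alpha> (phi_b b) V \<Longrightarrow> is_field_deriv w j k V Y \<Longrightarrow> Y \<in> ope_family w b"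
| scale: "X \<in> ope_family w b \<Longrightarrow> (\<lambda>c \<zeta>. Poly_Mapping.single 0 r * X c \<zeta>) \<in> ope_family w b"
| add: "X \<in> ope_family w b \<Longrightarrow> Y \<in> ope_family w b \<Longrightarrow> (\<lambda>c \<zeta>. X c \<zeta> + Y c \<zeta>) \<in> ope_family w b"
| ope: "X \<in> ope_family w b \<Longrightarrow> Y \<in> ope_family w b \<Longrightarrow> is_ope_product w X Y Z \<Longrightarrow> Z \<in> ope_family w b"


section \<open>Lie derivatives\<close>

definition local_flow ::
  "(complex \<Rightarrow> complex) \<Rightarrow> complex set \<Rightarrow> real \<Rightarrow> (real \<Rightarrow> complex \<Rightarrow> complex) \<Rightarrow> bool" where
  "local_flow v N \<epsilon> \<psi> \<longleftrightarrow>
     open N \<and> N \<subseteq> \<H> \<and> v holomorphic_on N \<and> \<epsilon> > 0 \<and> (\<forall>z\<in>N. \<psi> 0 z = z) \<and>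
     (\<forall>t. \<bar>t\<bar> < \<epsilon> \<longrightarrow> \<psi> t holomorphic_on N \<and> inj_on (\<psi> t) N \<and> \<psi> t ` N \<subseteq> \<H> \<and>
        (\<forall>z\<in>N. ((\<lambda>s. \<psi> s z) has_vector_derivative v (\<psi> t z)) (at t)))"

text \<open>
  The chart \<open>\<phi> \<circ> f\<^sup>-\<^sup>1\<close>, with inverse \<open>f \<circ> \<phi>\<^sup>-\<^sup>1\<close>, for \<open>f\<close> conformal on \<open>N\<close>. Its branch of the
  logarithm is that of \<open>\<phi>\<close> plus a principal value; for \<open>f = \<psi>\<^sub>t\<close> with \<open>t\<close> near 0 the argument of \<open>Ln\<close>
  is near 1, so this is the branch depending continuously on \<open>t\<close>.
\<close>

definition push_chart ::
  "(complex \<Rightarrow> complex) \<Rightarrow> complex set \<Rightarrow> (complex \<Rightarrow> complex) \<Rightarrow> chart \<Rightarrow> chart" where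
  "push_chart w N f c =
     (let h = chart_par c; q = (\<lambda>z. deriv (w \<circ> f) z / deriv w z)
      in Chart {\<zeta>\<in>chart_dom c. h \<zeta> \<in> N \<and> q (h \<zeta>) \<notin> \<real>\<^sub>\<le>\<^sub>0} (f \<circ> h)
           (\<lambda>\<zeta>. chart_log c \<zeta> + Ln (q (h \<zeta>))))"

text \<open>
  \<open>L\<close> is the Lie derivative along \<open>v\<close> of the product of the fields \<open>X j\<close>, \<open>j < n\<close>, taken in the charts
  \<open>c j\<close> at the points with coordinates \<open>\<zeta> j\<close>. It is a functional with the same nodes, determined in
  correlations with functionals having other nodes. As the coordinates are kept fixed, the node of
  the \<open>j\<close>-th field in the pushed chart moves along the flow.
\<close>

definition is_Lie_derivative ::
  "(complex \<Rightarrow> complex) \<Rightarrow> (complex \<Rightarrow> complex) \<Rightarrow> nat \<Rightarrow> (nat \<Rightarrow> field) \<Rightarrow> (nat \<Rightarrow> chart) \<Rightarrow>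
    (nat \<Rightarrow> complex) \<Rightarrow> functional \<Rightarrow> bool" where
  "is_Lie_derivative w v n X c \<zeta> L \<longleftrightarrow>
     (let nodes = (\<lambda>j. chart_par (c j) (\<zeta> j)) ` {..<n}
      in functional_on nodes L \<and>
         (\<exists>N \<epsilon> \<psi>. local_flow v N \<epsilon> \<psi> \<and> nodes \<subseteq> N \<and>
            (\<forall>\<Y>. functional_on (\<H> - nodes) \<Y> \<longrightarrow>
               ((\<lambda>t. expect (fprod_list
                       (map (\<lambda>j. field_at (X j) (push_chart w N (\<psi> t) (c j)) (\<zeta> j)) [0..<n]) \<star> \<Y>))
                 has_vector_derivative expect (L \<star> \<Y>)) (at 0))))"

end

theory Submission
  imports Defs "HOL-Real_Asymp.Real_Asymp"
begin

text \<open>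
  Replacing the field by a function \<open>m\<close> turns functionals into numbers, and an exponential of the field
  at other nodes acts on the fields only by such a replacement. So correlations of fields are moments
  of a Gaussian family with a covariance and a mean, differentiated with respect to the exponents.

  For a local flow of \<open>v\<^sub>\<xi>\<close> one has \<open>(\<psi>\<^sub>t z - \<xi>)\<^sup>2 = (z - \<xi>)\<^sup>2 - 2 t\<close>, and \<open>w\<close> is affine. In the charts
  moved by the flow, the two-point function is \<open>- 2 log |x - y|\<close> plus a regular part. If the products are
  ordered by subtracting only this logarithm, all members of the OPE family are linear combinations, with
  coefficients that do not depend on the chart, of derivatives of exponentials; by induction, this follows
  from the uniqueness of asymptotic expansions. Hence the Lie derivative acts only on covariance and mean.

  The covariance \<open>Q\<close> satisfies \<open>dQ/dt = u' u' / a\<^sup>2\<close>, where \<open>u = 2 a arg (z - \<xi>)\<close> is the shift of the mean due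
  to the insertion and \<open>u' = \<partial>\<^sub>\<xi> u\<close>; the mean including \<open>u\<close> changes at the rate
  \<open>- 2 (a + b) Im (1 / (z - \<xi>)\<^sup>2)\<close>, which equals \<open>u'' / (2 a\<^sup>2)\<close> as \<open>2 a (a + b) = 1\<close>. For Gaussian moments
  \<open>\<partial>\<^sub>\<xi>\<^sup>2\<close> is the variation of the covariance by \<open>2 u' u'\<close> and of the mean by \<open>u''\<close>, so the two sides agree.
\<close>

section \<open>Gaussian moments\<close>

text \<open>Derivatives, operator products and the Lie derivative are given only through
  correlations with functionals at other nodes, and these do not determine a functional: G is
  harmonic, so variables \<open>Jet h j k \<zeta>\<close> with j, k >= 1 are invisible. Hence means
  are restricted to \<open>adm\<close>. Conversely, exponentials at finitely many other points can
  prescribe any finite set of the remaining jets (\<open>matching\<close>). So an identity in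
  correlations holds for every admissible mean, including that of the boundary insertion, which is
  not itself a permitted test functional.

  Wick's formula is evaluated only on exponentials. Wick factors are derivatives of exponentials in
  their parameters, and a family with this property (\<open>coh\<close>) is fixed by its values on
  exponentials.

  The Lie derivative needs the fields in the charts of all small t, whereas an operator product is
  known chart by chart. The notion \<open>good\<close> therefore asks for one list of terms serving
  all t and all points; this is possible because the flow leaves the singularity of the two-point
  function unchanged (\<open>eg_split\<close>).\<close>

definition lin :: "('i \<Rightarrow>\<^sub>0 complex) \<Rightarrow> ('i \<Rightarrow> complex) \<Rightarrow> complex" where
  "lin \<gamma> f = (\<Sum>x\<in>Poly_Mapping.keys \<gamma>. Poly_Mapping.lookup \<gamma> x * f x)"

lemma lin_eq:
  assumes "finite S" "Poly_Mapping.keys \<gamma> \<subseteq> S"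
  shows "lin \<gamma> f = (\<Sum>x\<in>S. Poly_Mapping.lookup \<gamma> x * f x)"
  unfolding lin_def
  by (rule sum.mono_neutral_left) (use assms in \<open>auto simp: in_keys_iff\<close>)

lemma lin_zero [simp]: "lin 0 f = 0"
  by (simp add: lin_def)

lemma lin_single [simp]: "lin (Poly_Mapping.single x r) f = r * f x"
  by (simp add: lin_def)

lemma lin_add: "lin (\<gamma> + \<delta>) f = lin \<gamma> f + lin \<delta> f"
proof -
  let ?S = "Poly_Mapping.keys \<gamma> \<union> Poly_Mapping.keys \<delta>"
  have "lin (\<gamma> + \<delta>) f = (\<Sum>x\<in>?S. Poly_Mapping.lookup (\<gamma> + \<delta>) x * f x)"
    by (rule lin_eq) (use Poly_Mapping.keys_add[of \<gamma> \<delta>] in auto)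
  also have "\<dots> = lin \<gamma> f + lin \<delta> f"
    by (simp add: lin_eq[of ?S] lookup_add algebra_simps flip: sum.distrib)
  finally show ?thesis .
qed

lemma lin_fun_add: "lin \<gamma> (\<lambda>x. f x + g x) = lin \<gamma> f + lin \<gamma> g"
  by (simp add: lin_def algebra_simps sum.distrib)

lemma lin_fun_scale: "lin \<gamma> (\<lambda>x. c * f x) = c * lin \<gamma> f"
  by (simp add: lin_def sum_distrib_left mult.left_commute)

lemma lin_fun_scale_right: "lin \<gamma> (\<lambda>x. f x * c) = lin \<gamma> f * c"
  by (simp add: lin_def sum_distrib_right mult.assoc)

lemma lin_fun_zero [simp]: "lin \<gamma> (\<lambda>x. 0) = 0"
  by (simp add: lin_def)

lemma lin_fun_sum_list: "lin \<gamma> (\<lambda>x. \<Sum>k\<leftarrow>ks. f k x) = (\<Sum>k\<leftarrow>ks. lin \<gamma> (f k))"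
  by (induction ks) (simp_all add: lin_fun_add)

lemma lin_cong: "(\<And>x. x \<in> Poly_Mapping.keys \<gamma> \<Longrightarrow> f x = g x) \<Longrightarrow> lin \<gamma> f = lin \<gamma> g"
  by (simp add: lin_def)

lemma lin_swap: "lin \<gamma> (\<lambda>x. lin \<delta> (\<lambda>y. f x y)) = lin \<delta> (\<lambda>y. lin \<gamma> (\<lambda>x. f x y))"
  unfolding lin_def sum_distrib_left by (subst sum.swap) (simp add: mult_ac)

lemma exponent_sum_eq_lin: "exponent_sum = lin"
  by (intro ext) (simp add: exponent_sum_def lin_def)

lemma has_field_derivative_lin:
  assumes "\<And>x. x \<in> Poly_Mapping.keys \<gamma> \<Longrightarrow> (f x has_field_derivative f' x) (at t within S)"
  shows "((\<lambda>s. lin \<gamma> (\<lambda>x. f x s)) has_field_derivative lin \<gamma> f') (at t within S)"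
  unfolding lin_def by (rule DERIV_sum) (rule DERIV_cmult, rule assms)

lemma has_derivative_lin:
  assumes "\<And>x. x \<in> Poly_Mapping.keys \<gamma> \<Longrightarrow> ((\<lambda>s. f s x) has_derivative (\<lambda>h. f' h x)) F"
  shows "((\<lambda>s. lin \<gamma> (f s)) has_derivative (\<lambda>h. lin \<gamma> (f' h))) F"
  unfolding lin_def by (auto intro!: has_derivative_sum has_derivative_mult_right assms)

text \<open>The possible partners of a new factor in Wick's formula, each with the factors that
  remain for further pairing.\<close>

fun picks :: "'a list \<Rightarrow> ('a \<times> 'a list) list" where
  "picks [] = []"
| "picks (x # xs) = (x, xs) # map (\<lambda>(y, ys). (y, x # ys)) (picks xs)"

lemma picks_length: "(y, ys) \<in> set (picks xs) \<Longrightarrow> length ys < length xs"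
  by (induction xs arbitrary: y ys) auto

lemma picks_set: "(y, ys) \<in> set (picks xs) \<Longrightarrow> insert y (set ys) = set xs"
  by (induction xs arbitrary: y ys) force+

lemma picks_map: "picks (map f xs) = map (\<lambda>(y, ys). (f y, map f ys)) (picks xs)"
  by (induction xs) (auto simp: comp_def case_prod_unfold)

text \<open>Choosing two partners in succession is symmetric under exchanging them; this is what
  makes two factors of a moment commute.\<close>

lemma picks_picks_swap:
  fixes F :: "'a \<Rightarrow> 'a \<Rightarrow> 'a list \<Rightarrow> 'b :: comm_monoid_add"
  shows "(\<Sum>(y, ys)\<leftarrow>picks xs. \<Sum>(z, zs)\<leftarrow>picks ys. F y z zs) =
         (\<Sum>(y, ys)\<leftarrow>picks xs. \<Sum>(z, zs)\<leftarrow>picks ys. F z y zs)"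
proof (induction xs arbitrary: F)
  case (Cons x xs)
  show ?case
    using Cons[of "\<lambda>y z zs. F y z (x # zs)"]
    by (simp add: comp_def case_prod_unfold sum_list_addf add.left_commute)
qed simp

definition gexp :: "('i \<Rightarrow> 'i \<Rightarrow> complex) \<Rightarrow> ('i \<Rightarrow> complex) \<Rightarrow> ('i \<Rightarrow>\<^sub>0 complex) \<Rightarrow> complex" where
  "gexp Q m \<gamma> = exp (lin \<gamma> m + lin \<gamma> (\<lambda>x. lin \<gamma> (Q x)) / 2)"

text \<open>
  \<open>gm Q m \<gamma> [x\<^sub>1, \<dots>, x\<^sub>n]\<close> is the iterated partial derivative along \<open>x\<^sub>1, \<dots>, x\<^sub>n\<close> of the moment generating
  function \<open>gexp Q m\<close> at \<open>\<gamma>\<close>, that is, the expectation of \<open>x\<^sub>1 \<cdots> x\<^sub>n exp \<gamma>\<close> for a Gaussian family with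
  covariance \<open>Q\<close> and mean \<open>m\<close>.
\<close>

function gm :: "('i \<Rightarrow> 'i \<Rightarrow> complex) \<Rightarrow> ('i \<Rightarrow> complex) \<Rightarrow> ('i \<Rightarrow>\<^sub>0 complex) \<Rightarrow> 'i list \<Rightarrow> complex" where
  "gm Q m \<gamma> [] = gexp Q m \<gamma>"
| "gm Q m \<gamma> (x # xs) = (m x + lin \<gamma> (Q x)) * gm Q m \<gamma> xs +
     sum_list (map (\<lambda>p. Q x (fst p) * gm Q m \<gamma> (snd p)) (picks xs))"
  by pat_completeness auto
termination
proof (relation "Wellfounded.measure (\<lambda>(Q, m, \<gamma>, xs). length xs)")
  fix Q :: "'i \<Rightarrow> 'i \<Rightarrow> complex" and m \<gamma> and x :: 'i and xs :: "'i list" and p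
  assume "p \<in> set (picks xs)"
  then show "((Q, m, \<gamma>, snd p), (Q, m, \<gamma>, x # xs)) \<in> Wellfounded.measure (\<lambda>(Q, m, \<gamma>, xs). length xs)"
    using picks_length[of "fst p" "snd p" xs] by simp
qed auto

declare gm.simps(2) [simp del]

lemma gm_Cons: "gm Q m \<gamma> (x # xs) = (m x + lin \<gamma> (Q x)) * gm Q m \<gamma> xs +
    (\<Sum>(y, ys)\<leftarrow>picks xs. Q x y * gm Q m \<gamma> ys)"
  by (simp add: gm.simps(2) case_prod_unfold)

text \<open>Follows the recursion of \<open>gm\<close>, which descends to every list left after a
  partner is removed, not only to the tail.\<close>

lemma gm_induct [case_names Nil Cons]:
  assumes "P []"
    and "\<And>x xs. P xs \<Longrightarrow> (\<And>y ys. (y, ys) \<in> set (picks xs) \<Longrightarrow> P ys) \<Longrightarrow> P (x # xs)"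
  shows "P xs"
proof (induction xs rule: length_induct)
  case (1 xs)
  show ?case
  proof (cases xs)
    case Nil
    then show ?thesis using assms(1) by simp
  next
    case (Cons x ys)
    then show ?thesis using 1 assms(2)[of ys x] picks_length[of _ _ ys] less_SucI by fastforce
  qed
qed

lemma gm_cong:
  assumes "\<And>x y. x \<in> set xs \<union> Poly_Mapping.keys \<gamma> \<Longrightarrow> y \<in> set xs \<union> Poly_Mapping.keys \<gamma> \<Longrightarrow> Q x y = Q' x y"
    and "\<And>x. x \<in> set xs \<union> Poly_Mapping.keys \<gamma> \<Longrightarrow> m x = m' x"
  shows "gm Q m \<gamma> xs = gm Q' m' \<gamma> xs"
  using assms
proof (induction xs rule: gm_induct)
  case Nil
  then have "lin \<gamma> m = lin \<gamma> m'" "lin \<gamma> (\<lambda>x. lin \<gamma> (Q x)) = lin \<gamma> (\<lambda>x. lin \<gamma> (Q' x))"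
    by (auto intro!: lin_cong)
  then show ?case by (simp add: gexp_def)
next
  case (Cons x xs)
  have 1: "gm Q m \<gamma> xs = gm Q' m' \<gamma> xs" by (rule Cons.IH) (use Cons.prems in auto)
  have 2: "lin \<gamma> (Q x) = lin \<gamma> (Q' x)" by (rule lin_cong) (use Cons.prems in auto)
  have 3: "Q x y * gm Q m \<gamma> ys = Q' x y * gm Q' m' \<gamma> ys" if "(y, ys) \<in> set (picks xs)" for y ys
  proof -
    have s: "insert y (set ys) = set xs" using picks_set[OF that] .
    have "gm Q m \<gamma> ys = gm Q' m' \<gamma> ys" by (rule Cons.IH(2)[OF that]) (use Cons.prems s in auto)
    moreover have "Q x y = Q' x y" using Cons.prems s by auto
    ultimately show ?thesis by simp
  qed
  have "(\<Sum>(y, ys)\<leftarrow>picks xs. Q x y * gm Q m \<gamma> ys) = (\<Sum>(y, ys)\<leftarrow>picks xs. Q' x y * gm Q' m' \<gamma> ys)"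
    by (rule arg_cong[where f = sum_list], rule map_cong) (use 3 in auto)
  then show ?case unfolding gm_Cons using 1 2 Cons.prems by simp
qed

text \<open>The relabelling \<open>\<pi>\<close> need not be injective. When two labels merge, as at
  coincident points, their exponents add up in \<open>\<gamma>'\<close>.\<close>

lemma gm_reindex:
  assumes "\<And>f. lin \<gamma>' f = lin \<gamma> (f \<circ> \<pi>)"
  shows "gm (\<lambda>x y. Q (\<pi> x) (\<pi> y)) (m \<circ> \<pi>) \<gamma> xs = gm Q m \<gamma>' (map \<pi> xs)"
proof (induction xs rule: gm_induct)
  case Nil
  then show ?case by (simp add: gexp_def assms comp_def)
next
  case (Cons x xs)
  have "(\<Sum>(y, ys)\<leftarrow>picks xs. Q (\<pi> x) (\<pi> y) * gm (\<lambda>x y. Q (\<pi> x) (\<pi> y)) (m \<circ> \<pi>) \<gamma> ys) =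
    (\<Sum>(y, ys)\<leftarrow>picks xs. Q (\<pi> x) (\<pi> y) * gm Q m \<gamma>' (map \<pi> ys))"
    by (rule arg_cong[where f = sum_list], rule map_cong) (use Cons in \<open>auto simp del: comp_apply\<close>)
  with Cons show ?case unfolding gm_Cons list.map
    by (simp add: gm_Cons assms comp_def picks_map case_prod_unfold)
qed

text \<open>Cameron-Martin: weighting by the exponential of \<open>\<delta>\<close> shifts the mean
  by the covariance with \<open>\<delta>\<close>.\<close>

lemma gm_shift:
  assumes "\<And>x y. Q x y = Q y x"
  shows "gm Q m (\<delta> + \<gamma>) xs = gexp Q m \<delta> * gm Q (\<lambda>x. m x + lin \<delta> (Q x)) \<gamma> xs"
proof (induction xs rule: gm_induct)
  case Nil
  have "lin \<gamma> (\<lambda>x. lin \<delta> (Q x)) = lin \<delta> (\<lambda>x. lin \<gamma> (Q x))"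
    by (subst lin_swap) (simp add: assms)
  then show ?case
    by (simp add: gexp_def lin_add lin_fun_add add_divide_distrib algebra_simps flip: exp_add)
next
  case (Cons x xs)
  have "(\<Sum>(y, ys)\<leftarrow>picks xs. Q x y * gm Q m (\<delta> + \<gamma>) ys) =
    (\<Sum>(y, ys)\<leftarrow>picks xs. gexp Q m \<delta> * (Q x y * gm Q (\<lambda>x. m x + lin \<delta> (Q x)) \<gamma> ys))"
    by (rule arg_cong[where f = sum_list], rule map_cong) (use Cons in auto)
  also have "\<dots> = gexp Q m \<delta> * (\<Sum>(y, ys)\<leftarrow>picks xs. Q x y * gm Q (\<lambda>x. m x + lin \<delta> (Q x)) \<gamma> ys)"
    by (simp only: case_prod_unfold sum_list_const_mult)
  finally have e: "(\<Sum>(y, ys)\<leftarrow>picks xs. Q x y * gm Q m (\<delta> + \<gamma>) ys) =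
    gexp Q m \<delta> * (\<Sum>(y, ys)\<leftarrow>picks xs. Q x y * gm Q (\<lambda>x. m x + lin \<delta> (Q x)) \<gamma> ys)" .
  show ?case
    unfolding gm_Cons lin_add Cons(1) e by (simp only: distrib_left distrib_right mult_ac add_ac)
qed

text \<open>After both factors are expanded, the only terms not visibly symmetric run over ordered
  pairs of partners, and \<open>picks_picks_swap\<close> exchanges these.\<close>

lemma gm_swap:
  assumes "\<And>x y. Q x y = Q y x"
  shows "gm Q m \<gamma> (x # y # xs) = gm Q m \<gamma> (y # x # xs)"
proof -
  define l where "l = (\<lambda>x. m x + lin \<gamma> (Q x))"
  define G where "G = gm Q m \<gamma>"
  have G: "G (x # xs) = l x * G xs + (\<Sum>(y, ys)\<leftarrow>picks xs. Q x y * G ys)" for x xs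
    by (simp add: G_def l_def gm_Cons)
  have c: "(\<Sum>p\<leftarrow>ps. c * f p) = c * (\<Sum>p\<leftarrow>ps. f p)" for c and f :: "'i \<times> 'i list \<Rightarrow> complex" and ps
    by (rule sum_list_const_mult)
  have "G (x # y # xs) = l x * l y * G xs + Q x y * G xs +
      (\<Sum>(z, zs)\<leftarrow>picks xs. l x * (Q y z * G zs) + l y * (Q x z * G zs)) +
      (\<Sum>(z, zs)\<leftarrow>picks xs. \<Sum>(w, ws)\<leftarrow>picks zs. Q x z * Q y w * G ws)" for x y
    by (simp add: G case_prod_unfold comp_def distrib_left distrib_right sum_list_addf mult.assoc
        mult.left_commute[of "Q _ _" "l _"] add_ac c)
  from this[of x y] this[of y x] show ?thesis
    using picks_picks_swap[of "\<lambda>z w ws. Q x z * Q y w * G ws" xs]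
    by (simp add: G_def assms[of x y] add.commute mult.commute mult.left_commute)
qed

subsection \<open>Families closed under partial derivatives\<close>

text \<open>Adjoining y to the list is differentiation in the exponent of y. Such a family is
  determined by its values on the empty list, so an identity between two of them need only be
  checked on exponentials.\<close>

definition coh :: "(('i \<Rightarrow>\<^sub>0 complex) \<Rightarrow> 'i list \<Rightarrow> complex) \<Rightarrow> bool" where
  "coh \<Phi> \<longleftrightarrow> (\<forall>\<gamma> y xs. ((\<lambda>s. \<Phi> (\<gamma> + Poly_Mapping.single y s) xs) has_field_derivative \<Phi> \<gamma> (y # xs)) (at 0))"

text \<open>In the inductive step the product rule produces the recursion for
  \<open>x # y # xs\<close>; \<open>gm_swap\<close> then brings y to the front.\<close>

lemma coh_gm:
  assumes "\<And>x y. Q x y = Q y x"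
  shows "coh (gm Q m)"
  unfolding coh_def
proof (intro allI)
  fix \<gamma> y xs
  show "((\<lambda>s. gm Q m (\<gamma> + Poly_Mapping.single y s) xs) has_field_derivative gm Q m \<gamma> (y # xs)) (at 0)"
  proof (induction xs rule: gm_induct)
    case Nil
    have sym: "lin \<gamma> (\<lambda>x. Q x y) = lin \<gamma> (Q y)" by (rule lin_cong) (rule assms)
    have "((\<lambda>s. gexp Q m (\<gamma> + Poly_Mapping.single y s)) has_field_derivative
        (m y + lin \<gamma> (Q y)) * gexp Q m \<gamma>) (at 0)"
      unfolding gexp_def lin_add lin_single lin_fun_add lin_fun_scale
      by (rule derivative_eq_intros refl | simp)+ (simp add: sym algebra_simps)
    then show ?case by (simp add: gm_Cons)
  next
    case (Cons x xs)
    have d: "((\<lambda>s. \<Sum>(z, zs)\<leftarrow>ps. Q x z * gm Q m (\<gamma> + Poly_Mapping.single y s) zs) has_field_derivative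
        (\<Sum>(z, zs)\<leftarrow>ps. Q x z * gm Q m \<gamma> (y # zs))) (at 0)" if "set ps \<subseteq> set (picks xs)" for ps
      using that
    proof (induction ps)
      case (Cons p ps)
      then show ?case using Cons.IH Cons.prems \<open>\<And>z zs. (z, zs) \<in> set (picks xs) \<Longrightarrow> _\<close>
        by (auto intro!: DERIV_add DERIV_cmult split: prod.splits)
    qed simp
    have "((\<lambda>s. gm Q m (\<gamma> + Poly_Mapping.single y s) (x # xs)) has_field_derivative
       (Q x y * gm Q m \<gamma> xs + (m x + lin \<gamma> (Q x)) * gm Q m \<gamma> (y # xs)) +
         (\<Sum>(z, zs)\<leftarrow>picks xs. Q x z * gm Q m \<gamma> (y # zs))) (at 0)"
      unfolding gm_Cons[of _ _ _ x] lin_add lin_single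
      by (intro DERIV_add d[OF subset_refl])
        (rule derivative_eq_intros refl Cons.IH(1) | simp add: algebra_simps)+
    also have "(Q x y * gm Q m \<gamma> xs + (m x + lin \<gamma> (Q x)) * gm Q m \<gamma> (y # xs)) +
         (\<Sum>(z, zs)\<leftarrow>picks xs. Q x z * gm Q m \<gamma> (y # zs)) = gm Q m \<gamma> (x # y # xs)"
      by (simp add: gm_Cons[of Q m \<gamma> x "y # xs"] comp_def case_prod_unfold)
    also have "\<dots> = gm Q m \<gamma> (y # x # xs)" by (rule gm_swap) (rule assms)
    finally show ?case .
  qed
qed

text \<open>The base identity is required only for exponents that differ from
  \<open>\<gamma>\<^sub>0\<close> in variables of B. Changing the exponent of some y in B stays
  within this set, so the identity can be differentiated there.\<close>

lemma coh_unique: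
  assumes "coh \<Phi>" "coh \<Psi>"
    and base: "\<And>\<gamma>. Poly_Mapping.keys (\<gamma> - \<gamma>\<^sub>0) \<subseteq> B \<Longrightarrow> \<Phi> \<gamma> xs = \<Psi> \<gamma> xs'"
    and "set ys \<subseteq> B" "Poly_Mapping.keys (\<gamma> - \<gamma>\<^sub>0) \<subseteq> B"
  shows "\<Phi> \<gamma> (ys @ xs) = \<Psi> \<gamma> (ys @ xs')"
  using assms(4,5)
proof (induction ys arbitrary: \<gamma>)
  case Nil
  then show ?case using base by simp
next
  case (Cons y ys)
  have "Poly_Mapping.keys (\<gamma> + Poly_Mapping.single y s - \<gamma>\<^sub>0) \<subseteq> B" for s
  proof -
    have e: "\<gamma> + Poly_Mapping.single y s - \<gamma>\<^sub>0 = (\<gamma> - \<gamma>\<^sub>0) + Poly_Mapping.single y s" by simp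
    have "Poly_Mapping.keys (\<gamma> + Poly_Mapping.single y s - \<gamma>\<^sub>0) \<subseteq> Poly_Mapping.keys (\<gamma> - \<gamma>\<^sub>0) \<union> {y}"
      unfolding e using Poly_Mapping.keys_add[of "\<gamma> - \<gamma>\<^sub>0" "Poly_Mapping.single y s"] by (auto split: if_splits)
    then show ?thesis using Cons.prems by auto
  qed
  then have eq: "\<Phi> (\<gamma> + Poly_Mapping.single y s) (ys @ xs) = \<Psi> (\<gamma> + Poly_Mapping.single y s) (ys @ xs')" for s
    using Cons by simp
  have "((\<lambda>s. \<Phi> (\<gamma> + Poly_Mapping.single y s) (ys @ xs)) has_field_derivative \<Phi> \<gamma> (y # ys @ xs)) (at 0)"
    "((\<lambda>s. \<Psi> (\<gamma> + Poly_Mapping.single y s) (ys @ xs')) has_field_derivative \<Psi> \<gamma> (y # ys @ xs')) (at 0)"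
    using assms(1,2) by (auto simp: coh_def)
  then show ?case unfolding eq using DERIV_unique by auto
qed

lemma coh_unique':
  assumes "coh \<Phi>" "coh \<Psi>" "\<And>\<gamma>. \<Phi> \<gamma> [] = \<Psi> \<gamma> []"
  shows "\<Phi> \<gamma> xs = \<Psi> \<gamma> xs"
  using coh_unique[OF assms(1,2), where B = UNIV and ys = xs and xs = "[]" and xs' = "[]"] assms(3)
  by simp

text \<open>Moving x past z inside the list amounts to differentiating the induction hypothesis,
  which holds for all exponents, in the exponent of z.\<close>

lemma gm_middle:
  assumes "\<And>x y. Q x y = Q y x"
  shows "gm Q m \<gamma> (xs @ x # ys) = gm Q m \<gamma> (x # xs @ ys)"
proof (induction xs arbitrary: \<gamma>)
  case (Cons z xs)
  have c: "coh (gm Q m)" using coh_gm assms by blast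
  have "gm Q m \<gamma> ([z] @ (xs @ x # ys)) = gm Q m \<gamma> ([z] @ (x # xs @ ys))"
    by (rule coh_unique[OF c c, where B = UNIV and \<gamma>\<^sub>0 = 0]) (use Cons in auto)
  then show ?case using gm_swap[of Q, OF assms] by simp
qed simp

lemma gm_mset:
  assumes "\<And>x y. Q x y = Q y x" "mset xs = mset ys"
  shows "gm Q m \<gamma> xs = gm Q m \<gamma> ys"
  using assms(2)
proof (induction xs arbitrary: ys \<gamma>)
  case (Cons x xs)
  then obtain us vs where ys: "ys = us @ x # vs"
    by (metis list.set_intros(1) set_mset_mset split_list)
  have c: "coh (gm Q m)" using coh_gm assms by blast
  have "gm Q m \<gamma> ([x] @ xs) = gm Q m \<gamma> ([x] @ (us @ vs))"
    by (rule coh_unique[OF c c, where B = UNIV and \<gamma>\<^sub>0 = 0]) (use Cons ys in auto)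
  then show ?case using gm_middle[of Q, OF assms(1)] by (simp add: ys)
qed simp

section \<open>Leibniz products and sums of independent Gaussian families\<close>

fun splits :: "'a list \<Rightarrow> ('a list \<times> 'a list) list" where
  "splits [] = [([], [])]"
| "splits (x # xs) = map (\<lambda>(a, b). (x # a, b)) (splits xs) @ map (\<lambda>(a, b). (a, x # b)) (splits xs)"

text \<open>Leibniz rule: the iterated derivatives of a product of two functions of the exponents,
  as a sum over the ways to distribute the variables.\<close>

definition conv where
  "conv \<Phi> \<Psi> = (\<lambda>\<gamma> xs. \<Sum>(a, b)\<leftarrow>splits xs. \<Phi> \<gamma> a * \<Psi> \<gamma> b :: complex)"

lemma DERIV_sum_list:
  fixes f :: "'k \<Rightarrow> 'a::real_normed_field \<Rightarrow> 'a"
  assumes "\<And>k. k \<in> set ks \<Longrightarrow> (f k has_field_derivative f' k) (at t within S)"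
  shows "((\<lambda>s. \<Sum>k\<leftarrow>ks. f k s) has_field_derivative (\<Sum>k\<leftarrow>ks. f' k)) (at t within S)"
  using assms by (induction ks) (simp, simp add: DERIV_add)

lemma has_derivative_sum_list:
  assumes "\<And>k. k \<in> set ks \<Longrightarrow> (f k has_derivative f' k) F"
  shows "((\<lambda>s. \<Sum>k\<leftarrow>ks. f k s) has_derivative (\<lambda>h. \<Sum>k\<leftarrow>ks. f' k h)) F"
  using assms by (induction ks) (auto intro!: has_derivative_add)

lemma coh_conv:
  assumes "coh \<Phi>" "coh \<Psi>"
  shows "coh (conv \<Phi> \<Psi>)"
  unfolding coh_def
proof (intro allI)
  fix \<gamma> y xs
  have "((\<lambda>s. \<Sum>p\<leftarrow>splits xs. \<Phi> (\<gamma> + Poly_Mapping.single y s) (fst p) * \<Psi> (\<gamma> + Poly_Mapping.single y s) (snd p))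
    has_field_derivative (\<Sum>p\<leftarrow>splits xs. \<Phi> \<gamma> (y # fst p) * \<Psi> \<gamma> (snd p) + \<Phi> \<gamma> (fst p) * \<Psi> \<gamma> (y # snd p))) (at 0)"
  proof (rule DERIV_sum_list)
    fix p
    have "((\<lambda>s. \<Phi> (\<gamma> + Poly_Mapping.single y s) (fst p)) has_field_derivative \<Phi> \<gamma> (y # fst p)) (at 0)"
      "((\<lambda>s. \<Psi> (\<gamma> + Poly_Mapping.single y s) (snd p)) has_field_derivative \<Psi> \<gamma> (y # snd p)) (at 0)"
      using assms by (auto simp: coh_def)
    from DERIV_mult[OF this] show "((\<lambda>s. \<Phi> (\<gamma> + Poly_Mapping.single y s) (fst p) * \<Psi> (\<gamma> + Poly_Mapping.single y s) (snd p))
      has_field_derivative \<Phi> \<gamma> (y # fst p) * \<Psi> \<gamma> (snd p) + \<Phi> \<gamma> (fst p) * \<Psi> \<gamma> (y # snd p)) (at 0)"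
      by (simp add: mult.commute)
  qed
  then show "((\<lambda>s. conv \<Phi> \<Psi> (\<gamma> + Poly_Mapping.single y s) xs) has_field_derivative conv \<Phi> \<Psi> \<gamma> (y # xs)) (at 0)"
    by (simp add: conv_def case_prod_unfold comp_def sum_list_addf)
qed

text \<open>Moment generating functions of independent families multiply; the derivatives of the
  product are the convolution.\<close>

lemma gm_add:
  assumes "\<And>x y. Q x y = Q y x" "\<And>x y. Q' x y = Q' y x"
  shows "gm (\<lambda>x y. Q x y + Q' x y) (\<lambda>x. m x + m' x) \<gamma> xs = conv (gm Q m) (gm Q' m') \<gamma> xs"
proof (rule coh_unique')
  show "coh (gm (\<lambda>x y. Q x y + Q' x y) (\<lambda>x. m x + m' x))" by (rule coh_gm) (simp add: assms[of x y for x y])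
  show "coh (conv (gm Q m) (gm Q' m'))" using coh_conv coh_gm assms by blast
qed (simp add: conv_def gexp_def lin_fun_add add_divide_distrib add_ac flip: exp_add)

subsection \<open>Dependence on parameters\<close>

text \<open>The iterated derivatives of the exponent of \<open>gexp\<close>, a quadratic polynomial
  in \<open>\<gamma>\<close>, hence zero from the third variable on. Applied to variations of
  covariance and mean, this is the variation of the logarithm of \<open>gexp\<close>.\<close>

fun dg :: "('i \<Rightarrow> 'i \<Rightarrow> complex) \<Rightarrow> ('i \<Rightarrow> complex) \<Rightarrow> ('i \<Rightarrow>\<^sub>0 complex) \<Rightarrow> 'i list \<Rightarrow> complex" where
  "dg dQ dm \<gamma> [] = lin \<gamma> dm + lin \<gamma> (\<lambda>x. lin \<gamma> (dQ x)) / 2"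
| "dg dQ dm \<gamma> [x] = dm x + lin \<gamma> (dQ x)"
| "dg dQ dm \<gamma> [x, y] = dQ x y"
| "dg dQ dm \<gamma> (x # y # z # xs) = 0"

lemma dg_add: "dg (\<lambda>x y. Q x y + Q' x y) (\<lambda>x. m x + m' x) \<gamma> xs = dg Q m \<gamma> xs + dg Q' m' \<gamma> xs"
  by (induction Q m \<gamma> xs rule: dg.induct) (auto simp: lin_fun_add add_divide_distrib)

lemma dg_scale: "dg (\<lambda>x y. c * Q x y) (\<lambda>x. c * m x) \<gamma> xs = c * dg Q m \<gamma> xs"
  by (induction Q m \<gamma> xs rule: dg.induct) (auto simp: lin_fun_scale algebra_simps)

lemma dg_cong:
  assumes "\<And>x y. x \<in> set xs \<union> Poly_Mapping.keys \<gamma> \<Longrightarrow> y \<in> set xs \<union> Poly_Mapping.keys \<gamma> \<Longrightarrow> Q x y = Q' x y"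
    and "\<And>x. x \<in> set xs \<union> Poly_Mapping.keys \<gamma> \<Longrightarrow> m x = m' x"
  shows "dg Q m \<gamma> xs = dg Q' m' \<gamma> xs"
proof -
  have "lin \<gamma> m = lin \<gamma> m'" "lin \<gamma> (\<lambda>x. lin \<gamma> (Q x)) = lin \<gamma> (\<lambda>x. lin \<gamma> (Q' x))"
    "\<And>x. x \<in> set xs \<Longrightarrow> lin \<gamma> (Q x) = lin \<gamma> (Q' x)"
    using assms by (auto intro!: lin_cong)
  with assms show ?thesis
    by (cases "(Q, m, \<gamma>, xs)" rule: dg.cases) auto
qed

lemma coh_dg:
  assumes "\<And>x y. Q x y = Q y x"
  shows "coh (dg Q m)"
  unfolding coh_def
proof (intro allI)
  fix \<gamma> y xs
  have sym: "lin \<gamma> (\<lambda>x. Q x y) = lin \<gamma> (Q y)" for y by (rule lin_cong) (rule assms)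
  have "((\<lambda>s. lin \<gamma> m + s * m y + (lin \<gamma> (\<lambda>x. lin \<gamma> (Q x)) + s * lin \<gamma> (Q y) +
        s * (lin \<gamma> (Q y) + s * Q y y)) / 2) has_field_derivative m y + lin \<gamma> (Q y)) (at 0)"
    by (rule derivative_eq_intros refl | simp)+
  then have "((\<lambda>s. lin (\<gamma> + Poly_Mapping.single y s) m + lin (\<gamma> + Poly_Mapping.single y s)
      (\<lambda>x. lin (\<gamma> + Poly_Mapping.single y s) (Q x)) / 2) has_field_derivative m y + lin \<gamma> (Q y)) (at 0)"
    by (simp add: lin_add lin_fun_add lin_fun_scale sym distrib_left)
  moreover have "((\<lambda>s. m x + (lin \<gamma> (Q x) + s * Q x y)) has_field_derivative Q y x) (at 0)" for x
    by (rule derivative_eq_intros refl | simp)+ (rule assms)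
  ultimately show "((\<lambda>s. dg Q m (\<gamma> + Poly_Mapping.single y s) xs) has_field_derivative dg Q m \<gamma> (y # xs)) (at 0)"
    by (cases "(Q, m, \<gamma>, xs)" rule: dg.cases)
      (simp_all add: lin_add[of _ _ "Q _"])
qed

lemma gm_zero: "gm (\<lambda>_ _. 0) (\<lambda>_. 0) \<gamma> xs = (if xs = [] then 1 else 0)"
  by (induction xs rule: gm_induct) (simp_all add: gexp_def gm_Cons case_prod_unfold)

lemma gm_zero_picks: "(\<Sum>(y, ys)\<leftarrow>picks xs. q y * (gm (\<lambda>_ _. 0) (\<lambda>_. 0) \<gamma> ys :: complex)) =
    (case xs of [y] \<Rightarrow> q y | _ \<Rightarrow> 0)"
proof -
  have "ys \<noteq> []" if "(y, ys) \<in> set (picks xs)" "length xs \<noteq> 1" for y ys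
    using that by (cases xs rule: remdups_adj.cases) auto
  then have "length xs \<noteq> 1 \<Longrightarrow> (\<Sum>(y, ys)\<leftarrow>picks xs. q y * (gm (\<lambda>_ _. 0) (\<lambda>_. 0) \<gamma> ys :: complex)) =
      (\<Sum>(y, ys)\<leftarrow>picks xs. 0)"
    by (intro arg_cong[where f = sum_list] map_cong) (auto simp: gm_zero)
  then show ?thesis
    by (cases xs rule: remdups_adj.cases) (auto simp: gm_zero case_prod_unfold)
qed

text \<open>At the degenerate family with zero covariance and mean only the moment of the empty list
  is non-zero, so the product rule leaves just the terms collected in \<open>dg\<close>.\<close>

lemma gm_has_derivative_zero:
  fixes Q :: "'p :: real_normed_vector \<Rightarrow> 'i \<Rightarrow> 'i \<Rightarrow> complex"
  assumes Q: "\<And>x y. x \<in> S \<Longrightarrow> y \<in> S \<Longrightarrow> ((\<lambda>\<tau>. Q \<tau> x y) has_derivative (\<lambda>h. dQ h x y)) (at \<tau>)"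
    and m: "\<And>x. x \<in> S \<Longrightarrow> ((\<lambda>\<tau>. m \<tau> x) has_derivative (\<lambda>h. dm h x)) (at \<tau>)"
    and 0: "\<And>x y. Q \<tau> x y = 0" "\<And>x. m \<tau> x = 0"
    and S: "set xs \<subseteq> S" "Poly_Mapping.keys \<gamma> \<subseteq> S"
  shows "((\<lambda>\<tau>. gm (Q \<tau>) (m \<tau>) \<gamma> xs) has_derivative (\<lambda>h. dg (dQ h) (dm h) \<gamma> xs)) (at \<tau>)"
proof -
  have 00: "Q \<tau> = (\<lambda>_ _. 0)" "m \<tau> = (\<lambda>_. 0)" using 0 by auto
  have l: "((\<lambda>\<tau>. lin \<gamma> (Q \<tau> x)) has_derivative (\<lambda>h. lin \<gamma> (dQ h x))) (at \<tau>)" if "x \<in> S" for x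
    by (rule has_derivative_lin) (use Q S that in auto)
  have ll: "((\<lambda>\<tau>. lin \<gamma> (\<lambda>x. lin \<gamma> (Q \<tau> x))) has_derivative (\<lambda>h. lin \<gamma> (\<lambda>x. lin \<gamma> (dQ h x)))) (at \<tau>)"
    by (rule has_derivative_lin) (use l S in auto)
  have lm: "((\<lambda>\<tau>. lin \<gamma> (m \<tau>)) has_derivative (\<lambda>h. lin \<gamma> (dm h))) (at \<tau>)"
    by (rule has_derivative_lin) (use m S in auto)
  show ?thesis using S(1)
  proof (induction xs rule: gm_induct)
    case Nil
    have "((\<lambda>\<tau>. exp (lin \<gamma> (m \<tau>) + lin \<gamma> (\<lambda>x. lin \<gamma> (Q \<tau> x)) / 2)) has_derivative
        (\<lambda>h. lin \<gamma> (dm h) + lin \<gamma> (\<lambda>x. lin \<gamma> (dQ h x)) / 2)) (at \<tau>)"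
      using has_derivative_compose[OF has_derivative_add[OF lm has_derivative_mult_left[OF ll, of "1/2"]]
          DERIV_exp[unfolded has_field_derivative_def]]
      by (simp add: 00)
    then show ?case by (simp add: gexp_def)
  next
    case (Cons x xs)
    have d: "((\<lambda>\<tau>. \<Sum>p\<leftarrow>picks xs. Q \<tau> x (fst p) * gm (Q \<tau>) (m \<tau>) \<gamma> (snd p)) has_derivative
       (\<lambda>h. \<Sum>p\<leftarrow>picks xs. dQ h x (fst p) * gm (Q \<tau>) (m \<tau>) \<gamma> (snd p))) (at \<tau>)"
    proof (rule has_derivative_sum_list)
      fix p assume p: "p \<in> set (picks xs)"
      then have s: "insert (fst p) (set (snd p)) = set xs" using picks_set[of "fst p" "snd p" xs] by simp
      have 1: "((\<lambda>\<tau>. gm (Q \<tau>) (m \<tau>) \<gamma> (snd p)) has_derivative (\<lambda>h. dg (dQ h) (dm h) \<gamma> (snd p))) (at \<tau>)"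
        by (rule Cons.IH(2)[of "fst p"]) (use p s Cons.prems in auto)
      have 2: "((\<lambda>\<tau>. Q \<tau> x (fst p)) has_derivative (\<lambda>h. dQ h x (fst p))) (at \<tau>)"
        by (rule Q) (use s Cons.prems in auto)
      show "((\<lambda>\<tau>. Q \<tau> x (fst p) * gm (Q \<tau>) (m \<tau>) \<gamma> (snd p)) has_derivative
         (\<lambda>h. dQ h x (fst p) * gm (Q \<tau>) (m \<tau>) \<gamma> (snd p))) (at \<tau>)"
        using has_derivative_mult[OF 2 1] by (simp add: 00)
    qed
    have g: "((\<lambda>\<tau>. m \<tau> x + lin \<gamma> (Q \<tau> x)) has_derivative (\<lambda>h. dm h x + lin \<gamma> (dQ h x))) (at \<tau>)"
      using Cons.prems by (intro has_derivative_add m l) auto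
    have "((\<lambda>\<tau>. gm (Q \<tau>) (m \<tau>) \<gamma> xs) has_derivative (\<lambda>h. dg (dQ h) (dm h) \<gamma> xs)) (at \<tau>)"
      using Cons by auto
    from has_derivative_add[OF has_derivative_mult[OF g this] d]
    have "((\<lambda>\<tau>. gm (Q \<tau>) (m \<tau>) \<gamma> (x # xs)) has_derivative (\<lambda>h. (dm h x + lin \<gamma> (dQ h x)) * gm (Q \<tau>) (m \<tau>) \<gamma> xs +
        (\<Sum>p\<leftarrow>picks xs. dQ h x (fst p) * gm (Q \<tau>) (m \<tau>) \<gamma> (snd p)))) (at \<tau>)"
      by (simp add: gm_Cons case_prod_unfold 00)
    moreover have "(dm h x + lin \<gamma> (dQ h x)) * gm (Q \<tau>) (m \<tau>) \<gamma> xs +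
        (\<Sum>p\<leftarrow>picks xs. dQ h x (fst p) * gm (Q \<tau>) (m \<tau>) \<gamma> (snd p)) = dg (dQ h) (dm h) \<gamma> (x # xs)" for h
      using gm_zero_picks[of "dQ h x" \<gamma> xs] unfolding 00
      by (cases xs rule: remdups_adj.cases) (auto simp: gm_zero case_prod_unfold)
    ultimately show ?case by simp
  qed
qed

lemma splits_set: "(a, b) \<in> set (splits xs) \<Longrightarrow> set a \<subseteq> set xs \<and> set b \<subseteq> set xs"
  by (induction xs arbitrary: a b) fastforce+

text \<open>The increment of covariance and mean away from \<open>\<tau>\<close> is split off as a
  formally independent summand by \<open>gm_add\<close>. It vanishes at \<open>\<tau>\<close>, so
  the degenerate case applies to it.\<close>

lemma gm_has_derivative:
  fixes Q :: "'p :: real_normed_vector \<Rightarrow> 'i \<Rightarrow> 'i \<Rightarrow> complex"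
  assumes Q: "\<And>x y. x \<in> S \<Longrightarrow> y \<in> S \<Longrightarrow> ((\<lambda>\<tau>. Q \<tau> x y) has_derivative (\<lambda>h. dQ h x y)) (at \<tau>)"
    and m: "\<And>x. x \<in> S \<Longrightarrow> ((\<lambda>\<tau>. m \<tau> x) has_derivative (\<lambda>h. dm h x)) (at \<tau>)"
    and sym: "\<And>\<tau> x y. Q \<tau> x y = Q \<tau> y x"
    and S: "set xs \<subseteq> S" "Poly_Mapping.keys \<gamma> \<subseteq> S"
  shows "((\<lambda>\<tau>. gm (Q \<tau>) (m \<tau>) \<gamma> xs) has_derivative
    (\<lambda>h. conv (dg (dQ h) (dm h)) (gm (Q \<tau>) (m \<tau>)) \<gamma> xs)) (at \<tau>)"
proof -
  let ?Q = "\<lambda>\<tau>' x y. Q \<tau>' x y - Q \<tau> x y" and ?m = "\<lambda>\<tau>' x. m \<tau>' x - m \<tau> x"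
  have "gm (Q \<tau>') (m \<tau>') \<gamma> xs = conv (gm (?Q \<tau>') (?m \<tau>')) (gm (Q \<tau>) (m \<tau>)) \<gamma> xs" for \<tau>'
    using gm_add[of "?Q \<tau>'" "Q \<tau>" "?m \<tau>'" "m \<tau>" \<gamma> xs] sym by simp
  then have e: "(\<lambda>\<tau>'. gm (Q \<tau>') (m \<tau>') \<gamma> xs) =
      (\<lambda>\<tau>'. \<Sum>p\<leftarrow>splits xs. gm (?Q \<tau>') (?m \<tau>') \<gamma> (fst p) * gm (Q \<tau>) (m \<tau>) \<gamma> (snd p))"
    by (simp add: conv_def case_prod_unfold)
  show ?thesis unfolding e unfolding conv_def case_prod_unfold
  proof (rule has_derivative_sum_list, rule has_derivative_mult_left)
    fix p assume p: "p \<in> set (splits xs)"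
    have 1: "((\<lambda>\<tau>'. ?Q \<tau>' x y) has_derivative (\<lambda>h. dQ h x y)) (at \<tau>)" if "x \<in> S" "y \<in> S" for x y
      using has_derivative_diff[OF Q[OF that] has_derivative_const] by simp
    have 2: "((\<lambda>\<tau>'. ?m \<tau>' x) has_derivative (\<lambda>h. dm h x)) (at \<tau>)" if "x \<in> S" for x
      using has_derivative_diff[OF m[OF that] has_derivative_const] by simp
    show "((\<lambda>\<tau>'. gm (?Q \<tau>') (?m \<tau>') \<gamma> (fst p)) has_derivative (\<lambda>h. dg (dQ h) (dm h) \<gamma> (fst p))) (at \<tau>)"
      by (rule gm_has_derivative_zero[where S = S, OF 1 2])
        (use splits_set[of "fst p" "snd p" xs] p S in auto)
  qed
qed

lemma conv_assoc:
  assumes "coh A" "coh B" "coh C"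
  shows "conv (conv A B) C \<gamma> xs = conv A (conv B C) \<gamma> xs"
  by (rule coh_unique') (simp_all add: coh_conv assms, simp add: conv_def)

text \<open>The square of \<open>lin \<gamma> u\<close> is the quadratic form with covariance 2 u u.
  This is the origin of the variation 2 u' u' in the second derivative with respect to the insertion
  point.\<close>

lemma conv_dg_dg:
  "conv (dg (\<lambda>_ _. 0) u) (dg (\<lambda>_ _. 0) u) \<gamma> xs = dg (\<lambda>x y. 2 * u x * u y) (\<lambda>_. 0) \<gamma> xs"
proof (rule coh_unique')
  show "coh (conv (dg (\<lambda>_ _. 0) u) (dg (\<lambda>_ _. 0) u))" by (intro coh_conv coh_dg) simp_all
  show "coh (dg (\<lambda>x y. 2 * u x * u y) (\<lambda>_. 0))" by (rule coh_dg) simp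
qed (simp add: conv_def lin_fun_scale lin_fun_scale_right mult.assoc)

text \<open>Used with a map \<open>\<sigma>\<close> that sends a variable to the one representing
  its derivative at a moving point; \<open>None\<close> marks a variable that does not move and so
  has derivative zero.\<close>

definition opt :: "('a \<Rightarrow> complex) \<Rightarrow> 'a option \<Rightarrow> complex" where
  "opt f o' = (case o' of None \<Rightarrow> 0 | Some x \<Rightarrow> f x)"

lemma opt_simps [simp]: "opt f None = 0" "opt f (Some x) = f x"
  by (simp_all add: opt_def)

fun shifts :: "('a \<Rightarrow> 'a option) \<Rightarrow> 'a list \<Rightarrow> 'a list list" where
  "shifts \<sigma> [] = []"
| "shifts \<sigma> (x # xs) = (case \<sigma> x of None \<Rightarrow> [] | Some x' \<Rightarrow> [x' # xs]) @ map ((#) x) (shifts \<sigma> xs)"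

text \<open>The chain rule when the derivatives of covariance and mean are themselves entries at
  shifted labels: the variation is again a combination of moments, one group from shifting the
  exponential, the other from shifting one list entry at a time.\<close>

lemma conv_dg_shift:
  fixes Q :: "'i \<Rightarrow> 'i \<Rightarrow> complex"
  assumes "\<And>x y. Q x y = Q y x"
  shows "conv (dg (\<lambda>x y. opt (\<lambda>x'. Q x' y) (\<sigma> x) + opt (\<lambda>y'. Q x y') (\<sigma> y)) (\<lambda>x. opt m (\<sigma> x))) (gm Q m) \<gamma> xs =
    lin \<gamma> (\<lambda>x. opt (\<lambda>x'. gm Q m \<gamma> (x' # xs)) (\<sigma> x)) + (\<Sum>ys\<leftarrow>shifts \<sigma> xs. gm Q m \<gamma> ys)"
proof (rule coh_unique'[where \<Psi> = "\<lambda>\<gamma> xs. lin \<gamma> (\<lambda>x. opt (\<lambda>x'. gm Q m \<gamma> (x' # xs)) (\<sigma> x)) + (\<Sum>ys\<leftarrow>shifts \<sigma> xs. gm Q m \<gamma> ys)"])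
  have c: "coh (gm Q m)" by (rule coh_gm) (rule assms)
  have "opt (\<lambda>x'. Q x' y) o' = opt (\<lambda>x'. Q y x') o'" for y o'
    by (cases o') (auto intro: assms)
  then show "coh (conv (dg (\<lambda>x y. opt (\<lambda>x'. Q x' y) (\<sigma> x) + opt (\<lambda>y'. Q x y') (\<sigma> y)) (\<lambda>x. opt m (\<sigma> x))) (gm Q m))"
    by (intro coh_conv coh_dg c) (simp add: add.commute)
  show "coh (\<lambda>\<gamma> xs. lin \<gamma> (\<lambda>x. opt (\<lambda>x'. gm Q m \<gamma> (x' # xs)) (\<sigma> x)) + (\<Sum>ys\<leftarrow>shifts \<sigma> xs. gm Q m \<gamma> ys))"
    unfolding coh_def
  proof (intro allI)
    fix \<gamma> :: "'i \<Rightarrow>\<^sub>0 complex" and y :: 'i and xs :: "'i list"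
    let ?s = "Poly_Mapping.single y"
    have d: "((\<lambda>s. gm Q m (\<gamma> + ?s s) xs) has_field_derivative gm Q m \<gamma> (y # xs)) (at 0)" for xs
      using c by (simp add: coh_def)
    have 1: "((\<lambda>s. opt (\<lambda>x'. gm Q m (\<gamma> + ?s s) (x' # xs)) o') has_field_derivative
        opt (\<lambda>x'. gm Q m \<gamma> (y # x' # xs)) o') (at 0)" for o'
      by (cases o') (auto intro: d)
    have 2: "((\<lambda>s. lin \<gamma> (\<lambda>x. opt (\<lambda>x'. gm Q m (\<gamma> + ?s s) (x' # xs)) (\<sigma> x)) +
          s * opt (\<lambda>x'. gm Q m (\<gamma> + ?s s) (x' # xs)) (\<sigma> y)) has_field_derivative
       lin \<gamma> (\<lambda>x. opt (\<lambda>x'. gm Q m \<gamma> (y # x' # xs)) (\<sigma> x)) + opt (\<lambda>x'. gm Q m \<gamma> (x' # xs)) (\<sigma> y)) (at 0)"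
      by (rule DERIV_add[OF has_field_derivative_lin[OF 1]]) (rule derivative_eq_intros 1 refl | simp)+
    have 3: "((\<lambda>s. \<Sum>ys\<leftarrow>shifts \<sigma> xs. gm Q m (\<gamma> + ?s s) ys) has_field_derivative
        (\<Sum>ys\<leftarrow>shifts \<sigma> xs. gm Q m \<gamma> (y # ys))) (at 0)"
      by (rule DERIV_sum_list) (rule d)
    have sw: "gm Q m \<gamma> (y # x' # xs) = gm Q m \<gamma> (x' # y # xs)" for x'
      by (rule gm_swap) (rule assms)
    have "opt (\<lambda>x'. gm Q m \<gamma> (x' # xs)) (\<sigma> y) + (\<Sum>ys\<leftarrow>shifts \<sigma> xs. gm Q m \<gamma> (y # ys)) =
      (\<Sum>ys\<leftarrow>shifts \<sigma> (y # xs). gm Q m \<gamma> ys)"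
      by (cases "\<sigma> y") (auto simp: comp_def)
    with DERIV_add[OF 2 3]
    show "((\<lambda>s. lin (\<gamma> + ?s s) (\<lambda>x. opt (\<lambda>x'. gm Q m (\<gamma> + ?s s) (x' # xs)) (\<sigma> x)) +
        (\<Sum>ys\<leftarrow>shifts \<sigma> xs. gm Q m (\<gamma> + ?s s) ys)) has_field_derivative
       lin \<gamma> (\<lambda>x. opt (\<lambda>x'. gm Q m \<gamma> (x' # y # xs)) (\<sigma> x)) + (\<Sum>ys\<leftarrow>shifts \<sigma> (y # xs). gm Q m \<gamma> ys)) (at 0)"
      by (simp add: lin_add sw add.assoc)
  qed
next
  fix \<gamma> :: "'i \<Rightarrow>\<^sub>0 complex"
  have o: "lin \<gamma> (\<lambda>y. opt (f y) o') = opt (\<lambda>x'. lin \<gamma> (\<lambda>y. f y x')) o'" for f o'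
    by (cases o') auto
  \<comment> \<open>The two halves of the varied covariance contribute equally, which cancels the
    factor 1/2 in \<open>dg\<close>.\<close>
  have e: "lin \<gamma> (\<lambda>x. lin \<gamma> (\<lambda>y. opt (\<lambda>y'. Q x y') (\<sigma> y))) = lin \<gamma> (\<lambda>x. lin \<gamma> (\<lambda>y. opt (\<lambda>x'. Q x' y) (\<sigma> x)))"
  proof (subst lin_swap)
    have "opt (\<lambda>y'. Q x y') o' = opt (\<lambda>x'. Q x' x) o'" for x o'
      by (cases o') (auto intro: assms)
    then show "lin \<gamma> (\<lambda>y. lin \<gamma> (\<lambda>x. opt (\<lambda>y'. Q x y') (\<sigma> y))) =
        lin \<gamma> (\<lambda>x. lin \<gamma> (\<lambda>y. opt (\<lambda>x'. Q x' y) (\<sigma> x)))"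
      by presburger
  qed
  have "lin \<gamma> (\<lambda>x. opt (\<lambda>x'. (m x' + lin \<gamma> (Q x')) * c) (\<sigma> x)) =
      (lin \<gamma> (\<lambda>x. opt m (\<sigma> x)) + lin \<gamma> (\<lambda>x. opt (\<lambda>x'. lin \<gamma> (Q x')) (\<sigma> x))) * c" for c
  proof -
    have "opt (\<lambda>x'. (m x' + lin \<gamma> (Q x')) * c) o' = (opt m o' + opt (\<lambda>x'. lin \<gamma> (Q x')) o') * c" for o'
      by (cases o') auto
    then show ?thesis by (simp add: lin_fun_scale_right lin_fun_add)
  qed
  then show "conv (dg (\<lambda>x y. opt (\<lambda>x'. Q x' y) (\<sigma> x) + opt (\<lambda>y'. Q x y') (\<sigma> y)) (\<lambda>x. opt m (\<sigma> x))) (gm Q m) \<gamma> [] =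
    lin \<gamma> (\<lambda>x. opt (\<lambda>x'. gm Q m \<gamma> [x']) (\<sigma> x)) + (\<Sum>ys\<leftarrow>shifts \<sigma> []. gm Q m \<gamma> ys)"
    by (simp add: conv_def gm_Cons lin_fun_add e o)
qed

section \<open>Evaluation of correlation functionals\<close>

definition mon :: "('g \<Rightarrow> complex) \<Rightarrow> 'g multiset \<times> ('g \<Rightarrow>\<^sub>0 complex) \<Rightarrow> complex" where
  "mon m p = prod_mset (image_mset m (fst p)) * exp (lin (snd p) m)"

text \<open>
  Replace each Gaussian variable \<open>g\<close> by the number \<open>m g\<close>. Since Wick monomials without factors have
  expectation 1 and the others 0, \<open>ev m F\<close> is the expectation of \<open>F\<close> with the field shifted by \<open>m\<close>.
\<close>

definition ev :: "(gvar \<Rightarrow> complex) \<Rightarrow> functional \<Rightarrow> complex" where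
  "ev m F = lin F (mon m)"

lemma mon_add: "mon m (p + q) = mon m p * mon m q"
  by (simp add: mon_def lin_add exp_add)

lemma lin_sum_left: "lin (\<Sum>x\<in>A. F x) f = (\<Sum>x\<in>A. lin (F x) f)"
  by (induction A rule: infinite_finite_induct) (auto simp: lin_add)

lemma poly_mapping_expand: "\<gamma> = (\<Sum>x\<in>Poly_Mapping.keys \<gamma>. Poly_Mapping.single x (Poly_Mapping.lookup \<gamma> x))"
  by (rule poly_mapping_eqI) (auto simp: lookup_sum lookup_single when_def in_keys_iff)

lemma lin_mult:
  fixes F G :: "'m::monoid_add \<Rightarrow>\<^sub>0 complex"
  assumes "\<And>p q. f (p + q) = f p * f q"
  shows "lin (F * G) f = lin F f * lin G f"
proof -
  have "F * G = (\<Sum>p\<in>Poly_Mapping.keys F. \<Sum>q\<in>Poly_Mapping.keys G.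
          Poly_Mapping.single (p + q) (Poly_Mapping.lookup F p * Poly_Mapping.lookup G q))"
    by (subst poly_mapping_expand[of F], subst poly_mapping_expand[of G])
      (simp add: sum_product mult_single)
  then show ?thesis
    by (simp add: lin_sum_left assms lin_def[of F] lin_def[of G] sum_product mult_ac)
qed

lemma ev_add: "ev m (F + G) = ev m F + ev m G"
  by (simp add: ev_def lin_add)

lemma ev_sum: "ev m (sum F A) = (\<Sum>x\<in>A. ev m (F x))"
  by (simp add: ev_def lin_sum_left)

lemma ev_mult: "ev m (F * G) = ev m F * ev m G"
  by (simp add: ev_def lin_mult mon_add)

lemma ev_single [simp]: "ev m (Poly_Mapping.single p c) = c * mon m p"
  by (simp add: ev_def)

lemma mon_zero [simp]: "mon m 0 = 1"
  by (simp add: mon_def)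

lemma ev_one [simp]: "ev m 1 = 1"
  by (simp flip: single_one)

lemma ev_scal [simp]: "ev m (scal c) = c"
  by (simp add: scal_def)

lemma ev_gauss [simp]: "ev m (gauss g) = m g"
  by (simp add: gauss_def mon_def)

lemma ev_prod: "ev m (prod F A) = (\<Prod>x\<in>A. ev m (F x))"
  by (induction A rule: infinite_finite_induct) (auto simp: ev_mult)

lemma expect_eq_ev: "expect F = ev (\<lambda>_. 0) F"
proof -
  have "mon (\<lambda>_. 0) p = (if fst p = {#} then 1 else 0)" for p :: wmono
    by (auto simp: mon_def image_mset_const_eq nonempty_has_size[symmetric])
  then show ?thesis unfolding expect_def ev_def lin_def by (intro sum.cong) auto
qed

section \<open>Wick's formula with numbers in place of the field\<close>

definition PS where
  "PS K c d A B = pairing_sum (\<lambda>i j. K (enumeration A ! i) (enumeration B ! j))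
     (\<lambda>i. c (enumeration A ! i)) (\<lambda>j. d (enumeration B ! j))
     {..<length (enumeration A)} {..<length (enumeration B)}"

definition wval where
  "wval m p q = exp (lin (snd p) (\<lambda>g. lin (snd q) (pair_exp g)) + lin (snd p + snd q) m) *
     PS pair_exp (\<lambda>x. m x + lin (snd q) (pair_exp x)) (\<lambda>y. m y + lin (snd p) (\<lambda>g. pair_exp g y)) (fst p) (fst q)"

lemma ev_wick_formula: "ev m (wick_formula p q) = wval m p q"
  by (simp add: wick_formula_def Let_def ev_mult ev_sum ev_prod ev_add PS_def wval_def pairing_sum_def
      exponent_sum_eq_lin mon_def exp_add case_prod_unfold)

lemma ev_fprod: "ev m (F \<star> G) = lin F (\<lambda>p. lin G (wval m p))"
  by (simp add: fprod_def ev_sum ev_mult ev_wick_formula lin_def sum_distrib_left mult.assoc)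

lemma partial_pairings_swap: "partial_pairings J I = (`) prod.swap ` partial_pairings I J"
proof -
  have *: "prod.swap ` P \<in> partial_pairings J I" if "P \<in> partial_pairings I J" for P and I :: "'x set" and J :: "'y set"
    using that by (auto simp: partial_pairings_def inj_on_def)
  show ?thesis
  proof (rule equalityI; rule subsetI)
    fix P assume "P \<in> partial_pairings J I"
    from *[OF this] show "P \<in> (`) prod.swap ` partial_pairings I J"
      by (rule image_eqI[rotated]) (simp add: image_image)
  next
    fix P assume "P \<in> (`) prod.swap ` partial_pairings I J"
    then obtain P' where "P' \<in> partial_pairings I J" "P = prod.swap ` P'" by (rule imageE) simp
    with * show "P \<in> partial_pairings J I" by simp
  qed
qed

lemma pairing_sum_swap:
  fixes K :: "'i \<Rightarrow> 'j \<Rightarrow> complex"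
  shows "pairing_sum (\<lambda>j i. K i j) d c J I = pairing_sum K c d I J"
proof -
  have inj: "inj_on ((`) prod.swap) (partial_pairings I J)"
    by (rule inj_onI) (simp add: inj_image_eq_iff)
  have 1: "(\<Prod>(j, i)\<in>prod.swap ` P. K i j) = (\<Prod>(i, j)\<in>P. K i j)" for P
    by (subst prod.reindex) (auto simp: case_prod_unfold)
  have 2: "fst ` prod.swap ` P = snd ` P" "snd ` prod.swap ` P = fst ` P" for P :: "('i \<times> 'j) set"
    by (auto simp: image_image)
  show ?thesis
    unfolding pairing_sum_def partial_pairings_swap[of J I] sum.reindex[OF inj] comp_def 1 2
    by (rule sum.cong[OF refl]) (rule mult.assoc[THEN trans], subst mult.commute[of "prod d _"], rule mult.assoc[symmetric])
qed

lemma PS_swap: "PS (\<lambda>y x. K x y) d c B A = PS K c d A B"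
  unfolding PS_def by (rule pairing_sum_swap)

lemma PS_empty: "PS K c d {#} B = prod_mset (image_mset d B)"
proof -
  let ?ys = "enumeration B"
  have e: "enumeration {#} = []" using mset_enumeration[of "{#}"] by simp
  have "PS K c d {#} B = (\<Prod>j<length ?ys. d (?ys ! j))"
    by (simp add: PS_def e pairing_sum_def)
  also have "\<dots> = prod_mset (image_mset d (image_mset ((!) ?ys) (mset_set {..<length ?ys})))"
    by (simp add: prod_unfold_prod_mset image_mset.compositionality comp_def)
  finally show ?thesis by (simp only: image_mset_enumeration)
qed

lemma PS_add:
  fixes g :: 'x
  shows "PS K c d (add_mset g A) B = c g * PS K c d A B +
    (\<Sum>j<length (enumeration B). K g (enumeration B ! j) *
       pairing_sum (\<lambda>i j. K (enumeration A ! i) (enumeration B ! j)) (\<lambda>i. c (enumeration A ! i))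
         (\<lambda>j. d (enumeration B ! j)) {..<length (enumeration A)} ({..<length (enumeration B)} - {j}))"
proof -
  define xs where "xs = enumeration A"
  define y where "y = (!) (enumeration B)"
  define J where "J = {..<length (enumeration B)}"
  define n where "n = length xs"
  have J: "finite J" by (simp add: J_def)
  \<comment> \<open>\<open>enumeration (add_mset g A)\<close> is an arbitrary choice unrelated to
    that of A. The sum is therefore transported to the list with g appended, where g has index
    n.\<close>
  define x' where "x' = (!) (xs @ [g])"
  have m1: "image_mset x' (mset_set {..<Suc n}) = add_mset g A"
  proof -
    have "image_mset x' (mset_set {..<Suc n}) = mset (map x' [0..<Suc n])"
      by (simp only: mset_map mset_upt lessThan_atLeast0)
    also have "map x' [0..<Suc n] = xs @ [g]"
      unfolding x'_def n_def using map_nth[of "xs @ [g]"] by simp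
    finally show ?thesis by (simp add: xs_def mset_enumeration)
  qed
  have same: "x' i = xs ! i" if "i < n" for i using that by (simp add: x'_def n_def nth_append)
  have ps: "pairing_sum (\<lambda>i j. K (x' i) (y j)) (\<lambda>i. c (x' i)) D {..<n} J' =
      pairing_sum (\<lambda>i j. K (xs ! i) (y j)) (\<lambda>i. c (xs ! i)) D {..<n} J'" if "finite J'" for D J'
    by (rule pairing_sum_mset_cong[where K = "\<lambda>x j. K x (y j)"]) (use that in \<open>auto intro!: image_mset_cong simp: same\<close>)
  have "PS K c d (add_mset g A) B = pairing_sum (\<lambda>i j. K (x' i) (y j)) (\<lambda>i. c (x' i)) (\<lambda>j. d (y j)) {..<Suc n} J"
    unfolding PS_def y_def[symmetric] J_def[symmetric]
    by (rule pairing_sum_mset_cong[where K = "\<lambda>x j. K x (y j)"]) (use J in \<open>auto simp: m1 image_mset_enumeration\<close>)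
  also have "\<dots> = c (x' n) * pairing_sum (\<lambda>i j. K (x' i) (y j)) (\<lambda>i. c (x' i)) (\<lambda>j. d (y j)) {..<n} J +
     (\<Sum>j\<in>J. K (x' n) (y j) * pairing_sum (\<lambda>i j. K (x' i) (y j)) (\<lambda>i. c (x' i)) (\<lambda>j. d (y j)) {..<n} (J - {j}))"
    unfolding lessThan_Suc by (rule pairing_sum_insert) (use J in auto)
  also have "x' n = g" by (simp add: x'_def n_def nth_append)
  finally show ?thesis using J
    by (simp add: ps) (simp add: PS_def xs_def y_def J_def n_def)
qed

text \<open>The new factor g either contributes c g, which comes from the derivative of the
  exponential, or is paired with some y of B, with weight K g y from the derivative of the perturbed
  d.\<close>

lemma PS_deriv:
  "((\<lambda>s. E * exp (s * c g) * PS K c (\<lambda>y. d y + s * K g y) A B) has_field_derivative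
     E * PS K c d (add_mset g A) B) (at 0)"
proof -
  have "((\<lambda>s. PS K c (\<lambda>y. d y + s * K g y) A B) has_field_derivative
    (\<Sum>j<length (enumeration B). K g (enumeration B ! j) *
       pairing_sum (\<lambda>i j. K (enumeration A ! i) (enumeration B ! j)) (\<lambda>i. c (enumeration A ! i))
         (\<lambda>j. d (enumeration B ! j) + 0 * K g (enumeration B ! j)) {..<length (enumeration A)} ({..<length (enumeration B)} - {j}))) (at 0)"
    unfolding PS_def by (rule pairing_sum_has_field_derivative) auto
  moreover have "((\<lambda>s. E * exp (s * c g)) has_field_derivative E * c g) (at 0)"
    by (rule derivative_eq_intros refl | simp)+
  ultimately show ?thesis
    by (auto intro!: derivative_eq_intros simp: PS_add algebra_simps)
qed

text \<open>Wick factors are derivatives of Wick exponentials in their parameter. Together with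
  \<open>wval_right_deriv\<close> this makes both arguments of the product accessible to
  \<open>coh\<close>.\<close>

lemma wval_left_deriv:
  "((\<lambda>s. wval m (A, \<alpha> + Poly_Mapping.single g s) q) has_field_derivative wval m (add_mset g A, \<alpha>) q) (at 0)"
proof -
  let ?E = "exp (lin \<alpha> (\<lambda>g. lin (snd q) (pair_exp g)) + lin (\<alpha> + snd q) m)"
  let ?c = "\<lambda>x. m x + lin (snd q) (pair_exp x)"
  have "wval m (A, \<alpha> + Poly_Mapping.single g s) q = ?E * exp (s * ?c g) *
     PS pair_exp ?c (\<lambda>y. (m y + lin \<alpha> (\<lambda>g. pair_exp g y)) + s * pair_exp g y) A (fst q)" for s
    by (simp add: wval_def lin_add algebra_simps flip: exp_add)
  moreover have "wval m (add_mset g A, \<alpha>) q = ?E * PS pair_exp ?c (\<lambda>y. m y + lin \<alpha> (\<lambda>g. pair_exp g y)) (add_mset g A) (fst q)"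
    by (simp add: wval_def)
  ultimately show ?thesis using PS_deriv by simp
qed

lemma wval_right_deriv:
  "((\<lambda>s. wval m p (B, \<beta> + Poly_Mapping.single g s)) has_field_derivative wval m p (add_mset g B, \<beta>)) (at 0)"
proof -
  let ?E = "exp (lin (snd p) (\<lambda>g. lin \<beta> (pair_exp g)) + lin (snd p + \<beta>) m)"
  let ?c = "\<lambda>y. m y + lin (snd p) (\<lambda>g. pair_exp g y)"
  let ?K = "\<lambda>x y. pair_exp y x"
  have "wval m p (B, \<beta> + Poly_Mapping.single g s) = ?E * exp (s * ?c g) *
     PS ?K ?c (\<lambda>x. (m x + lin \<beta> (pair_exp x)) + s * ?K g x) B (fst p)" for s
    by (subst PS_swap) (simp add: wval_def lin_add lin_fun_add lin_fun_scale algebra_simps flip: exp_add)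
  moreover have "wval m p (add_mset g B, \<beta>) = ?E * PS ?K ?c (\<lambda>x. m x + lin \<beta> (pair_exp x)) (add_mset g B) (fst p)"
    by (subst PS_swap) (simp add: wval_def)
  ultimately show ?thesis using PS_deriv by simp
qed

lemma ev_left_deriv:
  "((\<lambda>s. ev m (Poly_Mapping.single (A, \<alpha> + Poly_Mapping.single g s) 1 \<star> G)) has_field_derivative
     ev m (Poly_Mapping.single (add_mset g A, \<alpha>) 1 \<star> G)) (at 0)"
  unfolding ev_fprod lin_single mult_1 by (rule has_field_derivative_lin) (rule wval_left_deriv)

lemma ev_right_deriv:
  "((\<lambda>s. ev m (F \<star> Poly_Mapping.single (B, \<beta> + Poly_Mapping.single g s) 1)) has_field_derivative
     ev m (F \<star> Poly_Mapping.single (add_mset g B, \<beta>) 1)) (at 0)"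
  unfolding ev_fprod lin_single mult_1 by (rule has_field_derivative_lin) (rule wval_right_deriv)

lemma ev_fprod_left: "ev m (F \<star> G) = lin F (\<lambda>p. ev m (Poly_Mapping.single p 1 \<star> G))"
  by (simp add: ev_fprod)

lemma ev_fprod_right: "ev m (F \<star> G) = lin G (\<lambda>q. ev m (F \<star> Poly_Mapping.single q 1))"
  unfolding ev_fprod lin_single mult_1 by (rule lin_swap)

text \<open>With no factors on the left every pairing starts from the exponential and only shifts
  the variables of G. For the boundary insertion this is the replacement of the field by the field
  plus 2 a arg (z - \<xi>).\<close>

lemma ev_exp_left:
  "ev m (Poly_Mapping.single ({#}, \<gamma>) 1 \<star> G) =
     exp (lin \<gamma> m) * ev (\<lambda>h. m h + lin \<gamma> (\<lambda>g. pair_exp g h)) G"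
proof -
  have "lin q (\<lambda>y. m y + lin \<gamma> (\<lambda>g. pair_exp g y)) = lin q m + lin \<gamma> (\<lambda>g. lin q (pair_exp g))" for q
    by (simp add: lin_fun_add lin_swap[of q])
  then have "wval m ({#}, \<gamma>) q = exp (lin \<gamma> m) * mon (\<lambda>h. m h + lin \<gamma> (\<lambda>g. pair_exp g h)) q" for q
    by (simp add: wval_def PS_empty mon_def lin_add exp_add)
  then have "wval m ({#}, \<gamma>) = (\<lambda>q. exp (lin \<gamma> m) * mon (\<lambda>h. m h + lin \<gamma> (\<lambda>g. pair_exp g h)) q)" by auto
  then show ?thesis unfolding ev_fprod by (simp add: ev_def lin_fun_scale)
qed

lemma ev_exp_right:
  "ev m (F \<star> Poly_Mapping.single ({#}, \<delta>) 1) =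
     exp (lin \<delta> m) * ev (\<lambda>g. m g + lin \<delta> (pair_exp g)) F"
proof -
  have "PS pair_exp c d A {#} = prod_mset (image_mset c A)" for c d A
    using PS_empty[of "\<lambda>y x. pair_exp x y" d c A] PS_swap[of pair_exp d c "{#}" A] by simp
  then have "wval m p ({#}, \<delta>) = exp (lin \<delta> m) * mon (\<lambda>g. m g + lin \<delta> (pair_exp g)) p" for p
    by (simp add: wval_def mon_def lin_add lin_fun_add exp_add)
  then show ?thesis unfolding ev_fprod by (simp add: ev_def lin_fun_scale)
qed

lemma expect_exp_right: "expect (F \<star> Poly_Mapping.single ({#}, \<delta>) 1) = ev (\<lambda>g. lin \<delta> (pair_exp g)) F"
  by (simp add: expect_eq_ev ev_exp_right)

text \<open>An equality of functionals, not only in correlations. It reconciles the product of two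
  fields with a fold that ends in the unit.\<close>

lemma fprod_one_right: "F \<star> 1 = F"
proof -
  have "wick_formula p 0 = Poly_Mapping.single p 1" for p
  proof -
    let ?xs = "enumeration (fst p)"
    have e: "enumeration ({#} :: gvar multiset) = []" using mset_enumeration[of "{#} :: gvar multiset"] by simp
    have pp: "partial_pairings I {} = {{}}" for I :: "nat set" by (auto simp: partial_pairings_def)
    have "wick_formula p 0 = Poly_Mapping.single (0, snd p) 1 * (\<Prod>i<length ?xs. gauss (?xs ! i))"
      by (simp add: wick_formula_def Let_def e exponent_sum_eq_lin pp) (simp add: scal_def)
    also have "(\<Prod>i<length ?xs. gauss (?xs ! i)) = Poly_Mapping.single (mset (map ((!) ?xs) [0..<length ?xs]), 0) 1"
    proof -
      have "(\<Prod>i<k. gauss (?xs ! i)) = Poly_Mapping.single (mset (map ((!) ?xs) [0..<k]), 0) 1" for k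
        by (induction k) (simp_all add: gauss_def mult_single add.commute flip: zero_prod_def)
      then show ?thesis .
    qed
    finally show ?thesis by (simp add: map_nth mset_enumeration mult_single)
  qed
  moreover have "Poly_Mapping.keys (1 :: functional) = {0}" by (simp flip: single_one)
  moreover have "Poly_Mapping.lookup (1 :: functional) 0 = 1" by (simp flip: single_one)
  ultimately have "F \<star> 1 = (\<Sum>p\<in>Poly_Mapping.keys F. scal (Poly_Mapping.lookup F p) * Poly_Mapping.single p 1)"
    by (simp add: fprod_def)
  also have "\<dots> = (\<Sum>p\<in>Poly_Mapping.keys F. Poly_Mapping.single p (Poly_Mapping.lookup F p))"
    by (simp add: scal_def mult_single)
  also have "\<dots> = F" by (rule poly_mapping_expand[symmetric])
  finally show ?thesis .
qed

text \<open>A substitute for associativity of the product. For an exponential on the left both sides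
  are explicit; differentiation in its parameters gives all Wick monomials, and linearity the
  rest.\<close>

lemma expect_fprod_exp:
  "expect (F \<star> (G \<star> Poly_Mapping.single ({#}, \<delta>) 1)) = ev (\<lambda>g. lin \<delta> (pair_exp g)) (F \<star> G)"
proof -
  let ?m = "\<lambda>g. lin \<delta> (pair_exp g)"
  let ?H = "G \<star> Poly_Mapping.single ({#}, \<delta>) 1"
  have "ev (\<lambda>_. 0) (Poly_Mapping.single (mset xs, \<gamma>) 1 \<star> ?H) = ev ?m (Poly_Mapping.single (mset xs, \<gamma>) 1 \<star> G)" for xs \<gamma>
  proof (rule coh_unique'[where \<Phi> = "\<lambda>\<gamma> xs. ev (\<lambda>_. 0) (Poly_Mapping.single (mset xs, \<gamma>) 1 \<star> ?H)"
        and \<Psi> = "\<lambda>\<gamma> xs. ev ?m (Poly_Mapping.single (mset xs, \<gamma>) 1 \<star> G)"])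
    show "coh (\<lambda>\<gamma> xs. ev (\<lambda>_. 0) (Poly_Mapping.single (mset xs, \<gamma>) 1 \<star> ?H))"
      "coh (\<lambda>\<gamma> xs. ev ?m (Poly_Mapping.single (mset xs, \<gamma>) 1 \<star> G))"
      by (auto simp: coh_def intro!: ev_left_deriv)
    fix \<gamma> :: "gvar \<Rightarrow>\<^sub>0 complex"
    have "lin \<delta> (\<lambda>h. lin \<gamma> (\<lambda>g. pair_exp g h)) = lin \<gamma> ?m" by (rule lin_swap)
    then show "ev (\<lambda>_. 0) (Poly_Mapping.single (mset [], \<gamma>) 1 \<star> ?H) = ev ?m (Poly_Mapping.single (mset [], \<gamma>) 1 \<star> G)"
      by (simp add: ev_exp_left ev_exp_right add.commute)
  qed
  then have "ev (\<lambda>_. 0) (Poly_Mapping.single p 1 \<star> ?H) = ev ?m (Poly_Mapping.single p 1 \<star> G)" for p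
    by (metis ex_mset prod.collapse)
  then show ?thesis
    unfolding expect_eq_ev ev_fprod_left[of _ F] by simp
qed

lemma insertion_expect_eq_ev:
  "insertion_expect a \<xi> F = ev (\<lambda>h. \<i> * complex_of_real a * pair_exp (Bdry \<xi>) h) F"
  by (simp add: insertion_expect_def wick_exp_def expect_eq_ev ev_exp_left)

section \<open>Correlations of fields in canonical form\<close>

text \<open>The shape of every mean that occurs in correlations: these are harmonic away from the
  other nodes, so jets with both kinds of derivative vanish.\<close>

definition adm :: "(nat \<times> nat \<Rightarrow> complex) \<Rightarrow> bool" where
  "adm m \<longleftrightarrow> (\<forall>j k. m (Suc j, Suc k) = 0)"

lemma adm_add: "adm f \<Longrightarrow> adm g \<Longrightarrow> adm (\<lambda>a. f a + g a)"
  by (simp add: adm_def)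

lemma adm_scale: "adm f \<Longrightarrow> adm (\<lambda>a. c * f a)"
  by (simp add: adm_def)

lemma adm_lin: "(\<And>x. x \<in> Poly_Mapping.keys \<gamma> \<Longrightarrow> adm (\<lambda>a. f a x)) \<Longrightarrow> adm (\<lambda>a. lin \<gamma> (f a))"
  by (simp add: adm_def lin_def)

definition evf :: "(nat \<times> nat \<Rightarrow> complex) \<Rightarrow> (field_mono \<Rightarrow>\<^sub>0 complex) \<Rightarrow> complex" where
  "evf m x = lin x (\<lambda>q. prod_mset (image_mset m (fst q)) * exp (snd q * m (0, 0)))"

type_synonym terms = "(complex \<times> (nat \<times> nat) list \<times> complex) list"

definition tsum where
  "tsum T \<Phi> = (\<Sum>(c, ys, \<alpha>)\<leftarrow>T. c * \<Phi> (Poly_Mapping.single (0 :: nat, 0 :: nat) \<alpha>) ys :: complex)"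

text \<open>
  A term \<open>(c, ys, \<alpha>)\<close> stands for the field \<open>c\<close> times the product of the derivatives \<open>ys\<close> and of the
  exponential with parameter \<open>\<alpha>\<close>, normally ordered by subtracting only the singular part of the
  two-point function in the chart; \<open>R\<close> and \<open>\<mu>\<close> are the derivatives of the remaining regular part and
  of the mean. In this normal ordering the fields of the OPE family have constant coefficients.
\<close>

definition represents where
  "represents R \<mu> x T \<longleftrightarrow> (\<forall>m. adm m \<longrightarrow> evf m x = tsum T (gm R (\<lambda>a. m a + \<mu> a)))"

text \<open>Multiplies out the product over the nodes of the sums \<open>T j\<close>. An index (j,
  a) is the jet variable a at node j; each entry collects the coefficient, exponents and factors
  from one term per node.\<close>

fun choices :: "(nat \<Rightarrow> terms) \<Rightarrow> nat list \<Rightarrow>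
    (complex \<times> (nat \<times> nat \<times> nat \<Rightarrow>\<^sub>0 complex) \<times> (nat \<times> nat \<times> nat) list) list" where
  "choices T [] = [(1, 0, [])]"
| "choices T (j # js) = concat (map (\<lambda>(c, ys, \<alpha>). map (\<lambda>(d, \<gamma>, zs).
     (c * d, Poly_Mapping.single (j, 0, 0) \<alpha> + \<gamma>, map (Pair j) ys @ zs)) (choices T js)) (T j))"

lemma choices_subset:
  "(d, \<gamma>, zs) \<in> set (choices T js) \<Longrightarrow> fst ` (Poly_Mapping.keys \<gamma> \<union> set zs) \<subseteq> set js"
proof (induction js arbitrary: d \<gamma> zs)
  case (Cons j js)
  then obtain \<alpha> d' \<gamma>' ys zs' where *: "(d', \<gamma>', zs') \<in> set (choices T js)"
    "\<gamma> = Poly_Mapping.single (j, 0, 0) \<alpha> + \<gamma>'" "zs = map (Pair j) ys @ zs'"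
    by auto
  have "Poly_Mapping.keys \<gamma> \<subseteq> {(j, 0, 0)} \<union> Poly_Mapping.keys \<gamma>'"
    unfolding *(2) using Poly_Mapping.keys_add[of "Poly_Mapping.single (j, 0, 0) \<alpha>" \<gamma>']
    by (auto split: if_splits)
  with Cons.IH[OF *(1)] show ?case unfolding *(3) by fastforce
qed simp

lemma gm_no_covariance: "gm (\<lambda>_ _. 0) m \<gamma> xs = exp (lin \<gamma> m) * prod_list (map m xs)"
  by (induction xs rule: gm_induct) (simp_all add: gexp_def gm_Cons case_prod_unfold)

definition field_functional where
  "field_functional jet nd x = (\<Sum>q\<in>Poly_Mapping.keys x.
     Poly_Mapping.single (image_mset jet (fst q), Poly_Mapping.single nd (snd q)) (Poly_Mapping.lookup x q))"

lemma ev_field_functional: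
  assumes "m nd = m (jet (0, 0))"
  shows "ev m (field_functional jet nd x) = evf (\<lambda>a. m (jet a)) x"
  by (simp add: field_functional_def ev_sum evf_def lin_def[of x] mon_def image_mset.compositionality comp_def assms)

lemma lin_field_functional:
  "lin (field_functional jet nd x) f =
     lin x (\<lambda>q. f (image_mset jet (fst q), Poly_Mapping.single nd (snd q)))"
  by (simp add: field_functional_def lin_sum_left lin_def[of x])

definition push where
  "push f \<gamma> = (\<Sum>k\<in>Poly_Mapping.keys \<gamma>. Poly_Mapping.single (f k) (Poly_Mapping.lookup \<gamma> k :: complex))"

lemma lin_push: "lin (push f \<gamma>) g = lin \<gamma> (\<lambda>k. g (f k))"
  by (simp add: push_def lin_sum_left) (simp add: lin_def)

lemma push_zero [simp]: "push f 0 = 0"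
  by (simp add: push_def)

lemma push_add_single: "push f (\<gamma> + Poly_Mapping.single y s) = push f \<gamma> + Poly_Mapping.single (f y) s"
proof -
  let ?S = "insert y (Poly_Mapping.keys \<gamma>)"
  have *: "push f \<delta> = (\<Sum>k\<in>?S. Poly_Mapping.single (f k) (Poly_Mapping.lookup \<delta> k))"
    if "Poly_Mapping.keys \<delta> \<subseteq> ?S" for \<delta>
    unfolding push_def by (rule sum.mono_neutral_left) (use that in \<open>auto simp: in_keys_iff\<close>)
  have "Poly_Mapping.keys (\<gamma> + Poly_Mapping.single y s) \<subseteq> ?S"
    using Poly_Mapping.keys_add[of \<gamma> "Poly_Mapping.single y s"] by (auto split: if_splits)
  then have "push f (\<gamma> + Poly_Mapping.single y s) =
    push f \<gamma> + (\<Sum>k\<in>?S. Poly_Mapping.single (f k) (Poly_Mapping.lookup (Poly_Mapping.single y s) k))"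
    by (simp only: * subset_insertI lookup_add single_add sum.distrib)
  also have "(\<Sum>k\<in>?S. Poly_Mapping.single (f k) (Poly_Mapping.lookup (Poly_Mapping.single y s) k)) =
      (\<Sum>k\<in>?S. if k = y then Poly_Mapping.single (f y) s else 0)"
    by (intro sum.cong refl) (auto simp: lookup_single)
  finally show ?thesis by simp
qed

text \<open>Field \<open>x i\<close> is given in Wick order and \<open>T i\<close> is its canonical
  form. The setting serves both the two nodes of an operator product and the n nodes of the Lie
  derivative. \<open>nd i\<close> is kept apart from \<open>jet i (0, 0)\<close> because in a chart
  the exponential is attached to the point and the jets to its coordinate; their pair expectations
  agree.\<close>

locale correlation =
  fixes jet :: "nat \<Rightarrow> nat \<times> nat \<Rightarrow> gvar" and nd :: "nat \<Rightarrow> gvar"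
    and R :: "nat \<Rightarrow> nat \<times> nat \<Rightarrow> nat \<times> nat \<Rightarrow> complex" and \<mu> :: "nat \<Rightarrow> nat \<times> nat \<Rightarrow> complex"
    and x :: "nat \<Rightarrow> field_mono \<Rightarrow>\<^sub>0 complex" and T :: "nat \<Rightarrow> terms" and N :: "nat set"
  assumes R_sym: "R i a b = R i b a"
    and repr: "i \<in> N \<Longrightarrow> represents (R i) (\<mu> i) (x i) (T i)"
    and adm_pair1: "i \<in> N \<Longrightarrow> k \<in> N \<Longrightarrow> i < k \<Longrightarrow> adm (\<lambda>a. pair_exp (jet i a) (jet k b))"
    and adm_pair2: "i \<in> N \<Longrightarrow> k \<in> N \<Longrightarrow> i < k \<Longrightarrow> adm (\<lambda>b. pair_exp (jet i a) (jet k b))"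
    and nd_left: "pair_exp (nd i) g = pair_exp (jet i (0, 0)) g"
    and nd_right: "pair_exp g (nd i) = pair_exp g (jet i (0, 0))"
begin

text \<open>Between nodes the smaller index always stands on the left, so symmetry needs no property
  of \<open>pair_exp\<close>. Within a node only the regular part remains.\<close>

fun Qc where
  "Qc (i, a) (k, b) = (if i < k then pair_exp (jet i a) (jet k b)
     else if k < i then pair_exp (jet k b) (jet i a) else R i a b)"

lemma Qc_sym: "Qc p q = Qc q p"
  by (cases p; cases q) (use R_sym in auto)

definition Mc where "Mc m = (\<lambda>(i, a). m (jet i a) + \<mu> i a)"

text \<open>Node j still in Wick order: no covariance within the node, and in \<open>Mr\<close> no
  mean \<open>\<mu> j\<close>, while all other nodes are already canonical.\<close>

definition Qr where "Qr j p q = (if fst p = j \<and> fst q = j then 0 else Qc p q)"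

definition Mr where "Mr j m = (\<lambda>(i, a). m (jet i a) + (if i = j then 0 else \<mu> i a))"

lemma Qr_sym: "Qr j p q = Qr j q p"
  by (auto simp: Qr_def Qc_sym)

text \<open>An exponential of the other nodes acts on node j only through its mean, which stays
  admissible, so \<open>represents\<close> applies with this mean. Factors at the other nodes follow
  by differentiation in exponents supported on J.\<close>

lemma substitute:
  assumes j: "j \<in> N" "\<forall>i\<in>J. j < i" and J: "J \<subseteq> N" and m: "adm (\<lambda>a. m (jet j a))"
    and \<gamma>: "fst ` (Poly_Mapping.keys \<gamma> \<union> set zs) \<subseteq> J"
  shows "lin (x j) (\<lambda>q. gm (Qr j) (Mr j m) (Poly_Mapping.single (j, 0, 0) (snd q) + \<gamma>)
           (map (Pair j) (enumeration (fst q)) @ zs)) =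
         (\<Sum>(c, ys, \<alpha>)\<leftarrow>T j. c * gm Qc (Mc m) (Poly_Mapping.single (j, 0, 0) \<alpha> + \<gamma>) (map (Pair j) ys @ zs))"
proof -
  let ?s = "Poly_Mapping.single (j, 0, 0)"
  define \<Phi> where "\<Phi> = (\<lambda>\<gamma> zs. lin (x j) (\<lambda>q. gm (Qr j) (Mr j m) (?s (snd q) + \<gamma>) (zs @ map (Pair j) (enumeration (fst q)))))"
  define \<Psi> where "\<Psi> = (\<lambda>\<gamma> zs. \<Sum>p\<leftarrow>T j. fst p * gm Qc (Mc m) (?s (snd (snd p)) + \<gamma>) (zs @ map (Pair j) (fst (snd p))))"
  have c: "((\<lambda>s. gm Q M (\<delta> + (\<gamma> + Poly_Mapping.single y s)) zs) has_field_derivative gm Q M (\<delta> + \<gamma>) (y # zs)) (at 0)"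
    if "\<And>p q. Q p q = Q q p" for Q M \<delta> \<gamma> y and zs :: "(nat \<times> nat \<times> nat) list"
    using coh_gm[of Q M] that unfolding coh_def add.assoc[symmetric] by blast
  have c1: "coh \<Phi>" unfolding coh_def \<Phi>_def append_Cons
    by (intro allI has_field_derivative_lin c Qr_sym)
  have c2: "coh \<Psi>" unfolding coh_def \<Psi>_def append_Cons
    by (intro allI DERIV_sum_list DERIV_cmult c Qc_sym)
  have base: "\<Phi> \<gamma> [] = \<Psi> \<gamma> []" if \<gamma>: "Poly_Mapping.keys (\<gamma> - 0) \<subseteq> {k. fst k \<in> J}" for \<gamma>
  proof -
    have k: "fst k \<in> J" "fst k \<noteq> j" "j < fst k" "fst k \<in> N" if "k \<in> Poly_Mapping.keys \<gamma>" for k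
      using that \<gamma> j J by auto
    define m' where "m' = (\<lambda>a. m (jet j a) + lin \<gamma> (Qr j (j, a)))"
    have adm: "adm m'" unfolding m'_def
    proof (intro adm_add m adm_lin)
      fix p assume p: "p \<in> Poly_Mapping.keys \<gamma>"
      then show "adm (\<lambda>a. Qr j (j, a) p)"
        using k[OF p] j adm_pair1[of j "fst p" "snd p"] by (cases p) (auto simp: Qr_def)
    qed
    have g: "gexp (Qr j) (Mr j m) \<gamma> = gexp Qc (Mc m) \<gamma>"
    proof -
      have "gm (Qr j) (Mr j m) \<gamma> [] = gm Qc (Mc m) \<gamma> []"
        by (rule gm_cong) (use k in \<open>auto simp: Qr_def Mr_def Mc_def\<close>)
      then show ?thesis by simp
    qed
    have s: "gm Q M (?s \<alpha> + \<gamma>) (map (Pair j) ys) = gexp Q M \<gamma> *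
        gm (\<lambda>a b. Q (j, a) (j, b)) (\<lambda>a. M (j, a) + lin \<gamma> (Q (j, a))) (Poly_Mapping.single (0, 0) \<alpha>) ys"
      if "\<And>p q. Q p q = Q q p" for Q M \<alpha> ys
      using gm_shift[of Q M \<gamma> "?s \<alpha>" "map (Pair j) ys"] that
        gm_reindex[of "?s \<alpha>" "Poly_Mapping.single (0, 0) \<alpha>" "Pair j" Q "\<lambda>x. M x + lin \<gamma> (Q x)" ys]
      by (simp add: add.commute comp_def)
    have 1: "gm (Qr j) (Mr j m) (?s (snd q) + \<gamma>) (map (Pair j) (enumeration (fst q))) =
        gexp Qc (Mc m) \<gamma> * (prod_mset (image_mset m' (fst q)) * exp (snd q * m' (0, 0)))" for q
    proof -
      have "(\<lambda>a b. Qr j (j, a) (j, b)) = (\<lambda>_ _. 0)" by (auto simp: Qr_def)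
      moreover have "(\<lambda>a. Mr j m (j, a) + lin \<gamma> (Qr j (j, a))) = m'" by (auto simp: Mr_def m'_def)
      moreover have "prod_list (map m' (enumeration (fst q))) = prod_mset (image_mset m' (fst q))"
        by (metis mset_enumeration mset_map prod_mset_prod_list)
      ultimately show ?thesis by (simp add: s Qr_sym g gm_no_covariance)
    qed
    have l: "lin \<gamma> (Qc (j, a)) = lin \<gamma> (Qr j (j, a))" for a
      by (rule lin_cong) (use k in \<open>auto simp: Qr_def\<close>)
    have 2: "gm Qc (Mc m) (?s \<alpha> + \<gamma>) (map (Pair j) ys) =
        gexp Qc (Mc m) \<gamma> * gm (R j) (\<lambda>a. m' a + \<mu> j a) (Poly_Mapping.single (0, 0) \<alpha>) ys" for \<alpha> ys
    proof -
      have "(\<lambda>a b. Qc (j, a) (j, b)) = R j" by auto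
      moreover have "(\<lambda>a. Mc m (j, a) + lin \<gamma> (Qc (j, a))) = (\<lambda>a. m' a + \<mu> j a)"
        by (auto simp: Mc_def m'_def l)
      ultimately show ?thesis by (simp add: s Qc_sym)
    qed
    have "\<Phi> \<gamma> [] = gexp Qc (Mc m) \<gamma> * evf m' (x j)"
      by (simp add: \<Phi>_def 1 evf_def lin_fun_scale)
    also have "evf m' (x j) = tsum (T j) (gm (R j) (\<lambda>a. m' a + \<mu> j a))"
      using repr[OF j(1)] adm by (simp add: represents_def)
    also have "gexp Qc (Mc m) \<gamma> * \<dots> = \<Psi> \<gamma> []"
      by (simp add: \<Psi>_def tsum_def 2 case_prod_unfold mult.left_commute sum_list_const_mult[symmetric])
    finally show ?thesis .
  qed
  have "\<Phi> \<gamma> (zs @ []) = \<Psi> \<gamma> (zs @ [])"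
    by (rule coh_unique[OF c1 c2 base, where \<gamma>\<^sub>0 = 0 and B = "{k. fst k \<in> J}"]) (use \<gamma> in \<open>auto simp: image_subset_iff\<close>)
  moreover have "gm Q M \<gamma>' (xs @ zs) = gm Q M \<gamma>' (zs @ xs)" if "\<And>p q. Q p q = Q q p" for Q M \<gamma>' and xs :: "(nat \<times> nat \<times> nat) list"
    by (rule gm_mset) (simp_all add: that)
  ultimately show ?thesis
    by (simp add: \<Phi>_def \<Psi>_def case_prod_unfold Qr_sym Qc_sym)
qed

text \<open>Induction on the nodes: the leftmost field is a sum of Wick monomials, these are
  derivatives of exponentials, and an exponential on the left only shifts the mean seen by the
  remaining fields. \<open>substitute\<close> then brings node j into canonical form.\<close>

lemma ev_product:
  assumes "set js \<subseteq> N" "sorted_wrt (<) js"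
    and "\<And>i. i \<in> set js \<Longrightarrow> m (nd i) = m (jet i (0, 0))"
    and "\<And>i. i \<in> set js \<Longrightarrow> adm (\<lambda>a. m (jet i a))"
  shows "ev m (foldr (\<star>) (map (\<lambda>i. field_functional (jet i) (nd i) (x i)) js) 1) =
    (\<Sum>(d, \<gamma>, zs)\<leftarrow>choices T js. d * gm Qc (Mc m) \<gamma> zs)"
  using assms
proof (induction js arbitrary: m)
  case Nil
  then show ?case by (simp add: gexp_def)
next
  case (Cons j js)
  define P where "P = foldr (\<star>) (map (\<lambda>i. field_functional (jet i) (nd i) (x i)) js) 1"
  let ?s = "Poly_Mapping.single (j, 0, 0)"
  let ?jet = "\<lambda>p :: nat \<times> nat \<times> nat. jet j (snd p)"
  have j: "j \<in> N" "\<forall>i\<in>set js. j < i" "j \<notin> set js" using Cons.prems by auto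
  define \<Phi> where "\<Phi> = (\<lambda>\<alpha> \<gamma>' (ys :: (nat \<times> nat \<times> nat) list). ev m (Poly_Mapping.single (mset (map ?jet ys),
      Poly_Mapping.single (nd j) \<alpha> + push ?jet \<gamma>') 1 \<star> P))"
  define \<Psi> where "\<Psi> = (\<lambda>\<alpha> \<gamma>' ys. \<Sum>p\<leftarrow>choices T js. fst p *
      gm (Qr j) (Mr j m) (?s \<alpha> + fst (snd p) + \<gamma>') (ys @ snd (snd p)))"
  have c1: "coh (\<Phi> \<alpha>)" for \<alpha>
    unfolding coh_def \<Phi>_def push_add_single add.assoc[symmetric] list.map mset.simps
    by (intro allI ev_left_deriv)
  have "((\<lambda>s. gm (Qr j) (Mr j m) (\<delta> + (\<gamma> + Poly_Mapping.single y s)) zs) has_field_derivative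
      gm (Qr j) (Mr j m) (\<delta> + \<gamma>) (y # zs)) (at 0)" for \<delta> \<gamma> y and zs :: "(nat \<times> nat \<times> nat) list"
    using coh_gm[of "Qr j" "Mr j m"] Qr_sym unfolding coh_def add.assoc[symmetric] by blast
  then have c2: "coh (\<Psi> \<alpha>)" for \<alpha>
    unfolding coh_def \<Psi>_def append_Cons by (intro allI DERIV_sum_list DERIV_cmult)
  have base: "\<Phi> \<alpha> \<gamma>' [] = \<Psi> \<alpha> \<gamma>' []" if "Poly_Mapping.keys (\<gamma>' - 0) \<subseteq> {p. fst p = j}"
    for \<alpha> and \<gamma>' :: "nat \<times> nat \<times> nat \<Rightarrow>\<^sub>0 complex"
  proof -
    define \<delta> where "\<delta> = ?s \<alpha> + \<gamma>'"
    define m' where "m' = (\<lambda>h. m h + lin \<delta> (\<lambda>p. pair_exp (?jet p) h))"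
    have \<delta>: "fst p = j" if "p \<in> Poly_Mapping.keys \<delta>" for p
    proof -
      have "p \<in> Poly_Mapping.keys (?s \<alpha>) \<union> Poly_Mapping.keys \<gamma>'"
        using that Poly_Mapping.keys_add[of "?s \<alpha>" \<gamma>'] unfolding \<delta>_def by blast
      then show ?thesis using \<open>Poly_Mapping.keys (\<gamma>' - 0) \<subseteq> _\<close> by (auto split: if_splits)
    qed
    have l: "lin (Poly_Mapping.single (nd j) \<alpha> + push ?jet \<gamma>') f = lin \<delta> (\<lambda>p. f (?jet p))"
      if "f (nd j) = f (jet j (0, 0))" for f
      by (simp add: lin_add lin_push \<delta>_def that)
    have "\<Phi> \<alpha> \<gamma>' [] = exp (lin \<delta> (\<lambda>p. m (?jet p))) * ev m' P"
      using Cons.prems by (simp add: \<Phi>_def ev_exp_left l nd_left m'_def)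
    also have "lin \<delta> (\<lambda>p. m (?jet p)) = lin \<delta> (Mr j m)"
      by (rule lin_cong) (auto simp: Mr_def dest: \<delta>)
    also have "exp \<dots> = gexp (Qr j) (Mr j m) \<delta>"
    proof -
      have "lin \<delta> (Qr j p) = 0" if "p \<in> Poly_Mapping.keys \<delta>" for p
        using lin_cong[of \<delta> "Qr j p" "\<lambda>_. 0"] \<delta> that by (simp add: Qr_def)
      then have "lin \<delta> (\<lambda>p. lin \<delta> (Qr j p)) = 0"
        using lin_cong[of \<delta> "\<lambda>p. lin \<delta> (Qr j p)" "\<lambda>_. 0"] by simp
      then show ?thesis by (simp add: gexp_def)
    qed
    also have "ev m' P = (\<Sum>(d, \<gamma>, zs)\<leftarrow>choices T js. d * gm Qc (Mc m') \<gamma> zs)"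
      unfolding P_def
    proof (rule Cons.IH)
      fix i assume i: "i \<in> set js"
      then show "m' (nd i) = m' (jet i (0, 0))" using Cons.prems by (simp add: m'_def nd_right)
      show "adm (\<lambda>a. m' (jet i a))" unfolding m'_def
        using i Cons.prems j adm_pair2[of j i] by (intro adm_add adm_lin) auto
    qed (use Cons.prems in auto)
    also have "gexp (Qr j) (Mr j m) \<delta> * \<dots> = (\<Sum>p\<leftarrow>choices T js. fst p * gm (Qr j) (Mr j m) (\<delta> + fst (snd p)) (snd (snd p)))"
      unfolding sum_list_const_mult[symmetric]
    proof (intro arg_cong[where f = sum_list] map_cong refl)
      fix p assume p: "p \<in> set (choices T js)"
      then obtain d \<gamma> zs where pd: "p = (d, \<gamma>, zs)" and k: "fst ` (Poly_Mapping.keys \<gamma> \<union> set zs) \<subseteq> set js"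
        using choices_subset by (metis prod.collapse)
      have k': "fst q \<in> set js" "fst q \<noteq> j" "j < fst q" if "q \<in> set zs \<union> Poly_Mapping.keys \<gamma>" for q
        using that k j by auto
      \<comment> \<open>The shift that the exponential of node j produces on the remaining fields is
        the covariance term of \<open>gm_shift\<close>.\<close>
      have "gm Qc (Mc m') \<gamma> zs = gm (Qr j) (\<lambda>p. Mr j m p + lin \<delta> (Qr j p)) \<gamma> zs"
      proof (rule gm_cong)
        fix q assume q: "q \<in> set zs \<union> Poly_Mapping.keys \<gamma>"
        have "lin \<delta> (Qr j q) = lin \<delta> (\<lambda>p. pair_exp (?jet p) (jet (fst q) (snd q)))"
        proof (rule lin_cong)
          fix p assume "p \<in> Poly_Mapping.keys \<delta>"
          then show "Qr j q p = pair_exp (?jet p) (jet (fst q) (snd q))"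
            using \<delta>[of p] k'[OF q] by (cases p; cases q) (auto simp: Qr_def)
        qed
        then show "Mc m' q = Mr j m q + lin \<delta> (Qr j q)"
          using k'[OF q] by (cases q) (auto simp: Mc_def Mr_def m'_def)
      qed (simp add: Qr_def k'(2))
      moreover have "gm (Qr j) (Mr j m) (\<delta> + \<gamma>) zs = gexp (Qr j) (Mr j m) \<delta> * gm (Qr j) (\<lambda>p. Mr j m p + lin \<delta> (Qr j p)) \<gamma> zs"
        by (rule gm_shift) (rule Qr_sym)
      ultimately show "gexp (Qr j) (Mr j m) \<delta> * (case p of (d, \<gamma>, zs) \<Rightarrow> d * gm Qc (Mc m') \<gamma> zs) =
          fst p * gm (Qr j) (Mr j m) (\<delta> + fst (snd p)) (snd (snd p))"
        by (simp add: pd)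
    qed
    also have "\<dots> = \<Psi> \<alpha> \<gamma>' []" by (simp add: \<Psi>_def \<delta>_def add_ac)
    finally show ?thesis .
  qed
  have raw: "ev m (Poly_Mapping.single (image_mset (jet j) A, Poly_Mapping.single (nd j) \<alpha>) 1 \<star> P) =
    (\<Sum>p\<leftarrow>choices T js. fst p * gm (Qr j) (Mr j m) (?s \<alpha> + fst (snd p)) (map (Pair j) (enumeration A) @ snd (snd p)))" for A \<alpha>
  proof -
    have "\<Phi> \<alpha> 0 (map (Pair j) (enumeration A) @ []) = \<Psi> \<alpha> 0 (map (Pair j) (enumeration A) @ [])"
      by (rule coh_unique[OF c1 c2 base, where \<gamma>\<^sub>0 = 0 and B = "{p. fst p = j}"]) auto
    moreover have e: "mset (map ?jet (map (Pair j) (enumeration A) @ [])) = image_mset (jet j) A"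
      by (simp only: append_Nil2 map_map comp_def snd_conv mset_map mset_enumeration)
    ultimately show ?thesis by (simp only: \<Phi>_def \<Psi>_def e push_zero add_0_right append_Nil2)
  qed
  have "ev m (field_functional (jet j) (nd j) (x j) \<star> P) =
    (\<Sum>p\<leftarrow>choices T js. fst p * lin (x j) (\<lambda>q. gm (Qr j) (Mr j m) (?s (snd q) + fst (snd p))
       (map (Pair j) (enumeration (fst q)) @ snd (snd p))))"
    unfolding ev_fprod_left[of m "field_functional _ _ _"] lin_field_functional raw
    by (simp add: lin_fun_sum_list lin_fun_scale)
  also have "\<dots> = (\<Sum>p\<leftarrow>choices T js. fst p * (\<Sum>(c, ys, \<alpha>)\<leftarrow>T j. c *
      gm Qc (Mc m) (?s \<alpha> + fst (snd p)) (map (Pair j) ys @ snd (snd p))))"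
  proof (intro arg_cong[where f = sum_list] map_cong refl arg_cong2[where f = "(*)"])
    fix p assume p: "p \<in> set (choices T js)"
    show "lin (x j) (\<lambda>q. gm (Qr j) (Mr j m) (?s (snd q) + fst (snd p)) (map (Pair j) (enumeration (fst q)) @ snd (snd p))) =
      (\<Sum>(c, ys, \<alpha>)\<leftarrow>T j. c * gm Qc (Mc m) (?s \<alpha> + fst (snd p)) (map (Pair j) ys @ snd (snd p)))"
      by (rule substitute[where J = "set js"])
        (use Cons.prems j choices_subset[of "fst p" "fst (snd p)" "snd (snd p)"] p in auto)
  qed
  also have "\<dots> = (\<Sum>(d, \<gamma>, zs)\<leftarrow>choices T (j # js). d * gm Qc (Mc m) \<gamma> zs)"
  proof -
    have sw: "(\<Sum>p\<leftarrow>A. \<Sum>q\<leftarrow>B. f p q) = (\<Sum>q\<leftarrow>B. \<Sum>p\<leftarrow>A. f p q)" for A :: "'p list" and B :: "'q list" and f :: "'p \<Rightarrow> 'q \<Rightarrow> complex"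
      by (induction A) (simp_all add: sum_list_addf)
    have cc: "sum_list (map f (concat xss)) = (\<Sum>xs\<leftarrow>xss. sum_list (map f xs))" for f :: "'p \<Rightarrow> complex" and xss
      by (induction xss) auto
    show ?thesis
      by (simp add: case_prod_unfold comp_def mult_ac cc sum_list_const_mult[symmetric] sw[of _ "T j"])
  qed
  finally show ?case by (simp add: P_def)
qed

end

section \<open>Asymptotic expansions\<close>

text \<open>The step h = 1 / |b - a| gives (b - a) h modulus 1, too small for a non-zero multiple of
  2 \<pi> i.\<close>

lemma exp_ne_exp_scaled:
  assumes "a \<noteq> b"
  shows "exp (a * complex_of_real (1 / cmod (b - a))) \<noteq> exp (b * complex_of_real (1 / cmod (b - a)))"
proof
  define h where "h = complex_of_real (1 / cmod (b - a))"
  define z where "z = (b - a) * h"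
  assume "exp (a * complex_of_real (1 / cmod (b - a))) = exp (b * complex_of_real (1 / cmod (b - a)))"
  then have "exp (a * h) = exp (b * h)" unfolding h_def .
  then have "exp z = 1" by (simp add: z_def left_diff_distrib exp_diff)
  then obtain n :: int where n: "Re z = 0" "Im z = of_int (2 * n) * pi" by (auto simp: exp_eq_1)
  have "cmod z = 1" using assms by (simp add: z_def h_def norm_mult norm_divide)
  then have 1: "\<bar>of_int (2 * n) * pi\<bar> = 1" using n by (simp add: cmod_def)
  then have "n \<noteq> 0" by auto
  then have "2 \<le> \<bar>real_of_int (2 * n)\<bar>" by linarith
  moreover have "pi > 3" using pi_gt3 .
  ultimately have "\<bar>real_of_int (2 * n)\<bar> * pi \<ge> 2 * 3" by (intro mult_mono) auto
  with 1 show False by (simp add: abs_mult)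
qed

text \<open>Translating by h and subtracting exp (a h) times the original lowers the degree of
  \<open>P a\<close> and raises no other, so by induction the difference vanishes identically. The
  resulting functional equations leave only a constant times a single exponential, which does not
  decay since Re a >= 0.\<close>

lemma exponential_polynomial_zero:
  assumes "finite A" "\<And>a. a \<in> A \<Longrightarrow> Re a \<ge> 0"
    and "((\<lambda>x::real. \<Sum>a\<in>A. exp (a * of_real x) * poly (P a) (of_real x)) \<longlongrightarrow> 0) at_top"
    and "a \<in> A"
  shows "P a = 0"
  using assms(3,4)
\<comment> \<open>A polynomial counts with its degree plus one, and the zero polynomial with 0, so
  that removing a constant is progress too.\<close>
proof (induction "\<Sum>a\<in>A. if P a = 0 then 0 else Suc (degree (P a))" arbitrary: P a rule: less_induct)
  case less
  let ?m = "\<lambda>p :: complex poly. if p = 0 then 0 else Suc (degree p)"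
  let ?f = "\<lambda>x. \<Sum>a\<in>A. exp (a * complex_of_real x) * poly (P a) (of_real x)"
  have step: "smult (exp (b * of_real h)) (P b \<circ>\<^sub>p [:of_real h, 1:]) = smult (exp (a * of_real h)) (P b)"
    if a: "a \<in> A" "P a \<noteq> 0" and b: "b \<in> A" for a b and h :: real
  proof -
    define P' where "P' = (\<lambda>c. smult (exp (c * of_real h)) (P c \<circ>\<^sub>p [:of_real h, 1:]) - smult (exp (a * of_real h)) (P c))"
    have "((\<lambda>x. ?f (x + h)) \<longlongrightarrow> 0) at_top"
      by (rule filterlim_compose[OF less.prems(1)], subst add.commute)
        (rule filterlim_tendsto_add_at_top[OF tendsto_const filterlim_ident])
    then have "((\<lambda>x. ?f (x + h) - exp (a * of_real h) * ?f x) \<longlongrightarrow> 0 - exp (a * of_real h) * 0) at_top"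
      by (intro tendsto_intros less.prems)
    moreover have "?f (x + h) - exp (a * of_real h) * ?f x = (\<Sum>c\<in>A. exp (c * of_real x) * poly (P' c) (of_real x))" for x
      by (simp add: P'_def sum_distrib_left poly_pcompose ring_distribs exp_add algebra_simps flip: sum_subtractf)
    ultimately have lim: "((\<lambda>x. \<Sum>c\<in>A. exp (c * of_real x) * poly (P' c) (of_real x)) \<longlongrightarrow> 0) at_top" by simp
    have le: "?m (P' c) \<le> ?m (P c)" for c
    proof -
      have "degree (P' c) \<le> degree (P c)"
        unfolding P'_def by (intro degree_diff_le order.trans[OF degree_smult_le]) (auto simp: degree_pcompose)
      then show ?thesis by (auto simp: P'_def)
    qed
    have lt: "?m (P' a) < ?m (P a)"
    proof -
      define q where "q = P a \<circ>\<^sub>p [:of_real h, 1:] - P a"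
      have q: "P' a = smult (exp (a * of_real h)) q" by (simp add: P'_def q_def smult_diff_right)
      have "degree q \<le> degree (P a)" unfolding q_def
        by (intro degree_diff_le) (auto simp: degree_pcompose)
      moreover have "coeff q (degree (P a)) = 0"
        using lead_coeff_comp[of "[:of_real h, 1:]" "P a"] by (simp add: q_def degree_pcompose)
      ultimately have "q \<noteq> 0 \<Longrightarrow> degree q < degree (P a)"
        by (metis le_neq_implies_less leading_coeff_0_iff)
      then show ?thesis using a by (auto simp: q)
    qed
    have "(\<Sum>c\<in>A. ?m (P' c)) < (\<Sum>c\<in>A. ?m (P c))"
      by (rule sum_strict_mono_ex1) (use assms(1) le lt a in auto)
    from less.hyps[OF this lim b] show ?thesis by (simp add: P'_def)
  qed
  show "P a = 0"
  proof (rule ccontr)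
    assume nz: "P a \<noteq> 0"
    consider "degree (P a) > 0" | b where "b \<in> A" "b \<noteq> a" "P b \<noteq> 0"
      | "degree (P a) = 0" "\<forall>b\<in>A - {a}. P b = 0" by blast
    then show False
    proof cases
      case 1
      \<comment> \<open>For b = a the exponential factors cancel, so \<open>P a\<close> is invariant
        under translation by 1 and takes its value at 0 infinitely often.\<close>
      have "P a \<circ>\<^sub>p [:1, 1:] = P a" using step[OF less.prems(2) nz less.prems(2), of 1] by (simp add: poly_eq_iff)
      then have s: "poly (P a) (1 + x) = poly (P a) x" for x
        using poly_pcompose[of "P a" "[:1, 1:]" x] by simp
      have "poly (P a) (of_nat n) = poly (P a) 0" for n
        by (induction n) (use s in auto)
      then have "range of_nat \<subseteq> {x. poly (P a - [:poly (P a) 0:]) x = 0}" by auto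
      moreover have "infinite (range (of_nat :: nat \<Rightarrow> complex))"
        by (rule range_inj_infinite) (rule inj_of_nat)
      ultimately have "P a - [:poly (P a) 0:] = 0" using poly_roots_finite finite_subset by blast
      then show False using 1 by (metis degree_pCons_0 eq_iff_diff_eq_0 less_irrefl)
    next
      case 2
      define h where "h = 1 / cmod (b - a)"
      have "lead_coeff (smult (exp (b * of_real h)) (P b \<circ>\<^sub>p [:of_real h, 1:])) = lead_coeff (smult (exp (a * of_real h)) (P b))"
        using step[OF less.prems(2) nz 2(1), of h] by simp
      then have "exp (b * of_real h) = exp (a * of_real h)"
        using 2 lead_coeff_comp[of "[:of_real h, 1:]" "P b"] by (simp add: lead_coeff_smult)
      then show False using exp_ne_exp_scaled[of a b] 2 by (simp add: h_def)
    next
      case 3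
      obtain c where c: "P a = [:c:]" using 3(1) degree_eq_zeroE by blast
      have "?f = (\<lambda>x. exp (a * of_real x) * c)"
      proof
        fix x :: real
        have "?f x = (\<Sum>b\<in>{a}. exp (b * of_real x) * poly (P b) (of_real x))"
          by (rule sum.mono_neutral_right) (use assms(1) less.prems(2) 3 in auto)
        then show "?f x = exp (a * of_real x) * c" by (simp add: c)
      qed
      then have "((\<lambda>x. cmod (exp (a * of_real x) * c)) \<longlongrightarrow> 0) at_top"
        using less.prems(1) tendsto_norm_zero by fastforce
      moreover have "eventually (\<lambda>x. cmod c \<le> cmod (exp (a * of_real x) * c)) at_top"
        using eventually_ge_at_top[of 0]
      proof eventually_elim
        case (elim x)
        then have "1 \<le> cmod (exp (a * of_real x))" using assms(2)[OF less.prems(2)] by simp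
        then show ?case by (simp add: norm_mult mult_le_cancel_right1)
      qed
      ultimately have "cmod c \<le> 0"
        using tendsto_lowerbound by fastforce
      then show False using nz c by simp
    qed
  qed
qed

lemma laurent_polynomial_zero:
  fixes c :: "int \<Rightarrow> complex"
  assumes "finite M" and "\<And>z. cmod z = 1 \<Longrightarrow> (\<Sum>m\<in>M. c m * z powi m) = 0" and "m \<in> M"
  shows "c m = 0"
proof -
  obtain K :: nat where K: "\<And>m. m \<in> M \<Longrightarrow> m + int K \<ge> 0"
  proof
    fix m assume "m \<in> M"
    then have "nat \<bar>m\<bar> \<le> (\<Sum>m\<in>M. nat \<bar>m\<bar>)" using assms(1) by (intro member_le_sum) auto
    then show "m + int (\<Sum>m\<in>M. nat \<bar>m\<bar>) \<ge> 0" by linarith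
  qed
  define p where "p = (\<Sum>m\<in>M. monom (c m) (nat (m + int K)))"
  have "poly p z = 0" if z: "cmod z = 1" for z
  proof -
    have "z \<noteq> 0" using z by auto
    have "poly p z = (\<Sum>m\<in>M. z ^ K * (c m * z powi m))"
      unfolding p_def poly_sum poly_monom
    proof (rule sum.cong[OF refl])
      fix m assume "m \<in> M"
      then have "z ^ nat (m + int K) = z powi (m + int K)" using K by (simp add: power_int_def)
      then show "c m * z ^ nat (m + int K) = z ^ K * (c m * z powi m)"
        using \<open>z \<noteq> 0\<close> by (simp add: power_int_add)
    qed
    also have "\<dots> = 0" using assms(2)[OF z] by (simp flip: sum_distrib_left)
    finally show ?thesis .
  qed
  then have "sphere 0 1 \<subseteq> {z. poly p z = 0}" by auto
  moreover have "infinite (sphere (0::complex) 1)"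
    using uncountable_infinite connected_uncountable[of "sphere (0::complex) 1" 1 "-1"] connected_sphere[of "0::complex" 1]
    by (simp add: DIM_complex)
  ultimately have "p = 0" using poly_roots_finite finite_subset by blast
  have "coeff p (nat (m + int K)) = (\<Sum>m'\<in>M. if m' = m then c m' else 0)"
    unfolding p_def coeff_sum coeff_monom
    by (rule sum.cong[OF refl]) (use K assms(3) in \<open>auto simp: eq_nat_nat_iff\<close>)
  then show ?thesis using \<open>p = 0\<close> assms by simp
qed

text \<open>On the ray of angle \<theta> the point u tends to 0 as x grows, and an index of order at
  most 0 becomes an exponential whose exponent has non-negative real part.\<close>

lemma ope_fun_polar:
  "ope_fun (m, s, k) (of_real (exp (- x)) * cis \<theta>) =
     exp (- (of_int m + s) * of_real x) * ((cis \<theta> powi m * (- 1) ^ k) * of_real x ^ k)"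
proof -
  have 1: "complex_of_real (exp (- x)) powr s = exp (- s * of_real x)"
    unfolding powr_def Ln_of_real[OF exp_gt_zero] by (simp del: exp_of_real of_real_exp add: exp_not_eq_zero)
  have 2: "complex_of_real (exp (- x)) powi m = exp (- of_int m * of_real x)"
    by (simp add: exp_of_real[symmetric] exp_power_int)
  have 3: "complex_of_real (- x) ^ k = (- 1) ^ k * of_real x ^ k"
    by (metis of_real_minus power_minus)
  have 4: "cmod (of_real (exp (- x)) * cis \<theta>) = exp (- x)"
    by (simp add: norm_mult)
  have 5: "exp (- (of_int m + s) * of_real x) = exp (- of_int m * of_real x) * exp (- s * complex_of_real x)"
    by (simp add: exp_add[symmetric] algebra_simps)
  show ?thesis
    unfolding ope_fun.simps 4 power_int_mult_distrib 1 2 ln_exp 3 5 by (simp only: mult_ac)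
qed

text \<open>Two separations: along each ray the functions are exponential polynomials, which
  distinguishes m + s and k; for fixed m + s and k the dependence on the angle is a Laurent
  polynomial in exp (i \<theta>), which distinguishes m.\<close>

lemma ope_fun_independent:
  assumes I: "finite I" "\<And>i. i \<in> I \<Longrightarrow> ope_order i \<le> 0"
    and lim: "((\<lambda>u. \<Sum>i\<in>I. d i * ope_fun i u) \<longlongrightarrow> 0) (at 0)"
    and i: "i \<in> I"
  shows "d i = 0"
proof -
  define e where "e = (\<lambda>(m, s, k :: nat). - (of_int m + s :: complex))"
  have *: "(\<Sum>i | i \<in> {i \<in> I. e i = a} \<and> snd (snd i) = k. d i * cis \<theta> powi fst i) = 0" if a: "a \<in> e ` I" for a k \<theta>
  proof -
    define P where "P = (\<lambda>a. \<Sum>i | i \<in> I \<and> e i = a. monom (d i * (cis \<theta> powi fst i * (- 1) ^ snd (snd i))) (snd (snd i)))"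
    have f: "filterlim (\<lambda>x::real. of_real (exp (- x)) * cis \<theta>) (at 0) at_top"
    proof (rule filterlim_atI)
      have "((\<lambda>x::real. of_real (exp (- x)) * cis \<theta>) \<longlongrightarrow> of_real 0 * cis \<theta>) at_top"
        by (intro tendsto_intros) real_asymp
      then show "((\<lambda>x::real. of_real (exp (- x)) * cis \<theta>) \<longlongrightarrow> 0) at_top" by simp
    qed simp
    have "P a = 0"
    proof (rule exponential_polynomial_zero[where A = "e ` I"])
      show "Re a \<ge> 0" if "a \<in> e ` I" for a using that I(2) by (force simp: e_def)
      have "(\<Sum>a\<in>e ` I. exp (a * of_real x) * poly (P a) (of_real x)) = (\<Sum>i\<in>I. d i * ope_fun i (of_real (exp (- x)) * cis \<theta>))" for x
      proof -
        have "(\<Sum>a\<in>e ` I. exp (a * of_real x) * poly (P a) (of_real x)) =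
          (\<Sum>a\<in>e ` I. \<Sum>i | i \<in> I \<and> e i = a. d i * ope_fun i (of_real (exp (- x)) * cis \<theta>))"
          unfolding P_def poly_sum sum_distrib_left
        proof (intro sum.cong refl)
          fix a i assume "i \<in> {i \<in> I. e i = a}"
          then show "exp (a * of_real x) * poly (monom (d i * (cis \<theta> powi fst i * (- 1) ^ snd (snd i))) (snd (snd i))) (of_real x) =
            d i * ope_fun i (of_real (exp (- x)) * cis \<theta>)"
            by (cases i) (auto simp: ope_fun_polar poly_monom e_def simp del: ope_fun.simps)
        qed
        then show ?thesis using I by (simp add: sum.group)
      qed
      then show "((\<lambda>x. \<Sum>a\<in>e ` I. exp (a * of_real x) * poly (P a) (of_real x)) \<longlongrightarrow> 0) at_top"
        using filterlim_compose[OF lim f] by simp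
    qed (use I a in auto)
    then have "coeff (P a) k = 0" by simp
    moreover have "(\<Sum>i | i \<in> {i \<in> I. e i = a} \<and> snd (snd i) = k. (- 1) ^ k * (d i * cis \<theta> powi fst i)) = coeff (P a) k"
      unfolding P_def coeff_sum coeff_monom
      by (rule trans[OF sum.inter_filter]) (use I in \<open>auto intro!: sum.cong\<close>)
    ultimately have "(\<Sum>i | i \<in> {i \<in> I. e i = a} \<and> snd (snd i) = k. (- 1) ^ k * (d i * cis \<theta> powi fst i)) = 0"
      by simp
    then show ?thesis by (simp flip: sum_distrib_left)
  qed
  define J where "J = {j. j \<in> {j \<in> I. e j = e i} \<and> snd (snd j) = snd (snd i)}"
  have s: "fst (snd p) = - e p - of_int (fst p)" for p by (cases p) (simp add: e_def)
  have inj: "inj_on fst J" by (rule inj_onI) (simp add: J_def prod_eq_iff s)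
  have J: "finite J" "i \<in> J" using I i by (auto simp: J_def)
  have "d (the_inv_into J fst (fst i)) = 0"
  proof (rule laurent_polynomial_zero[where M = "fst ` J" and c = "\<lambda>m. d (the_inv_into J fst m)"])
    fix z :: complex assume "cmod z = 1"
    then obtain \<theta> where z: "z = cis \<theta>" by (metis complex_norm_eq_1_exp cis_conv_exp mult.commute)
    show "(\<Sum>m\<in>fst ` J. d (the_inv_into J fst m) * z powi m) = 0"
      using *[where a = "e i" and k = "snd (snd i)" and \<theta> = \<theta>] i inj by (simp add: sum.reindex the_inv_into_f_f z J_def)
  qed (use J in auto)
  then show ?thesis using inj J by (simp add: the_inv_into_f_f)
qed

lemma ope_fun_mult:
  "u \<noteq> 0 \<Longrightarrow> ope_fun (m, s, k) u * ope_fun (m', s', k') u = ope_fun (m + m', s + s', k + k') u"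
  by (simp add: power_int_add powr_add power_add)

lemma norm_ope_fun:
  assumes "u \<noteq> 0"
  shows "cmod (ope_fun i u) = cmod u powr ope_order i * \<bar>ln (cmod u)\<bar> ^ snd (snd i)"
proof -
  obtain m s k where i: "i = (m, s, k)" by (cases i)
  have "cmod (u powi m) = cmod u powr of_int m"
    using assms by (simp add: norm_power_int powr_real_of_int')
  moreover have "cmod (complex_of_real (cmod u) powr s) = cmod u powr Re s"
    by (simp add: norm_powr_real_powr)
  ultimately show ?thesis by (simp add: i norm_mult norm_power powr_add)
qed

lemma powr_ln_power_tendsto_0:
  fixes p :: real
  assumes "p > 0"
  shows "((\<lambda>r. r powr p * \<bar>ln r\<bar> ^ k) \<longlongrightarrow> 0) (at_right 0)"
proof -
  have "filterlim (\<lambda>r. p * - ln r) at_top (at_right (0 :: real))"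
    using ln_at_0 assms
    by (intro filterlim_tendsto_pos_mult_at_top[OF tendsto_const]) (auto simp: filterlim_uminus_at_top)
  from filterlim_compose[OF tendsto_power_div_exp_0 this, of k]
  have "((\<lambda>r. inverse (p ^ k) * ((p * - ln r) ^ k / exp (p * - ln r))) \<longlongrightarrow> inverse (p ^ k) * 0) (at_right 0)"
    by (rule tendsto_mult_left)
  moreover have "eventually (\<lambda>r. inverse (p ^ k) * ((p * - ln r) ^ k / exp (p * - ln r)) = r powr p * \<bar>ln r\<bar> ^ k) (at_right 0)"
  proof -
    have "eventually (\<lambda>r :: real. 0 < r \<and> r < 1) (at_right 0)"
      by (auto simp: eventually_at_right_field intro!: exI[of _ 1])
    then show ?thesis
  proof eventually_elim
    case r: (elim r)
    then have "\<bar>ln r\<bar> = - ln r" by simp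
    moreover have "r powr p = inverse (exp (p * - ln r))" using r by (simp add: powr_def exp_minus)
    ultimately show "inverse (p ^ k) * ((p * - ln r) ^ k / exp (p * - ln r)) = r powr p * \<bar>ln r\<bar> ^ k"
      using assms unfolding power_mult_distrib by (simp add: field_simps del: mult_minus_right)
  qed
  qed
  ultimately show ?thesis by (auto intro: Lim_transform_eventually)
qed

lemma ope_fun_tendsto_0:
  assumes "ope_order i > 0"
  shows "(ope_fun i \<longlongrightarrow> 0) (at 0)"
proof (rule tendsto_norm_zero_cancel)
  have f: "filterlim (\<lambda>u::complex. cmod u) (at_right 0) (at 0)"
    by (intro filterlim_at_withinI) (auto simp: tendsto_norm_zero eventually_at_filter)
  have "((\<lambda>u. cmod u powr ope_order i * \<bar>ln (cmod u)\<bar> ^ snd (snd i)) \<longlongrightarrow> 0) (at 0)"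
    by (rule filterlim_compose[OF powr_ln_power_tendsto_0[OF assms] f])
  then show "((\<lambda>u. cmod (ope_fun i u)) \<longlongrightarrow> 0) (at 0)"
    by (rule Lim_transform_eventually) (auto simp: eventually_at_filter norm_ope_fun simp del: ope_fun.simps)
qed

text \<open>The K powers of |u| gained from g are absorbed into s, which makes the order
  positive.\<close>

lemma ope_fun_mult_tendsto_0:
  assumes g: "((\<lambda>u. g u / complex_of_real (cmod u ^ K)) \<longlongrightarrow> 0) (at 0)" and "ope_order i + real K > 0"
  shows "((\<lambda>u. ope_fun i u * g u) \<longlongrightarrow> 0) (at 0)"
proof -
  obtain m s k where i: "i = (m, s, k)" by (cases i)
  have "(ope_fun (m, s + of_nat K, k) \<longlongrightarrow> 0) (at 0)"
    by (rule ope_fun_tendsto_0) (use assms i in simp)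
  then have "((\<lambda>u. ope_fun (m, s + of_nat K, k) u * (g u / complex_of_real (cmod u ^ K))) \<longlongrightarrow> 0 * 0) (at 0)"
    by (rule tendsto_mult) (rule g)
  moreover have "ope_fun (m, s + of_nat K, k) u * (g u / complex_of_real (cmod u ^ K)) = ope_fun i u * g u" if "u \<noteq> 0" for u
  proof -
    have "complex_of_real (cmod u) powr of_nat K = complex_of_real (cmod u) ^ K"
      using that by (simp add: powr_nat')
    then show ?thesis using that by (simp add: i powr_add)
  qed
  ultimately show ?thesis
    by (auto intro: Lim_transform_eventually simp: eventually_at_filter)
qed

subsection \<open>Taylor expansion in \<open>u\<close> and its conjugate\<close>

definition taylor where
  "taylor g z K u = (\<Sum>(j, k)\<in>{(j, k). j + k \<le> K}. g j k z * (u ^ j / fact j) * (cnj u ^ k / fact k) :: complex)"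

lemma finite_taylor_index: "finite {(j :: nat, k). j + k \<le> K}"
  by (rule finite_subset[of _ "{..K} \<times> {..K}"]) auto

lemma taylor_0: "taylor g z K 0 = g 0 0 z"
proof -
  have "taylor g z K 0 = (\<Sum>p\<in>{(0, 0)}. case p of (j, k) \<Rightarrow> g j k z * (0 ^ j / fact j) * (0 ^ k / fact k))"
    unfolding taylor_def complex_cnj_zero
    by (rule sum.mono_neutral_right) (auto simp: finite_taylor_index)
  then show ?thesis by simp
qed

lemma taylor_has_derivative:
  "(taylor g z (Suc K) has_derivative
     (\<lambda>h. taylor (\<lambda>j. g (Suc j)) z K u * h + taylor (\<lambda>j k. g j (Suc k)) z K u * cnj h)) (at u)"
proof -
  let ?p = "\<lambda>j u :: complex. u ^ j / fact j"
  let ?q = "\<lambda>j u. case j of 0 \<Rightarrow> 0 | Suc i \<Rightarrow> ?p i u"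
  have p: "(?p j has_derivative (\<lambda>h. ?q j u * h)) (at u)" for j u
  proof (cases j)
    case (Suc i)
    have "((\<lambda>u. u ^ Suc i / fact (Suc i)) has_field_derivative (of_nat (Suc i) * u ^ i) / fact (Suc i)) (at u)"
      by (rule DERIV_cdivide) (use DERIV_power[OF DERIV_ident[of "at u"], of "Suc i"] in simp)
    also have "(of_nat (Suc i) * u ^ i) / fact (Suc i) = u ^ i / (fact i :: complex)"
      unfolding fact_Suc by (simp del: of_nat_Suc)
    finally show ?thesis unfolding has_field_derivative_def Suc by (simp only: nat.case)
  qed simp
  have c: "((\<lambda>u. ?p k (cnj u)) has_derivative (\<lambda>h. ?q k (cnj u) * cnj h)) (at u)" for k u
    using has_derivative_compose[OF bounded_linear.has_derivative[OF bounded_linear_cnj has_derivative_ident] p] .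
  let ?D = "\<lambda>K. {(j :: nat, k :: nat). j + k \<le> K}"
  have d: "(taylor g z (Suc K) has_derivative (\<lambda>h. \<Sum>(j, k)\<in>?D (Suc K).
      g j k z * (?q j u * ?p k (cnj u) * h + ?p j u * ?q k (cnj u) * cnj h))) (at u)"
    unfolding taylor_def case_prod_unfold
  proof (rule has_derivative_sum)
    fix x
    show "((\<lambda>u. g (fst x) (snd x) z * ?p (fst x) u * ?p (snd x) (cnj u)) has_derivative
       (\<lambda>h. g (fst x) (snd x) z * (?q (fst x) u * ?p (snd x) (cnj u) * h + ?p (fst x) u * ?q (snd x) (cnj u) * cnj h))) (at u)"
      by (rule has_derivative_eq_rhs[OF has_derivative_mult[OF has_derivative_mult_right[OF p] c]])
        (simp add: algebra_simps)
  qed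
  have 1: "(\<Sum>(j, k)\<in>?D (Suc K). g j k z * (?q j u * ?p k (cnj u))) = taylor (\<lambda>j. g (Suc j)) z K u"
  proof -
    have "(\<Sum>(j, k)\<in>?D (Suc K). g j k z * (?q j u * ?p k (cnj u))) =
      (\<Sum>(j, k)\<in>?D (Suc K) - {0} \<times> UNIV. g j k z * (?q j u * ?p k (cnj u)))"
      by (rule sum.mono_neutral_right) (auto simp: finite_taylor_index)
    also have "\<dots> = taylor (\<lambda>j. g (Suc j)) z K u" unfolding taylor_def
      by (rule sum.reindex_bij_witness[where i = "\<lambda>(j, k). (Suc j, k)" and j = "\<lambda>(j, k). (j - 1, k)"])
        (auto split: nat.splits simp: mult_ac)
    finally show ?thesis .
  qed
  have 2: "(\<Sum>(j, k)\<in>?D (Suc K). g j k z * (?p j u * ?q k (cnj u))) = taylor (\<lambda>j k. g j (Suc k)) z K u"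
  proof -
    have "(\<Sum>(j, k)\<in>?D (Suc K). g j k z * (?p j u * ?q k (cnj u))) =
      (\<Sum>(j, k)\<in>?D (Suc K) - UNIV \<times> {0}. g j k z * (?p j u * ?q k (cnj u)))"
      by (rule sum.mono_neutral_right) (auto simp: finite_taylor_index)
    also have "\<dots> = taylor (\<lambda>j k. g j (Suc k)) z K u" unfolding taylor_def
      by (rule sum.reindex_bij_witness[where i = "\<lambda>(j, k). (j, Suc k)" and j = "\<lambda>(j, k). (j, k - 1)"])
        (auto split: nat.splits simp: mult_ac)
    finally show ?thesis .
  qed
  show ?thesis
  proof (rule has_derivative_eq_rhs[OF d], rule ext)
    fix h
    show "(\<Sum>(j, k)\<in>?D (Suc K). g j k z * (?q j u * ?p k (cnj u) * h + ?p j u * ?q k (cnj u) * cnj h)) =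
      taylor (\<lambda>j. g (Suc j)) z K u * h + taylor (\<lambda>j k. g j (Suc k)) z K u * cnj h"
      unfolding 1[symmetric] 2[symmetric] sum_distrib_right sum.distrib[symmetric]
      by (rule sum.cong[OF refl]) (auto simp: distrib_left mult.assoc)
  qed
qed

text \<open>The derivatives of the remainder of order K + 1 are the remainders of order K of the two
  families of derivatives, so the mean value inequality gives the induction step. The claim is
  proved for all families at once.\<close>

lemma taylor_remainder:
  assumes "open S" "z \<in> S"
    and "\<And>j k \<zeta>. \<zeta> \<in> S \<Longrightarrow> (g j k has_derivative (\<lambda>h. g (Suc j) k \<zeta> * h + g j (Suc k) \<zeta> * cnj h)) (at \<zeta>)"
  shows "((\<lambda>u. (g 0 0 (z + u) - taylor g z K u) / complex_of_real (cmod u ^ K)) \<longlongrightarrow> 0) (at 0)"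
  using assms(3)
proof (induction K arbitrary: g)
  case 0
  have "isCont (g 0 0) z" using has_derivative_continuous[OF 0[OF assms(2)]] .
  then have "((\<lambda>u. g 0 0 (z + u) - g 0 0 z) \<longlongrightarrow> 0) (at 0)"
    by (simp add: isCont_def LIM_offset_zero_iff LIM_zero_iff)
  moreover have "taylor g z 0 u = g 0 0 z" for u
    unfolding taylor_def by (subst sum.mono_neutral_right[of _ "{(0, 0)}"]) (auto simp: finite_taylor_index)
  ultimately show ?case by simp
next
  case (Suc K)
  let ?g1 = "\<lambda>j. g (Suc j)" and ?g2 = "\<lambda>j k. g j (Suc k)"
  let ?r = "\<lambda>K g u. g 0 0 (z + u) - taylor g z K u"
  have IH: "((\<lambda>u. ?r K ?g1 u / complex_of_real (cmod u ^ K)) \<longlongrightarrow> 0) (at 0)"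
    "((\<lambda>u. ?r K ?g2 u / complex_of_real (cmod u ^ K)) \<longlongrightarrow> 0) (at 0)"
    by (rule Suc.IH; rule Suc.prems; assumption)+
  obtain d0 where d0: "d0 > 0" "ball z d0 \<subseteq> S" using assms(1,2) open_contains_ball by blast
  show ?case
  proof (rule LIM_I)
    fix e :: real assume e: "e > 0"
    have bd: "\<exists>d>0. \<forall>u. cmod u < d \<longrightarrow> cmod (?r K g' u) \<le> e / 4 * cmod u ^ K"
      if "((\<lambda>u. ?r K g' u / complex_of_real (cmod u ^ K)) \<longlongrightarrow> 0) (at 0)" for g' :: "nat \<Rightarrow> nat \<Rightarrow> complex \<Rightarrow> complex"
    proof -
      have "e / 4 > 0" using e by simp
      from LIM_D[OF that this] obtain d where d: "d > 0"
        "\<forall>u. u \<noteq> 0 \<and> norm (u - 0) < d \<longrightarrow> norm (?r K g' u / complex_of_real (cmod u ^ K) - 0) < e / 4" by blast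
      have "cmod (?r K g' u) \<le> e / 4 * cmod u ^ K" if "cmod u < d" for u
      proof (cases "u = 0")
        case True
        then show ?thesis using e by (simp add: taylor_0)
      next
        case False
        then show ?thesis using d(2)[rule_format, of u] that by (simp add: norm_divide norm_power field_simps)
      qed
      then show ?thesis using d(1) by blast
    qed
    from bd[OF IH(1)] bd[OF IH(2)] obtain d1 d2 where d1: "d1 > 0" "\<And>u. cmod u < d1 \<Longrightarrow> cmod (?r K ?g1 u) \<le> e / 4 * cmod u ^ K"
      and d2: "d2 > 0" "\<And>u. cmod u < d2 \<Longrightarrow> cmod (?r K ?g2 u) \<le> e / 4 * cmod u ^ K" by blast
    show "\<exists>s>0. \<forall>u. u \<noteq> 0 \<and> norm (u - 0) < s \<longrightarrow> norm (?r (Suc K) g u / complex_of_real (cmod u ^ Suc K) - 0) < e"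
    proof (intro exI[of _ "min d0 (min d1 d2)"] conjI allI impI)
      fix u :: complex assume u: "u \<noteq> 0 \<and> norm (u - 0) < min d0 (min d1 d2)"
      have der: "(?r (Suc K) g has_derivative (\<lambda>h. ?r K ?g1 w * h + ?r K ?g2 w * cnj h)) (at w)" if "cmod w < d0" for w
      proof -
        have "z + w \<in> S" using d0 that by (auto simp: dist_norm)
        from has_derivative_compose[OF has_derivative_add[OF has_derivative_const has_derivative_ident] Suc.prems[OF this]]
        have "((\<lambda>u. g 0 0 (z + u)) has_derivative (\<lambda>h. g 1 0 (z + w) * h + g 0 1 (z + w) * cnj h)) (at w)" by simp
        from has_derivative_diff[OF this taylor_has_derivative[of g z K w]] show ?thesis
          by (rule has_derivative_eq_rhs) (simp add: algebra_simps)
      qed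
      have "norm (?r (Suc K) g u - ?r (Suc K) g 0) \<le> (e / 2 * cmod u ^ K) * norm (u - 0)"
      proof (rule differentiable_bound[of "cball 0 (cmod u)"])
        fix w :: complex assume w: "w \<in> cball 0 (cmod u)"
        then have w': "cmod w \<le> cmod u" by simp
        show "(?r (Suc K) g has_derivative (\<lambda>h. ?r K ?g1 w * h + ?r K ?g2 w * cnj h)) (at w within cball 0 (cmod u))"
          by (rule has_derivative_at_withinI[OF der]) (use u w' in auto)
        have "cmod w ^ K \<le> cmod u ^ K" using w' by (intro power_mono) auto
        then have b: "e / 4 * cmod w ^ K \<le> e / 4 * cmod u ^ K" using e by (intro mult_left_mono) auto
        show "onorm (\<lambda>h. ?r K ?g1 w * h + ?r K ?g2 w * cnj h) \<le> e / 2 * cmod u ^ K"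
        proof (rule onorm_le)
          fix h :: complex
          have "norm (?r K ?g1 w * h + ?r K ?g2 w * cnj h) \<le> cmod (?r K ?g1 w) * cmod h + cmod (?r K ?g2 w) * cmod h"
            by (rule order.trans[OF norm_triangle_ineq]) (simp add: norm_mult)
          also have "\<dots> \<le> (e / 4 * cmod u ^ K) * cmod h + (e / 4 * cmod u ^ K) * cmod h"
            using d1(2)[of w] d2(2)[of w] u w' b by (intro add_mono mult_right_mono) auto
          finally show "norm (?r K ?g1 w * h + ?r K ?g2 w * cnj h) \<le> e / 2 * cmod u ^ K * norm h" by (simp add: mult_ac)
        qed
      qed auto
      then have "cmod (?r (Suc K) g u) \<le> e / 2 * cmod u ^ Suc K" by (simp add: taylor_0 mult_ac)
      also have "\<dots> < e * cmod u ^ Suc K" using e u by simp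
      finally show "norm (?r (Suc K) g u / complex_of_real (cmod u ^ Suc K) - 0) < e"
        using u by (simp add: norm_divide norm_power norm_mult field_simps)
    qed (use d0 d1 d2 in auto)
  qed
qed

section \<open>Wirtinger derivatives of explicit functions\<close>

definition hw :: "(complex \<Rightarrow> complex) \<Rightarrow> complex \<Rightarrow> complex \<Rightarrow> complex \<Rightarrow> bool" where
  "hw f a b x \<longleftrightarrow> (f has_derivative (\<lambda>h. a * h + b * cnj h)) (at x)"

lemma hw_dz: "hw f a b x \<Longrightarrow> dz f x = a" and hw_dzbar: "hw f a b x \<Longrightarrow> dzbar f x = b"
proof -
  assume "hw f a b x"
  then have "frechet_derivative f (at x) = (\<lambda>h. a * h + b * cnj h)"
    unfolding hw_def by (metis frechet_derivative_at)
  then show "dz f x = a" "dzbar f x = b" by (simp_all add: dz_def dzbar_def algebra_simps)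
qed

lemma has_derivative_cong_nhds:
  assumes "(f has_derivative D) (at x)" "\<forall>\<^sub>F y in nhds x. f y = g y"
  shows "(g has_derivative D) (at x)"
proof -
  obtain S where "open S" "x \<in> S" "\<And>y. y \<in> S \<Longrightarrow> f y = g y"
    using assms(2) unfolding eventually_nhds by blast
  then show ?thesis using has_derivative_transform_within_open[OF assms(1)] by blast
qed

lemma hw_cong: "hw f a b x \<Longrightarrow> \<forall>\<^sub>F y in nhds x. f y = g y \<Longrightarrow> hw g a b x"
  unfolding hw_def by (rule has_derivative_cong_nhds)

lemma hw_unique: "hw f a b x \<Longrightarrow> hw f a' b' x \<Longrightarrow> a = a' \<and> b = b'"
  using hw_dz hw_dzbar by metis

lemma hw_const [intro]: "hw (\<lambda>_. c) 0 0 x"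
  by (simp add: hw_def)

lemma hw_add: "hw f a b x \<Longrightarrow> hw g c d x \<Longrightarrow> hw (\<lambda>x. f x + g x) (a + c) (b + d) x"
  unfolding hw_def by (drule (1) has_derivative_add) (simp add: algebra_simps)

lemma hw_scale: "hw f a b x \<Longrightarrow> hw (\<lambda>x. c * f x) (c * a) (c * b) x"
  unfolding hw_def by (drule has_derivative_mult_right[of _ _ _ c]) (simp add: algebra_simps)

lemma hw_sum_list:
  "(\<And>k. k \<in> set ks \<Longrightarrow> hw (f k) (a k) (b k) x) \<Longrightarrow> hw (\<lambda>x. \<Sum>k\<leftarrow>ks. f k x) (\<Sum>k\<leftarrow>ks. a k) (\<Sum>k\<leftarrow>ks. b k) x"
  by (induction ks) (auto intro: hw_add)

lemma hw_lin:
  assumes "\<And>k. k \<in> Poly_Mapping.keys \<gamma> \<Longrightarrow> hw (\<lambda>x. f x k) (a k) (b k) x"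
  shows "hw (\<lambda>x. lin \<gamma> (f x)) (lin \<gamma> a) (lin \<gamma> b) x"
  using has_derivative_lin[of \<gamma> f "\<lambda>h k. a k * h + b k * cnj h" "at x"] assms
  by (simp add: hw_def lin_fun_add lin_fun_scale_right)

text \<open>All Wirtinger derivatives of \<open>g 0 0\<close> at once. Having both derivatives of
  each member inside the family builds in their commutation, which \<open>wirt\<close> with its
  fixed order does not provide.\<close>

definition jfam :: "complex set \<Rightarrow> (nat \<Rightarrow> nat \<Rightarrow> complex \<Rightarrow> complex) \<Rightarrow> bool" where
  "jfam S g \<longleftrightarrow> (\<forall>j k. \<forall>\<zeta>\<in>S. hw (g j k) (g (Suc j) k \<zeta>) (g j (Suc k) \<zeta>) \<zeta>)"

lemma wirt_eq:
  assumes "open S" "jfam S g" "\<And>\<zeta>. \<zeta> \<in> S \<Longrightarrow> f \<zeta> = g 0 0 \<zeta>" "\<zeta> \<in> S"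
  shows "wirt j k f \<zeta> = g j k \<zeta>"
proof -
  have ev: "\<forall>\<^sub>F y in nhds \<zeta>. P y" if "\<And>y. y \<in> S \<Longrightarrow> P y" "\<zeta> \<in> S" for P \<zeta>
    using eventually_nhds_in_open[OF assms(1) that(2)] by eventually_elim (rule that(1))
  have 1: "(dzbar ^^ k) f \<zeta> = g 0 k \<zeta>" if "\<zeta> \<in> S" for k \<zeta>
    using that
  proof (induction k arbitrary: \<zeta>)
    case (Suc k)
    have "hw ((dzbar ^^ k) f) (g 1 k \<zeta>) (g 0 (Suc k) \<zeta>) \<zeta>"
      by (rule hw_cong[of "g 0 k"]) (use assms(2) Suc in \<open>auto simp: jfam_def intro!: ev\<close>)
    then show ?case by (simp add: hw_dzbar)
  qed (use assms(3) in simp)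
  have "(dz ^^ j) ((dzbar ^^ k) f) \<zeta> = g j k \<zeta>" if "\<zeta> \<in> S" for \<zeta>
    using that
  proof (induction j arbitrary: \<zeta>)
    case (Suc j)
    have "hw ((dz ^^ j) ((dzbar ^^ k) f)) (g (Suc j) k \<zeta>) (g j (Suc k) \<zeta>) \<zeta>"
      by (rule hw_cong[of "g j k"]) (use assms(2) Suc in \<open>auto simp: jfam_def intro!: ev\<close>)
    then show ?case by (simp add: hw_dz)
  qed (use 1 in simp)
  then show ?thesis using assms(4) by (simp add: wirt_def)
qed

text \<open>Extends an identity of functions to all derivatives, so that jet identities need to be
  verified at order (0, 0) only.\<close>

lemma jfam_unique:
  assumes "open S" "jfam S g" "jfam S g'" "\<And>\<zeta>. \<zeta> \<in> S \<Longrightarrow> g 0 0 \<zeta> = g' 0 0 \<zeta>" "\<zeta> \<in> S"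
  shows "g j k \<zeta> = g' j k \<zeta>"
  using wirt_eq[OF assms(1,2), of "g 0 0"] wirt_eq[OF assms(1,3), of "g 0 0"] assms by metis

lemma jfam_scale: "jfam S g \<Longrightarrow> jfam S (\<lambda>j k \<zeta>. c * g j k \<zeta>)"
  by (simp add: jfam_def hw_scale)

lemma jfam_add: "jfam S g \<Longrightarrow> jfam S g' \<Longrightarrow> jfam S (\<lambda>j k \<zeta>. g j k \<zeta> + g' j k \<zeta>)"
  by (simp add: jfam_def hw_add)

subsection \<open>Expressions with formal derivatives\<close>

text \<open>
  Functions of the time \<open>t\<close> and of two points \<open>x\<close>, \<open>y\<close>. \<open>PX\<close> and \<open>PY\<close> are the images of the points under
  the flow of \<open>v\<^sub>\<xi>\<close>, which satisfy \<open>P\<^sup>2 = X\<^sup>2 - 2 t\<close> (all points being taken relative to \<open>\<xi>\<close>). Formal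
  differentiation commutes, which yields the symmetry of all higher derivatives.
\<close>

datatype ex = Cst complex | X | Y | PX | PY | Add ex ex | Mul ex ex | Scl complex ex | Inv ex | Cnj ex | Labs ex | Ag ex

text \<open>Of the two roots of x^2 - 2 t this one lies in the closed upper half-plane, as
  \<open>csqrt\<close> has non-negative real part. The branch cut is where the root would be
  real.\<close>

definition flow_root :: "real \<Rightarrow> complex \<Rightarrow> complex" where
  "flow_root t x = \<i> * csqrt (2 * of_real t - x\<^sup>2)"

type_synonym point = "real \<times> complex \<times> complex"

fun val :: "real \<Rightarrow> ex \<Rightarrow> point \<Rightarrow> complex" where
  "val \<xi> (Cst c) \<omega> = c"
| "val \<xi> X \<omega> = fst (snd \<omega>) - of_real \<xi>"
| "val \<xi> Y \<omega> = snd (snd \<omega>) - of_real \<xi>"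
| "val \<xi> PX \<omega> = flow_root (fst \<omega>) (fst (snd \<omega>) - of_real \<xi>)"
| "val \<xi> PY \<omega> = flow_root (fst \<omega>) (snd (snd \<omega>) - of_real \<xi>)"
| "val \<xi> (Add e f) \<omega> = val \<xi> e \<omega> + val \<xi> f \<omega>"
| "val \<xi> (Mul e f) \<omega> = val \<xi> e \<omega> * val \<xi> f \<omega>"
| "val \<xi> (Scl c e) \<omega> = c * val \<xi> e \<omega>"
| "val \<xi> (Inv e) \<omega> = inverse (val \<xi> e \<omega>)"
| "val \<xi> (Cnj e) \<omega> = cnj (val \<xi> e \<omega>)"
| "val \<xi> (Labs e) \<omega> = of_real (ln (cmod (val \<xi> e \<omega>)))"
| "val \<xi> (Ag e) \<omega> = of_real (Arg (val \<xi> e \<omega>))"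

fun valid :: "real \<Rightarrow> ex \<Rightarrow> point \<Rightarrow> bool" where
  "valid \<xi> (Cst c) \<omega> = True"
| "valid \<xi> X \<omega> = True"
| "valid \<xi> Y \<omega> = True"
| "valid \<xi> PX \<omega> = (2 * of_real (fst \<omega>) - (fst (snd \<omega>) - of_real \<xi>)\<^sup>2 \<notin> \<real>\<^sub>\<le>\<^sub>0)"
| "valid \<xi> PY \<omega> = (2 * of_real (fst \<omega>) - (snd (snd \<omega>) - of_real \<xi>)\<^sup>2 \<notin> \<real>\<^sub>\<le>\<^sub>0)"
| "valid \<xi> (Add e f) \<omega> = (valid \<xi> e \<omega> \<and> valid \<xi> f \<omega>)"
| "valid \<xi> (Mul e f) \<omega> = (valid \<xi> e \<omega> \<and> valid \<xi> f \<omega>)"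
| "valid \<xi> (Scl c e) \<omega> = valid \<xi> e \<omega>"
| "valid \<xi> (Inv e) \<omega> = (valid \<xi> e \<omega> \<and> val \<xi> e \<omega> \<noteq> 0)"
| "valid \<xi> (Cnj e) \<omega> = valid \<xi> e \<omega>"
| "valid \<xi> (Labs e) \<omega> = (valid \<xi> e \<omega> \<and> val \<xi> e \<omega> \<noteq> 0)"
| "valid \<xi> (Ag e) \<omega> = (valid \<xi> e \<omega> \<and> val \<xi> e \<omega> \<notin> \<real>\<^sub>\<le>\<^sub>0)"

datatype dir = Dx | Dxb | Dy | Dyb | Dt

text \<open>Conjugation exchanges the two Wirtinger derivatives in the same point and fixes the
  derivative in the real time.\<close>

fun bar where "bar Dx = Dxb" | "bar Dxb = Dx" | "bar Dy = Dyb" | "bar Dyb = Dy" | "bar Dt = Dt"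

text \<open>\<open>PX\<close> is differentiated through P^2 = X^2 - 2 t. \<open>Labs\<close> and
  \<open>Ag\<close> are treated as real and imaginary part of a logarithm, which gives the factors
  1/2 and -i/2.\<close>

fun der :: "dir \<Rightarrow> ex \<Rightarrow> ex" where
  "der k (Cst c) = Cst 0"
| "der k X = (if k = Dx then Cst 1 else Cst 0)"
| "der k Y = (if k = Dy then Cst 1 else Cst 0)"
| "der k PX = (if k = Dx then Mul X (Inv PX) else if k = Dt then Scl (-1) (Inv PX) else Cst 0)"
| "der k PY = (if k = Dy then Mul Y (Inv PY) else if k = Dt then Scl (-1) (Inv PY) else Cst 0)"
| "der k (Add e f) = Add (der k e) (der k f)"
| "der k (Mul e f) = Add (Mul (der k e) f) (Mul e (der k f))"
| "der k (Inv e) = Scl (-1) (Mul (Mul (Inv e) (Inv e)) (der k e))"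
| "der k (Scl c e) = Scl c (der k e)"
| "der k (Cnj e) = Cnj (der (bar k) e)"
| "der k (Labs e) = Scl (1 / 2) (Add (Mul (Inv e) (der k e)) (Cnj (Mul (Inv e) (der (bar k) e))))"
| "der k (Ag e) = Scl (- \<i> / 2) (Add (Mul (Inv e) (der k e))
     (Scl (-1) (Cnj (Mul (Inv e) (der (bar k) e)))))"

lemma flow_root_nz: "2 * of_real t - x\<^sup>2 \<notin> \<real>\<^sub>\<le>\<^sub>0 \<Longrightarrow> flow_root t x \<noteq> 0"
  by (auto simp: flow_root_def)

lemma valid_der: "valid \<xi> e \<omega> \<Longrightarrow> valid \<xi> (der k e) \<omega>"
  by (induction e arbitrary: k) (auto simp: flow_root_nz)

text \<open>An algebraic consequence of the formal rules at every point, valid or not; true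
  differentiability enters only through \<open>val_has_derivative\<close>.\<close>

lemma der_commute: "val \<xi> (der i (der j e)) \<omega> = val \<xi> (der j (der i e)) \<omega>"
proof (induction e arbitrary: i j)
  case PX
  then show ?case by (cases i; cases j) auto
next
  case PY
  then show ?case by (cases i; cases j) auto
qed (simp_all add: algebra_simps)

section \<open>Formal derivatives are true derivatives\<close>

definition total where
  "total \<xi> e \<omega> = (\<lambda>h :: point. val \<xi> (der Dt e) \<omega> * of_real (fst h) +
     (val \<xi> (der Dx e) \<omega> * fst (snd h) + val \<xi> (der Dxb e) \<omega> * cnj (fst (snd h))) +
     (val \<xi> (der Dy e) \<omega> * snd (snd h) + val \<xi> (der Dyb e) \<omega> * cnj (snd (snd h))))"

lemma Ln_comp_has_derivative:
  assumes "(f has_derivative f') (at \<omega>)" "f \<omega> \<notin> \<real>\<^sub>\<le>\<^sub>0"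
  shows "((\<lambda>\<omega>. Ln (f \<omega>)) has_derivative (\<lambda>h. inverse (f \<omega>) * f' h)) (at \<omega>)"
  using has_derivative_compose[OF assms(1) has_field_derivative_Ln[OF assms(2), unfolded has_field_derivative_def]] .

text \<open>Off the cut this is the real part of \<open>Ln\<close>; on the cut f is replaced by -f,
  which has the same modulus.\<close>

lemma Labs_has_derivative:
  assumes "(f has_derivative f') (at \<omega>)" "f \<omega> \<noteq> 0"
  shows "((\<lambda>\<omega>. complex_of_real (ln (cmod (f \<omega>)))) has_derivative
    (\<lambda>h. 1 / 2 * (inverse (f \<omega>) * f' h + cnj (inverse (f \<omega>) * f' h)))) (at \<omega>)"
proof -
  have main: "((\<lambda>\<omega>. complex_of_real (ln (cmod (g \<omega>)))) has_derivative
    (\<lambda>h. 1 / 2 * (inverse (g \<omega>) * g' h + cnj (inverse (g \<omega>) * g' h)))) (at \<omega>)"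
    if g: "(g has_derivative g') (at \<omega>)" "g \<omega> \<notin> \<real>\<^sub>\<le>\<^sub>0" for g g'
  proof -
    have L: "((\<lambda>\<omega>. Ln (g \<omega>)) has_derivative (\<lambda>h. inverse (g \<omega>) * g' h)) (at \<omega>)"
      by (rule Ln_comp_has_derivative[OF g])
    have "((\<lambda>\<omega>. 1 / 2 * (Ln (g \<omega>) + cnj (Ln (g \<omega>)))) has_derivative
      (\<lambda>h. 1 / 2 * (inverse (g \<omega>) * g' h + cnj (inverse (g \<omega>) * g' h)))) (at \<omega>)"
      by (intro has_derivative_mult_right has_derivative_add L
          bounded_linear.has_derivative[OF bounded_linear_cnj L])
    moreover have "\<forall>\<^sub>F w in nhds \<omega>. 1 / 2 * (Ln (g w) + cnj (Ln (g w))) = complex_of_real (ln (cmod (g w)))"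
    proof -
      have "isCont g \<omega>" using has_derivative_continuous[OF g(1)] .
      then have "\<forall>\<^sub>F w in nhds \<omega>. g w \<noteq> 0"
        using g(2) by (intro tendsto_imp_eventually_ne) (auto simp: isCont_def tendsto_nhds_iff)
      then show ?thesis by eventually_elim (simp add: complex_add_cnj)
    qed
    ultimately show ?thesis by (rule has_derivative_cong_nhds)
  qed
  show ?thesis
  proof (cases "f \<omega> \<in> \<real>\<^sub>\<le>\<^sub>0")
    case True
    then have "- f \<omega> \<notin> \<real>\<^sub>\<le>\<^sub>0" using assms(2) by (auto simp: complex_nonpos_Reals_iff complex_eq_iff)
    from main[OF has_derivative_minus[OF assms(1)] this] show ?thesis by simp
  qed (use main assms in blast)
qed

lemma Ag_has_derivative:
  assumes "(f has_derivative f') (at \<omega>)" "f \<omega> \<notin> \<real>\<^sub>\<le>\<^sub>0"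
  shows "((\<lambda>\<omega>. complex_of_real (Arg (f \<omega>))) has_derivative
    (\<lambda>h. - \<i> / 2 * (inverse (f \<omega>) * f' h + -1 * cnj (inverse (f \<omega>) * f' h)))) (at \<omega>)"
proof -
  have L: "((\<lambda>\<omega>. Ln (f \<omega>)) has_derivative (\<lambda>h. inverse (f \<omega>) * f' h)) (at \<omega>)"
    by (rule Ln_comp_has_derivative[OF assms])
  have "((\<lambda>\<omega>. - \<i> / 2 * (Ln (f \<omega>) + -1 * cnj (Ln (f \<omega>)))) has_derivative
    (\<lambda>h. - \<i> / 2 * (inverse (f \<omega>) * f' h + -1 * cnj (inverse (f \<omega>) * f' h)))) (at \<omega>)"
    by (intro has_derivative_mult_right has_derivative_add L
        bounded_linear.has_derivative[OF bounded_linear_cnj L])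
  moreover have "\<forall>\<^sub>F w in nhds \<omega>. - \<i> / 2 * (Ln (f w) + -1 * cnj (Ln (f w))) = complex_of_real (Arg (f w))"
  proof -
    have "isCont f \<omega>" using has_derivative_continuous[OF assms(1)] .
    then have "\<forall>\<^sub>F w in nhds \<omega>. f w \<noteq> 0"
      using assms(2) by (intro tendsto_imp_eventually_ne) (auto simp: isCont_def tendsto_nhds_iff)
    then show ?thesis by eventually_elim (simp add: Arg_eq_Im_Ln complex_eq_iff)
  qed
  ultimately show ?thesis by (rule has_derivative_cong_nhds)
qed

lemma flow_root_has_derivative:
  assumes "(T has_derivative T') (at \<omega>)" "(f has_derivative f') (at \<omega>)" "2 * of_real (T \<omega>) - (f \<omega>)\<^sup>2 \<notin> \<real>\<^sub>\<le>\<^sub>0"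
  shows "((\<lambda>\<omega>. flow_root (T \<omega>) (f \<omega>)) has_derivative
    (\<lambda>h. -1 * inverse (flow_root (T \<omega>) (f \<omega>)) * of_real (T' h) + f \<omega> * inverse (flow_root (T \<omega>) (f \<omega>)) * f' h)) (at \<omega>)"
proof -
  let ?g = "\<lambda>\<omega>. 2 * complex_of_real (T \<omega>) - (f \<omega>)\<^sup>2"
  have "(?g has_derivative (\<lambda>h. 2 * of_real (T' h) - 2 * f \<omega> * f' h)) (at \<omega>)"
    by (rule derivative_eq_intros assms bounded_linear.has_derivative[OF bounded_linear_of_real] refl | simp)+
      (simp add: mult_ac)
  from has_derivative_compose[OF this has_field_derivative_csqrt[OF assms(3), unfolded has_field_derivative_def]]
  have "((\<lambda>\<omega>. \<i> * csqrt (?g \<omega>)) has_derivative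
    (\<lambda>h. \<i> * (inverse (2 * csqrt (?g \<omega>)) * (2 * of_real (T' h) - 2 * f \<omega> * f' h)))) (at \<omega>)"
    by (rule has_derivative_mult_right)
  moreover have "\<i> * (inverse (2 * csqrt (?g \<omega>)) * (2 * of_real (T' h) - 2 * f \<omega> * f' h)) =
    -1 * inverse (flow_root (T \<omega>) (f \<omega>)) * of_real (T' h) + f \<omega> * inverse (flow_root (T \<omega>) (f \<omega>)) * f' h" for h
  proof -
    have "csqrt (?g \<omega>) \<noteq> 0" using assms(3) by auto
    then show ?thesis by (simp add: flow_root_def field_simps)
  qed
  ultimately show ?thesis by (simp only: flow_root_def)
qed

lemma point_has_derivative:
  "((\<lambda>\<omega>::point. fst (snd \<omega>)) has_derivative (\<lambda>h. fst (snd h))) (at \<omega>)"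
  "((\<lambda>\<omega>::point. snd (snd \<omega>)) has_derivative (\<lambda>h. snd (snd h))) (at \<omega>)"
  using has_derivative_fst[OF has_derivative_snd[OF has_derivative_ident[of "at \<omega>"]]]
    has_derivative_snd[OF has_derivative_snd[OF has_derivative_ident[of "at \<omega>"]]] by simp_all

lemma val_has_derivative: "valid \<xi> e \<omega> \<Longrightarrow> (val \<xi> e has_derivative total \<xi> e \<omega>) (at \<omega>)"
proof (induction e)
  case (Cst c)
  then show ?case by (simp add: total_def)
next
  case X
  show ?case using has_derivative_diff[OF point_has_derivative(1) has_derivative_const] by (simp add: total_def)
next
  case Y
  show ?case using has_derivative_diff[OF point_has_derivative(2) has_derivative_const] by (simp add: total_def)
next
  case PX
  show ?case unfolding val.simps
    by (rule has_derivative_eq_rhs[OF flow_root_has_derivative])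
      (use PX in \<open>auto intro!: derivative_eq_intros simp: total_def\<close>)
next
  case PY
  show ?case unfolding val.simps
    by (rule has_derivative_eq_rhs[OF flow_root_has_derivative])
      (use PY in \<open>auto intro!: derivative_eq_intros simp: total_def\<close>)
next
  case (Add e f)
  then have "((\<lambda>\<omega>. val \<xi> e \<omega> + val \<xi> f \<omega>) has_derivative (\<lambda>h. total \<xi> e \<omega> h + total \<xi> f \<omega> h)) (at \<omega>)"
    by (intro has_derivative_add) auto
  then show ?case unfolding val.simps
    by (rule has_derivative_eq_rhs) (simp add: total_def fun_eq_iff algebra_simps)
next
  case (Mul e f)
  then have "((\<lambda>\<omega>. val \<xi> e \<omega> * val \<xi> f \<omega>) has_derivative (\<lambda>h. val \<xi> e \<omega> * total \<xi> f \<omega> h + total \<xi> e \<omega> h * val \<xi> f \<omega>)) (at \<omega>)"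
    by (intro has_derivative_mult) auto
  then show ?case unfolding val.simps
    by (rule has_derivative_eq_rhs) (simp add: total_def fun_eq_iff algebra_simps)
next
  case (Scl c e)
  then have "((\<lambda>\<omega>. c * val \<xi> e \<omega>) has_derivative (\<lambda>h. c * total \<xi> e \<omega> h)) (at \<omega>)"
    by (intro has_derivative_mult_right) auto
  then show ?case unfolding val.simps
    by (rule has_derivative_eq_rhs) (simp add: total_def fun_eq_iff algebra_simps)
next
  case (Inv e)
  then have "((\<lambda>\<omega>. inverse (val \<xi> e \<omega>)) has_derivative (\<lambda>h. - (inverse (val \<xi> e \<omega>) * total \<xi> e \<omega> h * inverse (val \<xi> e \<omega>)))) (at \<omega>)"
    using has_derivative_compose[OF Inv.IH has_derivative_inverse'] by auto
  then show ?case unfolding val.simps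
    by (rule has_derivative_eq_rhs) (simp add: total_def fun_eq_iff algebra_simps)
next
  case (Cnj e)
  then have "((\<lambda>\<omega>. cnj (val \<xi> e \<omega>)) has_derivative (\<lambda>h. cnj (total \<xi> e \<omega> h))) (at \<omega>)"
    by (intro bounded_linear.has_derivative[OF bounded_linear_cnj]) auto
  then show ?case unfolding val.simps
    by (rule has_derivative_eq_rhs) (simp add: total_def fun_eq_iff algebra_simps)
next
  case (Labs e)
  then have "((\<lambda>\<omega>. complex_of_real (ln (cmod (val \<xi> e \<omega>)))) has_derivative
    (\<lambda>h. 1 / 2 * (inverse (val \<xi> e \<omega>) * total \<xi> e \<omega> h + cnj (inverse (val \<xi> e \<omega>) * total \<xi> e \<omega> h)))) (at \<omega>)"
    by (intro Labs_has_derivative) auto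
  then show ?case unfolding val.simps
    by (rule has_derivative_eq_rhs) (simp add: total_def fun_eq_iff algebra_simps)
next
  case (Ag e)
  then have "((\<lambda>\<omega>. complex_of_real (Arg (val \<xi> e \<omega>))) has_derivative
    (\<lambda>h. - \<i> / 2 * (inverse (val \<xi> e \<omega>) * total \<xi> e \<omega> h + -1 * cnj (inverse (val \<xi> e \<omega>) * total \<xi> e \<omega> h)))) (at \<omega>)"
    by (intro Ag_has_derivative) auto
  then show ?case unfolding val.simps
    by (rule has_derivative_eq_rhs) (simp add: total_def fun_eq_iff algebra_simps)
qed

lemma val_tendsto: "valid \<xi> e \<omega> \<Longrightarrow> (val \<xi> e \<longlongrightarrow> val \<xi> e \<omega>) (nhds \<omega>)"
  using has_derivative_continuous[OF val_has_derivative] by (simp add: isCont_def tendsto_nhds_iff)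

lemma eventually_not_nonpos:
  "(f \<longlongrightarrow> l) F \<Longrightarrow> l \<notin> \<real>\<^sub>\<le>\<^sub>0 \<Longrightarrow> \<forall>\<^sub>F w in F. f w \<notin> (\<real>\<^sub>\<le>\<^sub>0 :: complex set)"
  using topological_tendstoD[of f l F "- \<real>\<^sub>\<le>\<^sub>0"] open_Compl[OF closed_nonpos_Reals_complex] by auto

lemma eventually_valid: "valid \<xi> e \<omega> \<Longrightarrow> \<forall>\<^sub>F w in nhds \<omega>. valid \<xi> e w"
proof (induction e)
  case PX
  have "((\<lambda>w. 2 * of_real (fst w) - (fst (snd w) - of_real \<xi>)\<^sup>2) \<longlongrightarrow> 2 * complex_of_real (fst \<omega>) - (fst (snd \<omega>) - of_real \<xi>)\<^sup>2) (nhds \<omega>)"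
    by (intro tendsto_intros filterlim_ident)
  from eventually_not_nonpos[OF this] PX show ?case by simp
next
  case PY
  have "((\<lambda>w. 2 * of_real (fst w) - (snd (snd w) - of_real \<xi>)\<^sup>2) \<longlongrightarrow> 2 * complex_of_real (fst \<omega>) - (snd (snd \<omega>) - of_real \<xi>)\<^sup>2) (nhds \<omega>)"
    by (intro tendsto_intros filterlim_ident)
  from eventually_not_nonpos[OF this] PY show ?case by simp
next
  case (Inv e)
  then have "\<forall>\<^sub>F w in nhds \<omega>. valid \<xi> e w" "\<forall>\<^sub>F w in nhds \<omega>. val \<xi> e w \<noteq> 0"
    using tendsto_imp_eventually_ne[OF val_tendsto[of \<xi> e \<omega>]] by auto
  then show ?case by eventually_elim simp
next
  case (Labs e)
  then have "\<forall>\<^sub>F w in nhds \<omega>. valid \<xi> e w" "\<forall>\<^sub>F w in nhds \<omega>. val \<xi> e w \<noteq> 0"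
    using tendsto_imp_eventually_ne[OF val_tendsto[of \<xi> e \<omega>]] by auto
  then show ?case by eventually_elim simp
next
  case (Ag e)
  then have "\<forall>\<^sub>F w in nhds \<omega>. valid \<xi> e w" "\<forall>\<^sub>F w in nhds \<omega>. val \<xi> e w \<notin> \<real>\<^sub>\<le>\<^sub>0"
    using eventually_not_nonpos[OF val_tendsto[of \<xi> e \<omega>]] by auto
  then show ?case by eventually_elim simp
next
  case (Add e f)
  then have "\<forall>\<^sub>F w in nhds \<omega>. valid \<xi> e w" "\<forall>\<^sub>F w in nhds \<omega>. valid \<xi> f w" by auto
  then show ?case by eventually_elim simp
next
  case (Mul e f)
  then have "\<forall>\<^sub>F w in nhds \<omega>. valid \<xi> e w" "\<forall>\<^sub>F w in nhds \<omega>. valid \<xi> f w" by auto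
  then show ?case by eventually_elim simp
next
  case (Scl c e)
  then have "\<forall>\<^sub>F w in nhds \<omega>. valid \<xi> e w" by auto
  then show ?case by eventually_elim simp
next
  case (Cnj e)
  then have "\<forall>\<^sub>F w in nhds \<omega>. valid \<xi> e w" by auto
  then show ?case by eventually_elim simp
qed (simp_all add: always_eventually)

lemma eventually_nhds_slice:
  assumes "\<forall>\<^sub>F w in nhds (t, x, y). P w"
  shows "\<forall>\<^sub>F x' in nhds x. P (t, x', y)" "\<forall>\<^sub>F y' in nhds y. P (t, x, y')" "\<forall>\<^sub>F t' in nhds t. P (t', x, y)"
proof -
  have "((\<lambda>x'. (t, x', y)) \<longlongrightarrow> (t, x, y)) (nhds x)" "((\<lambda>y'. (t, x, y')) \<longlongrightarrow> (t, x, y)) (nhds y)"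
    "((\<lambda>t'. (t', x, y)) \<longlongrightarrow> (t, x, y)) (nhds t)"
    by (intro tendsto_intros filterlim_ident)+
  then show "\<forall>\<^sub>F x' in nhds x. P (t, x', y)" "\<forall>\<^sub>F y' in nhds y. P (t, x, y')" "\<forall>\<^sub>F t' in nhds t. P (t', x, y)"
    using assms by (auto simp: filterlim_iff)
qed

lemma open_valid_slice: "open {x. valid \<xi> e (t, x, y)}" "open {y. valid \<xi> e (t, x, y)}"
proof -
  show "open {x. valid \<xi> e (t, x, y)}"
  proof (rule open_subopen[THEN iffD2], rule ballI)
    fix x assume "x \<in> {x. valid \<xi> e (t, x, y)}"
    then have "\<forall>\<^sub>F x' in nhds x. valid \<xi> e (t, x', y)" using eventually_nhds_slice(1)[OF eventually_valid] by simp
    then show "\<exists>T. open T \<and> x \<in> T \<and> T \<subseteq> {x. valid \<xi> e (t, x, y)}" unfolding eventually_nhds by blast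
  qed
  show "open {y. valid \<xi> e (t, x, y)}"
  proof (rule open_subopen[THEN iffD2], rule ballI)
    fix y assume "y \<in> {y. valid \<xi> e (t, x, y)}"
    then have "\<forall>\<^sub>F y' in nhds y. valid \<xi> e (t, x, y')" using eventually_nhds_slice(2)[OF eventually_valid] by simp
    then show "\<exists>T. open T \<and> y \<in> T \<and> T \<subseteq> {y. valid \<xi> e (t, x, y)}" unfolding eventually_nhds by blast
  qed
qed

lemma hw_x: "valid \<xi> e (t, x, y) \<Longrightarrow>
  hw (\<lambda>x. val \<xi> e (t, x, y)) (val \<xi> (der Dx e) (t, x, y)) (val \<xi> (der Dxb e) (t, x, y)) x"
  unfolding hw_def
  by (rule has_derivative_eq_rhs[OF has_derivative_compose[where g = "val \<xi> e" and f = "\<lambda>x. (t, x, y)" and f' = "\<lambda>h. (0, h, 0)"]])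
    (auto intro!: derivative_eq_intros val_has_derivative simp: total_def)

lemma hw_y: "valid \<xi> e (t, x, y) \<Longrightarrow>
  hw (\<lambda>y. val \<xi> e (t, x, y)) (val \<xi> (der Dy e) (t, x, y)) (val \<xi> (der Dyb e) (t, x, y)) y"
  unfolding hw_def
  by (rule has_derivative_eq_rhs[OF has_derivative_compose[where g = "val \<xi> e" and f = "\<lambda>y. (t, x, y)" and f' = "\<lambda>h. (0, 0, h)"]])
    (auto intro!: derivative_eq_intros val_has_derivative simp: total_def)

lemma hw_diag: "valid \<xi> e (t, x, x) \<Longrightarrow>
  hw (\<lambda>x. val \<xi> e (t, x, x)) (val \<xi> (der Dx e) (t, x, x) + val \<xi> (der Dy e) (t, x, x))
    (val \<xi> (der Dxb e) (t, x, x) + val \<xi> (der Dyb e) (t, x, x)) x"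
  unfolding hw_def
  by (rule has_derivative_eq_rhs[OF has_derivative_compose[where g = "val \<xi> e" and f = "\<lambda>x. (t, x, x)" and f' = "\<lambda>h. (0, h, h)"]])
    (auto intro!: derivative_eq_intros val_has_derivative simp: total_def algebra_simps)

lemma val_has_derivative_t: "valid \<xi> e (t, x, y) \<Longrightarrow>
  ((\<lambda>t. val \<xi> e (t, x, y)) has_derivative (\<lambda>h. val \<xi> (der Dt e) (t, x, y) * of_real h)) (at t)"
  by (rule has_derivative_eq_rhs[OF has_derivative_compose[where g = "val \<xi> e" and f = "\<lambda>t. (t, x, y)" and f' = "\<lambda>h. (h, 0, 0)"]])
    (auto intro!: derivative_eq_intros val_has_derivative simp: total_def zero_prod_def)

text \<open>Openness in each point separately, with t and the other point fixed, is what partial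
  derivatives in x and y need. As nothing is asked in t, congruence of expressions is available for
  spatial derivatives only.\<close>

definition sopen where
  "sopen V \<longleftrightarrow> (\<forall>t x y. (t, x, y) \<in> V \<longrightarrow>
     (\<forall>\<^sub>F x' in nhds x. (t, x', y) \<in> V) \<and> (\<forall>\<^sub>F y' in nhds y. (t, x, y') \<in> V))"

lemma sopen_valid: "sopen {\<omega>. valid \<xi> e \<omega>}"
  using eventually_nhds_slice[OF eventually_valid] by (auto simp: sopen_def)

definition eqv where
  "eqv \<xi> V e f \<longleftrightarrow> (\<forall>\<omega>\<in>V. valid \<xi> e \<omega> \<and> valid \<xi> f \<omega> \<and> val \<xi> e \<omega> = val \<xi> f \<omega>)"

lemma eqv_trans [trans]: "eqv \<xi> V e f \<Longrightarrow> eqv \<xi> V f g \<Longrightarrow> eqv \<xi> V e g"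
  by (simp add: eqv_def)

lemma eqv_der:
  assumes V: "sopen V" and e: "eqv \<xi> V e f" and k: "k \<noteq> Dt"
  shows "eqv \<xi> V (der k e) (der k f)"
  unfolding eqv_def
proof (intro ballI conjI)
  fix \<omega> assume \<omega>: "\<omega> \<in> V"
  obtain t x y where txy: "\<omega> = (t, x, y)" by (cases \<omega>)
  have v: "valid \<xi> e \<omega>" "valid \<xi> f \<omega>" using e \<omega> by (auto simp: eqv_def)
  show "valid \<xi> (der k e) \<omega>" "valid \<xi> (der k f) \<omega>" using v valid_der by auto
  have "\<forall>\<^sub>F x' in nhds x. (t, x', y) \<in> V" "\<forall>\<^sub>F y' in nhds y. (t, x, y') \<in> V"
    using V \<omega> by (auto simp: sopen_def txy)
  then have "\<forall>\<^sub>F x' in nhds x. val \<xi> e (t, x', y) = val \<xi> f (t, x', y)"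
    "\<forall>\<^sub>F y' in nhds y. val \<xi> e (t, x, y') = val \<xi> f (t, x, y')"
    using e by (auto simp: eqv_def elim: eventually_mono)
  then have "hw (\<lambda>x. val \<xi> f (t, x, y)) (val \<xi> (der Dx e) \<omega>) (val \<xi> (der Dxb e) \<omega>) x"
    "hw (\<lambda>y. val \<xi> f (t, x, y)) (val \<xi> (der Dy e) \<omega>) (val \<xi> (der Dyb e) \<omega>) y"
    using hw_cong[OF hw_x[of \<xi> e t x y], of "\<lambda>x. val \<xi> f (t, x, y)"]
      hw_cong[OF hw_y[of \<xi> e t x y], of "\<lambda>y. val \<xi> f (t, x, y)"] v(1) by (simp_all only: txy)
  from hw_unique[OF this(1)] hw_unique[OF this(2)] hw_x[of \<xi> f t x y] hw_y[of \<xi> f t x y] v(2)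
  have "val \<xi> (der Dx e) \<omega> = val \<xi> (der Dx f) \<omega>" "val \<xi> (der Dxb e) \<omega> = val \<xi> (der Dxb f) \<omega>"
    "val \<xi> (der Dy e) \<omega> = val \<xi> (der Dy f) \<omega>" "val \<xi> (der Dyb e) \<omega> = val \<xi> (der Dyb f) \<omega>"
    unfolding txy by metis+
  with k show "val \<xi> (der k e) \<omega> = val \<xi> (der k f) \<omega>" by (cases k) simp_all
qed

lemma valid_ders: "valid \<xi> e \<omega> \<Longrightarrow> valid \<xi> (foldr der ks e) \<omega>"
  by (induction ks) (auto simp: valid_der)

lemma eqv_ders: "sopen V \<Longrightarrow> eqv \<xi> V e f \<Longrightarrow> Dt \<notin> set ks \<Longrightarrow> eqv \<xi> V (foldr der ks e) (foldr der ks f)"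
  by (induction ks) (auto intro!: eqv_der)

text \<open>Here k may be \<open>Dt\<close>: only the derivatives in ks, which end up outside, have
  to respect \<open>eqv\<close>.\<close>

lemma eqv_der_ders:
  assumes "sopen V" "\<And>\<omega>. \<omega> \<in> V \<Longrightarrow> valid \<xi> e \<omega>" "Dt \<notin> set ks"
  shows "eqv \<xi> V (der k (foldr der ks e)) (foldr der ks (der k e))"
  using assms(3)
proof (induction ks)
  case Nil
  then show ?case using assms(2) by (auto simp: eqv_def valid_der)
next
  case (Cons k' ks)
  have "eqv \<xi> V (der k (der k' (foldr der ks e))) (der k' (der k (foldr der ks e)))"
    using assms(2) by (simp add: eqv_def der_commute[of _ k] valid_der valid_ders)
  also have "eqv \<xi> V (der k' (der k (foldr der ks e))) (der k' (foldr der ks (der k e)))"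
    using Cons by (intro eqv_der assms(1)) auto
  finally show ?case by simp
qed

section \<open>Mixed jets of an expression at two points\<close>

fun word :: "nat \<times> nat \<Rightarrow> nat \<times> nat \<Rightarrow> dir list" where
  "word (j, k) (l, m) = replicate j Dx @ replicate k Dxb @ replicate l Dy @ replicate m Dyb"

definition ej :: "real \<Rightarrow> ex \<Rightarrow> nat \<times> nat \<Rightarrow> nat \<times> nat \<Rightarrow> point \<Rightarrow> complex" where
  "ej \<xi> e a b = val \<xi> (foldr der (word a b) e)"

lemma word_no_Dt [simp]: "Dt \<notin> set (word a b)"
  by (cases a; cases b) auto

lemma eqv_insert:
  assumes "sopen V" "\<And>\<omega>. \<omega> \<in> V \<Longrightarrow> valid \<xi> e \<omega>" "Dt \<notin> set ks" "Dt \<notin> set ls" "k \<noteq> Dt"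
  shows "eqv \<xi> V (foldr der (k # ks @ ls) e) (foldr der (ks @ k # ls) e)"
proof -
  have "eqv \<xi> V (der k (foldr der ks (foldr der ls e))) (foldr der ks (der k (foldr der ls e)))"
    by (rule eqv_der_ders[OF assms(1)]) (use assms valid_ders in auto)
  then show ?thesis by simp
qed

context
  fixes \<xi> :: real and e :: ex and \<omega> :: point
  assumes v: "valid \<xi> e \<omega>"
begin

lemma val_insert:
  assumes "Dt \<notin> set ks" "Dt \<notin> set ls" "k \<noteq> Dt"
  shows "val \<xi> (der k (foldr der (ks @ ls) e)) \<omega> = val \<xi> (foldr der (ks @ k # ls) e) \<omega>"
proof -
  have "eqv \<xi> {\<omega>. valid \<xi> e \<omega>} (foldr der (k # ks @ ls) e) (foldr der (ks @ k # ls) e)"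
    by (rule eqv_insert[OF sopen_valid _ assms]) simp
  from bspec[OF this[unfolded eqv_def], of \<omega>] v show ?thesis by simp
qed

lemma ej_Dx: "val \<xi> (der Dx (foldr der (word (j, k) b) e)) \<omega> = ej \<xi> e (Suc j, k) b \<omega>"
  by (cases b) (simp add: ej_def)

lemma ej_Dxb: "val \<xi> (der Dxb (foldr der (word (j, k) b) e)) \<omega> = ej \<xi> e (j, Suc k) b \<omega>"
  using val_insert[of "replicate j Dx" "replicate k Dxb @ replicate (fst b) Dy @ replicate (snd b) Dyb" Dxb]
  by (cases b) (simp add: ej_def)

lemma ej_Dy: "val \<xi> (der Dy (foldr der (word a (j, k)) e)) \<omega> = ej \<xi> e a (Suc j, k) \<omega>"
  using val_insert[of "replicate (fst a) Dx @ replicate (snd a) Dxb" "replicate j Dy @ replicate k Dyb" Dy]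
  by (cases a) (simp add: ej_def)

lemma ej_Dyb: "val \<xi> (der Dyb (foldr der (word a (j, k)) e)) \<omega> = ej \<xi> e a (j, Suc k) \<omega>"
  using val_insert[of "replicate (fst a) Dx @ replicate (snd a) Dxb @ replicate j Dy" "replicate k Dyb" Dyb]
  by (cases a) (simp add: ej_def)

lemma ej_Dt: "val \<xi> (der Dt (foldr der (word a b) e)) \<omega> = ej \<xi> (der Dt e) a b \<omega>"
proof -
  have "eqv \<xi> {\<omega>. valid \<xi> e \<omega>} (der Dt (foldr der (word a b) e)) (foldr der (word a b) (der Dt e))"
    by (rule eqv_der_ders[OF sopen_valid]) auto
  from bspec[OF this[unfolded eqv_def], of \<omega>] v show ?thesis by (simp add: ej_def)
qed

end

lemma ej_hw_x: "valid \<xi> e (t, x, y) \<Longrightarrow>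
  hw (\<lambda>x. ej \<xi> e (j, k) b (t, x, y)) (ej \<xi> e (Suc j, k) b (t, x, y)) (ej \<xi> e (j, Suc k) b (t, x, y)) x"
  using hw_x[OF valid_ders, of \<xi> e t x y "word (j, k) b"] by (simp add: ej_Dx ej_Dxb) (simp add: ej_def)

lemma ej_hw_y: "valid \<xi> e (t, x, y) \<Longrightarrow>
  hw (\<lambda>y. ej \<xi> e a (j, k) (t, x, y)) (ej \<xi> e a (Suc j, k) (t, x, y)) (ej \<xi> e a (j, Suc k) (t, x, y)) y"
  using hw_y[OF valid_ders, of \<xi> e t x y "word a (j, k)"] by (simp add: ej_Dy ej_Dyb) (simp add: ej_def)

lemma ej_hw_diag: "valid \<xi> e (t, x, x) \<Longrightarrow>
  hw (\<lambda>x. ej \<xi> e (j, k) (l, m) (t, x, x)) (ej \<xi> e (Suc j, k) (l, m) (t, x, x) + ej \<xi> e (j, k) (Suc l, m) (t, x, x))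
    (ej \<xi> e (j, Suc k) (l, m) (t, x, x) + ej \<xi> e (j, k) (l, Suc m) (t, x, x)) x"
  using hw_diag[OF valid_ders, of \<xi> e t x "word (j, k) (l, m)"]
  by (simp add: ej_Dx ej_Dxb ej_Dy ej_Dyb del: word.simps) (simp add: ej_def)

lemma ej_has_derivative_t: "valid \<xi> e (t, x, y) \<Longrightarrow>
  ((\<lambda>t. ej \<xi> e a b (t, x, y)) has_derivative (\<lambda>h. ej \<xi> (der Dt e) a b (t, x, y) * of_real h)) (at t)"
  using val_has_derivative_t[OF valid_ders, of \<xi> e t x y "word a b"] by (simp add: ej_Dt) (simp add: ej_def)

lemma ej_cong:
  assumes "sopen V" "eqv \<xi> V e f" "\<omega> \<in> V"
  shows "ej \<xi> e a b \<omega> = ej \<xi> f a b \<omega>"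
  using eqv_ders[OF assms(1,2) word_no_Dt[of a b]] assms(3) by (simp add: eqv_def ej_def)

lemma jfam_x: "jfam {x. valid \<xi> e (t, x, y)} (\<lambda>j k x. ej \<xi> e (j, k) b (t, x, y))"
  by (simp add: jfam_def ej_hw_x)

lemma jfam_y: "jfam {y. valid \<xi> e (t, x, y)} (\<lambda>j k y. ej \<xi> e a (j, k) (t, x, y))"
  by (simp add: jfam_def ej_hw_y)

lemma ej_0 [simp]: "ej \<xi> e (0, 0) (0, 0) = val \<xi> e"
  by (simp add: ej_def)

lemma jfam_mono: "jfam S g \<Longrightarrow> S' \<subseteq> S \<Longrightarrow> jfam S' g"
  by (auto simp: jfam_def)

lemma ders_Add: "foldr der ks (Add e f) = Add (foldr der ks e) (foldr der ks f)"
  by (induction ks) auto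

lemma ders_Scl: "foldr der ks (Scl c e) = Scl c (foldr der ks e)"
  by (induction ks) auto

lemma ders_Cst_0: "foldr der ks (Cst 0) = Cst 0"
  by (induction ks) auto

lemma ej_Add [simp]: "ej \<xi> (Add e f) a b \<omega> = ej \<xi> e a b \<omega> + ej \<xi> f a b \<omega>"
  by (simp add: ej_def ders_Add)

lemma ej_Scl [simp]: "ej \<xi> (Scl c e) a b \<omega> = c * ej \<xi> e a b \<omega>"
  by (simp add: ej_def ders_Scl)

lemma eqv_move:
  assumes "sopen V" "\<And>\<omega>. \<omega> \<in> V \<Longrightarrow> valid \<xi> e \<omega>" "Dt \<notin> set ks" "Dt \<notin> set ls"
  shows "eqv \<xi> V (foldr der (ks @ k # ls) e) (foldr der (ks @ ls) (der k e))"
  using eqv_ders[OF assms(1) eqv_der_ders[OF assms(1,2,4), of k] assms(3)] by simp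

text \<open>Harmonicity in one point kills all jets with both kinds of derivative there: one
  derivative of each kind is moved inside past all the others, where the expression becomes
  zero.\<close>

lemma ej_mixed_zero:
  assumes V: "sopen V" "\<And>\<omega>. \<omega> \<in> V \<Longrightarrow> valid \<xi> e \<omega>" and \<omega>: "\<omega> \<in> V"
  shows "(\<And>\<omega>. \<omega> \<in> V \<Longrightarrow> val \<xi> (der Dxb (der Dx e)) \<omega> = 0) \<Longrightarrow> ej \<xi> e (Suc j, Suc k) b \<omega> = 0"
    and "(\<And>\<omega>. \<omega> \<in> V \<Longrightarrow> val \<xi> (der Dyb (der Dy e)) \<omega> = 0) \<Longrightarrow> ej \<xi> e b (Suc j, Suc k) \<omega> = 0"
proof -
  have gen: "val \<xi> (foldr der (ks @ k1 # ls @ k2 # ms) e) \<omega> = 0"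
    if z: "\<And>\<omega>. \<omega> \<in> V \<Longrightarrow> val \<xi> (der k2 (der k1 e)) \<omega> = 0"
      and D: "Dt \<notin> set ks" "Dt \<notin> set ls" "Dt \<notin> set ms" "k1 \<noteq> Dt" "k2 \<noteq> Dt" for ks k1 ls k2 ms
  proof -
    have "eqv \<xi> V (foldr der (ks @ k1 # ls @ k2 # ms) e) (foldr der (ks @ ls @ k2 # ms) (der k1 e))"
      using eqv_move[OF V D(1), of "ls @ k2 # ms" k1] D by simp
    also have "eqv \<xi> V (foldr der (ks @ ls @ k2 # ms) (der k1 e)) (foldr der ((ks @ ls) @ ms) (der k2 (der k1 e)))"
      using eqv_move[OF V(1), of \<xi> "der k1 e" "ks @ ls" ms k2] D V(2) by (simp add: valid_der)
    also have "eqv \<xi> V (foldr der ((ks @ ls) @ ms) (der k2 (der k1 e))) (foldr der ((ks @ ls) @ ms) (Cst 0))"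
      by (rule eqv_ders[OF V(1)]) (use z V(2) D in \<open>auto simp: eqv_def valid_der\<close>)
    finally show ?thesis using \<omega> unfolding ders_Cst_0 by (simp add: eqv_def)
  qed
  { assume "\<And>\<omega>. \<omega> \<in> V \<Longrightarrow> val \<xi> (der Dxb (der Dx e)) \<omega> = 0"
    from gen[OF this, of "replicate j Dx" "[]" "replicate k Dxb @ replicate (fst b) Dy @ replicate (snd b) Dyb"]
    show "ej \<xi> e (Suc j, Suc k) b \<omega> = 0"
      by (cases b) (simp add: ej_def funpow_swap1) }
  { assume "\<And>\<omega>. \<omega> \<in> V \<Longrightarrow> val \<xi> (der Dyb (der Dy e)) \<omega> = 0"
    from gen[OF this, of "replicate (fst b) Dx @ replicate (snd b) Dxb @ replicate j Dy" "[]" "replicate k Dyb"]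
    show "ej \<xi> e b (Suc j, Suc k) \<omega> = 0"
      by (cases b) (simp add: ej_def funpow_swap1) }
qed

section \<open>Exchanging the two points\<close>

fun swp where
  "swp X = Y" | "swp Y = X" | "swp PX = PY" | "swp PY = PX" | "swp (Cst c) = Cst c"
| "swp (Add e f) = Add (swp e) (swp f)" | "swp (Mul e f) = Mul (swp e) (swp f)"
| "swp (Scl c e) = Scl c (swp e)" | "swp (Inv e) = Inv (swp e)" | "swp (Cnj e) = Cnj (swp e)"
| "swp (Labs e) = Labs (swp e)" | "swp (Ag e) = Ag (swp e)"

fun swd where "swd Dx = Dy" | "swd Dy = Dx" | "swd Dxb = Dyb" | "swd Dyb = Dxb" | "swd Dt = Dt"

lemma val_swp: "val \<xi> (swp e) (t, x, y) = val \<xi> e (t, y, x)"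
  by (induction e) auto

lemma swp_der: "swp (der k e) = der (swd k) (swp e)"
proof (induction e arbitrary: k)
  case (Cnj e)
  then show ?case by (cases k) auto
next
  case (Labs e)
  then show ?case by (cases k) auto
next
  case (Ag e)
  then show ?case by (cases k) auto
qed (case_tac [!] k, auto)

text \<open>Formal exchange of the letters yields the right derivatives at (y, x), but with the
  blocks of the two points in the wrong order; \<open>bl\<close> commutes the blocks.\<close>

lemma ej_swap:
  assumes V: "sopen V" "\<And>\<omega>. \<omega> \<in> V \<Longrightarrow> valid \<xi> (swp e) \<omega>" and "(t, y, x) \<in> V"
  shows "ej \<xi> e a b (t, x, y) = ej \<xi> (swp e) b a (t, y, x)"
proof -
  obtain j k l m where ab: "a = (j, k)" "b = (l, m)" by (cases a; cases b)
  have sw: "swp (foldr der ks e) = foldr der (map swd ks) (swp e)" for ks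
    by (induction ks) (auto simp: swp_der)
  have bl: "eqv \<xi> V (foldr der (ks @ ls) (swp e)) (foldr der (ls @ ks) (swp e))"
    if "Dt \<notin> set ks" "Dt \<notin> set ls" for ks ls
    using that
  proof (induction ks arbitrary: ls)
    case Nil
    then show ?case using V(2) by (simp add: eqv_def valid_ders)
  next
    case (Cons k ks)
    have "eqv \<xi> V (der k (foldr der (ks @ ls) (swp e))) (der k (foldr der (ls @ ks) (swp e)))"
      by (rule eqv_der[OF V(1)]) (use Cons in auto)
    also have "eqv \<xi> V (der k (foldr der (ls @ ks) (swp e))) (foldr der (ls @ k # ks) (swp e))"
      using eqv_insert[OF V, of ls ks k] Cons.prems by auto
    finally show ?case by simp
  qed
  have "ej \<xi> e a b (t, x, y) = val \<xi> (swp (foldr der (word a b) e)) (t, y, x)"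
    by (simp add: ej_def val_swp)
  also have "\<dots> = val \<xi> (foldr der ((replicate j Dy @ replicate k Dyb) @ (replicate l Dx @ replicate m Dxb)) (swp e)) (t, y, x)"
    by (simp only: sw) (simp add: ab)
  also have "\<dots> = val \<xi> (foldr der ((replicate l Dx @ replicate m Dxb) @ (replicate j Dy @ replicate k Dyb)) (swp e)) (t, y, x)"
    using bspec[OF bl[unfolded eqv_def, of "replicate j Dy @ replicate k Dyb" "replicate l Dx @ replicate m Dxb"] assms(3)] by auto
  also have "\<dots> = ej \<xi> (swp e) b a (t, y, x)" by (simp add: ej_def ab)
  finally show ?thesis .
qed

section \<open>The two-point function along the flow\<close>

abbreviation "Sub e f \<equiv> Add e (Scl (-1) f)"

text \<open>
  \<open>2 eg\<close> is the two-point function of the field in the chart moved by the flow; it splits into a regular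
  part \<open>2 er\<close> and the singular part \<open>2 el\<close>, which does not depend on \<open>t\<close>. In \<open>esrc\<close> only the first point
  is moved. \<open>emu\<close> is the argument of the derivative of the flow, and \<open>eins\<close> gives the mean
  produced by the insertion at \<open>y\<close>.
\<close>

definition eg where "eg = Sub (Labs (Sub PX (Cnj PY))) (Labs (Sub PX PY))"
definition er where "er = Add (Labs (Sub PX (Cnj PY))) (Sub (Labs (Add PX PY)) (Labs (Add X Y)))"
definition el where "el = Scl (-1) (Labs (Sub X Y))"
definition esrc where "esrc = Sub (Labs (Sub PX (Cnj Y))) (Labs (Sub PX Y))"
definition emu where "emu = Sub (Ag X) (Ag PX)"
definition eins where "eins = Ag (Sub X Y)"

text \<open>The points that the flow keeps in the upper half-plane up to time t: all of it for t >=
  0, and for t < 0 all but the vertical slit above \<xi> of height sqrt (-2 t), tip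
  included.\<close>

definition fdom :: "real \<Rightarrow> real \<Rightarrow> complex set" where
  "fdom \<xi> t = {x. Im x > 0 \<and> 2 * of_real t - (x - of_real \<xi>)\<^sup>2 \<notin> \<real>\<^sub>\<le>\<^sub>0}"

lemma fdom_open: "open (fdom \<xi> t)"
proof -
  have 1: "fdom \<xi> t = {x. Im x > 0} \<inter> {x. valid \<xi> PX (t, x, 0)}" by (auto simp: fdom_def)
  have "open {x. Im x > 0}" by (rule open_halfspace_Im_gt)
  then show ?thesis using open_valid_slice(1) unfolding 1 by (rule open_Int)
qed

lemma flow_root_square: "(flow_root t x)\<^sup>2 = x\<^sup>2 - 2 * of_real t"
  by (simp add: flow_root_def power_mult_distrib)

lemma Im_flow_root:
  assumes "2 * of_real t - x\<^sup>2 \<notin> \<real>\<^sub>\<le>\<^sub>0"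
  shows "Im (flow_root t x) > 0"
proof -
  define w where "w = csqrt (2 * of_real t - x\<^sup>2)"
  have w: "w\<^sup>2 = 2 * of_real t - x\<^sup>2" by (simp add: w_def)
  have "Re w \<noteq> 0"
  proof
    assume "Re w = 0"
    then have "w\<^sup>2 \<in> \<real>\<^sub>\<le>\<^sub>0" by (simp add: complex_nonpos_Reals_iff power2_eq_square)
    then show False using assms w by simp
  qed
  moreover have "Re w \<ge> 0" unfolding w_def by (rule Re_csqrt)
  ultimately show ?thesis by (simp add: flow_root_def w_def)
qed

lemma square_eq_upper: "Im (a :: complex) > 0 \<Longrightarrow> Im b > 0 \<Longrightarrow> a\<^sup>2 = b\<^sup>2 \<Longrightarrow> a = b"
  by (auto simp: power2_eq_iff)

lemma flow_root_inj:
  assumes "x \<in> fdom \<xi> t" "y \<in> fdom \<xi> t" "flow_root t (x - of_real \<xi>) = flow_root t (y - of_real \<xi>)"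
  shows "x = y"
proof -
  have "(x - of_real \<xi>)\<^sup>2 = (y - of_real \<xi>)\<^sup>2"
    using flow_root_square[of t "x - of_real \<xi>"] flow_root_square[of t "y - of_real \<xi>"] assms(3) by simp
  then have "x - of_real \<xi> = y - of_real \<xi>"
    by (rule square_eq_upper[rotated 2]) (use assms in \<open>auto simp: fdom_def\<close>)
  then show ?thesis by simp
qed

lemma nonzero_of_Im: "Im z > 0 \<Longrightarrow> z \<noteq> 0" by auto

lemma upper_ne:
  assumes "Im a > 0" "Im b > 0"
  shows "a \<noteq> cnj b" "a + b \<noteq> 2 * complex_of_real r" "complex_of_real r + a \<noteq> cnj b"
  using assms by (auto simp: complex_eq_iff)

lemma not_nonpos_of_Im: "Im z > 0 \<Longrightarrow> z \<notin> \<real>\<^sub>\<le>\<^sub>0" by (auto simp: complex_nonpos_Reals_iff)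

definition fdom2 where "fdom2 \<xi> = {(t, x, y). x \<in> fdom \<xi> t \<and> y \<in> fdom \<xi> t}"

lemma fdomD: "x \<in> fdom \<xi> t \<Longrightarrow> Im x > 0" "x \<in> fdom \<xi> t \<Longrightarrow> 2 * of_real t - (x - of_real \<xi>)\<^sup>2 \<notin> \<real>\<^sub>\<le>\<^sub>0"
  "x \<in> fdom \<xi> t \<Longrightarrow> Im (flow_root t (x - of_real \<xi>)) > 0"
  by (auto simp: fdom_def intro: Im_flow_root)

lemma valid_er: "x \<in> fdom \<xi> t \<Longrightarrow> y \<in> fdom \<xi> t \<Longrightarrow> valid \<xi> er (t, x, y)"
  using fdomD[of x \<xi> t] fdomD[of y \<xi> t] by (simp add: er_def nonzero_of_Im upper_ne)

lemma valid_el: "x \<noteq> y \<Longrightarrow> valid \<xi> el (t, x, y)"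
  by (simp add: el_def)

lemma valid_eg: "x \<in> fdom \<xi> t \<Longrightarrow> y \<in> fdom \<xi> t \<Longrightarrow> x \<noteq> y \<Longrightarrow> valid \<xi> eg (t, x, y)"
  using fdomD[of x \<xi> t] fdomD[of y \<xi> t] flow_root_inj[of x \<xi> t y] by (auto simp: eg_def nonzero_of_Im)

lemma valid_emu: "x \<in> fdom \<xi> t \<Longrightarrow> valid \<xi> emu (t, x, y)"
  using fdomD[of x \<xi> t] by (simp add: emu_def not_nonpos_of_Im)

lemma valid_esrc: "x \<in> fdom \<xi> t \<Longrightarrow> Im y > 0 \<Longrightarrow> y \<noteq> of_real \<xi> + flow_root t (x - of_real \<xi>) \<Longrightarrow> valid \<xi> esrc (t, x, y)"
  using fdomD[of x \<xi> t] by (auto simp: esrc_def nonzero_of_Im algebra_simps upper_ne)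

lemma valid_eins: "Im x > 0 \<Longrightarrow> Im y \<le> 0 \<Longrightarrow> valid \<xi> eins (t, x, y)"
  by (simp add: eins_def not_nonpos_of_Im)

lemma sopen_fdom2: "sopen (fdom2 \<xi>)"
  using fdom_open by (auto simp: sopen_def fdom2_def eventually_nhds)

lemma sopen_off_diagonal: "sopen (fdom2 \<xi> \<inter> {(t, x, y). x \<noteq> y})"
proof -
  have "\<forall>\<^sub>F x' in nhds x. x' \<in> fdom \<xi> t \<and> x' \<noteq> y" if "x \<noteq> y" "x \<in> fdom \<xi> t" for x y t
    using eventually_nhds_in_open[OF fdom_open that(2)] t1_space_nhds[OF that(1)] by (rule eventually_conj)
  then show ?thesis
    by (auto simp: sopen_def fdom2_def neq_commute intro!: eventually_conj)
qed

text \<open>P^2 - X^2 = -2 t is the same at both points, hence (PX - PY) (PX + PY) = (X - Y) (X +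
  Y). The logarithm of this identity separates the singularity, which therefore does not depend on
  t.\<close>

lemma eg_split:
  assumes "x \<in> fdom \<xi> t" "y \<in> fdom \<xi> t" "x \<noteq> y"
  shows "ej \<xi> eg a b (t, x, y) = ej \<xi> er a b (t, x, y) + ej \<xi> el a b (t, x, y)"
proof -
  have "eqv \<xi> (fdom2 \<xi> \<inter> {(t, x, y). x \<noteq> y}) eg (Add er el)"
    unfolding eqv_def
  proof (intro ballI conjI)
    fix \<omega> assume "\<omega> \<in> fdom2 \<xi> \<inter> {(t, x, y). x \<noteq> y}"
    then obtain t x y where \<omega>: "\<omega> = (t, x, y)" "x \<in> fdom \<xi> t" "y \<in> fdom \<xi> t" "x \<noteq> y" by (auto simp: fdom2_def)
    show "valid \<xi> eg \<omega>" "valid \<xi> (Add er el) \<omega>" using valid_eg valid_er valid_el \<omega> by auto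
    define p q where "p = flow_root t (x - of_real \<xi>)" and "q = flow_root t (y - of_real \<xi>)"
    have i: "Im p > 0" "Im q > 0" using fdomD \<omega> by (auto simp: p_def q_def)
    have ne: "p \<noteq> q" using flow_root_inj \<omega> by (auto simp: p_def q_def)
    have "(p - q) * (p + q) = p\<^sup>2 - q\<^sup>2" by (simp add: power2_eq_square algebra_simps)
    also have "\<dots> = (x - of_real \<xi>)\<^sup>2 - (y - of_real \<xi>)\<^sup>2" by (simp add: p_def q_def flow_root_square)
    also have "\<dots> = (x - y) * (x - of_real \<xi> + (y - of_real \<xi>))" by (simp add: power2_eq_square algebra_simps)
    finally have "(p - q) * (p + q) = (x - y) * (x - of_real \<xi> + (y - of_real \<xi>))" .
    then have "ln (cmod ((p - q) * (p + q))) = ln (cmod ((x - y) * (x - of_real \<xi> + (y - of_real \<xi>))))" by simp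
    moreover have "p + q \<noteq> 0" "x - of_real \<xi> + (y - of_real \<xi>) \<noteq> 0"
      using i fdomD(1)[OF \<omega>(2)] fdomD(1)[OF \<omega>(3)] by (intro nonzero_of_Im; simp)+
    ultimately have "ln (cmod (p - q)) + ln (cmod (p + q)) = ln (cmod (x - y)) + ln (cmod (x - of_real \<xi> + (y - of_real \<xi>)))"
      using ne \<omega>(4) by (simp add: norm_mult ln_mult)
    then have "complex_of_real (ln (cmod (p - q))) + of_real (ln (cmod (p + q))) =
        of_real (ln (cmod (x - y))) + of_real (ln (cmod (x - of_real \<xi> + (y - of_real \<xi>))))"
      by (metis of_real_add)
    then show "val \<xi> eg \<omega> = val \<xi> (Add er el) \<omega>"
      by (simp add: \<omega>(1) eg_def er_def el_def p_def[symmetric] q_def[symmetric] algebra_simps)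
  qed
  from ej_cong[OF sopen_off_diagonal this, of "(t, x, y)" a b] show ?thesis
    using assms by (simp add: fdom2_def)
qed

lemma er_symmetric:
  assumes "x \<in> fdom \<xi> t" "y \<in> fdom \<xi> t"
  shows "ej \<xi> er a b (t, x, y) = ej \<xi> er b a (t, y, x)"
proof -
  have "eqv \<xi> (fdom2 \<xi>) (swp er) er"
    unfolding eqv_def
  proof (intro ballI conjI)
    fix \<omega> assume "\<omega> \<in> fdom2 \<xi>"
    then obtain t x y where \<omega>: "\<omega> = (t, x, y)" "x \<in> fdom \<xi> t" "y \<in> fdom \<xi> t" by (auto simp: fdom2_def)
    show "valid \<xi> er \<omega>" using valid_er \<omega> by simp
    show "valid \<xi> (swp er) \<omega>" using fdomD[OF \<omega>(2)] fdomD[OF \<omega>(3)] by (simp add: er_def \<omega> nonzero_of_Im upper_ne)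
    have "cmod (p - cnj q) = cmod (q - cnj p)" for p q
      by (metis complex_cnj_cnj complex_cnj_diff complex_mod_cnj norm_minus_commute)
    then show "val \<xi> (swp er) \<omega> = val \<xi> er \<omega>" by (simp add: er_def \<omega>(1) add.commute)
  qed
  then have "ej \<xi> (swp er) b a (t, y, x) = ej \<xi> er b a (t, y, x)"
    by (rule ej_cong[OF sopen_fdom2]) (use assms in \<open>simp add: fdom2_def\<close>)
  moreover have "ej \<xi> er a b (t, x, y) = ej \<xi> (swp er) b a (t, y, x)"
    by (rule ej_swap[OF sopen_fdom2]) (use assms \<open>eqv \<xi> (fdom2 \<xi>) (swp er) er\<close> in \<open>auto simp: fdom2_def eqv_def\<close>)
  ultimately show ?thesis by simp
qed

subsection \<open>The singular part\<close>

fun pw where "pw 0 = Cst 1" | "pw (Suc n) = Mul (Inv (Sub X Y)) (pw n)"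

lemma val_pw: "val \<xi> (pw n) (t, x, y) = inverse (x - y) ^ n"
  by (induction n) auto

lemma valid_pw: "x \<noteq> y \<Longrightarrow> valid \<xi> (pw n) (t, x, y)"
  by (induction n) auto

lemma der_pw:
  "val \<xi> (der Dx (pw n)) (t, x, y) = - of_nat n * inverse (x - y) ^ Suc n"
  "val \<xi> (der Dxb (pw n)) (t, x, y) = 0"
  "val \<xi> (der Dy (pw n)) (t, x, y) = of_nat n * inverse (x - y) ^ Suc n"
  "val \<xi> (der Dyb (pw n)) (t, x, y) = 0"
  by (induction n) (auto simp: val_pw algebra_simps)

abbreviation "offd \<equiv> {(t, x, y). (x :: complex) \<noteq> y} :: point set"

lemma sopen_offd: "sopen offd"
proof -
  have "\<forall>\<^sub>F x' in nhds x. x' \<noteq> y" "\<forall>\<^sub>F y' in nhds y. x \<noteq> y'" if "x \<noteq> y" for x y :: complex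
    using t1_space_nhds[OF that] t1_space_nhds[OF that[symmetric]] by (simp_all only: neq_commute[of x])
  then show ?thesis by (simp add: sopen_def)
qed

text \<open>Every derivative of log |x - y| is a multiple, possibly 0, of a power of 1 / (x - y) or
  of its conjugate; s tells which.\<close>

definition elf where
  "elf \<xi> F c n s \<longleftrightarrow> (\<forall>t x y. x \<noteq> y \<longrightarrow> valid \<xi> F (t, x, y) \<and>
     val \<xi> F (t, x, y) = c * (if s then cnj (inverse (x - y) ^ n) else inverse (x - y) ^ n))"

lemma elf_der:
  assumes "elf \<xi> F c n s"
  shows "elf \<xi> (der Dx F) (if s then 0 else - of_nat n * c) (Suc n) s"
    "elf \<xi> (der Dxb F) (if s then - of_nat n * c else 0) (Suc n) s"
    "elf \<xi> (der Dy F) (if s then 0 else of_nat n * c) (Suc n) s"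
    "elf \<xi> (der Dyb F) (if s then of_nat n * c else 0) (Suc n) s"
proof -
  define e where "e = Scl c (if s then Cnj (pw n) else pw n)"
  have e: "eqv \<xi> offd F e"
    using assms by (auto simp: eqv_def elf_def e_def val_pw valid_pw)
  have v: "valid \<xi> F (t, x, y)" if "x \<noteq> y" for t x y using assms that by (simp add: elf_def)
  have d: "val \<xi> (der k F) (t, x, y) = val \<xi> (der k e) (t, x, y)" if "x \<noteq> y" "k \<noteq> Dt" for k t x y
    using bspec[OF eqv_der[OF sopen_offd e that(2), unfolded eqv_def], of "(t, x, y)"] that by simp
  show "elf \<xi> (der Dx F) (if s then 0 else - of_nat n * c) (Suc n) s"
    "elf \<xi> (der Dxb F) (if s then - of_nat n * c else 0) (Suc n) s"
    "elf \<xi> (der Dy F) (if s then 0 else of_nat n * c) (Suc n) s"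
    "elf \<xi> (der Dyb F) (if s then of_nat n * c else 0) (Suc n) s"
    unfolding elf_def using v by (auto simp: d valid_der e_def der_pw)
qed

lemma elf_der_ex: "elf \<xi> F c n s \<Longrightarrow> k \<noteq> Dt \<Longrightarrow> \<exists>c'. elf \<xi> (der k F) c' (Suc n) s"
  by (cases k) (auto dest: elf_der)

lemma elf_el:
  "elf \<xi> (der Dx el) (-1/2) 1 False" "elf \<xi> (der Dxb el) (-1/2) 1 True"
  "elf \<xi> (der Dy el) (1/2) 1 False" "elf \<xi> (der Dyb el) (1/2) 1 True"
  by (simp_all add: elf_def el_def)

lemma elf_ders:
  assumes "ks \<noteq> []" "Dt \<notin> set ks"
  shows "\<exists>c n s. elf \<xi> (foldr der ks el) c n s"
  using assms
proof (induction ks)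
  case (Cons k ks)
  show ?case
  proof (cases "ks = []")
    case True
    then show ?thesis using Cons.prems elf_el[of \<xi>] by (cases k) (simp_all del: der.simps, blast+)
  next
    case False
    then obtain c n s where "elf \<xi> (foldr der ks el) c n s" using Cons by auto
    then obtain c' where "elf \<xi> (der k (foldr der ks el)) c' (Suc n) s"
      using elf_der_ex Cons.prems by (metis list.set_intros(1))
    then show ?thesis by auto
  qed
qed simp

text \<open>The coefficient of an unmixed derivative is non-zero, so that the vanishing of a
  singular term in \<open>matching\<close> forces its prefactor to vanish.\<close>

lemma elf_ders_x: "\<exists>c. c \<noteq> 0 \<and> elf \<xi> ((der Dx ^^ Suc j) el) c (Suc j) False"
proof (induction j)
  case 0
  show ?case using elf_el(1) by (auto intro!: exI[of _ "-1/2"])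
next
  case (Suc j)
  then obtain c where c: "c \<noteq> 0" "elf \<xi> ((der Dx ^^ Suc j) el) c (Suc j) False" by blast
  show ?case
    by (rule exI[of _ "- of_nat (Suc j) * c"]) (use c(1) elf_der(1)[OF c(2)] in \<open>simp del: of_nat_Suc\<close>)
qed

lemma elf_ders_xb: "\<exists>c. c \<noteq> 0 \<and> elf \<xi> ((der Dxb ^^ Suc j) el) c (Suc j) True"
proof (induction j)
  case 0
  show ?case using elf_el(2) by (auto intro!: exI[of _ "-1/2"])
next
  case (Suc j)
  then obtain c where c: "c \<noteq> 0" "elf \<xi> ((der Dxb ^^ Suc j) el) c (Suc j) True" by blast
  show ?case
    by (rule exI[of _ "- of_nat (Suc j) * c"]) (use c(1) elf_der(2)[OF c(2)] in \<open>simp del: of_nat_Suc\<close>)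
qed

lemma inverse_power_ope_fun: "u \<noteq> 0 \<Longrightarrow> inverse u ^ n = ope_fun (- int n, 0, 0) u"
  by (simp add: power_int_minus power_inverse)

text \<open>In the normal form of OPE functions the conjugate of 1 / u is u / |u|^2.\<close>

lemma cnj_inverse_power_ope_fun:
  assumes "u \<noteq> 0"
  shows "cnj (inverse u ^ n) = ope_fun (int n, - 2 * of_nat n, 0) u"
proof -
  have "complex_of_real (cmod u) powr (- 2 * of_nat n) = inverse (complex_of_real (cmod u) ^ (2 * n))"
    using assms powr_nat'[of "complex_of_real (cmod u)" "2 * n"] by (simp add: powr_minus)
  also have "complex_of_real (cmod u) ^ (2 * n) = (u * cnj u) ^ n"
    by (simp only: power_mult complex_norm_square of_real_power[symmetric])
  finally show ?thesis using assms by (simp add: power_mult_distrib power_inverse field_simps)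
qed

text \<open>Also records that the singular jets depend on x - y alone and not on t.\<close>

lemma el_span: "\<exists>L. \<forall>t x y. x \<noteq> y \<longrightarrow> ej \<xi> el a b (t, x, y) = (\<Sum>(c, i)\<leftarrow>L. c * ope_fun i (x - y))"
proof (cases "word a b = []")
  case True
  then have "ej \<xi> el a b (t, x, y) = -1 * ope_fun (0, 0, 1) (x - y)" if "x \<noteq> y" for t x y
    using that by (simp add: ej_def el_def)
  then show ?thesis by (intro exI[of _ "[(-1, (0, 0, 1))]"]) simp
next
  case False
  then obtain c n s where "elf \<xi> (foldr der (word a b) el) c n s" using elf_ders word_no_Dt by blast
  then have "ej \<xi> el a b (t, x, y) = c * ope_fun (if s then (int n, - 2 * of_nat n, 0) else (- int n, 0, 0)) (x - y)"
    if "x \<noteq> y" for t x y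
    using that cnj_inverse_power_ope_fun[of "x - y" n] inverse_power_ope_fun[of "x - y" n]
    by (simp add: elf_def ej_def del: ope_fun.simps)
  then show ?thesis
    by (intro exI[of _ "[(c, (if s then (int n, - 2 * of_nat n, 0) else (- int n, 0, 0)))]"]) simp
qed

text \<open>The OPE function of the jet a of log |u|: the logarithm itself, a power of 1 / u, or a
  power of its conjugate in normal form.\<close>

fun sing_index :: "nat \<times> nat \<Rightarrow> ope_index" where
  "sing_index (0, 0) = (0, 0, 1)"
| "sing_index (Suc j, k) = (- int (Suc j), 0, 0)"
| "sing_index (0, Suc k) = (int (Suc k), - 2 * of_nat (Suc k), 0)"

lemma el_sing:
  assumes "fst a = 0 \<or> snd a = 0"
  shows "\<exists>c. c \<noteq> 0 \<and> (\<forall>t x y. x \<noteq> y \<longrightarrow> ej \<xi> el a (0, 0) (t, x, y) = c * ope_fun (sing_index a) (x - y))"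
proof -
  consider "a = (0, 0)" | j where "a = (Suc j, 0)" | k where "a = (0, Suc k)"
    using assms by (metis not0_implies_Suc prod.collapse)
  then show ?thesis
  proof cases
    case 1
    then show ?thesis by (intro exI[of _ "-1"]) (simp add: ej_def el_def)
  next
    case (2 j)
    obtain c where c: "c \<noteq> 0" "elf \<xi> ((der Dx ^^ Suc j) el) c (Suc j) False" using elf_ders_x by blast
    have "ej \<xi> el a (0, 0) (t, x, y) = c * ope_fun (sing_index a) (x - y)" if "x \<noteq> y" for t x y
      using c(2) that inverse_power_ope_fun[of "x - y" "Suc j"]
      by (simp add: 2 ej_def elf_def del: ope_fun.simps power_Suc)
    then show ?thesis using c(1) by blast
  next
    case (3 k)
    obtain c where c: "c \<noteq> 0" "elf \<xi> ((der Dxb ^^ Suc k) el) c (Suc k) True" using elf_ders_xb by blast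
    have "ej \<xi> el a (0, 0) (t, x, y) = c * ope_fun (sing_index a) (x - y)" if "x \<noteq> y" for t x y
      using c(2) that cnj_inverse_power_ope_fun[of "x - y" "Suc k"]
      by (simp add: 3 ej_def elf_def del: ope_fun.simps power_Suc)
    then show ?thesis using c(1) by blast
  qed
qed

subsection \<open>Pair expectations in the charts moved by the flow\<close>

text \<open>The neighbourhood of the second point may depend on the first, since it has to avoid the
  singularity there.\<close>

lemma wirt_wirt:
  assumes "open A" "x0 \<in> A"
    and "\<And>x. x \<in> A \<Longrightarrow> \<exists>B. open B \<and> y0 \<in> B \<and> (\<forall>y\<in>B. valid \<xi> e (t, x, y) \<and> f x y = val \<xi> e (t, x, y))"
  shows "wirt j k (\<lambda>x. wirt l m (f x) y0) x0 = ej \<xi> e (j, k) (l, m) (t, x0, y0)"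
proof -
  have inner: "wirt l m (f x) y0 = ej \<xi> e (0, 0) (l, m) (t, x, y0)" and v: "valid \<xi> e (t, x, y0)" if x: "x \<in> A" for x
  proof -
    obtain B where B: "open B" "y0 \<in> B" "\<forall>y\<in>B. valid \<xi> e (t, x, y) \<and> f x y = val \<xi> e (t, x, y)"
      using assms(3)[OF x] by blast
    then have "jfam B (\<lambda>j k y. ej \<xi> e (0, 0) (j, k) (t, x, y))"
      by (intro jfam_mono[OF jfam_y]) auto
    from wirt_eq[OF B(1) this, of "f x" y0 l m] B show "wirt l m (f x) y0 = ej \<xi> e (0, 0) (l, m) (t, x, y0)" by simp
    show "valid \<xi> e (t, x, y0)" using B by blast
  qed
  have "jfam A (\<lambda>j k x. ej \<xi> e (j, k) (l, m) (t, x, y0))"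
    by (rule jfam_mono[OF jfam_x]) (use v in auto)
  from wirt_eq[OF assms(1) this, of "\<lambda>x. wirt l m (f x) y0" x0 j k] inner assms(2) show ?thesis by simp
qed

definition cjet :: "chart \<Rightarrow> complex \<Rightarrow> nat \<times> nat \<Rightarrow> gvar" where
  "cjet c \<zeta> = (\<lambda>(j, k). Jet (chart_par c) j k \<zeta>)"

text \<open>What is used of the identity chart pushed by the flow, with t = 0 for the identity chart
  itself. Of the logarithm only the imaginary part is made explicit, as \<open>phi_b\<close> sees
  nothing else.\<close>

definition flow_chart :: "real \<Rightarrow> (complex \<Rightarrow> complex) \<Rightarrow> real \<Rightarrow> chart \<Rightarrow> bool" where
  "flow_chart \<xi> w t c \<longleftrightarrow> is_chart w c \<and> chart_dom c \<subseteq> fdom \<xi> t \<and>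
     (\<forall>x\<in>chart_dom c. chart_par c x = of_real \<xi> + flow_root t (x - of_real \<xi>) \<and>
        Im (chart_log c x) = Arg (x - of_real \<xi>) - Arg (flow_root t (x - of_real \<xi>)))"

lemma pair_exp_node:
  "pair_exp (Jet id 0 0 (chart_par c \<zeta>)) g = pair_exp (cjet c \<zeta> (0, 0)) g"
  "pair_exp g (Jet id 0 0 (chart_par c \<zeta>)) = pair_exp g (cjet c \<zeta> (0, 0))"
  by (cases g; simp add: cjet_def wirt_def)+

context
  fixes \<xi> w t c
  assumes c: "flow_chart \<xi> w t c"
begin

lemma c_open: "open (chart_dom c)" and c_chart: "is_chart w c" and c_fdom: "x \<in> chart_dom c \<Longrightarrow> x \<in> fdom \<xi> t"
  and c_par: "x \<in> chart_dom c \<Longrightarrow> chart_par c x = of_real \<xi> + flow_root t (x - of_real \<xi>)"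
  and c_log: "x \<in> chart_dom c \<Longrightarrow> Im (chart_log c x) = Arg (x - of_real \<xi>) - Arg (flow_root t (x - of_real \<xi>))"
  using c by (auto simp: flow_chart_def is_chart_def)

lemma c_par_upper: "x \<in> chart_dom c \<Longrightarrow> chart_par c x \<in> \<H>"
  using c_chart by (auto simp: is_chart_def)

lemma c_par_inj: "inj_on (chart_par c) (chart_dom c)"
  using c_chart by (auto simp: is_chart_def)

lemma pair_exp_flow:
  assumes "x \<in> chart_dom c" "y \<in> chart_dom c" "x \<noteq> y"
  shows "pair_exp (cjet c x a) (cjet c y b) = 2 * (ej \<xi> er a b (t, x, y) + ej \<xi> el a b (t, x, y))"
proof -
  obtain j k l m where ab: "a = (j, k)" "b = (l, m)" by (cases a; cases b)
  have "wirt j k (\<lambda>x. wirt l m (\<lambda>y. complex_of_real (green (chart_par c x) (chart_par c y))) y) x =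
      ej \<xi> eg (j, k) (l, m) (t, x, y)"
  proof (rule wirt_wirt[where A = "chart_dom c - {y}"])
    fix x assume x: "x \<in> chart_dom c - {y}"
    show "\<exists>B. open B \<and> y \<in> B \<and> (\<forall>y\<in>B. valid \<xi> eg (t, x, y) \<and>
        complex_of_real (green (chart_par c x) (chart_par c y)) = val \<xi> eg (t, x, y))"
    proof (intro exI[of _ "chart_dom c - {x}"] conjI ballI)
      fix y' assume y': "y' \<in> chart_dom c - {x}"
      then show v: "valid \<xi> eg (t, x, y')" using x c_fdom by (intro valid_eg) auto
      have "ln (cmod (z / z')) = ln (cmod z) - ln (cmod z')" if "z \<noteq> 0" "z' \<noteq> 0" for z z'
        using that by (simp add: norm_divide ln_div)
      then show "complex_of_real (green (chart_par c x) (chart_par c y')) = val \<xi> eg (t, x, y')"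
        using v x y' by (simp add: green_def eg_def c_par)
    qed (use c_open assms x in auto)
  qed (use c_open assms in auto)
  then show ?thesis
    using eg_split[of x \<xi> t y a b] assms c_fdom by (simp add: cjet_def ab)
qed

lemma pair_exp_source:
  assumes "x \<in> chart_dom c" "Im y > 0" "y \<noteq> chart_par c x"
  shows "pair_exp (cjet c x a) (Jet id l m y) = 2 * ej \<xi> esrc a (l, m) (t, x, y)"
proof -
  obtain j k where a: "a = (j, k)" by (cases a)
  define A where "A = {x \<in> chart_dom c. chart_par c x \<noteq> y}"
  have cont: "continuous_on (chart_dom c) (chart_par c)"
    using c_chart holomorphic_on_imp_continuous_on by (auto simp: is_chart_def)
  have "open A"
    using continuous_open_preimage[OF cont c_open, of "- {y}"] unfolding A_def vimage_def Int_def by (auto simp: conj_commute)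
  have "wirt j k (\<lambda>x. wirt l m (\<lambda>y. complex_of_real (green (chart_par c x) (id y))) y) x =
      ej \<xi> esrc (j, k) (l, m) (t, x, y)"
  proof (rule wirt_wirt[where A = A])
    fix x assume x: "x \<in> A"
    show "\<exists>B. open B \<and> y \<in> B \<and> (\<forall>y\<in>B. valid \<xi> esrc (t, x, y) \<and>
        complex_of_real (green (chart_par c x) (id y)) = val \<xi> esrc (t, x, y))"
    proof (intro exI[of _ "{y. Im y > 0} - {chart_par c x}"] conjI ballI)
      fix y' assume y': "y' \<in> {y. Im y > 0} - {chart_par c x}"
      have par: "chart_par c x = of_real \<xi> + flow_root t (x - of_real \<xi>)" using x c_par by (simp add: A_def)
      show v: "valid \<xi> esrc (t, x, y')" using x y' c_fdom par by (intro valid_esrc) (auto simp: A_def)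
      define p where "p = flow_root t (x - of_real \<xi>)"
      have n: "of_real \<xi> + p - cnj y' = p - cnj (y' - of_real \<xi>)" "of_real \<xi> + p - y' = p + (of_real \<xi> - y')"
        by simp_all
      have "p - cnj (y' - of_real \<xi>) \<noteq> 0" "p + (of_real \<xi> - y') \<noteq> 0"
        using v by (simp_all add: esrc_def p_def del: complex_cnj_diff)
      then have "ln (cmod ((p - cnj (y' - of_real \<xi>)) / (p + (of_real \<xi> - y')))) =
          ln (cmod (p - cnj (y' - of_real \<xi>))) - ln (cmod (p + (of_real \<xi> - y')))"
        by (simp add: norm_divide ln_div del: complex_cnj_diff)
      then show "complex_of_real (green (chart_par c x) (id y')) = val \<xi> esrc (t, x, y')"
        unfolding green_def par id_apply p_def[symmetric] n by (simp add: esrc_def p_def del: complex_cnj_diff)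
    qed (use assms x open_halfspace_Im_gt in \<open>auto simp: A_def\<close>)
  qed (use \<open>open A\<close> assms in \<open>auto simp: A_def\<close>)
  then show ?thesis by (simp add: cjet_def a)
qed

lemma adm_flow:
  assumes "x \<in> chart_dom c" "y \<in> chart_dom c" "x \<noteq> y"
  shows "adm (\<lambda>a. pair_exp (cjet c x a) (cjet c y b))" "adm (\<lambda>b. pair_exp (cjet c x a) (cjet c y b))"
proof -
  have in': "(t, x, y) \<in> fdom2 \<xi> \<inter> {(t, x, y). x \<noteq> y}" using assms c_fdom by (simp add: fdom2_def)
  have v: "valid \<xi> eg \<omega>" if "\<omega> \<in> fdom2 \<xi> \<inter> {(t, x, y). x \<noteq> y}" for \<omega>
    using that valid_eg by (auto simp: fdom2_def)
  have z: "val \<xi> (der Dxb (der Dx eg)) \<omega> = 0" "val \<xi> (der Dyb (der Dy eg)) \<omega> = 0" for \<omega>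
    by (simp_all add: eg_def)
  have "ej \<xi> eg (Suc j, Suc k) b (t, x, y) = 0" "ej \<xi> eg a (Suc j, Suc k) (t, x, y) = 0" for j k a b
    using ej_mixed_zero[OF sopen_off_diagonal v in'] z by auto
  moreover have "pair_exp (cjet c x a) (cjet c y b) = 2 * ej \<xi> eg a b (t, x, y)" for a b
    using eg_split[of x \<xi> t y a b] assms c_fdom by (simp add: pair_exp_flow)
  ultimately show "adm (\<lambda>a. pair_exp (cjet c x a) (cjet c y b))" "adm (\<lambda>b. pair_exp (cjet c x a) (cjet c y b))"
    by (simp_all only: adm_def) simp_all
qed

lemma adm_source:
  assumes "x \<in> chart_dom c" "Im y > 0" "y \<noteq> chart_par c x"
  shows "adm (\<lambda>a. pair_exp (cjet c x a) (Jet id l m y))"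
proof -
  have "(t, x, y) \<in> {\<omega>. valid \<xi> esrc \<omega>}"
    using assms c_par valid_esrc c_fdom by simp
  moreover have "val \<xi> (der Dxb (der Dx esrc)) \<omega> = 0" for \<omega> by (simp add: esrc_def)
  ultimately have "ej \<xi> esrc (Suc j, Suc k) (l, m) (t, x, y) = 0" for j k
    using ej_mixed_zero(1)[OF sopen_valid[of \<xi> esrc], of \<xi> esrc] by auto
  then show ?thesis using assms by (auto simp: adm_def pair_exp_source)
qed

end

subsection \<open>Prescribing the derivatives of the mean by sources\<close>

text \<open>Duality in finite dimension: if no non-trivial combination over k of the functions
  \<open>\<lambda>y. V y k\<close> vanishes on S, then combinations of evaluations at points of S
  attain any prescribed values.\<close>

lemma lin_span:
  fixes V :: "'y \<Rightarrow> 'k \<Rightarrow> complex"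
  assumes "finite K"
    and "\<And>l. (\<And>y. y \<in> S \<Longrightarrow> (\<Sum>k\<in>K. l k * V y k) = 0) \<Longrightarrow> (\<forall>k\<in>K. l k = 0)"
  shows "\<exists>\<delta>. Poly_Mapping.keys \<delta> \<subseteq> S \<and> (\<forall>k\<in>K. lin \<delta> (\<lambda>y. V y k) = \<tau> k)"
  using assms
proof (induction K arbitrary: \<tau> rule: finite_induct)
  case empty
  show ?case by (rule exI[of _ 0]) simp
next
  case (insert k0 K)
  have ind: "\<forall>k\<in>K. l k = 0" if "\<And>y. y \<in> S \<Longrightarrow> (\<Sum>k\<in>K. l k * V y k) = 0" for l
  proof -
    let ?l = "\<lambda>k. if k = k0 then 0 else l k"
    have "(\<Sum>k\<in>insert k0 K. ?l k * V y k) = (\<Sum>k\<in>K. l k * V y k)" for y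
      using insert.hyps by (auto intro!: sum.cong)
    then have "\<forall>k\<in>insert k0 K. ?l k = 0" using that by (intro insert.prems) simp
    then show ?thesis using insert.hyps(2) by (metis insertCI)
  qed
  have IH: "\<exists>\<delta>. Poly_Mapping.keys \<delta> \<subseteq> S \<and> (\<forall>k\<in>K. lin \<delta> (\<lambda>y. V y k) = \<tau>' k)" for \<tau>'
  proof (rule insert.IH)
    fix l assume "\<And>y. y \<in> S \<Longrightarrow> (\<Sum>k\<in>K. l k * V y k) = 0"
    then show "\<forall>k\<in>K. l k = 0" by (rule ind)
  qed
  have "\<exists>d. \<forall>k'\<in>K. Poly_Mapping.keys (d k') \<subseteq> S \<and> (\<forall>k\<in>K. lin (d k') (\<lambda>y. V y k) = (if k = k' then 1 else 0))"
  proof (rule bchoice, rule ballI)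
    fix k' show "\<exists>\<delta>. Poly_Mapping.keys \<delta> \<subseteq> S \<and> (\<forall>k\<in>K. lin \<delta> (\<lambda>y. V y k) = (if k = k' then 1 else 0))"
      by (rule IH)
  qed
  then obtain d where d: "\<And>k'. k' \<in> K \<Longrightarrow> Poly_Mapping.keys (d k') \<subseteq> S"
    "\<And>k k'. k' \<in> K \<Longrightarrow> k \<in> K \<Longrightarrow> lin (d k') (\<lambda>y. V y k) = (if k = k' then 1 else 0)" by blast
  \<comment> \<open>The relation that would hold on all of S if the column k0 were the combination
    of the others dictated by the dual family d.\<close>
  let ?l = "\<lambda>k. if k = k0 then 1 else - lin (d k) (\<lambda>y. V y k0)"
  have "\<exists>y\<in>S. (\<Sum>k\<in>insert k0 K. ?l k * V y k) \<noteq> 0"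
  proof (rule ccontr)
    assume "\<not> ?thesis"
    then have "\<forall>k\<in>insert k0 K. ?l k = 0" by (intro insert.prems) simp
    then show False by simp
  qed
  then obtain y where y: "y \<in> S" "(\<Sum>k\<in>insert k0 K. ?l k * V y k) \<noteq> 0" by blast
  \<comment> \<open>Evaluation at y, corrected by the dual family so that it vanishes on K; by the
    choice of y it does not vanish at k0.\<close>
  define \<epsilon> where "\<epsilon> = Poly_Mapping.single y 1 + (\<Sum>k\<in>K. Poly_Mapping.map ((*) (- V y k)) (d k))"
  have sc: "lin (Poly_Mapping.map ((*) r) \<gamma>) f = r * lin \<gamma> f" for r and \<gamma> :: "'y \<Rightarrow>\<^sub>0 complex" and f
  proof -
    have l: "Poly_Mapping.lookup (Poly_Mapping.map ((*) r) \<gamma>) x = r * Poly_Mapping.lookup \<gamma> x" for x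
      by (simp add: Poly_Mapping.map.rep_eq when_def)
    have "Poly_Mapping.keys (Poly_Mapping.map ((*) r) \<gamma>) \<subseteq> Poly_Mapping.keys \<gamma>" by (auto simp: in_keys_iff l)
    then have "lin (Poly_Mapping.map ((*) r) \<gamma>) f = (\<Sum>x\<in>Poly_Mapping.keys \<gamma>. r * Poly_Mapping.lookup \<gamma> x * f x)"
      by (subst lin_eq[of "Poly_Mapping.keys \<gamma>"]) (simp_all add: l)
    then show ?thesis by (simp add: lin_def sum_distrib_left mult.assoc)
  qed
  have keys_map: "Poly_Mapping.keys (Poly_Mapping.map ((*) r) \<gamma>) \<subseteq> Poly_Mapping.keys \<gamma>" for r and \<gamma> :: "'y \<Rightarrow>\<^sub>0 complex"
    by (auto simp: in_keys_iff Poly_Mapping.map.rep_eq when_def)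
  have keys_sum: "Poly_Mapping.keys (sum f A) \<subseteq> S" if "finite A" "\<And>x. x \<in> A \<Longrightarrow> Poly_Mapping.keys (f x) \<subseteq> S" for f :: "'k \<Rightarrow> 'y \<Rightarrow>\<^sub>0 complex" and A
    using that
  proof (induction A)
    case (insert x A)
    then show ?case using Poly_Mapping.keys_add[of "f x" "sum f A"] by simp blast
  qed simp
  have le: "lin \<epsilon> f = f y + (\<Sum>k\<in>K. - V y k * lin (d k) f)" for f
    by (simp add: \<epsilon>_def lin_add lin_sum_left sc)
  have \<epsilon>: "Poly_Mapping.keys \<epsilon> \<subseteq> S" "\<And>k. k \<in> K \<Longrightarrow> lin \<epsilon> (\<lambda>y. V y k) = 0" "lin \<epsilon> (\<lambda>y. V y k0) \<noteq> 0"
  proof -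
    have "Poly_Mapping.keys (\<Sum>k\<in>K. Poly_Mapping.map ((*) (- V y k)) (d k)) \<subseteq> S"
      by (rule keys_sum[OF insert.hyps(1)]) (use d(1) keys_map in blast)
    then show "Poly_Mapping.keys \<epsilon> \<subseteq> S" unfolding \<epsilon>_def
      using y(1) Poly_Mapping.keys_add[of "Poly_Mapping.single y 1" "\<Sum>k\<in>K. Poly_Mapping.map ((*) (- V y k)) (d k)"] by auto
    fix k assume "k \<in> K"
    then have "lin \<epsilon> (\<lambda>y. V y k) = V y k + (\<Sum>k'\<in>K. if k = k' then - V y k' else 0)"
      unfolding le by (intro arg_cong2[where f = "(+)"] sum.cong refl) (simp add: d(2))
    then show "lin \<epsilon> (\<lambda>y. V y k) = 0" using \<open>k \<in> K\<close> insert.hyps(1) by simp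
  next
    have "(\<Sum>k\<in>insert k0 K. ?l k * V y k) = lin \<epsilon> (\<lambda>y. V y k0)"
      using insert.hyps unfolding le by (auto intro!: sum.cong)
    then show "lin \<epsilon> (\<lambda>y. V y k0) \<noteq> 0" using y(2) by simp
  qed
  obtain \<delta> where \<delta>: "Poly_Mapping.keys \<delta> \<subseteq> S" "\<forall>k\<in>K. lin \<delta> (\<lambda>y. V y k) = \<tau> k" using IH by blast
  define r where "r = (\<tau> k0 - lin \<delta> (\<lambda>y. V y k0)) / lin \<epsilon> (\<lambda>y. V y k0)"
  show ?case
  proof (intro exI[of _ "\<delta> + Poly_Mapping.map ((*) r) \<epsilon>"] conjI ballI)
    show "Poly_Mapping.keys (\<delta> + Poly_Mapping.map ((*) r) \<epsilon>) \<subseteq> S"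
      using Poly_Mapping.keys_add[of \<delta> "Poly_Mapping.map ((*) r) \<epsilon>"] keys_map[of r \<epsilon>] \<delta>(1) \<epsilon>(1) by blast
    fix k assume "k \<in> insert k0 K"
    then show "lin (\<delta> + Poly_Mapping.map ((*) r) \<epsilon>) (\<lambda>y. V y k) = \<tau> k"
      using \<delta>(2) \<epsilon>(2,3) by (auto simp: lin_add sc r_def)
  qed
qed

lemma sing_index_order: "fst a = 0 \<or> snd a = 0 \<Longrightarrow> ope_order (sing_index a) \<le> 0"
  by (cases a rule: sing_index.cases) auto

lemma sing_index_nz: "fst a = 0 \<or> snd a = 0 \<Longrightarrow> sing_index a \<noteq> (0, 0, 0)"
  by (cases a rule: sing_index.cases) auto

lemma sing_index_inj: "inj_on sing_index {a. fst a = 0 \<or> snd a = 0}"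
proof (rule inj_onI)
  fix a b assume "a \<in> {a. fst a = 0 \<or> snd a = 0}" "b \<in> {a. fst a = 0 \<or> snd a = 0}" "sing_index a = sing_index b"
  then show "a = b" by (cases a rule: sing_index.cases; cases b rule: sing_index.cases) auto
qed

text \<open>A linear relation among the pair expectations, as functions of the source point, is
  tested by moving the source into \<open>\<zeta>0\<close>. The regular parts and the other nodes
  converge, while the jets at \<open>\<zeta>0\<close> behave like distinct OPE functions of order at
  most 0, none of them constant. Independence makes all coefficients at \<open>\<zeta>0\<close>
  vanish, and \<open>lin_span\<close> applies.\<close>

lemma matching:
  assumes c: "flow_chart \<xi> w t c" and Z: "finite Z" "Z \<subseteq> chart_dom c" and A: "finite A" "\<And>a. a \<in> A \<Longrightarrow> fst a = 0 \<or> snd a = 0"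
  shows "\<exists>\<delta>. (\<forall>g\<in>Poly_Mapping.keys \<delta>. \<exists>y \<in> \<H> - chart_par c ` Z. g = Jet id 0 0 y) \<and>
    (\<forall>\<zeta>\<in>Z. \<forall>a\<in>A. lin \<delta> (pair_exp (cjet c \<zeta> a)) = \<tau> \<zeta> a)"
proof -
  define S where "S = Jet id 0 0 ` (\<H> - chart_par c ` Z)"
  have "\<exists>\<delta>. Poly_Mapping.keys \<delta> \<subseteq> S \<and> (\<forall>k\<in>Z \<times> A. lin \<delta> (\<lambda>g. (case k of (\<zeta>, a) \<Rightarrow> pair_exp (cjet c \<zeta> a)) g) = (case k of (\<zeta>, a) \<Rightarrow> \<tau> \<zeta> a))"
  proof (rule lin_span)
    fix l assume l: "\<And>g. g \<in> S \<Longrightarrow> (\<Sum>k\<in>Z \<times> A. l k * (case k of (\<zeta>, a) \<Rightarrow> pair_exp (cjet c \<zeta> a)) g) = 0"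
    have "l (\<zeta>0, a0) = 0" if \<zeta>0: "\<zeta>0 \<in> Z" and a0: "a0 \<in> A" for \<zeta>0 a0
    proof -
      let ?e = "\<lambda>e \<zeta> a \<eta>. ej \<xi> e a (0, 0) (t, \<zeta>, \<eta>)"
      let ?\<eta> = "\<lambda>u. \<zeta>0 - u"
      have \<zeta>0d: "\<zeta>0 \<in> chart_dom c" using \<zeta>0 Z by auto
      have lim\<eta>: "(?\<eta> \<longlongrightarrow> \<zeta>0) (at 0)" by (rule tendsto_eq_intros refl | simp)+
      have cont: "((\<lambda>u. ?e e \<zeta> a (?\<eta> u)) \<longlongrightarrow> ?e e \<zeta> a \<zeta>0) (at 0)" if "valid \<xi> e (t, \<zeta>, \<zeta>0)" for e \<zeta> a
      proof -
        have "isCont (\<lambda>\<eta>. ?e e \<zeta> a \<eta>) \<zeta>0"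
          using ej_hw_y[OF that, of a 0 0] unfolding hw_def by (rule has_derivative_continuous)
        then show ?thesis using lim\<eta> isCont_tendsto_compose by blast
      qed
      define rest where "rest = (\<lambda>u. (\<Sum>(\<zeta>, a)\<in>Z \<times> A. l (\<zeta>, a) * (2 * ?e er \<zeta> a (?\<eta> u))) +
         (\<Sum>(\<zeta>, a)\<in>(Z - {\<zeta>0}) \<times> A. l (\<zeta>, a) * (2 * ?e el \<zeta> a (?\<eta> u))))"
      obtain L where L: "(rest \<longlongrightarrow> L) (at 0)"
      proof
        show "(rest \<longlongrightarrow> (\<Sum>(\<zeta>, a)\<in>Z \<times> A. l (\<zeta>, a) * (2 * ?e er \<zeta> a \<zeta>0)) +
         (\<Sum>(\<zeta>, a)\<in>(Z - {\<zeta>0}) \<times> A. l (\<zeta>, a) * (2 * ?e el \<zeta> a \<zeta>0))) (at 0)"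
          unfolding rest_def case_prod_unfold
          by (intro tendsto_add tendsto_sum tendsto_mult tendsto_const cont)
            (use Z \<zeta>0d c_fdom[OF c] in \<open>auto intro!: valid_er valid_el\<close>)
      qed
      have "\<forall>a\<in>A. \<exists>k. k \<noteq> 0 \<and> (\<forall>t x y. x \<noteq> y \<longrightarrow> ej \<xi> el a (0, 0) (t, x, y) = k * ope_fun (sing_index a) (x - y))"
        using el_sing A(2) by blast
      from bchoice[OF this] obtain k where kk: "\<forall>a\<in>A. k a \<noteq> 0 \<and>
        (\<forall>t x y. x \<noteq> y \<longrightarrow> ej \<xi> el a (0, 0) (t, x, y) = k a * ope_fun (sing_index a) (x - y))" ..
      have k: "k a \<noteq> 0" "x \<noteq> y \<Longrightarrow> ej \<xi> el a (0, 0) (t, x, y) = k a * ope_fun (sing_index a) (x - y)"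
        if "a \<in> A" for a t x y
        using bspec[OF kk that] by simp_all
      have ev: "\<forall>\<^sub>F u in at 0. (\<Sum>a\<in>A. (l (\<zeta>0, a) * (2 * k a)) * ope_fun (sing_index a) u) = - rest u"
      proof -
        have "open (chart_dom c - (Z - {\<zeta>0}))" using c_open[OF c] Z by (intro open_Diff[OF _ finite_imp_closed]) auto
        from topological_tendstoD[OF lim\<eta> this] have "\<forall>\<^sub>F u in at 0. ?\<eta> u \<in> chart_dom c - (Z - {\<zeta>0})"
          using \<zeta>0d by auto
        moreover have "\<forall>\<^sub>F u in at (0::complex). u \<noteq> 0" by (simp add: eventually_at_filter)
        ultimately show ?thesis
        proof eventually_elim
          case (elim u)
          have \<eta>: "?\<eta> u \<in> chart_dom c" "?\<eta> u \<notin> Z" using elim by auto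
          have "chart_par c (?\<eta> u) \<in> \<H> - chart_par c ` Z"
            using \<eta> Z c_par_upper[OF c] c_par_inj[OF c] by (auto simp: inj_on_def)
          then have "Jet id 0 0 (chart_par c (?\<eta> u)) \<in> S" by (simp add: S_def)
          from l[OF this] have "0 = (\<Sum>(\<zeta>, a)\<in>Z \<times> A. l (\<zeta>, a) * pair_exp (cjet c \<zeta> a) (cjet c (?\<eta> u) (0, 0)))"
            by (simp add: pair_exp_node case_prod_unfold)
          also have "\<dots> = (\<Sum>(\<zeta>, a)\<in>Z \<times> A. l (\<zeta>, a) * (2 * (?e er \<zeta> a (?\<eta> u) + ?e el \<zeta> a (?\<eta> u))))"
          proof (rule sum.cong[OF refl])
            fix p assume "p \<in> Z \<times> A"
            then obtain \<zeta> a where p: "p = (\<zeta>, a)" "\<zeta> \<in> Z" by auto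
            then have "\<zeta> \<in> chart_dom c" "\<zeta> \<noteq> ?\<eta> u" using Z \<eta> by auto
            then show "(case p of (\<zeta>, a) \<Rightarrow> l (\<zeta>, a) * pair_exp (cjet c \<zeta> a) (cjet c (?\<eta> u) (0, 0))) =
                (case p of (\<zeta>, a) \<Rightarrow> l (\<zeta>, a) * (2 * (?e er \<zeta> a (?\<eta> u) + ?e el \<zeta> a (?\<eta> u))))"
              using pair_exp_flow[OF c _ \<eta>(1), of \<zeta> a "(0, 0)"] unfolding p(1) prod.case by simp
          qed
          also have "\<dots> = (\<Sum>(\<zeta>, a)\<in>Z \<times> A. l (\<zeta>, a) * (2 * ?e er \<zeta> a (?\<eta> u))) + (\<Sum>(\<zeta>, a)\<in>Z \<times> A. l (\<zeta>, a) * (2 * ?e el \<zeta> a (?\<eta> u)))"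
            by (simp add: case_prod_unfold distrib_left sum.distrib)
          also have "(\<Sum>(\<zeta>, a)\<in>Z \<times> A. l (\<zeta>, a) * (2 * ?e el \<zeta> a (?\<eta> u))) =
            (\<Sum>(\<zeta>, a)\<in>(Z - {\<zeta>0}) \<times> A. l (\<zeta>, a) * (2 * ?e el \<zeta> a (?\<eta> u))) + (\<Sum>a\<in>A. l (\<zeta>0, a) * (2 * ?e el \<zeta>0 a (?\<eta> u)))"
            unfolding sum.cartesian_product[symmetric]
            by (subst sum.remove[OF Z(1) \<zeta>0]) (rule add.commute)
          also have "(\<Sum>a\<in>A. l (\<zeta>0, a) * (2 * ?e el \<zeta>0 a (?\<eta> u))) = (\<Sum>a\<in>A. (l (\<zeta>0, a) * (2 * k a)) * ope_fun (sing_index a) u)"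
          proof (rule sum.cong[OF refl])
            fix a assume "a \<in> A"
            have "\<zeta>0 \<noteq> ?\<eta> u" "\<zeta>0 - ?\<eta> u = u" using elim by auto
            with k(2)[OF \<open>a \<in> A\<close>, of \<zeta>0 "?\<eta> u" t] have "?e el \<zeta>0 a (?\<eta> u) = k a * ope_fun (sing_index a) u"
              by metis
            then show "l (\<zeta>0, a) * (2 * ?e el \<zeta>0 a (?\<eta> u)) = (l (\<zeta>0, a) * (2 * k a)) * ope_fun (sing_index a) u"
              by (simp only: mult_ac)
          qed
          finally have "0 = rest u + (\<Sum>a\<in>A. (l (\<zeta>0, a) * (2 * k a)) * ope_fun (sing_index a) u)"
            unfolding rest_def by (simp only: add.assoc)
          from minus_unique[OF this[symmetric]] show ?case by (rule sym)
        qed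
      qed
      \<comment> \<open>The convergent remainder is counted as the constant OPE function, with its
        limit L as coefficient at (0, 0, 0); the other labels are inverted by injectivity of
        \<open>sing_index\<close>.\<close>
      define d where "d = (\<lambda>i. if i = (0, 0, 0) then L else
          (let a = the_inv_into A sing_index i in l (\<zeta>0, a) * (2 * k a)))"
      have inj: "inj_on sing_index A" by (rule inj_on_subset[OF sing_index_inj], rule subsetI, rule CollectI, rule A(2))
      have d: "d (sing_index a) = l (\<zeta>0, a) * (2 * k a)" if "a \<in> A" for a
        unfolding d_def Let_def the_inv_into_f_f[OF inj that] using sing_index_nz[of a] A(2)[OF that] by simp
      have nz: "(0, 0, 0) \<notin> sing_index ` A"
      proof
        assume "(0, 0, 0) \<in> sing_index ` A"
        then obtain a where "(0, 0, 0) = sing_index a" "a \<in> A" by (rule imageE)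
        then show False using sing_index_nz[OF A(2)[OF \<open>a \<in> A\<close>]] by simp
      qed
      have nz0: "\<forall>\<^sub>F u in at (0::complex). u \<noteq> 0" by (simp add: eventually_at_filter)
      have "d (sing_index a0) = 0"
      proof (rule ope_fun_independent[where I = "insert (0, 0, 0) (sing_index ` A)"])
        have e: "(\<Sum>i\<in>insert (0, 0, 0) (sing_index ` A). d i * ope_fun i u) =
            L * ope_fun (0, 0, 0) u + (\<Sum>a\<in>A. (l (\<zeta>0, a) * (2 * k a)) * ope_fun (sing_index a) u)" for u
          using A(1) nz by (simp add: sum.reindex[OF inj] d del: ope_fun.simps) (simp add: d_def)
        have "((\<lambda>u. L * ope_fun (0, 0, 0) u + (\<Sum>a\<in>A. (l (\<zeta>0, a) * (2 * k a)) * ope_fun (sing_index a) u)) \<longlongrightarrow> 0) (at 0)"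
        proof (rule Lim_transform_eventually)
          show "((\<lambda>u. L - rest u) \<longlongrightarrow> 0) (at 0)" using tendsto_diff[OF tendsto_const[of L] L] by simp
          show "\<forall>\<^sub>F u in at 0. L - rest u = L * ope_fun (0, 0, 0) u + (\<Sum>a\<in>A. (l (\<zeta>0, a) * (2 * k a)) * ope_fun (sing_index a) u)"
            using ev nz0
          proof eventually_elim
            case (elim u)
            then have "ope_fun (0, 0, 0) u = 1" by simp
            then show ?case using elim by (simp del: ope_fun.simps)
          qed
        qed
        then show "((\<lambda>u. \<Sum>i\<in>insert (0, 0, 0) (sing_index ` A). d i * ope_fun i u) \<longlongrightarrow> 0) (at 0)"
          unfolding e .
        show "ope_order i \<le> 0" if "i \<in> insert (0, 0, 0) (sing_index ` A)" for i
        proof (cases "i = (0, 0, 0)")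
          case False
          with that obtain a where "i = sing_index a" "a \<in> A" by blast
          then show ?thesis using A(2)[of a] sing_index_order[of a] by (simp del: ope_order.simps)
        qed simp
      qed (use A(1) a0 in auto)
      then show ?thesis using d[OF a0] k(1)[OF a0] by simp
    qed
    then show "\<forall>k\<in>Z \<times> A. l k = 0" by auto
  qed (use Z A in auto)
  then obtain \<delta> where "Poly_Mapping.keys \<delta> \<subseteq> S" "\<forall>\<zeta>\<in>Z. \<forall>a\<in>A. lin \<delta> (pair_exp (cjet c \<zeta> a)) = \<tau> \<zeta> a"
    by auto
  then have "\<forall>g\<in>Poly_Mapping.keys \<delta>. \<exists>y\<in>\<H> - chart_par c ` Z. g = Jet id 0 0 y"
    unfolding S_def by (meson imageE subsetD)
  with \<open>\<forall>\<zeta>\<in>Z. \<forall>a\<in>A. lin \<delta> (pair_exp (cjet c \<zeta> a)) = \<tau> \<zeta> a\<close> show ?thesis by (intro exI[of _ \<delta>] conjI)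
qed

subsection \<open>Symmetry of second derivatives\<close>

text \<open>The second difference \<open>\<Delta> h k\<close> is symmetric. Up to o(|h|^2) it equals
  the form B of second derivatives, because the function g of s in [0, 1] below has a small
  derivative. Differentiability of a and b at the single point x0 suffices for this
  estimate.\<close>

lemma hw_commute:
  assumes f: "\<forall>\<^sub>F x in nhds x0. hw f (a x) (b x) x" and a: "hw a aa ab x0" and b: "hw b ba bb x0"
  shows "ab = ba"
proof -
  define D where "D x h = a x * h + b x * cnj h" for x h
  define B where "B h k = (aa * k + ab * cnj k) * h + (ba * k + bb * cnj k) * cnj h" for h k
  define \<Delta> where "\<Delta> h k = f (x0 + h + k) - f (x0 + h) - f (x0 + k) + f x0" for h k
  have key: "\<exists>d>0. \<forall>h k. cmod h < d \<longrightarrow> cmod k < d \<longrightarrow> cmod h = cmod k \<longrightarrow> cmod (\<Delta> h k - B h k) \<le> 6 * e * (cmod h)\<^sup>2"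
    if "e > 0" for e :: real
  proof -
    have alt: "\<exists>d>0. \<forall>p. cmod p < d \<longrightarrow> cmod (g (x0 + p) - g x0 - (u * p + v * cnj p)) \<le> e * cmod p"
      if g: "hw g u v x0" for g u v
    proof -
      obtain d where d: "d > 0" "\<And>y. cmod (y - x0) < d \<Longrightarrow> cmod (g y - g x0 - (u * (y - x0) + v * cnj (y - x0))) \<le> e * cmod (y - x0)"
        using has_derivative_at_alt[THEN iffD1, OF g[unfolded hw_def]] \<open>e > 0\<close> by blast
      show ?thesis using d(1) d(2)[of "x0 + p" for p] by (intro exI[of _ d]) simp
    qed
    obtain d1 where d1: "d1 > 0" "\<And>p. cmod p < d1 \<Longrightarrow> cmod (a (x0 + p) - a x0 - (aa * p + ab * cnj p)) \<le> e * cmod p"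
      using alt[OF a] by blast
    obtain d2 where d2: "d2 > 0" "\<And>p. cmod p < d2 \<Longrightarrow> cmod (b (x0 + p) - b x0 - (ba * p + bb * cnj p)) \<le> e * cmod p"
      using alt[OF b] by blast
    obtain d3 where d3: "d3 > 0" "\<And>x. dist x x0 < d3 \<Longrightarrow> hw f (a x) (b x) x"
      using f unfolding eventually_nhds_metric by blast
    define d where "d = min d1 (min d2 d3)"
    have err: "cmod (D (x0 + p) h - D x0 h - B h p) \<le> 2 * e * cmod p * cmod h" if "cmod p < d" for p h
    proof -
      have "D (x0 + p) h - D x0 h - B h p = (a (x0 + p) - a x0 - (aa * p + ab * cnj p)) * h +
          (b (x0 + p) - b x0 - (ba * p + bb * cnj p)) * cnj h"
        unfolding D_def B_def by (simp add: algebra_simps)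
      also have "cmod \<dots> \<le> (e * cmod p) * cmod h + (e * cmod p) * cmod h"
        by (rule norm_triangle_mono) (use d1(2)[of p] d2(2)[of p] that in \<open>auto simp: norm_mult d_def intro!: mult_right_mono\<close>)
      also have "\<dots> = 2 * e * cmod p * cmod h" by algebra
      finally show ?thesis .
    qed
    show ?thesis
    proof (intro exI[of _ "d / 2"] conjI allI impI)
      fix h k assume hk: "cmod h < d / 2" "cmod k < d / 2" "cmod h = cmod k"
      define g where "g s = f (x0 + of_real s * h + k) - f (x0 + of_real s * h) - of_real s * B h k" for s :: real
      have small: "cmod (of_real s * h + k) \<le> 2 * cmod h" "cmod (of_real s * h) \<le> cmod h" if "s \<in> {0..1}" for s :: real
      proof -
        show 1: "cmod (of_real s * h) \<le> cmod h" using that by (simp add: norm_mult mult_left_le_one_le)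
        show "cmod (of_real s * h + k) \<le> 2 * cmod h" using norm_triangle_ineq[of "of_real s * h" k] 1 hk by simp
      qed
      have "cmod (g 1 - g 0) \<le> 6 * e * (cmod h)\<^sup>2 * norm (1 - 0 :: real)"
      proof (rule differentiable_bound[where S = "{0..1}"])
        fix s :: real assume s: "s \<in> {0..1}"
        have fd: "(f has_derivative D (x0 + of_real s * h + q)) (at (x0 + of_real s * h + q))"
          if "cmod (of_real s * h + q) < d" for q
          using d3(2)[of "x0 + of_real s * h + q"] that unfolding hw_def D_def d_def dist_norm
          by (simp add: add.assoc)
        have lin: "((\<lambda>s. x0 + of_real s * h + q) has_derivative (\<lambda>r. of_real r * h)) (at s within {0..1})" for q
          by (auto intro!: derivative_eq_intros)
        have comp: "((\<lambda>s. f (x0 + of_real s * h + q)) has_derivative (\<lambda>r. D (x0 + of_real s * h + q) (of_real r * h))) (at s within {0..1})"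
          if "cmod (of_real s * h + q) < d" for q
          using has_derivative_compose[OF lin fd[OF that]] .
        have sm: "cmod (of_real s * h + k) < d" "cmod (of_real s * h) < d" using small[OF s] hk(1) norm_ge_zero[of h] by linarith+
        show "(g has_derivative (\<lambda>r. D (x0 + of_real s * h + k) (of_real r * h) - D (x0 + of_real s * h) (of_real r * h) - of_real r * B h k)) (at s within {0..1})"
          unfolding g_def using comp[OF sm(1)] comp[of 0] sm(2)
          by (auto intro!: derivative_eq_intros)
        have lin': "D (x0 + of_real s * h + k) (of_real r * h) - D (x0 + of_real s * h) (of_real r * h) - of_real r * B h k =
           of_real r * ((D (x0 + (of_real s * h + k)) h - D x0 h - B h (of_real s * h + k)) -
             (D (x0 + of_real s * h) h - D x0 h - B h (of_real s * h)))" for r :: real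
          unfolding D_def B_def by (simp add: algebra_simps)
        have "cmod ((D (x0 + (of_real s * h + k)) h - D x0 h - B h (of_real s * h + k)) -
             (D (x0 + of_real s * h) h - D x0 h - B h (of_real s * h))) \<le>
             2 * e * cmod (of_real s * h + k) * cmod h + 2 * e * cmod (of_real s * h) * cmod h"
          by (rule norm_triangle_le_diff) (intro add_mono err sm)
        also have "\<dots> \<le> 2 * e * (2 * cmod h) * cmod h + 2 * e * cmod h * cmod h"
          using small[OF s] \<open>e > 0\<close> by (intro add_mono mult_right_mono mult_left_mono) auto
        finally have bd: "cmod ((D (x0 + (of_real s * h + k)) h - D x0 h - B h (of_real s * h + k)) -
             (D (x0 + of_real s * h) h - D x0 h - B h (of_real s * h))) \<le> 6 * e * (cmod h)\<^sup>2"
          by (simp add: power2_eq_square)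
        show "onorm (\<lambda>r. D (x0 + of_real s * h + k) (of_real r * h) - D (x0 + of_real s * h) (of_real r * h) - of_real r * B h k) \<le> 6 * e * (cmod h)\<^sup>2"
        proof (rule onorm_le)
          fix r :: real
          show "cmod (D (x0 + of_real s * h + k) (of_real r * h) - D (x0 + of_real s * h) (of_real r * h) - of_real r * B h k) \<le> 6 * e * (cmod h)\<^sup>2 * norm r"
            unfolding lin' norm_mult norm_of_real using mult_left_mono[OF bd abs_ge_zero[of r]] by (simp add: mult.commute)
        qed
      qed auto
      also have "g 1 - g 0 = \<Delta> h k - B h k" unfolding g_def \<Delta>_def by simp
      finally show "cmod (\<Delta> h k - B h k) \<le> 6 * e * (cmod h)\<^sup>2" by simp
    qed (use d1 d2 d3 in \<open>auto simp: d_def\<close>)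
  qed
  have "cmod (ab - ba) \<le> 6 * e" if e: "e > 0" for e :: real
  proof -
    obtain d where d: "d > 0" "\<forall>h k. cmod h < d \<longrightarrow> cmod k < d \<longrightarrow> cmod h = cmod k \<longrightarrow> cmod (\<Delta> h k - B h k) \<le> 6 * e * (cmod h)\<^sup>2"
      using key[OF e] by (elim exE conjE)
    define r where "r = d / 2"
    have r: "r > 0" "r < d" using d by (auto simp: r_def)
    \<comment> \<open>A real and an imaginary increment of equal length; for these,
      \<open>B ?h ?k - B ?k ?h\<close> isolates ab - ba.\<close>
    let ?h = "of_real r :: complex" and ?k = "\<i> * of_real r"
    have 1: "cmod (\<Delta> ?h ?k - B ?h ?k) \<le> 6 * e * r\<^sup>2" using d(2)[rule_format, of ?h ?k] r by (simp add: norm_mult)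
    have 2: "cmod (\<Delta> ?k ?h - B ?k ?h) \<le> 6 * e * r\<^sup>2" using d(2)[rule_format, of ?k ?h] r by (simp add: norm_mult)
    have "\<Delta> ?h ?k = \<Delta> ?k ?h" unfolding \<Delta>_def by (simp add: algebra_simps)
    then have "cmod (B ?h ?k - B ?k ?h) \<le> 12 * e * r\<^sup>2"
      using norm_triangle_le_diff[OF add_mono[OF 2 1]] by (simp add: algebra_simps)
    moreover have "B ?h ?k - B ?k ?h = - 2 * \<i> * of_real (r\<^sup>2) * (ab - ba)"
      unfolding B_def by (simp add: algebra_simps power2_eq_square)
    ultimately have "2 * r\<^sup>2 * cmod (ab - ba) \<le> 12 * e * r\<^sup>2" by (simp add: norm_mult norm_power)
    then have "(2 * r\<^sup>2) * cmod (ab - ba) \<le> (2 * r\<^sup>2) * (6 * e)" by (simp add: mult_ac)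
    then show ?thesis using r by (simp add: mult_le_cancel_left_pos)
  qed
  from this[of "e / 6" for e] have "cmod (ab - ba) \<le> 0 + e" if "e > 0" for e :: real using that by simp
  then have "cmod (ab - ba) \<le> 0" by (rule field_le_epsilon)
  then show ?thesis by simp
qed

text \<open>The operations p and q act on symbols and need not commute there. By
  \<open>hw_commute\<close> their values commute, which suffices to move q past powers of p.\<close>

lemma jfam_ops:
  assumes S: "open S" and v: "\<And>T \<zeta>. \<zeta> \<in> S \<Longrightarrow> hw (v T) (v (p T) \<zeta>) (v (q T) \<zeta>) \<zeta>"
  shows "jfam S (\<lambda>j k. v ((p ^^ j) ((q ^^ k) T)))"
proof -
  have comm: "v (q (p T)) \<zeta> = v (p (q T)) \<zeta>" if "\<zeta> \<in> S" for T \<zeta>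
  proof (rule hw_commute)
    show "\<forall>\<^sub>F x in nhds \<zeta>. hw (v T) (v (p T) x) (v (q T) x) x"
      using eventually_nhds_in_open[OF S that] by eventually_elim (rule v)
  qed (use v[OF that] in auto)
  have cong: "v (p T) \<zeta> = v (p T') \<zeta>" if "\<zeta> \<in> S" "\<And>\<zeta>. \<zeta> \<in> S \<Longrightarrow> v T \<zeta> = v T' \<zeta>" for T T' \<zeta>
  proof -
    have "\<forall>\<^sub>F x in nhds \<zeta>. v T x = v T' x" using eventually_nhds_in_open[OF S that(1)] by eventually_elim (rule that(2))
    from hw_cong[OF v[OF that(1)] this] show ?thesis using hw_unique v[OF that(1)] by blast
  qed
  have "v (q ((p ^^ j) T)) \<zeta> = v ((p ^^ j) (q T)) \<zeta>" if "\<zeta> \<in> S" for j T \<zeta>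
    using that
  proof (induction j arbitrary: \<zeta>)
    case (Suc j)
    have "v (q ((p ^^ Suc j) T)) \<zeta> = v (p (q ((p ^^ j) T))) \<zeta>" using comm[OF Suc.prems] by simp
    also have "\<dots> = v (p ((p ^^ j) (q T))) \<zeta>" by (rule cong[OF Suc.prems Suc.IH])
    finally show ?case by simp
  qed simp
  then show ?thesis unfolding jfam_def using v by (auto simp: funpow_swap1[symmetric]) (metis funpow.simps(2) o_apply)
qed

lemma gm_hw:
  fixes Q :: "complex \<Rightarrow> 'i \<Rightarrow> 'i \<Rightarrow> complex"
  assumes Q: "\<And>x y. hw (\<lambda>\<zeta>. Q \<zeta> x y) (opt (\<lambda>x'. Q \<zeta> x' y) (\<sigma> x) + opt (\<lambda>y'. Q \<zeta> x y') (\<sigma> y))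
      (opt (\<lambda>x'. Q \<zeta> x' y) (\<tau> x) + opt (\<lambda>y'. Q \<zeta> x y') (\<tau> y)) \<zeta>"
    and m: "\<And>x. hw (\<lambda>\<zeta>. m \<zeta> x) (opt (m \<zeta>) (\<sigma> x)) (opt (m \<zeta>) (\<tau> x)) \<zeta>"
    and sym: "\<And>\<zeta> x y. Q \<zeta> x y = Q \<zeta> y x"
  shows "hw (\<lambda>\<zeta>. gm (Q \<zeta>) (m \<zeta>) \<gamma> xs)
     (lin \<gamma> (\<lambda>x. opt (\<lambda>x'. gm (Q \<zeta>) (m \<zeta>) \<gamma> (x' # xs)) (\<sigma> x)) + (\<Sum>ys\<leftarrow>shifts \<sigma> xs. gm (Q \<zeta>) (m \<zeta>) \<gamma> ys))
     (lin \<gamma> (\<lambda>x. opt (\<lambda>x'. gm (Q \<zeta>) (m \<zeta>) \<gamma> (x' # xs)) (\<tau> x)) + (\<Sum>ys\<leftarrow>shifts \<tau> xs. gm (Q \<zeta>) (m \<zeta>) \<gamma> ys)) \<zeta>"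
proof -
  let ?q = "\<lambda>\<sigma> x y. opt (\<lambda>x'. Q \<zeta> x' y) (\<sigma> x) + opt (\<lambda>y'. Q \<zeta> x y') (\<sigma> y)"
  let ?u = "\<lambda>\<sigma> x. opt (m \<zeta>) (\<sigma> x)"
  let ?c = "\<lambda>\<sigma>. conv (dg (?q \<sigma>) (?u \<sigma>)) (gm (Q \<zeta>) (m \<zeta>)) \<gamma> xs"
  have "((\<lambda>\<zeta>. gm (Q \<zeta>) (m \<zeta>) \<gamma> xs) has_derivative
    (\<lambda>h. conv (dg (\<lambda>x y. ?q \<sigma> x y * h + ?q \<tau> x y * cnj h) (\<lambda>x. ?u \<sigma> x * h + ?u \<tau> x * cnj h)) (gm (Q \<zeta>) (m \<zeta>)) \<gamma> xs)) (at \<zeta>)"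
    by (rule gm_has_derivative[where S = UNIV]) (use Q m sym in \<open>auto simp: hw_def\<close>)
  also have "(\<lambda>h. conv (dg (\<lambda>x y. ?q \<sigma> x y * h + ?q \<tau> x y * cnj h) (\<lambda>x. ?u \<sigma> x * h + ?u \<tau> x * cnj h)) (gm (Q \<zeta>) (m \<zeta>)) \<gamma> xs) =
     (\<lambda>h. ?c \<sigma> * h + ?c \<tau> * cnj h)"
  proof
    fix h
    have "dg (\<lambda>x y. ?q \<sigma> x y * h + ?q \<tau> x y * cnj h) (\<lambda>x. ?u \<sigma> x * h + ?u \<tau> x * cnj h) \<gamma> a =
       h * dg (?q \<sigma>) (?u \<sigma>) \<gamma> a + cnj h * dg (?q \<tau>) (?u \<tau>) \<gamma> a" for a
      unfolding dg_add[symmetric] dg_scale[symmetric] by (simp only: mult.commute)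
    then show "conv (dg (\<lambda>x y. ?q \<sigma> x y * h + ?q \<tau> x y * cnj h) (\<lambda>x. ?u \<sigma> x * h + ?u \<tau> x * cnj h)) (gm (Q \<zeta>) (m \<zeta>)) \<gamma> xs =
      ?c \<sigma> * h + ?c \<tau> * cnj h"
      unfolding conv_def by (simp add: sum_list_addf[symmetric] sum_list_const_mult[symmetric] mult.commute[of _ h]
        mult.commute[of _ "cnj h"] case_prod_unfold distrib_right mult.assoc)
  qed
  finally show ?thesis unfolding hw_def conv_dg_shift[OF sym] .
qed

section \<open>Linear combinations of moments and their derivatives\<close>

definition lsum where
  "lsum T \<Phi> = (\<Sum>(c, xs)\<leftarrow>T. c * \<Phi> xs :: complex)"

text \<open>Differentiates moments whose exponential has weight \<open>\<alpha>\<close> at one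
  moving label with shift p: the exponential contributes \<open>\<alpha>\<close> times the new
  factor p, the list its shifted entries.\<close>

definition dterms :: "complex \<Rightarrow> 'i \<Rightarrow> ('i \<Rightarrow> 'i option) \<Rightarrow> (complex \<times> 'i list) list \<Rightarrow> (complex \<times> 'i list) list" where
  "dterms \<alpha> p \<sigma> T = concat (map (\<lambda>(c, xs). (c * \<alpha>, p # xs) # map (Pair c) (shifts \<sigma> xs)) T)"

lemma lsum_simps [simp]: "lsum [] \<Phi> = 0" "lsum ((c, xs) # T) \<Phi> = c * \<Phi> xs + lsum T \<Phi>" "lsum (T @ T') \<Phi> = lsum T \<Phi> + lsum T' \<Phi>"
  by (simp_all add: lsum_def)

lemma lsum_map: "lsum (map (Pair c) L) \<Phi> = c * (\<Sum>ys\<leftarrow>L. \<Phi> ys)"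
  by (simp add: lsum_def o_def sum_list_const_mult)

lemma lsum_hw:
  fixes Q :: "complex \<Rightarrow> 'i \<Rightarrow> 'i \<Rightarrow> complex"
  assumes Q: "\<And>x y. hw (\<lambda>\<zeta>. Q \<zeta> x y) (opt (\<lambda>x'. Q \<zeta> x' y) (\<sigma> x) + opt (\<lambda>y'. Q \<zeta> x y') (\<sigma> y))
      (opt (\<lambda>x'. Q \<zeta> x' y) (\<tau> x) + opt (\<lambda>y'. Q \<zeta> x y') (\<tau> y)) \<zeta>"
    and m: "\<And>x. hw (\<lambda>\<zeta>. m \<zeta> x) (opt (m \<zeta>) (\<sigma> x)) (opt (m \<zeta>) (\<tau> x)) \<zeta>"
    and sym: "\<And>\<zeta> x y. Q \<zeta> x y = Q \<zeta> y x"
    and p: "\<And>f. lin \<gamma> (\<lambda>x. opt f (\<sigma> x)) = \<alpha> * f p" "\<And>f. lin \<gamma> (\<lambda>x. opt f (\<tau> x)) = \<alpha> * f q"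
  shows "hw (\<lambda>\<zeta>. lsum T (gm (Q \<zeta>) (m \<zeta>) \<gamma>)) (lsum (dterms \<alpha> p \<sigma> T) (gm (Q \<zeta>) (m \<zeta>) \<gamma>))
    (lsum (dterms \<alpha> q \<tau> T) (gm (Q \<zeta>) (m \<zeta>) \<gamma>)) \<zeta>"
proof -
  have *: "lsum (dterms \<alpha> p \<sigma> T) \<Phi> = (\<Sum>(c, xs)\<leftarrow>T. c * (\<alpha> * \<Phi> (p # xs) + (\<Sum>ys\<leftarrow>shifts \<sigma> xs. \<Phi> ys)))" for \<Phi> p \<sigma>
    by (induction T) (auto simp: dterms_def lsum_map algebra_simps)
  show ?thesis
    unfolding * unfolding lsum_def case_prod_unfold
    using gm_hw[OF Q m sym, of \<gamma>] unfolding p by (intro hw_sum_list hw_scale)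
qed

section \<open>Fields of the OPE family in canonical form\<close>

definition Rj :: "real \<Rightarrow> real \<Rightarrow> complex \<Rightarrow> nat \<times> nat \<Rightarrow> nat \<times> nat \<Rightarrow> complex" where
  "Rj \<xi> t \<zeta> a b = 2 * ej \<xi> er a b (t, \<zeta>, \<zeta>)"

text \<open>The mean -2 b arg of the derivative of the chart; the last coordinate 0 is a dummy, as
  \<open>emu\<close> contains only the first point.\<close>

definition Mj :: "real \<Rightarrow> real \<Rightarrow> real \<Rightarrow> complex \<Rightarrow> nat \<times> nat \<Rightarrow> complex" where
  "Mj \<xi> b t \<zeta> a = - 2 * of_real b * ej \<xi> emu a (0, 0) (t, \<zeta>, 0)"

definition src :: "chart \<Rightarrow> (gvar \<Rightarrow>\<^sub>0 complex) \<Rightarrow> complex \<Rightarrow> nat \<times> nat \<Rightarrow> complex" where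
  "src c \<delta> \<zeta> a = lin \<delta> (pair_exp (cjet c \<zeta> a))"

definition source :: "(gvar \<Rightarrow>\<^sub>0 complex) \<Rightarrow> bool" where
  "source \<delta> \<longleftrightarrow> (\<forall>g\<in>Poly_Mapping.keys \<delta>. \<exists>y\<in>\<H>. g = Jet id 0 0 y)"

definition sdom :: "chart \<Rightarrow> (gvar \<Rightarrow>\<^sub>0 complex) \<Rightarrow> complex set" where
  "sdom c \<delta> = {\<zeta>\<in>chart_dom c. Jet id 0 0 (chart_par c \<zeta>) \<notin> Poly_Mapping.keys \<delta>}"

text \<open>One list T for all t, charts and points. This uniformity allows the Lie derivative to be
  taken with the coefficients held fixed.\<close>

definition good :: "real \<Rightarrow> (complex \<Rightarrow> complex) \<Rightarrow> real \<Rightarrow> field \<Rightarrow> terms \<Rightarrow> bool" where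
  "good \<xi> w b F T \<longleftrightarrow> (\<forall>t c \<zeta>. flow_chart \<xi> w t c \<longrightarrow> \<zeta> \<in> chart_dom c \<longrightarrow>
     represents (Rj \<xi> t \<zeta>) (Mj \<xi> b t \<zeta>) (F c \<zeta>) T)"

lemma field_at_eq: "field_at F c \<zeta> = field_functional (cjet c \<zeta>) (Jet id 0 0 (chart_par c \<zeta>)) (F c \<zeta>)"
  unfolding field_at_def field_functional_def cjet_def ..

lemma sdom_open:
  assumes c: "flow_chart \<xi> w t c"
  shows "open (sdom c \<delta>)"
proof -
  define Z where "Z = {\<zeta> \<in> chart_dom c. Jet id 0 0 (chart_par c \<zeta>) \<in> Poly_Mapping.keys \<delta>}"
  have "inj_on (\<lambda>\<zeta>. Jet id 0 0 (chart_par c \<zeta>)) Z"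
    using c_par_inj[OF c] by (auto simp: Z_def inj_on_def)
  then have "finite Z" by (rule finite_imageD[rotated]) (rule finite_subset[of _ "Poly_Mapping.keys \<delta>"], auto simp: Z_def)
  moreover have "sdom c \<delta> = chart_dom c - Z" by (auto simp: sdom_def Z_def)
  ultimately show ?thesis using c_open[OF c] by (simp add: open_Diff finite_imp_closed)
qed

lemma functional_on_source:
  "functional_on (\<H> - {chart_par c \<zeta>}) (Poly_Mapping.single ({#}, \<delta>) 1) \<longleftrightarrow>
     source \<delta> \<and> Jet id 0 0 (chart_par c \<zeta>) \<notin> Poly_Mapping.keys \<delta>"
  unfolding functional_on_def source_def by auto

lemma source_cases:
  assumes "source \<delta>" "\<zeta> \<in> sdom c \<delta>" "g \<in> Poly_Mapping.keys \<delta>"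
  obtains y where "g = Jet id 0 0 y" "Im y > 0" "y \<noteq> chart_par c \<zeta>"
  using assms unfolding source_def sdom_def upper_half_plane_def by force

lemma src_adm:
  assumes "flow_chart \<xi> w t c" "source \<delta>" "\<zeta> \<in> sdom c \<delta>"
  shows "adm (src c \<delta> \<zeta>)"
proof -
  have "adm (\<lambda>a. lin \<delta> (\<lambda>g. pair_exp (cjet c \<zeta> a) g))"
  proof (rule adm_lin)
    fix g assume "g \<in> Poly_Mapping.keys \<delta>"
    then obtain y where y: "g = Jet id 0 0 y" "Im y > 0" "y \<noteq> chart_par c \<zeta>" using assms source_cases by blast
    have "\<zeta> \<in> chart_dom c" using assms(3) by (simp add: sdom_def)
    then show "adm (\<lambda>a. pair_exp (cjet c \<zeta> a) g)" unfolding y(1) using adm_source[OF assms(1)] y by blast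
  qed
  then show ?thesis unfolding src_def[abs_def] .
qed

lemma src_hw:
  assumes c: "flow_chart \<xi> w t c" and d: "source \<delta>" "\<zeta> \<in> sdom c \<delta>"
  shows "hw (\<lambda>\<zeta>. src c \<delta> \<zeta> (j, k)) (src c \<delta> \<zeta> (Suc j, k)) (src c \<delta> \<zeta> (j, Suc k)) \<zeta>"
  unfolding src_def
proof (rule hw_lin)
  fix g assume g: "g \<in> Poly_Mapping.keys \<delta>"
  then obtain y where y: "g = Jet id 0 0 y" "Im y > 0" "y \<noteq> chart_par c \<zeta>" using d source_cases by blast
  have \<zeta>: "\<zeta> \<in> chart_dom c" using d by (simp add: sdom_def)
  have val: "valid \<xi> esrc (t, \<zeta>, y)" by (rule valid_esrc) (use c_fdom[OF c \<zeta>] y c_par[OF c \<zeta>] in auto)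
  have "\<forall>\<^sub>F x in nhds \<zeta>. x \<in> sdom c \<delta>" by (rule eventually_nhds_in_open[OF sdom_open[OF c] d(2)])
  then have ev: "\<forall>\<^sub>F x in nhds \<zeta>. 2 * ej \<xi> esrc a (0, 0) (t, x, y) = pair_exp (cjet c x a) g" for a
  proof eventually_elim
    case (elim x)
    then have "y \<noteq> chart_par c x" "x \<in> chart_dom c" using g y by (auto simp: sdom_def)
    then show ?case unfolding y(1) using pair_exp_source[OF c] y by simp
  qed
  note this[THEN eventually_nhds_x_imp_x]
  then show "hw (\<lambda>\<zeta>. pair_exp (cjet c \<zeta> (j, k)) g) (pair_exp (cjet c \<zeta> (Suc j, k)) g) (pair_exp (cjet c \<zeta> (j, Suc k)) g) \<zeta>"
    using hw_cong[OF hw_scale[OF ej_hw_x[OF val, of j k "(0, 0)"], of 2] ev] by simp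
qed

lemma evf_cong:
  assumes "\<And>q a. q \<in> Poly_Mapping.keys x \<Longrightarrow> a \<in># fst q \<Longrightarrow> m a = m' a" "m (0, 0) = m' (0, 0)"
  shows "evf m x = evf m' x"
  unfolding evf_def
proof (rule lin_cong)
  fix q assume "q \<in> Poly_Mapping.keys x"
  then have "image_mset m (fst q) = image_mset m' (fst q)" using assms(1) by (intro image_mset_cong) auto
  then show "prod_mset (image_mset m (fst q)) * exp (snd q * m (0, 0)) = prod_mset (image_mset m' (fst q)) * exp (snd q * m' (0, 0))"
    using assms(2) by simp
qed

lemma tsum_gm_cong:
  assumes "\<And>c ys \<alpha> a. (c, ys, \<alpha>) \<in> set T \<Longrightarrow> a \<in> set ys \<Longrightarrow> m a = m' a" "m (0, 0) = m' (0, 0)"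
  shows "tsum T (gm R m) = tsum T (gm R m')"
  unfolding tsum_def
proof (intro arg_cong[where f = sum_list] map_cong refl, safe)
  fix c ys \<alpha> assume T: "(c, ys, \<alpha>) \<in> set T"
  have "gm R m (Poly_Mapping.single (0, 0) \<alpha>) ys = gm R m' (Poly_Mapping.single (0, 0) \<alpha>) ys"
  proof (rule gm_cong)
    fix x assume "x \<in> set ys \<union> Poly_Mapping.keys (Poly_Mapping.single (0 :: nat, 0 :: nat) \<alpha>)"
    then consider "x \<in> set ys" | "x = (0, 0)" by (auto split: if_splits)
    then show "m x = m' x" using assms(1)[OF T, of x] assms(2) by cases auto
  qed auto
  then show "c * gm R m (Poly_Mapping.single (0, 0) \<alpha>) ys = c * gm R m' (Poly_Mapping.single (0, 0) \<alpha>) ys" by simp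
qed

lemma expect_field:
  "expect (field_at F c \<zeta> \<star> Poly_Mapping.single ({#}, \<delta>) 1) = evf (src c \<delta> \<zeta>) (F c \<zeta>)"
proof -
  have "expect (field_at F c \<zeta> \<star> Poly_Mapping.single ({#}, \<delta>) 1) = evf (\<lambda>a. lin \<delta> (pair_exp (cjet c \<zeta> a))) (F c \<zeta>)"
    unfolding expect_exp_right field_at_eq
    by (rule ev_field_functional) (simp add: pair_exp_node cong: lin_cong)
  then show ?thesis by (simp add: src_def[abs_def])
qed

lemma expect_good:
  assumes "good \<xi> w b F T" "flow_chart \<xi> w t c" "source \<delta>" "\<zeta> \<in> sdom c \<delta>"
  shows "expect (field_at F c \<zeta> \<star> Poly_Mapping.single ({#}, \<delta>) 1) = tsum T (gm (Rj \<xi> t \<zeta>) (\<lambda>a. src c \<delta> \<zeta> a + Mj \<xi> b t \<zeta> a))"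
proof -
  have "\<zeta> \<in> chart_dom c" using assms(4) by (simp add: sdom_def)
  then have "represents (Rj \<xi> t \<zeta>) (Mj \<xi> b t \<zeta>) (F c \<zeta>) T" using assms(1,2) by (simp add: good_def)
  then show ?thesis unfolding expect_field represents_def using src_adm[OF assms(2-4)] by blast
qed

text \<open>Exponentials of sources are enough as test functionals: \<open>matching\<close> realizes
  any admissible mean on the finitely many jets that occur in F and T, and mixed jets vanish on both
  sides.\<close>

lemma goodI:
  assumes "\<And>t c \<zeta> \<delta>. flow_chart \<xi> w t c \<Longrightarrow> source \<delta> \<Longrightarrow> \<zeta> \<in> sdom c \<delta> \<Longrightarrow>
    expect (field_at F c \<zeta> \<star> Poly_Mapping.single ({#}, \<delta>) 1) = tsum T (gm (Rj \<xi> t \<zeta>) (\<lambda>a. src c \<delta> \<zeta> a + Mj \<xi> b t \<zeta> a))"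
  shows "good \<xi> w b F T"
  unfolding good_def represents_def
proof (intro allI impI)
  fix t c \<zeta> m assume c: "flow_chart \<xi> w t c" and \<zeta>: "\<zeta> \<in> chart_dom c" and m: "adm m"
  define A0 where "A0 = insert (0, 0) ((\<Union>q\<in>Poly_Mapping.keys (F c \<zeta>). set_mset (fst q)) \<union> (\<Union>(c, ys, \<alpha>)\<in>set T. set ys))"
  define A where "A = {a \<in> A0. fst a = 0 \<or> snd a = 0}"
  have "finite A0" by (auto simp: A0_def)
  then have "finite A" by (simp add: A_def)
  then have "\<exists>\<delta>. (\<forall>g\<in>Poly_Mapping.keys \<delta>. \<exists>y \<in> \<H> - chart_par c ` {\<zeta>}. g = Jet id 0 0 y) \<and>
    (\<forall>\<zeta>\<in>{\<zeta>}. \<forall>a\<in>A. lin \<delta> (pair_exp (cjet c \<zeta> a)) = m a)"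
    by (intro matching[OF c]) (use \<zeta> in \<open>auto simp: A_def\<close>)
  then obtain \<delta> where \<delta>: "\<forall>g\<in>Poly_Mapping.keys \<delta>. \<exists>y \<in> \<H> - chart_par c ` {\<zeta>}. g = Jet id 0 0 y"
    "\<And>a. a \<in> A \<Longrightarrow> src c \<delta> \<zeta> a = m a"
    unfolding src_def by blast
  have s: "source \<delta>" "\<zeta> \<in> sdom c \<delta>" using \<delta>(1) \<zeta> unfolding source_def sdom_def by auto
  have eq: "src c \<delta> \<zeta> a = m a" if "a \<in> A0" for a
  proof (cases "a \<in> A")
    case False
    obtain j k where jk: "a = (j, k)" by fastforce
    then have "j \<noteq> 0" "k \<noteq> 0" using False that by (auto simp: A_def)
    then have "a = (Suc (j - 1), Suc (k - 1))" using jk by simp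
    then show ?thesis using m src_adm[OF c s] by (simp add: adm_def)
  qed (rule \<delta>(2))
  have A0: "q \<in> Poly_Mapping.keys (F c \<zeta>) \<Longrightarrow> a \<in># fst q \<Longrightarrow> a \<in> A0" "(d, ys, \<alpha>) \<in> set T \<Longrightarrow> a \<in> set ys \<Longrightarrow> a \<in> A0"
    "(0, 0) \<in> A0" for q a d ys \<alpha>
    unfolding A0_def by (blast, fastforce, blast)
  have "evf m (F c \<zeta>) = evf (src c \<delta> \<zeta>) (F c \<zeta>)"
    by (rule evf_cong) (rule eq[symmetric], erule (1) A0(1), rule eq[symmetric], rule A0(3))
  also have "\<dots> = tsum T (gm (Rj \<xi> t \<zeta>) (\<lambda>a. src c \<delta> \<zeta> a + Mj \<xi> b t \<zeta> a))"
    using assms[OF c s] unfolding expect_field .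
  also have "\<dots> = tsum T (gm (Rj \<xi> t \<zeta>) (\<lambda>a. m a + Mj \<xi> b t \<zeta> a))"
    by (rule tsum_gm_cong) (simp only: add_right_cancel, rule eq, erule (1) A0(2), simp only: add_right_cancel, rule eq, rule A0(3))
  finally show "evf m (F c \<zeta>) = tsum T (gm (Rj \<xi> t \<zeta>) (\<lambda>a. m a + Mj \<xi> b t \<zeta> a))" .
qed

section \<open>Derivatives and linear combinations of canonical fields\<close>

fun up_z :: "nat \<times> nat \<Rightarrow> nat \<times> nat" where "up_z (j, k) = (Suc j, k)"
fun up_zbar :: "nat \<times> nat \<Rightarrow> nat \<times> nat" where "up_zbar (j, k) = (j, Suc k)"

lemma Rj_hw:
  assumes "\<zeta> \<in> fdom \<xi> t"
  shows "hw (\<lambda>\<zeta>. Rj \<xi> t \<zeta> x y) (Rj \<xi> t \<zeta> (up_z x) y + Rj \<xi> t \<zeta> x (up_z y)) (Rj \<xi> t \<zeta> (up_zbar x) y + Rj \<xi> t \<zeta> x (up_zbar y)) \<zeta>"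
  using hw_scale[OF ej_hw_diag[OF valid_er[OF assms assms], of "fst x" "snd x" "fst y" "snd y"], of 2]
  by (cases x; cases y) (simp add: Rj_def distrib_left)

lemma Mj_hw:
  assumes "\<zeta> \<in> fdom \<xi> t"
  shows "hw (\<lambda>\<zeta>. Mj \<xi> b t \<zeta> x) (Mj \<xi> b t \<zeta> (up_z x)) (Mj \<xi> b t \<zeta> (up_zbar x)) \<zeta>"
  using hw_scale[OF ej_hw_x[OF valid_emu[OF assms], of "fst x" "snd x" "(0, 0)" 0], of "- 2 * of_real b"]
  by (cases x) (simp add: Mj_def)

lemma Rj_sym: "\<zeta> \<in> fdom \<xi> t \<Longrightarrow> Rj \<xi> t \<zeta> a b = Rj \<xi> t \<zeta> b a"
  by (simp add: Rj_def er_symmetric)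

definition tder where
  "tder p \<sigma> T = concat (map (\<lambda>(c, ys, \<alpha>). map (\<lambda>(c', ys'). (c', ys', \<alpha>)) (dterms \<alpha> p \<sigma> [(c, ys)])) T)"

lemma tsum_lsum: "tsum T \<Phi> = (\<Sum>(c, ys, \<alpha>)\<leftarrow>T. lsum [(c, ys)] (\<Phi> (Poly_Mapping.single (0, 0) \<alpha>)))"
  by (simp add: tsum_def)

lemma tsum_tder: "tsum (tder p \<sigma> T) \<Phi> = (\<Sum>(c, ys, \<alpha>)\<leftarrow>T. lsum (dterms \<alpha> p \<sigma> [(c, ys)]) (\<Phi> (Poly_Mapping.single (0, 0) \<alpha>)))"
proof -
  have 1: "tsum (A @ B) \<Phi> = tsum A \<Phi> + tsum B \<Phi>" for A B by (simp add: tsum_def)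
  have 2: "tsum (map (\<lambda>(c', ys'). (c', ys', \<alpha>)) L) \<Phi> = lsum L (\<Phi> (Poly_Mapping.single (0, 0) \<alpha>))" for L \<alpha>
    by (simp add: tsum_def lsum_def o_def case_prod_unfold)
  show ?thesis
    unfolding tder_def
    by (induction T) (auto simp: 1 2 simp: tsum_def[of "[]"])
qed

lemma tsum_hw:
  fixes T :: terms
  assumes S: "open S" "\<zeta> \<in> S" and c: "flow_chart \<xi> w t c" and \<delta>: "source \<delta>" "S \<subseteq> sdom c \<delta>"
  shows "hw (\<lambda>\<zeta>. tsum T (gm (Rj \<xi> t \<zeta>) (\<lambda>a. src c \<delta> \<zeta> a + Mj \<xi> b t \<zeta> a)))
     (tsum (tder (1, 0) (Some \<circ> up_z) T) (gm (Rj \<xi> t \<zeta>) (\<lambda>a. src c \<delta> \<zeta> a + Mj \<xi> b t \<zeta> a)))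
     (tsum (tder (0, 1) (Some \<circ> up_zbar) T) (gm (Rj \<xi> t \<zeta>) (\<lambda>a. src c \<delta> \<zeta> a + Mj \<xi> b t \<zeta> a))) \<zeta>"
proof -
  let ?m = "\<lambda>\<zeta> a. src c \<delta> \<zeta> a + Mj \<xi> b t \<zeta> a"
  \<comment> \<open>Cut off outside S, since \<open>lsum_hw\<close> asks for a covariance symmetric
    at every parameter, and \<open>Rj\<close> is known to be so only inside the domain of the
    flow.\<close>
  define R where "R \<zeta> x y = (if \<zeta> \<in> S then Rj \<xi> t \<zeta> x y else 0)" for \<zeta> x y
  have dom: "x \<in> fdom \<xi> t" if "x \<in> S" for x using that \<delta> c_fdom[OF c] by (auto simp: sdom_def)
  have R: "R \<zeta> = Rj \<xi> t \<zeta>" if "\<zeta> \<in> S" for \<zeta> using that by (simp add: R_def fun_eq_iff)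
  have evS: "\<forall>\<^sub>F x in nhds \<zeta>. x \<in> S" by (rule eventually_nhds_in_open[OF S])
  have main: "hw (\<lambda>\<zeta>. lsum L (gm (R \<zeta>) (?m \<zeta>) (Poly_Mapping.single (0, 0) \<alpha>)))
     (lsum (dterms \<alpha> (1, 0) (Some \<circ> up_z) L) (gm (R \<zeta>) (?m \<zeta>) (Poly_Mapping.single (0, 0) \<alpha>)))
     (lsum (dterms \<alpha> (0, 1) (Some \<circ> up_zbar) L) (gm (R \<zeta>) (?m \<zeta>) (Poly_Mapping.single (0, 0) \<alpha>))) \<zeta>" for L \<alpha>
  proof (rule lsum_hw)
    fix x y
    have "\<forall>\<^sub>F \<zeta>' in nhds \<zeta>. Rj \<xi> t \<zeta>' x y = R \<zeta>' x y" using evS by eventually_elim (simp add: R)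
    from hw_cong[OF Rj_hw[OF dom[OF S(2)], of x y] this]
    show "hw (\<lambda>\<zeta>. R \<zeta> x y) (opt (\<lambda>x'. R \<zeta> x' y) ((Some \<circ> up_z) x) + opt (R \<zeta> x) ((Some \<circ> up_z) y))
       (opt (\<lambda>x'. R \<zeta> x' y) ((Some \<circ> up_zbar) x) + opt (R \<zeta> x) ((Some \<circ> up_zbar) y)) \<zeta>"
      by (simp add: R[OF S(2)])
  next
    fix x
    have "\<zeta> \<in> sdom c \<delta>" using S \<delta> by blast
    from hw_add[OF src_hw[OF c \<delta>(1) this, of "fst x" "snd x"] Mj_hw[OF dom[OF S(2)], of b x]]
    show "hw (\<lambda>\<zeta>. src c \<delta> \<zeta> x + Mj \<xi> b t \<zeta> x) (opt (?m \<zeta>) ((Some \<circ> up_z) x)) (opt (?m \<zeta>) ((Some \<circ> up_zbar) x)) \<zeta>"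
      by (cases x) simp
  next
    show "R \<zeta> x y = R \<zeta> y x" for \<zeta> x y using Rj_sym[OF dom, of \<zeta> x y] by (simp add: R_def)
  qed (simp_all add: One_nat_def)
  have "hw (\<lambda>\<zeta>. tsum T (gm (R \<zeta>) (?m \<zeta>))) (tsum (tder (1, 0) (Some \<circ> up_z) T) (gm (R \<zeta>) (?m \<zeta>)))
     (tsum (tder (0, 1) (Some \<circ> up_zbar) T) (gm (R \<zeta>) (?m \<zeta>))) \<zeta>"
    unfolding tsum_tder tsum_lsum[of T] case_prod_unfold by (intro hw_sum_list main)
  moreover have "\<forall>\<^sub>F \<zeta> in nhds \<zeta>. tsum T (gm (R \<zeta>) (?m \<zeta>)) = tsum T (gm (Rj \<xi> t \<zeta>) (?m \<zeta>))"
    using evS by eventually_elim (simp add: R)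
  ultimately show ?thesis unfolding R[OF S(2)] by (rule hw_cong)
qed

text \<open>The terms are differentiated formally, so the new list is again independent of t and of
  the chart.\<close>

lemma good_deriv:
  assumes F: "good \<xi> w b F T" and G: "is_field_deriv w j k F G"
  shows "\<exists>T'. good \<xi> w b G T'"
proof
  let ?p = "tder (1, 0) (Some \<circ> up_z)" and ?q = "tder (0, 1) (Some \<circ> up_zbar)"
  show "good \<xi> w b G ((?p ^^ j) ((?q ^^ k) T))"
  proof (rule goodI)
    fix t c \<zeta> \<delta> assume c: "flow_chart \<xi> w t c" and \<delta>: "source \<delta>" "\<zeta> \<in> sdom c \<delta>"
    let ?y = "Poly_Mapping.single ({#}, \<delta>) 1"
    let ?v = "\<lambda>T \<zeta>. tsum T (gm (Rj \<xi> t \<zeta>) (\<lambda>a. src c \<delta> \<zeta> a + Mj \<xi> b t \<zeta> a))"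
    have "expect (field_at G c \<zeta> \<star> ?y) = wirt j k (\<lambda>\<eta>. expect (field_at F c \<eta> \<star> ?y)) \<zeta>"
      using G \<delta> c_chart[OF c] functional_on_source[of c \<zeta> \<delta>] unfolding is_field_deriv_def sdom_def by auto
    also have "\<dots> = ?v ((?p ^^ j) ((?q ^^ k) T)) \<zeta>"
    proof (rule wirt_eq[OF sdom_open[OF c, of \<delta>], where g = "\<lambda>j k. ?v ((?p ^^ j) ((?q ^^ k) T))"])
      show "jfam (sdom c \<delta>) (\<lambda>j k. ?v ((?p ^^ j) ((?q ^^ k) T)))"
        by (rule jfam_ops[OF sdom_open[OF c]]) (rule tsum_hw[OF sdom_open[OF c] _ c \<delta>(1) subset_refl])
      show "expect (field_at F c \<zeta> \<star> ?y) = ?v ((?p ^^ 0) ((?q ^^ 0) T)) \<zeta>"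
        if "\<zeta> \<in> sdom c \<delta>" for \<zeta>
        using expect_good[OF F c \<delta>(1) that] by simp
    qed (rule \<delta>(2))
    finally show "expect (field_at G c \<zeta> \<star> ?y) = tsum ((?p ^^ j) ((?q ^^ k) T)) (gm (Rj \<xi> t \<zeta>) (\<lambda>a. src c \<delta> \<zeta> a + Mj \<xi> b t \<zeta> a))" .
  qed
qed

lemma good_one: "good \<xi> w b (\<lambda>c \<zeta>. 1) [(1, [], 0)]"
  unfolding good_def represents_def
  by (simp add: evf_def tsum_def gexp_def flip: single_one)

lemma good_phi: "good \<xi> w b (phi_b b) [(1, [(0, 0)], 0)]"
  unfolding good_def represents_def
proof (intro allI impI)
  fix t c \<zeta> m assume c: "flow_chart \<xi> w t c" and \<zeta>: "\<zeta> \<in> chart_dom c"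
  have "evf m (phi_b b c \<zeta>) = m (0, 0) + of_real (- 2 * b * Im (chart_log c \<zeta>))"
    unfolding phi_b_def evf_def lin_add by (simp add: zero_prod_def)
  also have "of_real (- 2 * b * Im (chart_log c \<zeta>)) = Mj \<xi> b t \<zeta> (0, 0)"
    unfolding Mj_def c_log[OF c \<zeta>] by (simp add: emu_def algebra_simps)
  finally show "evf m (phi_b b c \<zeta>) = tsum [(1, [(0, 0)], 0)] (gm (Rj \<xi> t \<zeta>) (\<lambda>a. m a + Mj \<xi> b t \<zeta> a))"
    by (simp add: tsum_def gm_Cons gm.simps(1) gexp_def)
qed

lemma good_scale: "good \<xi> w b F T \<Longrightarrow> good \<xi> w b (\<lambda>c \<zeta>. Poly_Mapping.single 0 r * F c \<zeta>) (map (\<lambda>(c, ys, \<alpha>). (r * c, ys, \<alpha>)) T)"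
proof -
  have 1: "evf m (Poly_Mapping.single 0 r * x) = r * evf m x" for m x
    unfolding evf_def by (subst lin_mult) (simp_all add: plus_prod_def exp_add distrib_right zero_prod_def)
  have 2: "tsum (map (\<lambda>(c, ys, \<alpha>). (r * c, ys, \<alpha>)) T) \<Phi> = r * tsum T \<Phi>" for \<Phi>
    unfolding tsum_def by (induction T) (auto simp: algebra_simps)
  show "good \<xi> w b F T \<Longrightarrow> ?thesis" unfolding good_def represents_def 1 2 by simp
qed

lemma good_add: "good \<xi> w b F T \<Longrightarrow> good \<xi> w b G U \<Longrightarrow> good \<xi> w b (\<lambda>c \<zeta>. F c \<zeta> + G c \<zeta>) (T @ U)"
  unfolding good_def represents_def by (simp add: evf_def lin_add tsum_def)

subsection \<open>Operator products\<close>

declare ope_fun.simps [simp del] ope_order.simps [simp del]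

definition osum :: "(complex \<times> ope_index) list \<Rightarrow> complex \<Rightarrow> complex" where
  "osum L u = (\<Sum>(c, i)\<leftarrow>L. c * ope_fun i u)"

definition ospan :: "(complex \<Rightarrow> complex) \<Rightarrow> bool" where
  "ospan f \<longleftrightarrow> (\<exists>L. \<forall>u. u \<noteq> 0 \<longrightarrow> f u = osum L u)"

lemma osum_simps [simp]: "osum [] u = 0" "osum ((c, i) # L) u = c * ope_fun i u + osum L u" "osum (L @ L') u = osum L u + osum L' u"
  by (simp_all add: osum_def)

lemma ope_fun_add: "u \<noteq> 0 \<Longrightarrow> ope_fun (i + j) u = ope_fun i u * ope_fun j u"
  by (cases i; cases j) (simp add: ope_fun_mult)

lemma ope_fun_zero [simp]: "u \<noteq> 0 \<Longrightarrow> ope_fun (0, 0, 0) u = 1" by (simp add: ope_fun.simps)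

lemma ope_order_zero [simp]: "ope_order (0, 0, 0) = 0" by (simp add: ope_order.simps)

lemma osum_mult:
  assumes "u \<noteq> 0"
  shows "\<exists>M. \<forall>u. u \<noteq> 0 \<longrightarrow> osum L u * osum L' u = osum M u"
proof (intro exI allI impI)
  fix u :: complex assume u: "u \<noteq> 0"
  have *: "osum (map (\<lambda>(c', i'). (c * c', i + i')) L') u = c * ope_fun i u * osum L' u" for c i
    by (induction L') (auto simp: ope_fun_add[OF u] algebra_simps)
  show "osum L u * osum L' u = osum (concat (map (\<lambda>(c, i). map (\<lambda>(c', i'). (c * c', i + i')) L') L)) u"
    by (induction L) (auto simp: * distrib_right)
qed

lemma ospan_add: "ospan f \<Longrightarrow> ospan g \<Longrightarrow> ospan (\<lambda>u. f u + g u)"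
  unfolding ospan_def by (metis osum_simps(3))

lemma ospan_mult:
  assumes "ospan f" "ospan g"
  shows "ospan (\<lambda>u. f u * g u)"
proof -
  obtain L L' where "\<forall>u. u \<noteq> 0 \<longrightarrow> f u = osum L u" "\<forall>u. u \<noteq> 0 \<longrightarrow> g u = osum L' u"
    using assms unfolding ospan_def by blast
  with osum_mult[OF one_neq_zero, of L L'] show ?thesis unfolding ospan_def by metis
qed

lemma ospan_ope_fun: "ospan (\<lambda>u. c * ope_fun i u)"
  unfolding ospan_def by (intro exI[of _ "[(c, i)]"]) simp

lemma ospan_const: "ospan (\<lambda>u. c)"
  unfolding ospan_def by (intro exI[of _ "[(c, (0, 0, 0))]"]) simp

lemma ospan_cong: "ospan f \<Longrightarrow> (\<And>u. u \<noteq> 0 \<Longrightarrow> f u = g u) \<Longrightarrow> ospan g"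
  unfolding ospan_def by auto

lemma ospan_sum_list: "(\<And>k. k \<in> set ks \<Longrightarrow> ospan (f k)) \<Longrightarrow> ospan (\<lambda>u. \<Sum>k\<leftarrow>ks. f k u)"
  by (induction ks) (auto intro: ospan_const ospan_add)

lemma ospan_lin: "(\<And>k. ospan (f k)) \<Longrightarrow> ospan (\<lambda>u. lin \<gamma> (\<lambda>k. f k u))"
proof -
  assume f: "\<And>k. ospan (f k)"
  have "ospan (\<lambda>u. \<Sum>k\<in>A. Poly_Mapping.lookup \<gamma> k * f k u)" if "finite A" for A
    using that by (induction A) (auto intro!: ospan_const ospan_add ospan_mult f)
  then show ?thesis by (simp add: lin_def)
qed

definition usum where
  "usum U \<Phi> u = (\<Sum>(c, i, ys, \<alpha>)\<leftarrow>U. c * ope_fun i u * \<Phi> (Poly_Mapping.single (0 :: nat, 0 :: nat) \<alpha>) ys)"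

definition coef where
  "coef U = map (\<lambda>(c, i, ys, \<alpha>). (c, ys, \<alpha>)) (filter (\<lambda>(c, i, ys, \<alpha>). i = (0, 0, 0)) U)"

lemma sum_list_group:
  fixes f :: "'i \<Rightarrow> 'a :: comm_ring_1"
  assumes "finite I" "snd ` set L \<subseteq> I"
  shows "(\<Sum>(c, i)\<leftarrow>L. c * f i) = (\<Sum>i\<in>I. (\<Sum>(c, j)\<leftarrow>L. if j = i then c else 0) * f i)"
  using assms(2)
proof (induction L)
  case (Cons p L)
  obtain c j where p: "p = (c, j)" by fastforce
  have "(\<Sum>i\<in>I. (if j = i then c else 0) * f i) = (\<Sum>i\<in>I. if j = i then c * f i else 0)"
    by (rule sum.cong) auto
  also have "\<dots> = c * f j" using Cons.prems assms(1) p by simp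
  finally show ?case using Cons p by (simp add: distrib_right sum.distrib)
qed simp

lemma field_at_zero: "F = (\<lambda>c \<zeta>. 0) \<Longrightarrow> expect (field_at F c \<zeta> \<star> G) = 0"
  by (simp add: field_at_def fprod_def expect_def)

text \<open>By independence of the OPE functions, an expansion modulo o(1) must have the same
  coefficient of 1 as the one behind \<open>is_ope_product\<close>. Terms of positive order tend to
  0 and are discarded.\<close>

lemma ope_coefficient:
  assumes H: "is_ope_product w F G H"
    and U: "\<And>t c z \<delta>. flow_chart \<xi> w t c \<Longrightarrow> source \<delta> \<Longrightarrow> z \<in> sdom c \<delta> \<Longrightarrow>
      ((\<lambda>u. expect (field_at F c (z + u) \<star> field_at G c z \<star> Poly_Mapping.single ({#}, \<delta>) 1) -
         usum U (gm (Rj \<xi> t z) (\<lambda>a. src c \<delta> z a + Mj \<xi> b t z a)) u) \<longlongrightarrow> 0) (at 0)"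
  shows "good \<xi> w b H (coef U)"
proof (rule goodI)
  fix t c z \<delta> assume c: "flow_chart \<xi> w t c" and \<delta>: "source \<delta>" "z \<in> sdom c \<delta>"
  let ?y = "Poly_Mapping.single ({#}, \<delta>) 1 :: functional"
  let ?\<Phi> = "gm (Rj \<xi> t z) (\<lambda>a. src c \<delta> z a + Mj \<xi> b t z a)"
  let ?E = "\<lambda>\<zeta>. expect (field_at F c \<zeta> \<star> field_at G c z \<star> ?y)"
  obtain C where C: "has_ope w F G C" "H = C (0, 0, 0)" using H unfolding is_ope_product_def by blast
  define I0 where "I0 = {i. ope_order i \<le> 0 \<and> C i \<noteq> (\<lambda>c \<zeta>. 0)}"
  define e where "e i = expect (field_at (C i) c z \<star> ?y)" for i
  have fin: "finite I0" using C(1) unfolding has_ope_def I0_def by blast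
  have z: "z \<in> chart_dom c" "functional_on (\<H> - {chart_par c z}) ?y"
    using \<delta> by (simp_all add: sdom_def functional_on_source)
  \<comment> \<open>The expansion is taken with N = 0, where the weight |u|^N is 1 off the
    node.\<close>
  have "((\<lambda>\<zeta>. (?E \<zeta> - (\<Sum>i\<in>I0. e i * ope_fun i (\<zeta> - z))) / complex_of_real (cmod (\<zeta> - z) powr 0)) \<longlongrightarrow> 0) (at z)"
    using C(1) c_chart[OF c] z unfolding has_ope_def I0_def e_def by blast
  from LIM_offset_zero[OF this]
  have "((\<lambda>u. (?E (z + u) - (\<Sum>i\<in>I0. e i * ope_fun i u)) / complex_of_real (cmod u powr 0)) \<longlongrightarrow> 0) (at 0)" by simp
  moreover have "\<forall>\<^sub>F u in at 0. (?E (z + u) - (\<Sum>i\<in>I0. e i * ope_fun i u)) / complex_of_real (cmod u powr 0) =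
      ?E (z + u) - (\<Sum>i\<in>I0. e i * ope_fun i u)"
    by (auto simp: eventually_at_filter)
  ultimately have lim1: "((\<lambda>u. ?E (z + u) - (\<Sum>i\<in>I0. e i * ope_fun i u)) \<longlongrightarrow> 0) (at 0)"
    by (rule Lim_transform_eventually)
  define neg where "neg = (\<lambda>(c :: complex, i, ys :: (nat \<times> nat) list, \<alpha> :: complex). ope_order i \<le> 0)"
  define val where "val = (\<lambda>(c, i :: ope_index, ys, \<alpha>). (c * ?\<Phi> (Poly_Mapping.single (0, 0) \<alpha>) ys, i))"
  define L where "L = map val (filter neg U)"
  have split: "usum U ?\<Phi> u = osum L u + usum (filter (\<lambda>l. \<not> neg l) U) ?\<Phi> u" for u
    unfolding L_def by (induction U) (auto simp: usum_def val_def algebra_simps)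
  have pos: "((\<lambda>u. usum (filter (\<lambda>l. \<not> neg l) U) ?\<Phi> u) \<longlongrightarrow> 0) (at 0)"
  proof (induction U)
    case (Cons l U)
    obtain d i ys \<alpha> where l: "l = (d, i, ys, \<alpha>)" by (cases l) auto
    show ?case
    proof (cases "neg l")
      case False
      then have "(ope_fun i \<longlongrightarrow> 0) (at 0)" by (intro ope_fun_tendsto_0) (simp add: neg_def l)
      from tendsto_add[OF tendsto_mult[OF tendsto_mult[OF tendsto_const[of d] this] tendsto_const[of "?\<Phi> (Poly_Mapping.single (0, 0) \<alpha>) ys"]] Cons]
      show ?thesis using False by (simp add: usum_def l)
    qed (use Cons in simp)
  qed (simp add: usum_def)
  have "((\<lambda>u. (?E (z + u) - (\<Sum>i\<in>I0. e i * ope_fun i u)) - (?E (z + u) - usum U ?\<Phi> u) - usum (filter (\<lambda>l. \<not> neg l) U) ?\<Phi> u) \<longlongrightarrow> 0 - 0 - 0) (at 0)"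
    by (intro tendsto_diff lim1 U c \<delta> pos)
  then have lim2: "((\<lambda>u. osum L u - (\<Sum>i\<in>I0. e i * ope_fun i u)) \<longlongrightarrow> 0) (at 0)" by (simp add: split)
  define I where "I = insert (0, 0, 0) (I0 \<union> snd ` set L)"
  have I: "finite I" using fin by (simp add: I_def)
  define d where "d i = (\<Sum>(c, j)\<leftarrow>L. if j = i then c else 0) - (if i \<in> I0 then e i else 0)" for i
  have "(\<Sum>i\<in>I. (if i \<in> I0 then e i else 0) * ope_fun i u) = (\<Sum>i\<in>I0. e i * ope_fun i u)" for u
    using I by (intro sum.mono_neutral_cong_right) (auto simp: I_def)
  then have "osum L u - (\<Sum>i\<in>I0. e i * ope_fun i u) = (\<Sum>i\<in>I. d i * ope_fun i u)" for u
    unfolding osum_def d_def left_diff_distrib sum_subtractf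
    by (subst sum_list_group[OF I]) (auto simp: I_def)
  then have "((\<lambda>u. \<Sum>i\<in>I. d i * ope_fun i u) \<longlongrightarrow> 0) (at 0)" using lim2 by simp
  then have "d (0, 0, 0) = 0"
    by (rule ope_fun_independent[OF I, rotated]) (auto simp: I_def I0_def L_def val_def neg_def)
  moreover have "(if (0, 0, 0) \<in> I0 then e (0, 0, 0) else 0) = e (0, 0, 0)"
    using field_at_zero[of "C (0, 0, 0)"] by (auto simp: I0_def e_def)
  ultimately have "e (0, 0, 0) = (\<Sum>(c, j)\<leftarrow>L. if j = (0, 0, 0) then c else 0)" by (simp add: d_def)
  also have "\<dots> = tsum (coef U) ?\<Phi>"
    unfolding L_def by (induction U) (auto simp: coef_def tsum_def val_def neg_def split: if_splits)
  finally show "expect (field_at H c z \<star> ?y) = tsum (coef U) ?\<Phi>" by (simp add: e_def C(2))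
qed

section \<open>Expansion of the correlation of two fields\<close>

definition pt :: "complex \<Rightarrow> complex \<Rightarrow> nat \<Rightarrow> complex" where
  "pt \<zeta> z i = (if i = 0 then \<zeta> else z)"

definition Qreg :: "real \<Rightarrow> real \<Rightarrow> complex \<Rightarrow> complex \<Rightarrow> nat \<times> nat \<times> nat \<Rightarrow> nat \<times> nat \<times> nat \<Rightarrow> complex" where
  "Qreg \<xi> t \<zeta> z p q = 2 * ej \<xi> er (snd p) (snd q) (t, pt \<zeta> z (fst p), pt \<zeta> z (fst q))"

definition Mreg :: "real \<Rightarrow> real \<Rightarrow> real \<Rightarrow> chart \<Rightarrow> (gvar \<Rightarrow>\<^sub>0 complex) \<Rightarrow> complex \<Rightarrow> complex \<Rightarrow> nat \<times> nat \<times> nat \<Rightarrow> complex" where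
  "Mreg \<xi> b t c \<delta> \<zeta> z p = src c \<delta> (pt \<zeta> z (fst p)) (snd p) + Mj \<xi> b t (pt \<zeta> z (fst p)) (snd p)"

text \<open>The singular part couples only the two different nodes and depends on them through u
  alone; it is evaluated at the points u and 0 and at time 0.\<close>

definition Qs :: "real \<Rightarrow> complex \<Rightarrow> nat \<times> nat \<times> nat \<Rightarrow> nat \<times> nat \<times> nat \<Rightarrow> complex" where
  "Qs \<xi> u p q = (if fst p = 0 \<and> fst q \<noteq> 0 then 2 * ej \<xi> el (snd p) (snd q) (0, u, 0)
     else if fst p \<noteq> 0 \<and> fst q = 0 then 2 * ej \<xi> el (snd q) (snd p) (0, u, 0) else 0)"

definition \<gamma>2 :: "complex \<Rightarrow> complex \<Rightarrow> nat \<times> nat \<times> nat \<Rightarrow>\<^sub>0 complex" where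
  "\<gamma>2 \<alpha> \<beta> = Poly_Mapping.single (0, 0, 0) \<alpha> + Poly_Mapping.single (1, 0, 0) \<beta>"

lemma lin_\<gamma>2: "lin (\<gamma>2 \<alpha> \<beta>) f = \<alpha> * f (0, 0, 0) + \<beta> * f (1, 0, 0)"
  by (simp add: \<gamma>2_def lin_add)

lemma ej_el_shift: "x \<noteq> y \<Longrightarrow> ej \<xi> el a b (t, x, y) = ej \<xi> el a b (0, x - y, 0)"
proof -
  assume "x \<noteq> y"
  obtain L where "\<forall>t x y. x \<noteq> y \<longrightarrow> ej \<xi> el a b (t, x, y) = (\<Sum>(c, i)\<leftarrow>L. c * ope_fun i (x - y))" using el_span by blast
  then show ?thesis using \<open>x \<noteq> y\<close> by (metis diff_zero right_minus_eq)
qed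

lemma ospan_el: "ospan (\<lambda>u. ej \<xi> el a b (0, u, 0))"
proof -
  obtain L where L: "\<forall>t x y. x \<noteq> y \<longrightarrow> ej \<xi> el a b (t, x, y) = (\<Sum>(c, i)\<leftarrow>L. c * ope_fun i (x - y))" using el_span by blast
  show ?thesis unfolding ospan_def osum_def
  proof (intro exI[of _ L] allI impI)
    fix u :: complex assume "u \<noteq> 0"
    from L[rule_format, OF this] show "ej \<xi> el a b (0, u, 0) = (\<Sum>(c, i)\<leftarrow>L. c * ope_fun i u)" by simp
  qed
qed

lemma ospan_Qs: "ospan (\<lambda>u. Qs \<xi> u p q)"
  unfolding Qs_def by (cases "fst p = 0"; cases "fst q = 0") (auto intro!: ospan_mult ospan_const ospan_el)

text \<open>Covariance -2 log |u| between exponentials with parameters \<alpha> and \<beta> gives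
  |u| to the power -2 \<alpha> \<beta>; each further factor brings in sums and products within the
  span.\<close>

lemma ospan_gm_Qs: "ospan (\<lambda>u. gm (Qs \<xi> u) (\<lambda>_. 0) (\<gamma>2 \<alpha> \<beta>) xs)"
proof (induction xs rule: gm_induct)
  case Nil
  show ?case
  proof (rule ospan_cong[OF ospan_ope_fun[of 1 "(0, - 2 * \<alpha> * \<beta>, 0)"]])
    fix u :: complex assume "u \<noteq> 0"
    then show "1 * ope_fun (0, - 2 * \<alpha> * \<beta>, 0) u = gm (Qs \<xi> u) (\<lambda>_. 0) (\<gamma>2 \<alpha> \<beta>) []"
      by (simp add: ope_fun.simps gm.simps(1) gexp_def lin_\<gamma>2 Qs_def el_def powr_def Ln_of_real mult_ac)
  qed
next
  case (Cons x xs)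
  have IH: "ospan (\<lambda>u. gm (Qs \<xi> u) (\<lambda>_. 0) (\<gamma>2 \<alpha> \<beta>) (snd p))" if "p \<in> set (picks xs)" for p
    using Cons(2)[of "fst p" "snd p"] that by simp
  show ?case unfolding gm_Cons case_prod_unfold
    by (intro ospan_add ospan_mult ospan_const ospan_lin ospan_Qs Cons(1) ospan_sum_list IH)
qed

text \<open>Expansion modulo o(1) with one list U for all t, charts, points and sources; the
  coefficients are canonical moments at the fixed point z.\<close>

definition expn :: "real \<Rightarrow> (complex \<Rightarrow> complex) \<Rightarrow> real \<Rightarrow>
    (real \<Rightarrow> chart \<Rightarrow> complex \<Rightarrow> (gvar \<Rightarrow>\<^sub>0 complex) \<Rightarrow> complex \<Rightarrow> complex) \<Rightarrow> bool" where
  "expn \<xi> w b F \<longleftrightarrow> (\<exists>U. \<forall>t c z \<delta>. flow_chart \<xi> w t c \<longrightarrow> source \<delta> \<longrightarrow> z \<in> sdom c \<delta> \<longrightarrow>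
      ((\<lambda>u. F t c z \<delta> u - usum U (gm (Rj \<xi> t z) (\<lambda>a. src c \<delta> z a + Mj \<xi> b t z a)) u) \<longlongrightarrow> 0) (at 0))"

lemma expn_zero: "expn \<xi> w b (\<lambda>t c z \<delta> u. 0)"
  unfolding expn_def by (rule exI[of _ "[]"]) (simp add: usum_def)

lemma expn_add:
  assumes "expn \<xi> w b F" "expn \<xi> w b G"
  shows "expn \<xi> w b (\<lambda>t c z \<delta> u. F t c z \<delta> u + G t c z \<delta> u)"
proof -
  obtain U where U: "\<And>t c z \<delta>. flow_chart \<xi> w t c \<Longrightarrow> source \<delta> \<Longrightarrow> z \<in> sdom c \<delta> \<Longrightarrow>
      ((\<lambda>u. F t c z \<delta> u - usum U (gm (Rj \<xi> t z) (\<lambda>a. src c \<delta> z a + Mj \<xi> b t z a)) u) \<longlongrightarrow> 0) (at 0)"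
    using assms(1) unfolding expn_def by blast
  obtain V where V: "\<And>t c z \<delta>. flow_chart \<xi> w t c \<Longrightarrow> source \<delta> \<Longrightarrow> z \<in> sdom c \<delta> \<Longrightarrow>
      ((\<lambda>u. G t c z \<delta> u - usum V (gm (Rj \<xi> t z) (\<lambda>a. src c \<delta> z a + Mj \<xi> b t z a)) u) \<longlongrightarrow> 0) (at 0)"
    using assms(2) unfolding expn_def by blast
  show ?thesis unfolding expn_def
  proof (intro exI[of _ "U @ V"] allI impI)
    fix t c z \<delta> assume *: "flow_chart \<xi> w t c" "source \<delta>" "z \<in> sdom c \<delta>"
    from tendsto_add[OF U[OF *] V[OF *]]
    show "((\<lambda>u. F t c z \<delta> u + G t c z \<delta> u - usum (U @ V) (gm (Rj \<xi> t z) (\<lambda>a. src c \<delta> z a + Mj \<xi> b t z a)) u) \<longlongrightarrow> 0) (at 0)"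
      by (simp add: usum_def algebra_simps)
  qed
qed

lemma expn_scale:
  assumes "expn \<xi> w b F"
  shows "expn \<xi> w b (\<lambda>t c z \<delta> u. r * F t c z \<delta> u)"
proof -
  obtain U where U: "\<And>t c z \<delta>. flow_chart \<xi> w t c \<Longrightarrow> source \<delta> \<Longrightarrow> z \<in> sdom c \<delta> \<Longrightarrow>
      ((\<lambda>u. F t c z \<delta> u - usum U (gm (Rj \<xi> t z) (\<lambda>a. src c \<delta> z a + Mj \<xi> b t z a)) u) \<longlongrightarrow> 0) (at 0)"
    using assms(1) unfolding expn_def by blast
  have s: "usum (map (\<lambda>(d, l). (r * d, l)) U) \<Phi> u = r * usum U \<Phi> u" for \<Phi> u
    unfolding usum_def by (induction U) (auto simp: algebra_simps)
  show ?thesis unfolding expn_def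
  proof (intro exI[of _ "map (\<lambda>(d, l). (r * d, l)) U"] allI impI)
    fix t c z \<delta> assume *: "flow_chart \<xi> w t c" "source \<delta>" "z \<in> sdom c \<delta>"
    from tendsto_mult_right_zero[OF U[OF *], of r]
    show "((\<lambda>u. r * F t c z \<delta> u - usum (map (\<lambda>(d, l). (r * d, l)) U) (gm (Rj \<xi> t z) (\<lambda>a. src c \<delta> z a + Mj \<xi> b t z a)) u) \<longlongrightarrow> 0) (at 0)"
      by (simp add: s right_diff_distrib)
  qed
qed

lemma expn_sum_list:
  "(\<And>k. k \<in> set ks \<Longrightarrow> expn \<xi> w b (F k)) \<Longrightarrow> expn \<xi> w b (\<lambda>t c z \<delta> u. \<Sum>k\<leftarrow>ks. F k t c z \<delta> u)"
  by (induction ks) (auto intro: expn_zero expn_add)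

lemma expn_cong:
  assumes "expn \<xi> w b F"
    and "\<And>t c z \<delta>. flow_chart \<xi> w t c \<Longrightarrow> source \<delta> \<Longrightarrow> z \<in> sdom c \<delta> \<Longrightarrow> \<forall>\<^sub>F u in at 0. F t c z \<delta> u = G t c z \<delta> u"
  shows "expn \<xi> w b G"
proof -
  obtain U where U: "\<And>t c z \<delta>. flow_chart \<xi> w t c \<Longrightarrow> source \<delta> \<Longrightarrow> z \<in> sdom c \<delta> \<Longrightarrow>
      ((\<lambda>u. F t c z \<delta> u - usum U (gm (Rj \<xi> t z) (\<lambda>a. src c \<delta> z a + Mj \<xi> b t z a)) u) \<longlongrightarrow> 0) (at 0)"
    using assms(1) unfolding expn_def by blast
  show ?thesis unfolding expn_def
  proof (intro exI[of _ U] allI impI)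
    fix t c z \<delta> assume *: "flow_chart \<xi> w t c" "source \<delta>" "z \<in> sdom c \<delta>"
    show "((\<lambda>u. G t c z \<delta> u - usum U (gm (Rj \<xi> t z) (\<lambda>a. src c \<delta> z a + Mj \<xi> b t z a)) u) \<longlongrightarrow> 0) (at 0)"
      by (rule Lim_transform_eventually[OF U[OF *]]) (use assms(2)[OF *] in eventually_elim, simp)
  qed
qed

lemma eventually_near:
  fixes z :: complex
  assumes "open S" "z \<in> S"
  shows "\<forall>\<^sub>F u in at 0. z + u \<in> S" "\<forall>\<^sub>F u in nhds 0. z + u \<in> S"
proof -
  have "open ((\<lambda>u. z + u) -` S)" by (intro open_vimage assms continuous_intros)
  from eventually_nhds_in_open[OF this, of 0] show n: "\<forall>\<^sub>F u in nhds 0. z + u \<in> S" using assms by simp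
  then show "\<forall>\<^sub>F u in at 0. z + u \<in> S" by (auto simp: eventually_at_filter elim: eventually_mono)
qed

text \<open>When the two points merge, the two labels become one and the parameters of the
  exponentials add.\<close>

lemma Qreg_coincident: "gm (Qreg \<xi> t z z) (Mreg \<xi> b t c \<delta> z z) (\<gamma>2 \<alpha> \<beta>) xs =
    gm (Rj \<xi> t z) (\<lambda>a. src c \<delta> z a + Mj \<xi> b t z a) (Poly_Mapping.single (0, 0) (\<alpha> + \<beta>)) (map snd xs)"
proof -
  have "gm (\<lambda>p q. Rj \<xi> t z (snd p) (snd q)) ((\<lambda>a. src c \<delta> z a + Mj \<xi> b t z a) \<circ> snd) (\<gamma>2 \<alpha> \<beta>) xs =
     gm (Rj \<xi> t z) (\<lambda>a. src c \<delta> z a + Mj \<xi> b t z a) (Poly_Mapping.single (0, 0) (\<alpha> + \<beta>)) (map snd xs)"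
    by (rule gm_reindex) (simp add: lin_\<gamma>2 distrib_right)
  moreover have "Qreg \<xi> t z z = (\<lambda>p q. Rj \<xi> t z (snd p) (snd q))" "Mreg \<xi> b t c \<delta> z z = (\<lambda>a. src c \<delta> z a + Mj \<xi> b t z a) \<circ> snd"
    by (auto simp: Qreg_def Rj_def Mreg_def pt_def fun_eq_iff)
  ultimately show ?thesis by simp
qed

text \<open>Only node 0 moves; node 1 is the fixed point of the expansion.\<close>

definition sh1 :: "nat \<times> nat \<times> nat \<Rightarrow> (nat \<times> nat \<times> nat) option" where
  "sh1 p = (if fst p = 0 then Some (0, up_z (snd p)) else None)"
definition sh2 :: "nat \<times> nat \<times> nat \<Rightarrow> (nat \<times> nat \<times> nat) option" where
  "sh2 p = (if fst p = 0 then Some (0, up_zbar (snd p)) else None)"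

lemma lsum_reg_hw:
  fixes b :: real and \<alpha> \<beta> :: complex
  assumes c: "flow_chart \<xi> w t c" and \<delta>: "source \<delta>" "\<zeta> \<in> sdom c \<delta>" and z: "z \<in> sdom c \<delta>"
  defines "\<Psi> \<equiv> \<lambda>\<zeta>. gm (Qreg \<xi> t \<zeta> z) (Mreg \<xi> b t c \<delta> \<zeta> z) (\<gamma>2 \<alpha> \<beta>)"
  shows "hw (\<lambda>\<zeta>. lsum T (\<Psi> \<zeta>)) (lsum (dterms \<alpha> (0, 1, 0) sh1 T) (\<Psi> \<zeta>)) (lsum (dterms \<alpha> (0, 0, 1) sh2 T) (\<Psi> \<zeta>)) \<zeta>"
proof -
  let ?S = "sdom c \<delta>"
  define Q where "Q \<zeta> x y = (if \<zeta> \<in> ?S then Qreg \<xi> t \<zeta> z x y else 0)" for \<zeta> x y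
  have dom: "x \<in> fdom \<xi> t" if "x \<in> ?S" for x using that c_fdom[OF c] by (auto simp: sdom_def)
  note ff = dom[OF \<delta>(2)] dom[OF z]
  have Q: "Q \<zeta> = Qreg \<xi> t \<zeta> z" if "\<zeta> \<in> ?S" for \<zeta> using that by (simp add: Q_def fun_eq_iff)
  have evS: "\<forall>\<^sub>F x in nhds \<zeta>. x \<in> ?S" by (rule eventually_nhds_in_open[OF sdom_open[OF c] \<delta>(2)])
  have 1: "hw (\<lambda>\<zeta>. lsum T (gm (Q \<zeta>) (Mreg \<xi> b t c \<delta> \<zeta> z) (\<gamma>2 \<alpha> \<beta>)))
     (lsum (dterms \<alpha> (0, 1, 0) sh1 T) (gm (Q \<zeta>) (Mreg \<xi> b t c \<delta> \<zeta> z) (\<gamma>2 \<alpha> \<beta>)))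
     (lsum (dterms \<alpha> (0, 0, 1) sh2 T) (gm (Q \<zeta>) (Mreg \<xi> b t c \<delta> \<zeta> z) (\<gamma>2 \<alpha> \<beta>))) \<zeta>"
  proof (rule lsum_hw)
    fix x y
    have "hw (\<lambda>\<zeta>. Qreg \<xi> t \<zeta> z x y) (opt (\<lambda>x'. Qreg \<xi> t \<zeta> z x' y) (sh1 x) + opt (Qreg \<xi> t \<zeta> z x) (sh1 y))
       (opt (\<lambda>x'. Qreg \<xi> t \<zeta> z x' y) (sh2 x) + opt (Qreg \<xi> t \<zeta> z x) (sh2 y)) \<zeta>"
    proof -
      obtain i j k where x: "x = (i, j, k)" by (cases x) auto
      obtain i' l m where y: "y = (i', l, m)" by (cases y) auto
      consider "i = 0" "i' = 0" | "i = 0" "i' \<noteq> 0" | "i \<noteq> 0" "i' = 0" | "i \<noteq> 0" "i' \<noteq> 0" by blast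
      then show ?thesis
      proof cases
        case 1
        then show ?thesis using Rj_hw[OF ff(1), of "(j, k)" "(l, m)"] by (simp add: x y Qreg_def pt_def sh1_def sh2_def Rj_def)
      next
        case 2
        then show ?thesis using hw_scale[OF ej_hw_x[OF valid_er[OF ff]], of 2 j k "(l, m)"] by (simp add: x y Qreg_def pt_def sh1_def sh2_def)
      next
        case 3
        then show ?thesis using hw_scale[OF ej_hw_y[OF valid_er[OF ff(2,1)]], of 2 "(j, k)" l m] by (simp add: x y Qreg_def pt_def sh1_def sh2_def)
      next
        case 4
        then show ?thesis by (simp add: x y Qreg_def pt_def sh1_def sh2_def hw_const)
      qed
    qed
    moreover have "\<forall>\<^sub>F \<zeta>' in nhds \<zeta>. Qreg \<xi> t \<zeta>' z x y = Q \<zeta>' x y" using evS by eventually_elim (simp add: Q)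
    ultimately show "hw (\<lambda>\<zeta>. Q \<zeta> x y) (opt (\<lambda>x'. Q \<zeta> x' y) (sh1 x) + opt (Q \<zeta> x) (sh1 y))
       (opt (\<lambda>x'. Q \<zeta> x' y) (sh2 x) + opt (Q \<zeta> x) (sh2 y)) \<zeta>"
      unfolding Q[OF \<delta>(2)] by (rule hw_cong)
  next
    fix x :: "nat \<times> nat \<times> nat"
    obtain i j k where x: "x = (i, j, k)" by (cases x) auto
    from hw_add[OF src_hw[OF c \<delta>, of j k] Mj_hw[OF ff(1), of b "(j, k)"]]
    show "hw (\<lambda>\<zeta>. Mreg \<xi> b t c \<delta> \<zeta> z x) (opt (Mreg \<xi> b t c \<delta> \<zeta> z) (sh1 x)) (opt (Mreg \<xi> b t c \<delta> \<zeta> z) (sh2 x)) \<zeta>"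
      by (auto simp: x Mreg_def pt_def sh1_def sh2_def hw_const)
  next
    show "Q \<zeta> x y = Q \<zeta> y x" for \<zeta> x y
      using dom[of \<zeta>] dom[OF z] er_symmetric[of "pt \<zeta> z (fst x)" \<xi> t "pt \<zeta> z (fst y)" "snd x" "snd y"] by (auto simp: Q_def Qreg_def pt_def)
  qed (simp_all add: lin_\<gamma>2 sh1_def sh2_def)
  have "\<forall>\<^sub>F \<zeta> in nhds \<zeta>. lsum T (gm (Q \<zeta>) (Mreg \<xi> b t c \<delta> \<zeta> z) (\<gamma>2 \<alpha> \<beta>)) = lsum T (\<Psi> \<zeta>)"
    using evS by eventually_elim (simp add: Q \<Psi>_def)
  from hw_cong[OF 1 this] show ?thesis unfolding \<Psi>_def Q[OF \<delta>(2)] .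
qed

lemma power_ope_fun: "u \<noteq> 0 \<Longrightarrow> u ^ j * cnj u ^ k = ope_fun (int j - int k, 2 * of_nat k, 0) u"
proof -
  assume u: "u \<noteq> 0"
  have "ope_fun (int j - int k, 2 * of_nat k, 0) u = u powi (int j - int k) * (of_real (cmod u) powr (2 * of_nat k))"
    by (simp add: ope_fun.simps)
  also have "of_real (cmod u) powr (2 * of_nat k) = (of_real (cmod u) ^ (2 * k) :: complex)"
    using u powr_nat'[of "complex_of_real (cmod u)" "2 * k"] by simp
  also have "\<dots> = (u * cnj u) ^ k" by (simp add: power_mult complex_norm_square[symmetric])
  also have "u powi (int j - int k) = u ^ j / u ^ k" using u by (simp add: power_int_diff)
  finally show ?thesis using u by (simp add: power_mult_distrib)
qed

text \<open>Taylor expansion of the regular factor in u and its conjugate, to an order K that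
  compensates a negative order of i. The Taylor coefficients are combinations of moments at
  coincident points, hence again canonical.\<close>

lemma expn_regular:
  fixes b :: real and \<alpha> \<beta> :: complex
  shows "expn \<xi> w b (\<lambda>t c z \<delta> u. ope_fun i u * gm (Qreg \<xi> t (z + u) z) (Mreg \<xi> b t c \<delta> (z + u) z) (\<gamma>2 \<alpha> \<beta>) xs)"
proof -
  obtain K :: nat where "- ope_order i < real K" using reals_Archimedean2 by blast
  then have K: "ope_order i + real K > 0" by simp
  obtain ks where ks: "set ks = {(j :: nat, k). j + k \<le> K}" "distinct ks"
    using finite_distinct_list[OF finite_taylor_index] by blast
  let ?p = "dterms \<alpha> (0, 1, 0) sh1" and ?q = "dterms \<alpha> (0, 0, 1) sh2"
  define W where "W j k = (?p ^^ j) ((?q ^^ k) [(1, xs)])" for j k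
  \<comment> \<open>A monomial in u and its conjugate of degrees j and k is the OPE function with
    index (j - k, 2 k, 0), which is added to i.\<close>
  define V where "V = concat (map (\<lambda>(j, k). map (\<lambda>(d, ys). (d / (fact j * fact k), i + (int j - int k, 2 * of_nat k, 0), map snd ys, \<alpha> + \<beta>)) (W j k)) ks)"
  show ?thesis unfolding expn_def
  proof (intro exI[of _ V] allI impI)
    fix t c z \<delta> assume c: "flow_chart \<xi> w t c" and \<delta>: "source \<delta>" and z: "z \<in> sdom c \<delta>"
    let ?\<Phi> = "gm (Rj \<xi> t z) (\<lambda>a. src c \<delta> z a + Mj \<xi> b t z a)"
    define \<Psi> where "\<Psi> \<zeta> = gm (Qreg \<xi> t \<zeta> z) (Mreg \<xi> b t c \<delta> \<zeta> z) (\<gamma>2 \<alpha> \<beta>)" for \<zeta>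
    define g where "g j k \<zeta> = lsum (W j k) (\<Psi> \<zeta>)" for j k \<zeta>
    have "jfam (sdom c \<delta>) (\<lambda>j k. (\<lambda>T \<zeta>. lsum T (\<Psi> \<zeta>)) ((?p ^^ j) ((?q ^^ k) [(1, xs)])))"
      unfolding \<Psi>_def
      by (rule jfam_ops[OF sdom_open[OF c]]) (rule lsum_reg_hw[OF c \<delta> _ z])
    then have j: "jfam (sdom c \<delta>) g" unfolding g_def[abs_def] W_def .
    have "((\<lambda>u. (g 0 0 (z + u) - taylor g z K u) / complex_of_real (cmod u ^ K)) \<longlongrightarrow> 0) (at 0)"
      by (rule taylor_remainder[OF sdom_open[OF c] z]) (use j in \<open>simp add: jfam_def hw_def\<close>)
    from ope_fun_mult_tendsto_0[OF this K]
    have lim: "((\<lambda>u. ope_fun i u * (g 0 0 (z + u) - taylor g z K u)) \<longlongrightarrow> 0) (at 0)" .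
    have V: "ope_fun i u * taylor g z K u = usum V ?\<Phi> u" if u: "u \<noteq> 0" for u
    proof -
      have 1: "usum (map (\<lambda>(d, ys). (d / (fact j * fact k), i', map snd ys, \<alpha> + \<beta>)) L) ?\<Phi> u =
          ope_fun i u * (lsum L (\<Psi> z) * (u ^ j / fact j) * (cnj u ^ k / fact k))"
        if "ope_fun i' u = ope_fun i u * (u ^ j * cnj u ^ k)" for i' j k L
        by (induction L) (auto simp: usum_def \<Psi>_def Qreg_coincident that field_simps)
      have e: "ope_fun (i + (int j - int k, 2 * of_nat k, 0)) u = ope_fun i u * (u ^ j * cnj u ^ k)" for j k
        by (simp only: ope_fun_add[OF u] power_ope_fun[OF u])
      have 2: "usum (A @ B) \<Phi> u = usum A \<Phi> u + usum B \<Phi> u" for A B \<Phi> by (simp add: usum_def)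
      have "usum V ?\<Phi> u = (\<Sum>(j, k)\<leftarrow>ks. ope_fun i u * (g j k z * (u ^ j / fact j) * (cnj u ^ k / fact k)))"
        unfolding V_def g_def
      proof (induction ks)
        case (Cons a ks)
        then show ?case by (cases a) (simp add: 1[OF e] 2)
      qed (simp add: usum_def)
      also have "\<dots> = (\<Sum>(j, k)\<in>set ks. ope_fun i u * (g j k z * (u ^ j / fact j) * (cnj u ^ k / fact k)))"
        by (rule sum_list_distinct_conv_sum_set[OF ks(2)])
      also have "\<dots> = ope_fun i u * taylor g z K u"
        unfolding taylor_def sum_distrib_left ks(1) case_prod_unfold by simp
      finally show ?thesis by simp
    qed
    show "((\<lambda>u. ope_fun i u * gm (Qreg \<xi> t (z + u) z) (Mreg \<xi> b t c \<delta> (z + u) z) (\<gamma>2 \<alpha> \<beta>) xs - usum V ?\<Phi> u) \<longlongrightarrow> 0) (at 0)"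
    proof (rule Lim_transform_eventually[OF lim])
      have "g 0 0 \<zeta> = gm (Qreg \<xi> t \<zeta> z) (Mreg \<xi> b t c \<delta> \<zeta> z) (\<gamma>2 \<alpha> \<beta>) xs" for \<zeta>
        by (simp add: g_def W_def \<Psi>_def)
      then show "\<forall>\<^sub>F u in at 0. ope_fun i u * (g 0 0 (z + u) - taylor g z K u) =
        ope_fun i u * gm (Qreg \<xi> t (z + u) z) (Mreg \<xi> b t c \<delta> (z + u) z) (\<gamma>2 \<alpha> \<beta>) xs - usum V ?\<Phi> u"
        by (auto simp: eventually_at_filter right_diff_distrib V)
    qed
  qed
qed

lemma expn_ospan_regular:
  fixes b :: real and \<alpha> \<beta> :: complex
  assumes "ospan f"
  shows "expn \<xi> w b (\<lambda>t c z \<delta> u. f u * gm (Qreg \<xi> t (z + u) z) (Mreg \<xi> b t c \<delta> (z + u) z) (\<gamma>2 \<alpha> \<beta>) xs)"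
proof -
  obtain L where L: "\<And>u. u \<noteq> 0 \<Longrightarrow> f u = osum L u" using assms unfolding ospan_def by blast
  have "expn \<xi> w b (\<lambda>t c z \<delta> u. \<Sum>l\<leftarrow>L. fst l * (ope_fun (snd l) u * gm (Qreg \<xi> t (z + u) z) (Mreg \<xi> b t c \<delta> (z + u) z) (\<gamma>2 \<alpha> \<beta>) xs))"
    by (intro expn_sum_list expn_scale expn_regular)
  then show ?thesis
  proof (rule expn_cong)
    show "\<forall>\<^sub>F u in at 0. (\<Sum>l\<leftarrow>L. fst l * (ope_fun (snd l) u * gm (Qreg \<xi> t (z + u) z) (Mreg \<xi> b t c \<delta> (z + u) z) (\<gamma>2 \<alpha> \<beta>) xs)) =
        f u * gm (Qreg \<xi> t (z + u) z) (Mreg \<xi> b t c \<delta> (z + u) z) (\<gamma>2 \<alpha> \<beta>) xs" for t c z \<delta>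
      unfolding eventually_at_filter
      by (rule always_eventually) (auto simp: L osum_def sum_list_mult_const[symmetric] case_prod_unfold mult.assoc)
  qed
qed

text \<open>By \<open>gm_add\<close> the singular and the regular part act as independent Gaussian
  families, so the moment is a sum of products of functions in the OPE span and regular
  moments.\<close>

lemma expn_total:
  fixes b :: real and \<alpha> \<beta> :: complex
  shows "expn \<xi> w b (\<lambda>t c z \<delta> u. gm (\<lambda>p q. Qs \<xi> u p q + Qreg \<xi> t (z + u) z p q) (Mreg \<xi> b t c \<delta> (z + u) z) (\<gamma>2 \<alpha> \<beta>) xs)"
proof -
  have "expn \<xi> w b (\<lambda>t c z \<delta> u. \<Sum>s\<leftarrow>splits xs. gm (Qs \<xi> u) (\<lambda>_. 0) (\<gamma>2 \<alpha> \<beta>) (fst s) *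
      gm (Qreg \<xi> t (z + u) z) (Mreg \<xi> b t c \<delta> (z + u) z) (\<gamma>2 \<alpha> \<beta>) (snd s))"
    by (intro expn_sum_list expn_ospan_regular ospan_gm_Qs)
  then show ?thesis
  proof (rule expn_cong)
    fix t c z \<delta> assume c: "flow_chart \<xi> w t c" and \<delta>: "source \<delta>" and z: "z \<in> sdom c \<delta>"
    have dom: "x \<in> fdom \<xi> t" if "x \<in> sdom c \<delta>" for x using that c_fdom[OF c] by (auto simp: sdom_def)
    show "\<forall>\<^sub>F u in at 0. (\<Sum>s\<leftarrow>splits xs. gm (Qs \<xi> u) (\<lambda>_. 0) (\<gamma>2 \<alpha> \<beta>) (fst s) *
      gm (Qreg \<xi> t (z + u) z) (Mreg \<xi> b t c \<delta> (z + u) z) (\<gamma>2 \<alpha> \<beta>) (snd s)) =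
      gm (\<lambda>p q. Qs \<xi> u p q + Qreg \<xi> t (z + u) z p q) (Mreg \<xi> b t c \<delta> (z + u) z) (\<gamma>2 \<alpha> \<beta>) xs"
      using eventually_near(1)[OF sdom_open[OF c] z]
    proof eventually_elim
      case (elim u)
      have "Qreg \<xi> t (z + u) z x y = Qreg \<xi> t (z + u) z y x" for x y
        using dom[OF elim] dom[OF z] er_symmetric[of "pt (z + u) z (fst x)" \<xi> t "pt (z + u) z (fst y)" "snd x" "snd y"]
        by (auto simp: Qreg_def pt_def)
      moreover have "Qs \<xi> u x y = Qs \<xi> u y x" for x y by (simp add: Qs_def)
      ultimately have "gm (\<lambda>p q. Qs \<xi> u p q + Qreg \<xi> t (z + u) z p q) (\<lambda>p. 0 + Mreg \<xi> b t c \<delta> (z + u) z p) (\<gamma>2 \<alpha> \<beta>) xs =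
         conv (gm (Qs \<xi> u) (\<lambda>_. 0)) (gm (Qreg \<xi> t (z + u) z) (Mreg \<xi> b t c \<delta> (z + u) z)) (\<gamma>2 \<alpha> \<beta>) xs"
        by (intro gm_add)
      then show ?case by (simp add: conv_def case_prod_unfold)
    qed
  qed
qed

lemma correlation_pair:
  assumes F: "good \<xi> w b F T" and G: "good \<xi> w b G U" and c: "flow_chart \<xi> w t c" and \<delta>: "source \<delta>"
    and \<zeta>: "\<zeta> \<in> sdom c \<delta>" and z: "z \<in> sdom c \<delta>" and ne: "\<zeta> \<noteq> z"
  shows "expect (field_at F c \<zeta> \<star> field_at G c z \<star> Poly_Mapping.single ({#}, \<delta>) 1) =
    (\<Sum>(d, \<gamma>, zs)\<leftarrow>choices (\<lambda>i. if i = 0 then T else U) [0, 1].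
       d * gm (\<lambda>p q. Qs \<xi> (\<zeta> - z) p q + Qreg \<xi> t \<zeta> z p q) (Mreg \<xi> b t c \<delta> \<zeta> z) \<gamma> zs)"
proof -
  have d: "\<zeta> \<in> chart_dom c" "z \<in> chart_dom c" using \<zeta> z by (simp_all add: sdom_def)
  note f = c_fdom[OF c d(1)] c_fdom[OF c d(2)]
  define jet where "jet i = cjet c (pt \<zeta> z i)" for i
  define nd where "nd i = Jet id 0 0 (chart_par c (pt \<zeta> z i))" for i
  define R where "R i = Rj \<xi> t (pt \<zeta> z i)" for i
  define \<mu> where "\<mu> i = Mj \<xi> b t (pt \<zeta> z i)" for i
  define x where "x i = (if i = 0 then F c \<zeta> else G c z)" for i :: nat
  define TT where "TT i = (if i = 0 then T else U)" for i :: nat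
  interpret correlation jet nd R \<mu> x TT "{0, 1}"
  proof
    show "R i a b = R i b a" for i a b using f by (simp add: R_def pt_def Rj_sym)
    show "represents (R i) (\<mu> i) (x i) (TT i)" if "i \<in> {0, 1}" for i
      using F G c d that by (auto simp: good_def R_def \<mu>_def x_def TT_def pt_def)
    show "adm (\<lambda>a. pair_exp (jet i a) (jet k b))" "adm (\<lambda>b. pair_exp (jet i a) (jet k b))"
      if "i \<in> {0, 1}" "k \<in> {0, 1}" "i < k" for i k a b
      using that adm_flow[OF c d ne] by (auto simp: jet_def pt_def)
  qed (simp_all add: nd_def jet_def pair_exp_node)
  have "expect (field_at F c \<zeta> \<star> field_at G c z \<star> Poly_Mapping.single ({#}, \<delta>) 1) =
    ev (\<lambda>g. lin \<delta> (pair_exp g)) (foldr (\<star>) (map (\<lambda>i. field_functional (jet i) (nd i) (x i)) [0, 1]) 1)"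
    by (simp add: expect_fprod_exp fprod_one_right field_at_eq jet_def nd_def x_def pt_def)
  also have "ev (\<lambda>g. lin \<delta> (pair_exp g)) (foldr (\<star>) (map (\<lambda>i. field_functional (jet i) (nd i) (x i)) [0, 1]) 1) =
      (\<Sum>(d, \<gamma>, zs)\<leftarrow>choices TT [0, 1]. d * gm Qc (Mc (\<lambda>g. lin \<delta> (pair_exp g))) \<gamma> zs)"
  proof (rule ev_product)
    fix i assume "i \<in> set [0, 1 :: nat]"
    show "lin \<delta> (pair_exp (nd i)) = lin \<delta> (pair_exp (jet i (0, 0)))"
      by (rule lin_cong) (rule nd_left)
    have "pt \<zeta> z i \<in> sdom c \<delta>" using \<zeta> z by (simp add: pt_def)
    from src_adm[OF c \<delta> this] show "adm (\<lambda>a. lin \<delta> (pair_exp (jet i a)))" by (simp add: src_def[abs_def] jet_def)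
  qed auto
  also have "\<dots> = (\<Sum>(d, \<gamma>, zs)\<leftarrow>choices TT [0, 1].
       d * gm (\<lambda>p q. Qs \<xi> (\<zeta> - z) p q + Qreg \<xi> t \<zeta> z p q) (Mreg \<xi> b t c \<delta> \<zeta> z) \<gamma> zs)"
  proof (intro arg_cong[where f = sum_list] map_cong refl, clarify)
  fix d \<gamma> zs assume *: "(d, \<gamma>, zs) \<in> set (choices TT [0, 1])"
  have "gm Qc (Mc (\<lambda>g. lin \<delta> (pair_exp g))) \<gamma> zs = gm (\<lambda>p q. Qs \<xi> (\<zeta> - z) p q + Qreg \<xi> t \<zeta> z p q) (Mreg \<xi> b t c \<delta> \<zeta> z) \<gamma> zs"
  proof (rule gm_cong)
    from choices_subset[OF *] have 01: "fst p = 0 \<or> fst p = 1" if "p \<in> set zs \<union> Poly_Mapping.keys \<gamma>" for p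
      using that by auto
    show "Qc p q = Qs \<xi> (\<zeta> - z) p q + Qreg \<xi> t \<zeta> z p q"
      if "p \<in> set zs \<union> Poly_Mapping.keys \<gamma>" "q \<in> set zs \<union> Poly_Mapping.keys \<gamma>" for p q
      using 01[OF that(1)] 01[OF that(2)] f ne
      by (cases p; cases q) (auto simp: Qs_def Qreg_def pt_def jet_def R_def Rj_def pair_exp_flow[OF c d ne]
          ej_el_shift[OF ne, of _ _ _ t] er_symmetric[of z \<xi> t \<zeta>])
    show "Mc (\<lambda>g. lin \<delta> (pair_exp g)) p = Mreg \<xi> b t c \<delta> \<zeta> z p" if "p \<in> set zs \<union> Poly_Mapping.keys \<gamma>" for p
      by (simp add: Mc_def Mreg_def src_def jet_def \<mu>_def case_prod_unfold)
  qed
  then show "d * gm Qc (Mc (\<lambda>g. lin \<delta> (pair_exp g))) \<gamma> zs = d * gm (\<lambda>p q. Qs \<xi> (\<zeta> - z) p q + Qreg \<xi> t \<zeta> z p q) (Mreg \<xi> b t c \<delta> \<zeta> z) \<gamma> zs" by simp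
  qed
  finally show ?thesis unfolding TT_def[abs_def] .
qed

lemma choices_\<gamma>2: "(d, \<gamma>, zs) \<in> set (choices T [0, 1]) \<Longrightarrow> \<exists>\<alpha> \<beta>. \<gamma> = \<gamma>2 \<alpha> \<beta>"
  by (auto simp: \<gamma>2_def)

lemma good_ope:
  assumes F: "good \<xi> w b F T" and G: "good \<xi> w b G U" and H: "is_ope_product w F G H"
  shows "\<exists>V. good \<xi> w b H V"
proof -
  have "expn \<xi> w b (\<lambda>t c z \<delta> u. \<Sum>l\<leftarrow>choices (\<lambda>i. if i = 0 then T else U) [0, 1].
       fst l * gm (\<lambda>p q. Qs \<xi> u p q + Qreg \<xi> t (z + u) z p q) (Mreg \<xi> b t c \<delta> (z + u) z) (fst (snd l)) (snd (snd l)))"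
  proof (intro expn_sum_list expn_scale)
    fix l assume "l \<in> set (choices (\<lambda>i. if i = 0 then T else U) [0, 1])"
    then obtain \<alpha> \<beta> where "fst (snd l) = \<gamma>2 \<alpha> \<beta>" using choices_\<gamma>2 by (metis prod.collapse)
    then show "expn \<xi> w b (\<lambda>t c z \<delta> u. gm (\<lambda>p q. Qs \<xi> u p q + Qreg \<xi> t (z + u) z p q) (Mreg \<xi> b t c \<delta> (z + u) z) (fst (snd l)) (snd (snd l)))"
      using expn_total by simp
  qed
  then have "expn \<xi> w b (\<lambda>t c z \<delta> u. expect (field_at F c (z + u) \<star> field_at G c z \<star> Poly_Mapping.single ({#}, \<delta>) 1))"
  proof (rule expn_cong)
    fix t c z \<delta> assume c: "flow_chart \<xi> w t c" and \<delta>: "source \<delta>" and z: "z \<in> sdom c \<delta>"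
    have "\<forall>\<^sub>F u in at (0 :: complex). u \<noteq> 0" by (simp add: eventually_at_filter)
    then show "\<forall>\<^sub>F u in at 0. (\<Sum>l\<leftarrow>choices (\<lambda>i. if i = 0 then T else U) [0, 1].
       fst l * gm (\<lambda>p q. Qs \<xi> u p q + Qreg \<xi> t (z + u) z p q) (Mreg \<xi> b t c \<delta> (z + u) z) (fst (snd l)) (snd (snd l))) =
       expect (field_at F c (z + u) \<star> field_at G c z \<star> Poly_Mapping.single ({#}, \<delta>) 1)"
      using eventually_near(1)[OF sdom_open[OF c] z]
    proof eventually_elim
      case (elim u)
      then show ?case using correlation_pair[OF F G c \<delta> _ z, of "z + u"] by (simp add: case_prod_unfold)
    qed
  qed
  then show ?thesis using ope_coefficient[OF H, where \<xi> = \<xi> and b = b] unfolding expn_def by blast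
qed

section \<open>OPE powers and the OPE exponential of the field\<close>

lemma picks_replicate: "(y, ys) \<in> set (picks (replicate n x)) \<Longrightarrow> y = x \<and> set ys \<subseteq> {x}"
proof -
  assume "(y, ys) \<in> set (picks (replicate n x))"
  from picks_set[OF this] have "insert y (set ys) \<subseteq> {x}" by (simp add: set_replicate_conv_if)
  then show ?thesis by blast
qed

lemma tendsto_sum_list:
  fixes f :: "'k \<Rightarrow> 'a \<Rightarrow> 'b :: topological_monoid_add"
  shows "(\<And>k. k \<in> set ks \<Longrightarrow> (f k \<longlongrightarrow> l k) F) \<Longrightarrow> ((\<lambda>u. \<Sum>k\<leftarrow>ks. f k u) \<longlongrightarrow> (\<Sum>k\<leftarrow>ks. l k)) F"
  by (induction ks) (auto intro!: tendsto_add)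

text \<open>For the exponential series the list of terms must be explicit, whereas
  \<open>good_ope\<close> only gives its existence. The terms with log |u| are the singular pairings
  of the new field; without them the canonical power remains.\<close>

lemma good_phi_power:
  assumes H: "is_ope_product w (phi_b b) G H" and G: "good \<xi> w b G [(1, replicate n (0, 0), 0)]"
  shows "good \<xi> w b H [(1, replicate (Suc n) (0, 0), 0)]"
proof -
  define P where "P = picks (replicate n (0 :: nat, 0 :: nat))"
  \<comment> \<open>The coefficient -2 comes from the singular part 2 \<open>el\<close> = -2 log
    |u|, whose index is (0, 0, 1).\<close>
  define U :: "(complex \<times> ope_index \<times> (nat \<times> nat) list \<times> complex) list" where "U = (1, (0, 0, 0), replicate (Suc n) (0, 0), 0) # map (\<lambda>p. (- 2, (0, 0, 1), snd p, 0 :: complex)) P"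
  have "good \<xi> w b H (coef U)"
  proof (rule ope_coefficient[OF H])
    fix t c z \<delta> assume c: "flow_chart \<xi> w t c" and \<delta>: "source \<delta>" and z: "z \<in> sdom c \<delta>"
    define m where "m \<zeta> a = src c \<delta> \<zeta> a + Mj \<xi> b t \<zeta> a" for \<zeta> a
    let ?\<Phi> = "gm (Rj \<xi> t z) (m z) 0"
    let ?E = "\<lambda>u. expect (field_at (phi_b b) c (z + u) \<star> field_at G c z \<star> Poly_Mapping.single ({#}, \<delta>) 1)"
    define D where "D u = (m (z + u) (0, 0) - m z (0, 0)) * ?\<Phi> (replicate n (0, 0)) +
        (\<Sum>p\<leftarrow>P. (2 * ej \<xi> er (0, 0) (0, 0) (t, z + u, z) - Rj \<xi> t z (0, 0) (0, 0)) * ?\<Phi> (snd p))" for u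
    have zd: "z \<in> fdom \<xi> t" using z c_fdom[OF c] by (simp add: sdom_def)
    have us: "usum U (gm (Rj \<xi> t z) (m z)) u = m z (0, 0) * ?\<Phi> (replicate n (0, 0)) + (\<Sum>p\<leftarrow>P. Rj \<xi> t z (0, 0) (0, 0) * ?\<Phi> (snd p)) +
        (\<Sum>p\<leftarrow>P. - 2 * of_real (ln (cmod u)) * ?\<Phi> (snd p))" if "u \<noteq> 0" for u
    proof -
      have "(\<Sum>(y, ys)\<leftarrow>P. Rj \<xi> t z (0, 0) y * ?\<Phi> ys) = (\<Sum>p\<leftarrow>P. Rj \<xi> t z (0, 0) (0, 0) * ?\<Phi> (snd p))"
        by (intro arg_cong[where f = sum_list] map_cong refl) (use picks_replicate in \<open>fastforce simp: P_def\<close>)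
      then have "?\<Phi> (replicate (Suc n) (0, 0)) = m z (0, 0) * ?\<Phi> (replicate n (0, 0)) + (\<Sum>p\<leftarrow>P. Rj \<xi> t z (0, 0) (0, 0) * ?\<Phi> (snd p))"
        by (simp add: gm_Cons P_def)
      moreover have "ope_fun (0, 0, 1) u = of_real (ln (cmod u))" using that by (simp add: ope_fun.simps)
      ultimately show ?thesis using that by (simp add: usum_def U_def o_def)
    qed
    have E: "?E u - usum U (gm (Rj \<xi> t z) (m z)) u = D u" if u: "u \<noteq> 0" "z + u \<in> sdom c \<delta>" for u
    proof -
      let ?Q = "\<lambda>p q. Qs \<xi> u p q + Qreg \<xi> t (z + u) z p q" and ?M = "Mreg \<xi> b t c \<delta> (z + u) z"
      have one: "gm ?Q ?M 0 (map (Pair 1) ys) = ?\<Phi> ys" for ys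
      proof -
        have "gm (\<lambda>p q. Rj \<xi> t z (snd p) (snd q)) (m z \<circ> snd) 0 (map (Pair (1 :: nat)) ys) = gm (Rj \<xi> t z) (m z) 0 (map snd (map (Pair (1 :: nat)) ys))"
          by (rule gm_reindex) simp
        moreover have "gm ?Q ?M 0 (map (Pair 1) ys) = gm (\<lambda>p q. Rj \<xi> t z (snd p) (snd q)) (m z \<circ> snd) 0 (map (Pair (1 :: nat)) ys)"
          by (rule gm_cong) (auto simp: Qs_def Qreg_def pt_def Rj_def Mreg_def m_def)
        ultimately show ?thesis by (simp add: o_def)
      qed
      have "?E u = gm ?Q ?M 0 ((0, 0, 0) # map (Pair 1) (replicate n (0, 0)))"
        using correlation_pair[OF good_phi G c \<delta> u(2) z] u(1) by simp
      also have "\<dots> = m (z + u) (0, 0) * ?\<Phi> (replicate n (0, 0)) +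
         (\<Sum>(y, ys)\<leftarrow>picks (map (Pair 1) (replicate n (0, 0))). ?Q (0, 0, 0) y * gm ?Q ?M 0 ys)"
        unfolding gm_Cons one by (simp add: Mreg_def m_def pt_def)
      also have "(\<Sum>(y, ys)\<leftarrow>picks (map (Pair 1) (replicate n (0, 0))). ?Q (0, 0, 0) y * gm ?Q ?M 0 ys) =
         (\<Sum>(y, ys)\<leftarrow>P. ?Q (0, 0, 0) (1, y) * ?\<Phi> ys)"
        unfolding picks_map P_def[symmetric] by (simp add: o_def case_prod_unfold one[simplified])
      finally have "?E u = m (z + u) (0, 0) * ?\<Phi> (replicate n (0, 0)) + (\<Sum>(y, ys)\<leftarrow>P. ?Q (0, 0, 0) (1, y) * ?\<Phi> ys)" .
      moreover have "(\<Sum>(y, ys)\<leftarrow>P. ?Q (0, 0, 0) (1, y) * ?\<Phi> ys) = (\<Sum>p\<leftarrow>P. (2 * ej \<xi> er (0, 0) (0, 0) (t, z + u, z) - 2 * of_real (ln (cmod u))) * ?\<Phi> (snd p))"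
        by (intro arg_cong[where f = sum_list] map_cong refl)
          (use picks_replicate in \<open>fastforce simp: P_def Qs_def Qreg_def pt_def el_def\<close>)
      moreover have neg: "(\<Sum>p\<leftarrow>P. - 2 * of_real (ln (cmod u)) * ?\<Phi> (snd p)) = - (\<Sum>p\<leftarrow>P. 2 * of_real (ln (cmod u)) * ?\<Phi> (snd p))"
        by (induction P) (auto simp: algebra_simps)
      ultimately show ?thesis unfolding us[OF u(1)] neg D_def by (simp add: algebra_simps sum_list_addf sum_list_subtractf)
    qed
    have cont: "isCont (\<lambda>\<zeta>. m \<zeta> (0, 0)) z" "isCont (\<lambda>\<zeta>. 2 * ej \<xi> er (0, 0) (0, 0) (t, \<zeta>, z)) z"
      using hw_add[OF src_hw[OF c \<delta> z, of 0 0] Mj_hw[OF zd, of b "(0, 0)"]]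
        hw_scale[OF ej_hw_x[OF valid_er[OF zd zd], of 0 0 "(0, 0)"], of 2]
      unfolding hw_def m_def by (blast intro: has_derivative_continuous)+
    have lim: "((\<lambda>u. m (z + u) (0, 0)) \<longlongrightarrow> m z (0, 0)) (at 0)"
      "((\<lambda>u. 2 * ej \<xi> er (0, 0) (0, 0) (t, z + u, z)) \<longlongrightarrow> Rj \<xi> t z (0, 0) (0, 0)) (at 0)"
      using cont[unfolded isCont_def, THEN LIM_offset_zero] by (simp_all add: Rj_def)
    have "(D \<longlongrightarrow> (m z (0, 0) - m z (0, 0)) * ?\<Phi> (replicate n (0, 0)) +
        (\<Sum>p\<leftarrow>P. (Rj \<xi> t z (0, 0) (0, 0) - Rj \<xi> t z (0, 0) (0, 0)) * ?\<Phi> (snd p))) (at 0)"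
      unfolding D_def by (intro tendsto_intros tendsto_sum_list lim)
    then have "(D \<longlongrightarrow> 0) (at 0)" by simp
    then show "((\<lambda>u. ?E u - usum U (gm (Rj \<xi> t z) (\<lambda>a. src c \<delta> z a + Mj \<xi> b t z a)) u) \<longlongrightarrow> 0) (at 0)"
    proof (rule Lim_transform_eventually)
      have "\<forall>\<^sub>F u in at (0 :: complex). u \<noteq> 0" by (simp add: eventually_at_filter)
      then show "\<forall>\<^sub>F u in at 0. D u = ?E u - usum U (gm (Rj \<xi> t z) (\<lambda>a. src c \<delta> z a + Mj \<xi> b t z a)) u"
        using eventually_near(1)[OF sdom_open[OF c] z]
        by eventually_elim (simp add: E[symmetric] m_def[abs_def])
    qed
  qed
  moreover have "coef U = [(1, replicate (Suc n) (0, 0), 0)]"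
    unfolding U_def coef_def by (simp add: filter_map o_def)
  ultimately show ?thesis by simp
qed

text \<open>The power series in \<alpha> of an entire function, whose derivatives at 0 are the
  moments by \<open>coh\<close>.\<close>

lemma gexp_series:
  assumes "\<And>x y. R x y = R y x"
  shows "(\<lambda>n. \<alpha> ^ n / fact n * gm R m 0 (replicate n x)) sums gexp R m (Poly_Mapping.single x \<alpha>)"
proof -
  define \<phi> where "\<phi> n s = gm R m (Poly_Mapping.single x s) (replicate n x)" for n s
  have coh: "coh (gm R m)" by (rule coh_gm) (rule assms)
  have d: "(\<phi> n has_field_derivative \<phi> (Suc n) s) (at s)" for n s
  proof -
    have "((\<lambda>h. gm R m (Poly_Mapping.single x s + Poly_Mapping.single x h) (replicate n x)) has_field_derivative
        gm R m (Poly_Mapping.single x s) (x # replicate n x)) (at 0)"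
      using coh unfolding coh_def by blast
    then have "((\<lambda>h. \<phi> n (h + s)) has_field_derivative \<phi> (Suc n) s) (at 0)"
      by (simp add: \<phi>_def single_add[symmetric] add.commute)
    then show ?thesis using DERIV_at_within_shift[of "\<phi> n" "\<phi> (Suc n) s" s 0 UNIV] by (simp add: add.commute)
  qed
  have der: "(deriv ^^ n) (\<phi> 0) = \<phi> n" for n
    by (induction n) (auto intro!: ext DERIV_imp_deriv d)
  have "\<phi> 0 holomorphic_on ball 0 (cmod \<alpha> + 1)"
    by (rule holomorphic_on_subset[of _ UNIV]) (auto simp: holomorphic_on_open intro: d)
  from holomorphic_power_series[OF this, of \<alpha>]
  have "(\<lambda>n. (deriv ^^ n) (\<phi> 0) 0 / fact n * (\<alpha> - 0) ^ n) sums \<phi> 0 \<alpha>" by simp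
  then show ?thesis unfolding der by (simp add: \<phi>_def gm.simps(1) mult.commute)
qed

lemma good_exp:
  assumes V: "is_ope_exp w \<alpha> (phi_b b) V"
  shows "good \<xi> w b V [(1, [], \<alpha>)]"
proof -
  obtain P where P: "P 0 = (\<lambda>c \<zeta>. 1)" "\<And>n. is_ope_product w (phi_b b) (P n) (P (Suc n))"
    and S: "\<And>c \<zeta> \<Y>. is_chart w c \<Longrightarrow> \<zeta> \<in> chart_dom c \<Longrightarrow> functional_on (\<H> - {chart_par c \<zeta>}) \<Y> \<Longrightarrow>
          (\<lambda>n. \<alpha> ^ n / fact n * expect (field_at (P n) c \<zeta> \<star> \<Y>)) sums expect (field_at V c \<zeta> \<star> \<Y>)"
    using V unfolding is_ope_exp_def by blast
  have good: "good \<xi> w b (P n) [(1, replicate n (0, 0), 0)]" for n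
  proof (induction n)
    case 0
    then show ?case using good_one by (simp add: P(1))
  next
    case (Suc n)
    from good_phi_power[OF P(2) this] show ?case .
  qed
  show ?thesis
  proof (rule goodI)
    fix t c \<zeta> \<delta> assume c: "flow_chart \<xi> w t c" and \<delta>: "source \<delta>" and \<zeta>: "\<zeta> \<in> sdom c \<delta>"
    let ?m = "\<lambda>a. src c \<delta> \<zeta> a + Mj \<xi> b t \<zeta> a"
    have d: "\<zeta> \<in> chart_dom c" "functional_on (\<H> - {chart_par c \<zeta>}) (Poly_Mapping.single ({#}, \<delta>) 1)"
      using \<zeta> \<delta> by (simp_all add: sdom_def functional_on_source)
    from S[OF c_chart[OF c] d]
    have "(\<lambda>n. \<alpha> ^ n / fact n * gm (Rj \<xi> t \<zeta>) ?m 0 (replicate n (0, 0))) sums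
        expect (field_at V c \<zeta> \<star> Poly_Mapping.single ({#}, \<delta>) 1)"
      unfolding expect_good[OF good c \<delta> \<zeta>] by (simp add: tsum_def)
    moreover have "(\<lambda>n. \<alpha> ^ n / fact n * gm (Rj \<xi> t \<zeta>) ?m 0 (replicate n (0, 0))) sums gexp (Rj \<xi> t \<zeta>) ?m (Poly_Mapping.single (0, 0) \<alpha>)"
      by (rule gexp_series) (rule Rj_sym[OF c_fdom[OF c d(1)]])
    ultimately show "expect (field_at V c \<zeta> \<star> Poly_Mapping.single ({#}, \<delta>) 1) = tsum [(1, [], \<alpha>)] (gm (Rj \<xi> t \<zeta>) ?m)"
      using sums_unique2 by (simp add: tsum_def gm.simps(1)) blast
  qed
qed

theorem good_family:
  assumes "F \<in> ope_family w b"
  shows "\<exists>T. good \<xi> w b F T"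
  using assms
proof induction
  case one
  then show ?case using good_one by blast
next
  case (deriv_phi j k G)
  then show ?case using good_deriv[OF good_phi] by blast
next
  case (deriv_exp \<alpha> V j k G)
  then show ?case using good_deriv[OF good_exp] by blast
next
  case (scale F r)
  then show ?case using good_scale by blast
next
  case (add F G)
  then show ?case using good_add by blast
next
  case (ope F G H)
  then show ?case using good_ope by blast
qed

section \<open>The conformal map and the flow\<close>

text \<open>After a Cayley transform, the Schwarz lemma for \<open>w\<close> and its inverse shows that \<open>w\<close> is a rotation of the disc, and the fixed boundary point excludes all rotations but the identity.\<close>

lemma affine_of_conformal:
  assumes w: "conformal_fixing_infinity w"
  obtains c :: real where "c > 0" "\<And>z. z \<in> \<H> \<Longrightarrow> (w has_field_derivative of_real c) (at z)"
proof -
  have hol: "w holomorphic_on \<H>" and bij: "bij_betw w \<H> \<H>" and lim: "filterlim w at_infinity (inf at_infinity (principal \<H>))"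
    using w by (auto simp: conformal_fixing_infinity_def)
  have oH: "open \<H>" by (simp add: upper_half_plane_def open_halfspace_Im_gt)
  define a where "a = w \<i>"
  have aH: "Im a > 0" using bij_betwE[OF bij] by (auto simp: a_def upper_half_plane_def)
  have wH: "Im (w z) > 0" if "Im z > 0" for z using bij_betwE[OF bij] that by (auto simp: upper_half_plane_def)
  have ne: "w z \<noteq> cnj a" if "Im z > 0" for z using upper_ne(1)[OF wH[OF that] aH] .
  \<comment> \<open>Cayley transform from the disc to the half-plane; it sends 0 to i, and its
    inverse is (z - i) / (z + i).\<close>
  let ?C = "\<lambda>s. \<i> * (1 + s) / (1 - s)"
  have CH: "Im (?C s) > 0" if "cmod s < 1" for s
  proof -
    have s: "s \<noteq> 1" using that by auto
    have "Im (?C s) = (1 - ((Re s)\<^sup>2 + (Im s)\<^sup>2)) / ((Re (1 - s))\<^sup>2 + (Im (1 - s))\<^sup>2)"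
      by (simp add: Im_divide power2_eq_square algebra_simps)
    moreover have "(Re s)\<^sup>2 + (Im s)\<^sup>2 < 1" using that unfolding cmod_power2[symmetric] by (simp add: power_less_one_iff abs_square_less_1)
    moreover have "(Re (1 - s))\<^sup>2 + (Im (1 - s))\<^sup>2 > 0"
      using s by (auto simp: sum_power2_gt_zero_iff complex_eq_iff)
    ultimately show ?thesis by (simp del: minus_complex.sel)
  qed
  have cay: "cmod ((z - p) / (z - cnj p)) < 1" if "Im z > 0" "Im p > 0" for z p
  proof -
    have "(cmod (z - p))\<^sup>2 < (cmod (z - cnj p))\<^sup>2"
      using mult_pos_pos[OF that] unfolding cmod_power2 by (simp add: power2_eq_square algebra_simps)
    then have "cmod (z - p) < cmod (z - cnj p)" by (rule power2_less_imp_less) simp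
    then show ?thesis using upper_ne(1)[OF that] by (simp add: norm_divide)
  qed
  define g where "g s = (w (?C s) - a) / (w (?C s) - cnj a)" for s
  have g_hol: "g holomorphic_on ball 0 1"
  proof -
    have "(w \<circ> ?C) holomorphic_on ball 0 1"
      by (rule holomorphic_on_compose_gen[OF _ hol]) (auto intro!: holomorphic_intros CH simp: upper_half_plane_def)
    then have "(\<lambda>s. w (?C s)) holomorphic_on ball 0 1" by (simp add: o_def)
    then show ?thesis unfolding g_def by (intro holomorphic_intros) (use ne CH in auto)
  qed
  have g0: "g 0 = 0" by (simp add: g_def a_def)
  have g1: "cmod (g s) < 1" if "cmod s < 1" for s unfolding g_def by (rule cay[OF wH[OF CH[OF that]] aH])
  have inj: "inj_on g (ball 0 1)"
  proof (rule inj_onI)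
    fix s t assume st: "s \<in> ball 0 1" "t \<in> ball 0 (1 :: real)" "g s = g t"
    then have n: "cmod s < 1" "cmod t < 1" by auto
    have n1: "s \<noteq> 1" "t \<noteq> 1" using n by auto
    have "(w (?C s) - a) * (w (?C t) - cnj a) = (w (?C t) - a) * (w (?C s) - cnj a)"
      using st(3) ne[OF CH[OF n(1)]] ne[OF CH[OF n(2)]] unfolding g_def by (simp add: frac_eq_eq)
    then have "(a - cnj a) * (w (?C s) - w (?C t)) = 0" by (simp add: algebra_simps)
    moreover have "a - cnj a \<noteq> 0" using aH by (auto simp: complex_eq_iff)
    ultimately have "w (?C s) = w (?C t)" by simp
    then have "?C s = ?C t" using inj_onD[OF bij_betw_imp_inj_on[OF bij]] CH[OF n(1)] CH[OF n(2)]
      by (auto simp: upper_half_plane_def)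
    then show "s = t" using n1 by (simp add: frac_eq_eq) (simp add: algebra_simps)
  qed
  have surj: "\<exists>s. cmod s < 1 \<and> g s = r" if r: "cmod r < 1" for r
  proof -
    have r1: "r \<noteq> 1" using r by auto
    \<comment> \<open>The solution of (y - a) / (y - cnj a) = r, that is, the value that w has to
      attain.\<close>
    define y where "y = (a - r * cnj a) / (1 - r)"
    have "y = of_real (Re a) + of_real (Im a) * ?C r"
      unfolding y_def using r1 by (simp add: divide_simps) (simp add: complex_eq_iff algebra_simps)
    moreover have "Im (of_real p + of_real q * x) = q * Im x" for p q x by simp
    ultimately have "Im y = Im a * Im (?C r)" by (simp only:)
    then have "Im y > 0" using CH[OF r] aH by (simp only: mult_pos_pos)
    then obtain z where z: "Im z > 0" "w z = y" using bij_betw_imp_surj_on[OF bij]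
      by (metis (mono_tags, lifting) image_iff mem_Collect_eq upper_half_plane_def)
    define s where "s = (z - \<i>) / (z + \<i>)"
    have zi: "z + \<i> \<noteq> 0" using z(1) by (auto simp: complex_eq_iff)
    have "1 - s = 2 * \<i> / (z + \<i>)" "1 + s = 2 * z / (z + \<i>)" using zi by (simp_all add: s_def divide_simps)
    then have "?C s = z" using zi by simp
    moreover have "cmod s < 1" using cay[OF z(1), of \<i>] by (simp add: s_def)
    moreover have "(y - a) / (y - cnj a) = r"
    proof -
      have "y - a = r * (a - cnj a) / (1 - r)" "y - cnj a = (a - cnj a) / (1 - r)"
        using r1 by (simp_all add: y_def divide_simps algebra_simps)
      moreover have "a - cnj a \<noteq> 0" using aH by (auto simp: complex_eq_iff)
      ultimately show ?thesis using r1 by simp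
    qed
    ultimately show ?thesis using z by (auto simp: g_def)
  qed
  obtain h where h: "h holomorphic_on g ` ball 0 1" "\<And>s. s \<in> ball 0 1 \<Longrightarrow> h (g s) = s"
    using holomorphic_has_inverse[OF g_hol open_ball inj] by metis
  have im: "g ` ball 0 1 = ball 0 1" using g1 surj by (force simp: image_iff)
  have h1: "cmod (h r) < 1" if "cmod r < 1" for r
    using surj[OF that] h(2) by force
  have h0: "h 0 = 0" using h(2)[of 0] by (simp add: g0)
  have "cmod (h r) \<le> cmod r" if "cmod r < 1" for r
    by (rule Schwarz_Lemma(1)[OF h(1)[unfolded im] h0 h1 that])
  then have ge: "cmod s \<le> cmod (g s)" if "cmod s < 1" for s using g1[OF that] h(2)[of s] that by force
  have le: "cmod (g s) \<le> cmod s" if "cmod s < 1" for s by (rule Schwarz_Lemma(1)[OF g_hol g0 g1 that])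
  \<comment> \<open>Equality in the Schwarz lemma at one point of the disc other than 0 already
    forces a rotation; 1/2 is such a point.\<close>
  have "cmod (g (1/2)) = cmod (1/2)" by (intro antisym le ge) auto
  then have "\<exists>\<alpha>. (\<forall>z. cmod z < 1 \<longrightarrow> g z = \<alpha> * z) \<and> cmod \<alpha> = 1"
    by (intro Schwarz_Lemma(3)[OF g_hol g0 g1, of "1/2"] disjI1 exI[of _ "1/2"]) auto
  then obtain \<alpha> where \<alpha>: "\<And>z. cmod z < 1 \<Longrightarrow> g z = \<alpha> * z" by blast
  have W: "(w z - a) / (w z - cnj a) = \<alpha> * ((z - \<i>) / (z + \<i>))" if z: "Im z > 0" for z
  proof -
    define s where "s = (z - \<i>) / (z + \<i>)"
    have zi: "z + \<i> \<noteq> 0" using z(1) by (auto simp: complex_eq_iff)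
    have "1 - s = 2 * \<i> / (z + \<i>)" "1 + s = 2 * z / (z + \<i>)" using zi by (simp_all add: s_def divide_simps)
    then have "?C s = z" using zi by simp
    moreover have "cmod s < 1" using cay[OF z(1), of \<i>] by (simp add: s_def)
    ultimately show ?thesis using \<alpha>[of s] unfolding g_def s_def[symmetric] by simp
  qed
  have "\<alpha> = 1"
  proof -
    \<comment> \<open>Along the imaginary axis the left side of \<open>W\<close> tends to 1, because
      w tends to infinity, and the right side to \<open>\<alpha>\<close>.\<close>
    let ?z = "\<lambda>y :: real. \<i> * of_real y"
    have "filterlim ?z (inf at_infinity (principal \<H>)) at_top"
    proof (subst filterlim_inf, intro conjI)
      have "filterlim (\<lambda>y. norm (?z y)) at_top at_top"
        by (rule filterlim_at_top_mono[OF filterlim_ident]) (auto simp: norm_mult intro!: always_eventually)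
      then show "filterlim ?z at_infinity at_top" by (rule filterlim_norm_at_top_imp_at_infinity)
      show "filterlim ?z (principal \<H>) at_top"
        unfolding filterlim_principal using eventually_gt_at_top[of 0] by eventually_elim (simp add: upper_half_plane_def)
    qed
    from filterlim_compose[OF lim this] have wl: "filterlim (\<lambda>y. w (?z y)) at_infinity at_top" .
    have "filterlim (\<lambda>y. w (?z y) - cnj a) at_infinity at_top"
      using tendsto_add_filterlim_at_infinity'[OF wl tendsto_const[of "- cnj a"]] by simp
    from tendsto_divide_0[OF tendsto_const[of "cnj a - a"] this]
    have "((\<lambda>y. 1 + (cnj a - a) / (w (?z y) - cnj a)) \<longlongrightarrow> 1 + 0) at_top" by (intro tendsto_intros)
    moreover have "\<forall>\<^sub>F y in at_top. 1 + (cnj a - a) / (w (?z y) - cnj a) = \<alpha> * ((?z y - \<i>) / (?z y + \<i>))"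
      using eventually_gt_at_top[of 0]
    proof eventually_elim
      case (elim y)
      then have y: "Im (?z y) > 0" by simp
      have "1 + (cnj a - a) / (w (?z y) - cnj a) = (w (?z y) - a) / (w (?z y) - cnj a)" using ne[OF y] by (simp add: divide_simps)
      then show ?case using W[OF y] by simp
    qed
    ultimately have 1: "((\<lambda>y. \<alpha> * ((?z y - \<i>) / (?z y + \<i>))) \<longlongrightarrow> 1) at_top"
      using Lim_transform_eventually by fastforce
    have "((\<lambda>y :: real. (y - 1) / (y + 1)) \<longlongrightarrow> 1) at_top" by real_asymp
    then have "((\<lambda>y. of_real ((y - 1) / (y + 1)) :: complex) \<longlongrightarrow> of_real 1) at_top" by (rule tendsto_of_real)
    moreover have "\<forall>\<^sub>F y in at_top. of_real ((y - 1) / (y + 1)) = (?z y - \<i>) / (?z y + \<i>)"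
      using eventually_gt_at_top[of 0]
    proof eventually_elim
      case (elim y)
      have "(?z y - \<i>) / (?z y + \<i>) = (\<i> * of_real (y - 1)) / (\<i> * of_real (y + 1))" by (simp add: algebra_simps)
      then show ?case by simp
    qed
    ultimately have "((\<lambda>y. (?z y - \<i>) / (?z y + \<i>)) \<longlongrightarrow> 1) at_top"
      using Lim_transform_eventually by fastforce
    from tendsto_mult[OF tendsto_const[of \<alpha>] this] 1 show ?thesis
      using tendsto_unique[OF trivial_limit_at_top_linorder] by fastforce
  qed
  have wz: "w z = of_real (Im a) * z + of_real (Re a)" if z: "Im z > 0" for z
  proof -
    have zi: "z + \<i> \<noteq> 0" using z(1) by (auto simp: complex_eq_iff)
    have "(w z - a) * (z + \<i>) = (z - \<i>) * (w z - cnj a)"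
      using W[OF z] ne[OF z] zi \<open>\<alpha> = 1\<close> by (simp add: frac_eq_eq)
    then have "2 * \<i> * w z = z * (a - cnj a) + \<i> * (a + cnj a)" by (simp add: algebra_simps)
    also have "\<dots> = 2 * \<i> * (of_real (Im a) * z + of_real (Re a))"
      by (simp add: complex_diff_cnj complex_add_cnj algebra_simps)
    finally show ?thesis by simp
  qed
  show thesis
  proof (rule that[OF aH])
    fix z assume z: "z \<in> \<H>"
    have d: "((\<lambda>z. of_real (Im a) * z + of_real (Re a)) has_field_derivative of_real (Im a)) (at z)"
      by (auto intro!: derivative_eq_intros)
    show "(w has_field_derivative of_real (Im a)) (at z)"
      by (rule has_field_derivative_transform_within_open[OF d oH z]) (simp add: wz upper_half_plane_def)
  qed
qed

text \<open>On the cut y^2 would be real and non-negative, so y would be real.\<close>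

lemma flow_nonpos:
  assumes "Im x > 0" and y: "Im y > 0" and "y\<^sup>2 = x\<^sup>2 - 2 * complex_of_real t"
  shows "2 * of_real t - x\<^sup>2 \<notin> \<real>\<^sub>\<le>\<^sub>0"
proof
  assume "2 * of_real t - x\<^sup>2 \<in> \<real>\<^sub>\<le>\<^sub>0"
  then have n: "- (y\<^sup>2) \<in> \<real>\<^sub>\<le>\<^sub>0" using assms(3) by simp
  then have "Im (y\<^sup>2) = 0" "Re (y\<^sup>2) \<ge> 0" by (auto simp: complex_nonpos_Reals_iff)
  then have "Re y * Im y = 0" "(Re y)\<^sup>2 \<ge> (Im y)\<^sup>2" by (auto simp: power2_eq_square)
  moreover from this have "Re y = 0" using y by simp
  ultimately show False using y by simp
qed

text \<open>The differential equation makes the square of \<open>\<psi> s z - \<xi>\<close> plus 2 s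
  constant in s. With the positive imaginary part this determines \<psi>, so every local flow is the
  explicit one.\<close>

lemma local_flow_eq:
  assumes flow: "local_flow (\<lambda>y. 1 / (complex_of_real \<xi> - y)) N \<epsilon> \<psi>" and t: "\<bar>t\<bar> < \<epsilon>" and z: "z \<in> N"
  shows "z \<in> fdom \<xi> t" "\<psi> t z = of_real \<xi> + flow_root t (z - of_real \<xi>)"
proof -
  have N: "N \<subseteq> \<H>" "\<psi> 0 z = z" using flow z by (auto simp: local_flow_def)
  have up: "Im (\<psi> s z) > 0" and der: "((\<lambda>s. \<psi> s z) has_vector_derivative 1 / (of_real \<xi> - \<psi> s z)) (at s)" if "\<bar>s\<bar> < \<epsilon>" for s
  proof -
    have "\<psi> s ` N \<subseteq> \<H>" "\<forall>z\<in>N. ((\<lambda>s. \<psi> s z) has_vector_derivative 1 / (of_real \<xi> - \<psi> s z)) (at s)"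
      using flow that unfolding local_flow_def by blast+
    then show "Im (\<psi> s z) > 0" "((\<lambda>s. \<psi> s z) has_vector_derivative 1 / (of_real \<xi> - \<psi> s z)) (at s)"
      using z by (auto simp: upper_half_plane_def)
  qed
  define p where "p s = (\<psi> s z - of_real \<xi>)\<^sup>2 + 2 * of_real s" for s
  have ne: "\<psi> s z \<noteq> of_real \<xi>" if "\<bar>s\<bar> < \<epsilon>" for s using up[OF that] by auto
  have "p t = p 0"
  proof (rule has_derivative_zero_unique[where s = "{-\<epsilon><..<\<epsilon>}"])
    fix s assume s: "s \<in> {-\<epsilon><..<\<epsilon>}"
    then have s: "\<bar>s\<bar> < \<epsilon>" by auto
    have "((\<lambda>x. (x - of_real \<xi>)\<^sup>2) has_field_derivative 2 * (\<psi> s z - of_real \<xi>)) (at (\<psi> s z))"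
      by (auto intro!: derivative_eq_intros)
    then have 1: "((\<lambda>s. (\<psi> s z - of_real \<xi>)\<^sup>2) has_vector_derivative - 2) (at s)"
    proof -
      define d where "d = of_real \<xi> - \<psi> s z"
      have "\<psi> s z = of_real \<xi> - d" "d \<noteq> 0" using ne[OF s] by (simp_all add: d_def)
      then have "1 / (of_real \<xi> - \<psi> s z) * (2 * (\<psi> s z - of_real \<xi>)) = - 2" by simp
      with field_vector_diff_chain_at[OF der[OF s] \<open>((\<lambda>x. (x - of_real \<xi>)\<^sup>2) has_field_derivative _) _\<close>]
      show ?thesis by (simp only: o_def)
    qed
    have 2: "((\<lambda>s. 2 * complex_of_real s) has_vector_derivative 2) (at s)"
      using has_vector_derivative_mult_right[OF has_vector_derivative_of_real[OF DERIV_ident], of 2] by simp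
    have "(p has_vector_derivative 0) (at s)"
      unfolding p_def using has_vector_derivative_add[OF 1 2] by simp
    then show "(p has_derivative (\<lambda>h. 0)) (at s within {-\<epsilon><..<\<epsilon>})"
      by (simp add: has_vector_derivative_def has_derivative_at_withinI)
  qed (use t in auto)
  then have sq: "(\<psi> t z - of_real \<xi>)\<^sup>2 = (z - of_real \<xi>)\<^sup>2 - 2 * complex_of_real t"
    by (simp add: p_def N algebra_simps)
  have I: "Im (z - of_real \<xi>) > 0" "Im (\<psi> t z - of_real \<xi>) > 0" using N z up[OF t] by (auto simp: upper_half_plane_def)
  from flow_nonpos[OF I sq] show d: "z \<in> fdom \<xi> t" using I by (simp add: fdom_def)
  have "\<psi> t z - of_real \<xi> = flow_root t (z - of_real \<xi>)"
    by (rule square_eq_upper[OF I(2) fdomD(3)[OF d]]) (simp add: sq flow_root_square)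
  then show "\<psi> t z = of_real \<xi> + flow_root t (z - of_real \<xi>)" by (simp add: algebra_simps)
qed

lemma flow_root_0: "Im x > 0 \<Longrightarrow> flow_root 0 x = x"
proof -
  assume x: "Im x > 0"
  have n: "2 * of_real 0 - x\<^sup>2 \<notin> \<real>\<^sub>\<le>\<^sub>0" by (rule flow_nonpos[OF x x]) simp
  show ?thesis by (rule square_eq_upper[OF Im_flow_root[OF n] x]) (simp add: flow_root_square)
qed

lemma fdom_0: "fdom \<xi> 0 = \<H>"
proof -
  have "2 * of_real 0 - (x - of_real \<xi>)\<^sup>2 \<notin> \<real>\<^sub>\<le>\<^sub>0" if "Im x > 0" for x
    by (rule flow_nonpos[where y = "x - of_real \<xi>"]) (use that in auto)
  then show ?thesis by (auto simp: fdom_def upper_half_plane_def)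
qed

lemma flow_root_z_derivative:
  assumes "z \<in> fdom \<xi> t"
  shows "((\<lambda>z. of_real \<xi> + flow_root t (z - of_real \<xi>)) has_field_derivative (z - of_real \<xi>) / flow_root t (z - of_real \<xi>)) (at z)"
proof -
  have "((\<lambda>z. flow_root ((\<lambda>_. t) z) (z - of_real \<xi>)) has_derivative (\<lambda>h. -1 * inverse (flow_root t (z - of_real \<xi>)) * of_real 0 + (z - of_real \<xi>) * inverse (flow_root t (z - of_real \<xi>)) * h)) (at z)"
    by (rule flow_root_has_derivative) (use fdomD[OF assms] in \<open>auto intro!: derivative_eq_intros\<close>)
  then have "((\<lambda>z. flow_root t (z - of_real \<xi>)) has_field_derivative (z - of_real \<xi>) / flow_root t (z - of_real \<xi>)) (at z)"
    unfolding has_field_derivative_def by (simp add: divide_inverse)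
  from DERIV_add[OF DERIV_const[of "of_real \<xi>"] this] show ?thesis by simp
qed

text \<open>Both arguments lie in (0, \<pi>), so their difference needs no correction by 2
  \<pi>.\<close>

lemma Arg_divide_upper:
  assumes "Im x > 0" "Im y > 0"
  shows "Arg (x / y) = Arg x - Arg y"
proof (rule Arg_unique)
  have nz: "x \<noteq> 0" "y \<noteq> 0" using assms by auto
  show "of_real (cmod (x / y)) * exp (\<i> * of_real (Arg x - Arg y)) = x / y"
    using Arg_divide[OF nz(2,1)] by (simp add: is_Arg_def)
  show "0 < cmod (x / y)" using nz by simp
  show "- pi < Arg x - Arg y" "Arg x - Arg y \<le> pi"
    using Arg_lt_pi[of x] Arg_lt_pi[of y] assms by linarith+
qed

section \<open>Charts moved by the flow\<close>

locale conformal_affine =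
  fixes w :: "complex \<Rightarrow> complex" and c :: real
  assumes c: "c > 0" and w: "\<And>z. z \<in> \<H> \<Longrightarrow> (w has_field_derivative of_real c) (at z)"
begin

lemma deriv_w: "z \<in> \<H> \<Longrightarrow> deriv w z = of_real c"
  using w DERIV_imp_deriv by blast

lemma flow_chart_id: "flow_chart \<xi> w 0 (id_chart w)"
proof -
  have "open \<H>" by (simp add: upper_half_plane_def open_halfspace_Im_gt)
  moreover have "(\<lambda>\<zeta>. Ln (deriv w \<zeta>)) holomorphic_on \<H>"
    by (rule holomorphic_transform[of "\<lambda>_. Ln (of_real c)"]) (auto simp: deriv_w)
  moreover have "flow_root 0 (x - of_real \<xi>) = x - of_real \<xi>" if "x \<in> \<H>" for x
    by (rule flow_root_0) (use that in \<open>simp add: upper_half_plane_def\<close>)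
  moreover have "Ln (of_real c) = of_real (ln c)" using c by (simp add: Ln_of_real)
  ultimately show ?thesis
    using c by (auto simp: flow_chart_def is_chart_def id_chart_def fdom_0 deriv_w o_def exp_of_real)
qed

text \<open>As w' is constant, it cancels in the quotient of \<open>push_chart\<close>, which
  becomes the derivative (z - \<xi>) / P of the flow; as it is positive, it adds nothing to the
  argument.\<close>

lemma flow_chart_push:
  assumes flow: "local_flow (\<lambda>y. 1 / (complex_of_real \<xi> - y)) N \<epsilon> \<psi>" and t: "\<bar>t\<bar> < \<epsilon>"
  shows "flow_chart \<xi> w t (push_chart w N (\<psi> t) (id_chart w))"
    and "z \<in> N \<Longrightarrow> (z - of_real \<xi>) / flow_root t (z - of_real \<xi>) \<notin> \<real>\<^sub>\<le>\<^sub>0 \<Longrightarrow> z \<in> chart_dom (push_chart w N (\<psi> t) (id_chart w))"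
proof -
  let ?f = "\<lambda>z. of_real \<xi> + flow_root t (z - of_real \<xi>)"
  let ?q = "\<lambda>z. (z - of_real \<xi>) / flow_root t (z - of_real \<xi>)"
  have N: "open N" "N \<subseteq> \<H>" "\<psi> t holomorphic_on N" "inj_on (\<psi> t) N" "\<psi> t ` N \<subseteq> \<H>" using flow t by (auto simp: local_flow_def)
  note e = local_flow_eq[OF flow t]
  have dpsi: "(\<psi> t has_field_derivative ?q z) (at z)" if "z \<in> N" for z
    by (rule has_field_derivative_transform_within_open[OF flow_root_z_derivative[OF e(1)[OF that]] N(1) that]) (simp add: e(2))
  have dw: "((w \<circ> \<psi> t) has_field_derivative of_real c * ?q z) (at z)" if "z \<in> N" for z
    using DERIV_chain[OF w dpsi[OF that]] N that by blast
  define q where "q z = deriv (w \<circ> \<psi> t) z / deriv w z" for z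
  have q: "q z = ?q z" if "z \<in> N" for z
  proof -
    have "z \<in> \<H>" using that N by blast
    then show ?thesis using DERIV_imp_deriv[OF dw[OF that]] c by (simp add: q_def deriv_w)
  qed
  have qhol: "?q holomorphic_on N"
  proof -
    have "(\<lambda>z. flow_root t (z - of_real \<xi>)) holomorphic_on N"
      by (rule holomorphic_transform[of "\<lambda>z. \<psi> t z - of_real \<xi>"]) (use N e in \<open>auto intro!: holomorphic_intros\<close>)
    moreover have "flow_root t (z - of_real \<xi>) \<noteq> 0" if "z \<in> N" for z
      using fdomD(3)[OF e(1)[OF that]] by auto
    ultimately show ?thesis by (intro holomorphic_intros) auto
  qed
  define D where "D = {\<zeta> \<in> N. ?q \<zeta> \<notin> \<real>\<^sub>\<le>\<^sub>0}"
  have ch: "push_chart w N (\<psi> t) (id_chart w) = Chart D (\<psi> t) (\<lambda>\<zeta>. Ln (deriv w \<zeta>) + Ln (q \<zeta>))"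
    unfolding push_chart_def id_chart_def Let_def q_def[symmetric] D_def using N q by auto
  have oD: "open D"
  proof -
    have "open (N \<inter> ?q -` (- \<real>\<^sub>\<le>\<^sub>0))"
      using continuous_open_preimage[OF holomorphic_on_imp_continuous_on[OF qhol] N(1), of "- \<real>\<^sub>\<le>\<^sub>0"] by (simp add: open_Compl)
    moreover have "D = N \<inter> ?q -` (- \<real>\<^sub>\<le>\<^sub>0)" by (auto simp: D_def)
    ultimately show ?thesis by simp
  qed
  have DN: "D \<subseteq> N" by (auto simp: D_def)
  have qn: "?q z \<noteq> 0" "?q z \<notin> \<real>\<^sub>\<le>\<^sub>0" if "z \<in> D" for z using that by (auto simp: D_def)
  have lhol: "(\<lambda>\<zeta>. Ln (deriv w \<zeta>) + Ln (q \<zeta>)) holomorphic_on D"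
  proof (rule holomorphic_transform)
    show "(\<lambda>\<zeta>. of_real (ln c) + Ln (?q \<zeta>)) holomorphic_on D"
      by (intro holomorphic_intros holomorphic_on_Ln' holomorphic_on_subset[OF qhol DN] qn)
    show "of_real (ln c) + Ln (?q z) = Ln (deriv w z) + Ln (q z)" if "z \<in> D" for z
      using that DN N q c by (auto simp: deriv_w Ln_of_real subset_iff)
  qed
  show "flow_chart \<xi> w t (push_chart w N (\<psi> t) (id_chart w))"
    unfolding flow_chart_def is_chart_def ch chart.sel
  proof (intro conjI ballI oD lhol)
    show "\<psi> t holomorphic_on D" "inj_on (\<psi> t) D" "D \<subseteq> fdom \<xi> t"
      using N DN e by (auto intro: holomorphic_on_subset inj_on_subset)
    show "\<psi> t ` D \<subseteq> \<H>" using N(5) DN by blast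
    fix z assume z: "z \<in> D"
    then have zN: "z \<in> N" "z \<in> \<H>" using DN N by auto
    show "exp (Ln (deriv w z) + Ln (q z)) = deriv (w \<circ> \<psi> t) z"
      using qn[OF z] c DERIV_imp_deriv[OF dw[OF zN(1)]] by (simp add: exp_add q[OF zN(1)] deriv_w[OF zN(2)])
    show "\<psi> t z = of_real \<xi> + flow_root t (z - of_real \<xi>)" by (rule e(2)[OF zN(1)])
    have "Im (Ln (?q z)) = Arg (?q z)" using qn[OF z] by (simp add: Arg_eq_Im_Ln)
    also have "\<dots> = Arg (z - of_real \<xi>) - Arg (flow_root t (z - of_real \<xi>))"
      by (rule Arg_divide_upper) (use zN e fdomD(3) in \<open>auto simp: upper_half_plane_def\<close>)
    finally show "Im (Ln (deriv w z) + Ln (q z)) = Arg (z - of_real \<xi>) - Arg (flow_root t (z - of_real \<xi>))"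
      using c by (simp add: q[OF zN(1)] deriv_w[OF zN(2)] Ln_of_real)
  qed
  show "z \<in> N \<Longrightarrow> ?q z \<notin> \<real>\<^sub>\<le>\<^sub>0 \<Longrightarrow> z \<in> chart_dom (push_chart w N (\<psi> t) (id_chart w))"
    unfolding ch by (simp add: D_def)
qed

text \<open>The derivative of the flow is 1 at t = 0, hence off the branch cut for small t.\<close>

lemma eventually_push_dom:
  assumes flow: "local_flow (\<lambda>y. 1 / (complex_of_real \<xi> - y)) N \<epsilon> \<psi>" and z: "z \<in> N"
  shows "\<forall>\<^sub>F t in nhds 0. z \<in> chart_dom (push_chart w N (\<psi> t) (id_chart w))"
proof -
  have \<epsilon>: "\<epsilon> > 0" "N \<subseteq> \<H>" using flow by (auto simp: local_flow_def)
  have zi: "Im (z - of_real \<xi>) > 0" using \<epsilon> z by (auto simp: upper_half_plane_def)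
  have z0: "z \<in> fdom \<xi> 0" using \<epsilon> z by (auto simp: fdom_0)
  have "((\<lambda>t. flow_root t ((\<lambda>_. z - of_real \<xi>) t)) has_derivative (\<lambda>h. -1 * inverse (flow_root 0 (z - of_real \<xi>)) * of_real h + (z - of_real \<xi>) * inverse (flow_root 0 (z - of_real \<xi>)) * 0)) (at 0)"
    by (rule flow_root_has_derivative) (use fdomD[OF z0] in \<open>auto intro!: derivative_eq_intros\<close>)
  from has_derivative_continuous[OF this]
  have "isCont (\<lambda>t. flow_root t (z - of_real \<xi>)) 0" .
  then have "isCont (\<lambda>t. (z - of_real \<xi>) / flow_root t (z - of_real \<xi>)) 0"
    using fdomD(3)[OF z0] by (intro continuous_intros) auto
  then have "((\<lambda>t. (z - of_real \<xi>) / flow_root t (z - of_real \<xi>)) \<longlongrightarrow> (z - of_real \<xi>) / flow_root 0 (z - of_real \<xi>)) (nhds 0)"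
    unfolding isCont_def using tendsto_at_iff_tendsto_nhds[of "\<lambda>t. (z - of_real \<xi>) / flow_root t (z - of_real \<xi>)" 0] by (simp only:)
  then have "((\<lambda>t. (z - of_real \<xi>) / flow_root t (z - of_real \<xi>)) \<longlongrightarrow> 1) (nhds 0)"
    using zi fdomD(3)[OF z0] by (simp only: flow_root_0[OF zi]) (metis divide_self_if less_irrefl zero_complex.sel(2))
  moreover have "open (- \<real>\<^sub>\<le>\<^sub>0 :: complex set)" by (simp add: open_Compl)
  ultimately have "\<forall>\<^sub>F t in nhds 0. (z - of_real \<xi>) / flow_root t (z - of_real \<xi>) \<in> - \<real>\<^sub>\<le>\<^sub>0"
    by (rule topological_tendstoD) simp
  moreover have "\<forall>\<^sub>F t in nhds 0. \<bar>t\<bar> < \<epsilon>"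
    using eventually_nhds_in_open[of "{-\<epsilon><..<\<epsilon>}" 0] \<epsilon> by (auto elim!: eventually_mono)
  ultimately show ?thesis by eventually_elim (use flow_chart_push(2)[OF flow _ z] in auto)
qed

end

text \<open>For times below d^2 / 2 in modulus the slit missing from the domain of the flow has
  height less than d, so it does not reach the half-plane Im z > d.\<close>

lemma local_flow_exists:
  assumes "finite Z" "Z \<subseteq> \<H>"
  shows "\<exists>N \<epsilon> \<psi>. local_flow (\<lambda>y. 1 / (complex_of_real \<xi> - y)) N \<epsilon> \<psi> \<and> Z \<subseteq> N"
proof -
  define d where "d = Min (insert 1 (Im ` Z)) / 2"
  have "Min (insert 1 (Im ` Z)) > 0" using assms by (subst Min_gr_iff) (auto simp: upper_half_plane_def)
  then have d: "d > 0" by (simp add: d_def)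
  define N where "N = {z. Im z > d}"
  have ZN: "Z \<subseteq> N"
  proof
    fix z assume "z \<in> Z"
    then have "Min (insert 1 (Im ` Z)) \<le> Im z" using assms by (intro Min_le) auto
    then show "z \<in> N" using d by (simp add: N_def d_def)
  qed
  define \<psi> where "\<psi> t z = of_real \<xi> + flow_root t (z - of_real \<xi>)" for t z
  have fd: "z \<in> fdom \<xi> t" if "\<bar>t\<bar> < d\<^sup>2 / 2" "z \<in> N" for t z
  proof -
    have "2 * complex_of_real t - (z - of_real \<xi>)\<^sup>2 \<notin> \<real>\<^sub>\<le>\<^sub>0"
    proof
      assume "2 * complex_of_real t - (z - of_real \<xi>)\<^sup>2 \<in> \<real>\<^sub>\<le>\<^sub>0"
      then have "Im z * (Re z - \<xi>) = 0" "2 * t - ((Re z - \<xi>)\<^sup>2 - (Im z)\<^sup>2) \<le> 0"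
        by (auto simp: complex_nonpos_Reals_iff power2_eq_square)
      then have "2 * t + (Im z)\<^sup>2 \<le> 0" using that(2) d by (auto simp: N_def)
      moreover have "d\<^sup>2 < (Im z)\<^sup>2" using that(2) d by (intro power_strict_mono) (auto simp: N_def)
      ultimately show False using that(1) by linarith
    qed
    then show ?thesis using that d by (simp add: fdom_def N_def)
  qed
  have "local_flow (\<lambda>y. 1 / (complex_of_real \<xi> - y)) N (d\<^sup>2 / 2) \<psi>"
    unfolding local_flow_def
  proof (intro conjI allI impI ballI)
    show "open N" by (simp add: N_def open_halfspace_Im_gt)
    show NH: "N \<subseteq> \<H>" using d by (auto simp: N_def upper_half_plane_def)
    show "(\<lambda>y. 1 / (complex_of_real \<xi> - y)) holomorphic_on N"
      by (intro holomorphic_intros) (use d in \<open>auto simp: N_def\<close>)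
    show "0 < d\<^sup>2 / 2" using d by simp
    show "\<psi> 0 z = z" if "z \<in> N" for z
      unfolding \<psi>_def using that d by (subst flow_root_0) (auto simp: N_def)
    fix t assume t: "\<bar>t\<bar> < d\<^sup>2 / 2"
    show "\<psi> t holomorphic_on N"
      unfolding holomorphic_on_open[OF \<open>open N\<close>] \<psi>_def using flow_root_z_derivative[OF fd[OF t]] by blast
    show "inj_on (\<psi> t) N" using flow_root_inj[OF fd[OF t] fd[OF t]] by (auto simp: inj_on_def \<psi>_def)
    show "\<psi> t ` N \<subseteq> \<H>" using fdomD(3)[OF fd[OF t]] by (auto simp: \<psi>_def upper_half_plane_def)
    fix z assume z: "z \<in> N"
    have "((\<lambda>t. flow_root t ((\<lambda>_. z - of_real \<xi>) t)) has_derivative (\<lambda>h. -1 * inverse (flow_root t (z - of_real \<xi>)) * of_real h + (z - of_real \<xi>) * inverse (flow_root t (z - of_real \<xi>)) * 0)) (at t)"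
      by (rule flow_root_has_derivative) (use fdomD[OF fd[OF t z]] in \<open>auto intro!: derivative_eq_intros\<close>)
    then have "((\<lambda>t. flow_root t (z - of_real \<xi>)) has_vector_derivative - inverse (flow_root t (z - of_real \<xi>))) (at t)"
      unfolding has_vector_derivative_def by (simp add: scaleR_conv_of_real mult.commute)
    from has_vector_derivative_add[OF has_vector_derivative_const[of "of_real \<xi>"] this]
    show "((\<lambda>s. \<psi> s z) has_vector_derivative 1 / (complex_of_real \<xi> - \<psi> t z)) (at t)"
      by (simp add: \<psi>_def divide_inverse)
  qed
  with ZN show ?thesis by blast
qed

section \<open>The Lie derivative and the heat equation\<close>

lemma hw_mult: "hw f a b x \<Longrightarrow> hw g c d x \<Longrightarrow> hw (\<lambda>x. f x * g x) (a * g x + f x * c) (b * g x + f x * d) x"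
  unfolding hw_def
  by (rule has_derivative_eq_rhs, rule has_derivative_mult) (auto simp: algebra_simps fun_eq_iff)

definition om :: "real \<Rightarrow> nat \<Rightarrow> bool \<Rightarrow> complex \<Rightarrow> complex" where
  "om \<xi> p s x = (if s then cnj (inverse (x - of_real \<xi>) ^ p) else inverse (x - of_real \<xi>) ^ p)"

lemma om_hw:
  assumes "x \<noteq> of_real \<xi>"
  shows "hw (om \<xi> p s) (if s then 0 else - of_nat p * om \<xi> (Suc p) s x) (if s then - of_nat p * om \<xi> (Suc p) s x else 0) x"
proof -
  have "((\<lambda>x. inverse (x - of_real \<xi>)) has_field_derivative - ((inverse (x - of_real \<xi>))\<^sup>2)) (at x)"
    using assms by (auto intro!: derivative_eq_intros simp: power2_eq_square)
  from DERIV_power[OF this, of p]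
  have "((\<lambda>x. inverse (x - of_real \<xi>) ^ p) has_field_derivative - of_nat p * inverse (x - of_real \<xi>) ^ Suc p) (at x)"
    by (rule DERIV_cong) (cases p, simp_all only: power2_eq_square power_Suc mult_ac diff_Suc_Suc, simp_all add: algebra_simps)
  then have d: "((\<lambda>x. inverse (x - of_real \<xi>) ^ p) has_derivative (\<lambda>h. - of_nat p * inverse (x - of_real \<xi>) ^ Suc p * h)) (at x)"
    unfolding has_field_derivative_def .
  have o: "om \<xi> p s = (\<lambda>x. if s then cnj (inverse (x - of_real \<xi>) ^ p) else inverse (x - of_real \<xi>) ^ p)"
    by (simp add: om_def fun_eq_iff)
  show ?thesis
  proof (cases s)
    case True
    from bounded_linear.has_derivative[OF bounded_linear_cnj d] show ?thesis
      unfolding hw_def o using True by (simp add: om_def mult.assoc)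
  next
    case False
    then show ?thesis unfolding hw_def o using d by (simp add: om_def mult.assoc)
  qed
qed

type_synonym vterms = "(complex \<times> nat \<times> bool \<times> (nat \<times> nat)) list"

definition vval :: "real \<Rightarrow> vterms \<Rightarrow> (nat \<times> nat \<Rightarrow> complex) \<Rightarrow> complex \<Rightarrow> complex" where
  "vval \<xi> T m x = (\<Sum>(c, p, s, a)\<leftarrow>T. c * (om \<xi> p s x * m a))"

definition vdz :: "vterms \<Rightarrow> vterms" where
  "vdz T = concat (map (\<lambda>(c, p, s, a). [(if s then 0 else - of_nat p * c, Suc p, s, a), (c, p, s, up_z a)]) T)"
definition vdzbar :: "vterms \<Rightarrow> vterms" where
  "vdzbar T = concat (map (\<lambda>(c, p, s, a). [(if s then - of_nat p * c else 0, Suc p, s, a), (c, p, s, up_zbar a)]) T)"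

lemma vval_hw:
  assumes x: "x \<noteq> of_real \<xi>" and g: "\<And>a. hw (g a) (g (up_z a) x) (g (up_zbar a) x) x"
  shows "hw (\<lambda>x. vval \<xi> T (\<lambda>a. g a x) x) (vval \<xi> (vdz T) (\<lambda>a. g a x) x) (vval \<xi> (vdzbar T) (\<lambda>a. g a x) x) x"
proof (induction T)
  case Nil
  then show ?case by (simp add: vval_def vdz_def vdzbar_def hw_const)
next
  case (Cons l T)
  obtain c p s a where l: "l = (c, p, s, a)" by (cases l) auto
  from hw_add[OF hw_scale[OF hw_mult[OF om_hw[OF x, of p s] g[of a]], of c] Cons]
  show ?case by (cases s) (simp_all add: l vval_def vdz_def vdzbar_def algebra_simps)
qed

text \<open>
  \<open>vact \<xi> x m\<close> is the jet at \<open>x\<close> of the derivative along \<open>v\<close>, where \<open>v = - 1 / (x - \<xi>)\<close>, of a function with jet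
  \<open>m\<close>. The coefficients, which arise by differentiating \<open>v\<close> and its conjugate, do not depend on the function.
\<close>

fun vact :: "real \<Rightarrow> complex \<Rightarrow> (nat \<times> nat \<Rightarrow> complex) \<Rightarrow> nat \<times> nat \<Rightarrow> complex" where
  "vact \<xi> x m (j, k) = vval \<xi> ((vdz ^^ j) ((vdzbar ^^ k) [(- 1, 1, False, (1, 0)), (- 1, 1, True, (0, 1))])) m x"

text \<open>Knowing the derivative along v as an identity of functions on an open set is enough:
  both sides are jet families, so the jets agree.\<close>

lemma vact_eq:
  assumes S: "open S" "of_real \<xi> \<notin> S" "x \<in> S" and g: "jfam S (\<lambda>j k. g (j, k))" and h: "jfam S h"
    and base: "\<And>x. x \<in> S \<Longrightarrow> h 0 0 x = - (inverse (x - of_real \<xi>) * g (1, 0) x) - cnj (inverse (x - of_real \<xi>)) * g (0, 1) x"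
  shows "h j k x = vact \<xi> x (\<lambda>a. g a x) (j, k)"
proof -
  let ?T = "[(- 1, 1, False, (1, 0)), (- 1, 1, True, (0, 1))] :: vterms"
  have "jfam S (\<lambda>j k. (\<lambda>T x. vval \<xi> T (\<lambda>a. g a x) x) ((vdz ^^ j) ((vdzbar ^^ k) ?T)))"
  proof (rule jfam_ops[OF S(1)])
    fix T x assume x: "x \<in> S"
    show "hw (\<lambda>x. vval \<xi> T (\<lambda>a. g a x) x) (vval \<xi> (vdz T) (\<lambda>a. g a x) x) (vval \<xi> (vdzbar T) (\<lambda>a. g a x) x) x"
    proof (rule vval_hw)
      show "x \<noteq> of_real \<xi>" using x S by auto
      show "hw (g a) (g (up_z a) x) (g (up_zbar a) x) x" for a
        using g x unfolding jfam_def by (cases a) auto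
    qed
  qed
  from jfam_unique[OF S(1) h this _ S(3)] show ?thesis
    by (simp add: base vval_def om_def)
qed

section \<open>Time derivatives at t = 0 of source means, of the mean and of the covariance\<close>

lemma open_upper: "open \<H>" by (simp add: upper_half_plane_def open_halfspace_Im_gt)

lemma flow_root_0': "x \<in> \<H> \<Longrightarrow> flow_root 0 (x - of_real \<xi>) = x - of_real \<xi>"
  by (rule flow_root_0) (simp add: upper_half_plane_def)

text \<open>At t = 0, moving the first point by the flow is differentiation along v. The identity of
  values is extended to jets first in y and then in x.\<close>

lemma vact_source:
  assumes x: "x \<in> \<H>" and y: "y \<in> \<H>" "x \<noteq> y"
  shows "ej \<xi> (der Dt esrc) a d (0, x, y) = vact \<xi> x (\<lambda>a. ej \<xi> esrc a d (0, x, y)) a"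
proof -
  have val: "valid \<xi> esrc (0, x, y)" if "x \<in> \<H>" "y \<in> \<H>" "x \<noteq> y" for x y
    by (rule valid_esrc) (use that flow_root_0'[of x] in \<open>auto simp: fdom_0 upper_half_plane_def\<close>)
  obtain j k where a: "a = (j, k)" by fastforce
  obtain l m where d: "d = (l, m)" by fastforce
  have base0: "val \<xi> (der Dt esrc) (0, x, y) = - (inverse (x - of_real \<xi>) * val \<xi> (der Dx esrc) (0, x, y)) -
      cnj (inverse (x - of_real \<xi>)) * val \<xi> (der Dxb esrc) (0, x, y)" if x: "x \<in> \<H>" for x y
  proof -
    define X where "X = x - of_real \<xi>"
    have "X * inverse X = 1" "cnj X * inverse (cnj X) = 1" using x by (auto simp: upper_half_plane_def X_def complex_eq_iff)
    then show ?thesis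
      by (simp add: esrc_def flow_root_0'[OF x, of \<xi>, folded X_def] X_def[symmetric] distrib_left right_diff_distrib) (simp add: algebra_simps)
  qed
  have base: "ej \<xi> (der Dt esrc) (0, 0) (l, m) (0, x, y) = - (inverse (x - of_real \<xi>) * ej \<xi> esrc (1, 0) (l, m) (0, x, y)) -
      cnj (inverse (x - of_real \<xi>)) * ej \<xi> esrc (0, 1) (l, m) (0, x, y)" if x: "x \<in> \<H> - {y}" for x
  proof -
    have S: "open (\<H> - {x})" "y \<in> \<H> - {x}" using open_upper y x by (auto intro: open_delete)
    have V: "\<H> - {x} \<subseteq> {y. valid \<xi> esrc (0, x, y)}" using val x by auto
    have "jfam (\<H> - {x}) (\<lambda>l m y. ej \<xi> (der Dt esrc) (0, 0) (l, m) (0, x, y))"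
      by (rule jfam_mono[OF jfam_y]) (use V valid_der in auto)
    moreover have "jfam (\<H> - {x}) (\<lambda>l m y. (- inverse (x - of_real \<xi>)) * ej \<xi> esrc (1, 0) (l, m) (0, x, y) +
       (- cnj (inverse (x - of_real \<xi>))) * ej \<xi> esrc (0, 1) (l, m) (0, x, y))"
      by (intro jfam_add jfam_scale jfam_mono[OF jfam_y V])
    ultimately have "ej \<xi> (der Dt esrc) (0, 0) (l, m) (0, x, y) = (- inverse (x - of_real \<xi>)) * ej \<xi> esrc (1, 0) (l, m) (0, x, y) +
       (- cnj (inverse (x - of_real \<xi>))) * ej \<xi> esrc (0, 1) (l, m) (0, x, y)"
      by (rule jfam_unique[OF S(1) _ _ _ S(2)]) (use base0[of x] x in \<open>simp add: ej_def\<close>)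
    then show ?thesis by simp
  qed
  have V: "\<H> - {y} \<subseteq> {x. valid \<xi> esrc (0, x, y)}" using val y by auto
  have S: "open (\<H> - {y})" "of_real \<xi> \<notin> \<H> - {y}" "x \<in> \<H> - {y}"
    using x y open_delete[OF open_upper] by (simp_all add: upper_half_plane_def)
  have J: "jfam (\<H> - {y}) (\<lambda>j k x. ej \<xi> esrc (j, k) (l, m) (0, x, y))"
    "jfam (\<H> - {y}) (\<lambda>j k x. ej \<xi> (der Dt esrc) (j, k) (l, m) (0, x, y))"
    by (rule jfam_mono[OF jfam_x], use V valid_der in auto)+
  show ?thesis unfolding a d
    by (rule vact_eq[where g = "\<lambda>a x. ej \<xi> esrc a (l, m) (0, x, y)", OF S J base])
qed

text \<open>The mean 2 a arg (x - \<xi>) due to the insertion; \<open>u1\<close> and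
  \<open>u2\<close> are its derivatives in \<xi>. The boundary point is a complex variable of
  \<open>eins\<close>, so the real derivative is the sum of both Wirtinger derivatives.\<close>

definition u0 where "u0 \<xi> a x d = 2 * of_real a * ej \<xi> eins d (0, 0) (0, x, of_real \<xi>)"
definition u1 where "u1 \<xi> a x d = 2 * of_real a * (ej \<xi> eins d (1, 0) (0, x, of_real \<xi>) + ej \<xi> eins d (0, 1) (0, x, of_real \<xi>))"
definition u2 where "u2 \<xi> a x d = 2 * of_real a * (ej \<xi> eins d (2, 0) (0, x, of_real \<xi>) +
  2 * ej \<xi> eins d (1, 1) (0, x, of_real \<xi>) + ej \<xi> eins d (0, 2) (0, x, of_real \<xi>))"

lemma valid_eins_real: "x \<in> \<H> \<Longrightarrow> valid \<xi> eins (t, x, of_real r)"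
  by (rule valid_eins) (auto simp: upper_half_plane_def)

lemma jfam_eins: "jfam \<H> (\<lambda>j k x. ej \<xi> eins (j, k) d (0, x, of_real r))"
  by (rule jfam_mono[OF jfam_x]) (auto simp: valid_eins_real)

lemma eins_derivs:
  "ej \<xi> eins (0, 0) (1, 0) (0, x, y) = \<i> / 2 * inverse (x - y)"
  "ej \<xi> eins (0, 0) (0, 1) (0, x, y) = - \<i> / 2 * cnj (inverse (x - y))"
  "ej \<xi> eins (0, 0) (2, 0) (0, x, y) = \<i> / 2 * (inverse (x - y))\<^sup>2"
  "ej \<xi> eins (0, 0) (0, 2) (0, x, y) = - \<i> / 2 * (cnj (inverse (x - y)))\<^sup>2"
  "ej \<xi> eins (0, 0) (1, 1) (0, x, y) = 0"
  "ej \<xi> eins (1, 0) (0, 0) (0, x, y) = - \<i> / 2 * inverse (x - y)"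
  "ej \<xi> eins (0, 1) (0, 0) (0, x, y) = \<i> / 2 * cnj (inverse (x - y))"
  by (simp_all add: ej_def eins_def numeral_2_eq_2 power2_eq_square algebra_simps)

text \<open>With X = 1 / (x - \<xi>) and D = X^2 - cnj X^2 the three terms at order (0, 0) are i a
  D, i b D and i D / (2 a). They balance because a + b = 1 / (2 a).\<close>

lemma vact_insertion:
  assumes a: "a > 0" "2 * a * (a + b) = 1" and x: "x \<in> \<H>"
  shows "vact \<xi> x (u0 \<xi> a x) d + - 2 * of_real b * ej \<xi> (der Dt emu) d (0, 0) (0, x, 0) = of_real (1 / (2 * a\<^sup>2)) * u2 \<xi> a x d"
proof -
  obtain j k where d: "d = (j, k)" by fastforce
  define h where "h j k x = of_real (1 / (2 * a\<^sup>2)) * u2 \<xi> a x (j, k) + 2 * of_real b * ej \<xi> (der Dt emu) (j, k) (0, 0) (0, x, 0)" for j k x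
  have "h j k x = vact \<xi> x (\<lambda>d. u0 \<xi> a x d) (j, k)"
  proof (rule vact_eq[where S = \<H>])
    show "jfam \<H> (\<lambda>j k x. u0 \<xi> a x (j, k))"
      unfolding u0_def by (intro jfam_scale jfam_eins)
    show "jfam \<H> h"
      unfolding h_def u2_def
      by (intro jfam_add jfam_scale jfam_eins jfam_mono[OF jfam_x]) (auto intro!: valid_der valid_emu simp: fdom_0)
    fix x assume x: "x \<in> \<H>"
    define X where "X = inverse (x - of_real \<xi>)"
    have nz: "x - of_real \<xi> \<noteq> 0" using x by (auto simp: upper_half_plane_def)
    have mu: "ej \<xi> (der Dt emu) (0, 0) (0, 0) (0, x, 0) = - \<i> / 2 * (X\<^sup>2 - (cnj X)\<^sup>2)"
      using nz by (simp add: emu_def flow_root_0'[OF x] X_def power2_eq_square algebra_simps)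
    have "1 / (2 * a\<^sup>2) * (2 * a) = (2 * a * (a + b)) / (2 * a\<^sup>2) * (2 * a)" using a(2) by simp
    also have "\<dots> = 2 * (a + b)" using a(1) by (simp add: field_simps power2_eq_square)
    finally have "of_real (1 / (2 * a\<^sup>2)) * (2 * of_real a) = (of_real (2 * (a + b)) :: complex)"
      by (metis of_real_mult of_real_numeral)
    then have u: "of_real (1 / (2 * a\<^sup>2)) * u2 \<xi> a x (0, 0) = of_real (2 * (a + b)) * (\<i> / 2 * (X\<^sup>2 - (cnj X)\<^sup>2))"
      unfolding u2_def eins_derivs X_def[symmetric] mult.assoc[symmetric] by (simp add: algebra_simps)
    have "h 0 0 x = \<i> * of_real a * (X\<^sup>2 - (cnj X)\<^sup>2)"
      unfolding h_def u mu by (simp add: algebra_simps)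
    also have "\<dots> = - (X * u0 \<xi> a x (1, 0)) - cnj X * u0 \<xi> a x (0, 1)"
      unfolding u0_def eins_derivs X_def[symmetric] by (simp add: algebra_simps power2_eq_square)
    finally show "h 0 0 x = - (inverse (x - of_real \<xi>) * u0 \<xi> a x (1, 0)) - cnj (inverse (x - of_real \<xi>)) * u0 \<xi> a x (0, 1)"
      by (simp only: X_def)
  qed (rule open_upper, simp add: upper_half_plane_def, rule x)
  then have "vact \<xi> x (u0 \<xi> a x) (j, k) = h j k x" by simp
  then show ?thesis unfolding d by (simp only: h_def) simp
qed

text \<open>With q and r the reciprocals of x - \<xi> and y - \<xi>, the time derivative of 2
  \<open>er\<close> factors as i (q - cnj q) times i (r - cnj r), and the value of \<open>u1\<close>
  at x is a times the first factor. The jets follow one point at a time.\<close>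

lemma flow_er_derivative:
  assumes a: "a > 0" and x: "x \<in> \<H>" and y: "y \<in> \<H>"
  shows "2 * ej \<xi> (der Dt er) d e (0, x, y) = of_real (1 / a\<^sup>2) * u1 \<xi> a x d * u1 \<xi> a y e"
proof -
  obtain j k where d: "d = (j, k)" by fastforce
  obtain l m where e: "e = (l, m)" by fastforce
  have val: "valid \<xi> (der Dt er) (0, x, y)" if "x \<in> \<H>" "y \<in> \<H>" for x y
    by (intro valid_der valid_er) (use that in \<open>simp_all add: fdom_0\<close>)
  have u1: "jfam \<H> (\<lambda>j k x. u1 \<xi> a x (j, k))" unfolding u1_def by (intro jfam_add jfam_scale jfam_eins)
  have u10: "u1 \<xi> a x (0, 0) = of_real a * \<i> * (inverse (x - of_real \<xi>) - cnj (inverse (x - of_real \<xi>)))" for x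
    by (simp add: u1_def eins_derivs algebra_simps del: One_nat_def)
  have base: "2 * val \<xi> (der Dt er) (0, x, y) = of_real (1 / a\<^sup>2) * u1 \<xi> a x (0, 0) * u1 \<xi> a y (0, 0)" if x: "x \<in> \<H>" and y: "y \<in> \<H>" for x y
  proof -
    define X' where "X' = x - of_real \<xi>"
    define Y' where "Y' = y - of_real \<xi>"
    define q where "q = inverse X'"
    define r where "r = inverse Y'"
    have im: "Im X' > 0" "Im Y' > 0" using x y by (simp_all add: X'_def Y'_def upper_half_plane_def)
    have nz: "X' \<noteq> 0" "Y' \<noteq> 0" "X' - cnj Y' \<noteq> 0" "X' + Y' \<noteq> 0" using im by (auto simp: complex_eq_iff)
    have e1: "inverse (X' - cnj Y') * (- q + cnj r) = q * cnj r"
      using nz by (simp add: q_def r_def divide_simps)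
    have e2: "inverse (X' + Y') * (- q - r) = - q * r"
      using nz by (simp add: q_def r_def divide_simps)
    have "val \<xi> (der Dt er) (0, x, y) = 1 / 2 * (inverse (X' - cnj Y') * (- q + cnj r) + cnj (inverse (X' - cnj Y') * (- q + cnj r))) +
       1 / 2 * (inverse (X' + Y') * (- q - r) + cnj (inverse (X' + Y') * (- q - r)))"
      by (simp add: er_def flow_root_0'[OF x, of \<xi>, folded X'_def] flow_root_0'[OF y, of \<xi>, folded Y'_def] X'_def[symmetric] Y'_def[symmetric] q_def[symmetric] r_def[symmetric])
    also have "\<dots> = 1 / 2 * (q * cnj r + cnj q * r - q * r - cnj q * cnj r)"
      unfolding e1 e2 by (simp add: algebra_simps)
    finally have v: "val \<xi> (der Dt er) (0, x, y) = 1 / 2 * (q * cnj r + cnj q * r - q * r - cnj q * cnj r)" .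
    have "2 * val \<xi> (der Dt er) (0, x, y) = (\<i> * (q - cnj q)) * (\<i> * (r - cnj r))" unfolding v by (simp add: algebra_simps)
    moreover have "of_real (1 / a\<^sup>2) * u1 \<xi> a x (0, 0) * u1 \<xi> a y (0, 0) = (\<i> * (q - cnj q)) * (\<i> * (r - cnj r))"
      using a unfolding u10 X'_def[symmetric] Y'_def[symmetric] q_def[symmetric] r_def[symmetric]
      by (simp add: field_simps power2_eq_square)
    ultimately show ?thesis by simp
  qed
  have x0: "2 * ej \<xi> (der Dt er) (j, k) (0, 0) (0, x, y) = (of_real (1 / a\<^sup>2) * u1 \<xi> a y (0, 0)) * u1 \<xi> a x (j, k)" if y: "y \<in> \<H>" for y
  proof (rule jfam_unique[OF open_upper _ jfam_scale[OF u1] _ x, of "\<lambda>j k x. 2 * ej \<xi> (der Dt er) (j, k) (0, 0) (0, x, y)"])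
    show "jfam \<H> (\<lambda>j k x. 2 * ej \<xi> (der Dt er) (j, k) (0, 0) (0, x, y))"
      by (intro jfam_scale jfam_mono[OF jfam_x]) (use y val in auto)
  qed (use base[OF _ y] in \<open>simp add: mult_ac\<close>)
  have "2 * ej \<xi> (der Dt er) (j, k) (l, m) (0, x, y) = (of_real (1 / a\<^sup>2) * u1 \<xi> a x (j, k)) * u1 \<xi> a y (l, m)"
  proof (rule jfam_unique[OF open_upper _ jfam_scale[OF u1] _ y, of "\<lambda>l m y. 2 * ej \<xi> (der Dt er) (j, k) (l, m) (0, x, y)"])
    show "jfam \<H> (\<lambda>l m y. 2 * ej \<xi> (der Dt er) (j, k) (l, m) (0, x, y))"
      by (intro jfam_scale jfam_mono[OF jfam_y]) (use x val in auto)
  qed (use x0 in \<open>simp add: mult_ac\<close>)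
  then show ?thesis by (simp add: d e)
qed

lemma insertion_jet:
  assumes x: "x \<in> \<H>"
  shows "\<i> * of_real a * pair_exp (Bdry r) (Jet id j k x) = 2 * of_real a * ej \<xi> eins (j, k) (0, 0) (0, x, of_real r)"
proof -
  have "wirt j k (\<lambda>x. - 2 * \<i> * complex_of_real (Arg (id x - complex_of_real r))) x = (- 2 * \<i>) * ej \<xi> eins (j, k) (0, 0) (0, x, of_real r)"
    by (rule wirt_eq[OF open_upper jfam_scale[OF jfam_eins] _ x]) (simp add: eins_def)
  then show ?thesis by (simp add: algebra_simps)
qed

lemma insertion_adm:
  assumes x: "x \<in> \<H>"
  shows "adm (\<lambda>d. ej \<xi> eins d (0, 0) (0, x, of_real r))"
  unfolding adm_def
proof (intro allI)
  fix j k
  show "ej \<xi> eins (Suc j, Suc k) (0, 0) (0, x, of_real r) = 0"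
  proof (rule ej_mixed_zero(1)[OF sopen_valid[of \<xi> eins]])
    show "val \<xi> (der Dxb (der Dx eins)) \<omega> = 0" if "\<omega> \<in> {\<omega>. valid \<xi> eins \<omega>}" for \<omega>
      by (simp add: eins_def)
  qed (use valid_eins_real[OF x] in auto)
qed

text \<open>Functions of the mean that are evaluations of a functional with nodes in Z. They are
  closed under sums and products, the latter through the Wick product, and serve to obtain the Lie
  derivative as a functional.\<close>

definition evaluable :: "complex set \<Rightarrow> ((gvar \<Rightarrow> complex) \<Rightarrow> complex) \<Rightarrow> bool" where
  "evaluable Z f \<longleftrightarrow> (\<exists>L. functional_on Z L \<and> (\<forall>m. ev m L = f m))"

lemma evaluable_single:
  assumes "\<forall>g\<in>#A. \<exists>j k z. z \<in> Z \<and> g = Jet id j k z" "\<forall>g\<in>Poly_Mapping.keys \<alpha>. \<exists>z\<in>Z. g = Jet id 0 0 z"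
  shows "evaluable Z (\<lambda>m. c * mon m (A, \<alpha>))"
  unfolding evaluable_def
  by (rule exI[of _ "Poly_Mapping.single (A, \<alpha>) c"]) (use assms in \<open>auto simp: functional_on_def\<close>)

lemma evaluable_const: "evaluable Z (\<lambda>m. c)"
  using evaluable_single[of "{#}" Z 0 c] by (simp add: mon_def)

lemma evaluable_var: "z \<in> Z \<Longrightarrow> evaluable Z (\<lambda>m. m (Jet id j k z))"
  using evaluable_single[of "{#Jet id j k z#}" Z 0 1] by (auto simp: mon_def)

lemma evaluable_exp: "z \<in> Z \<Longrightarrow> evaluable Z (\<lambda>m. exp (\<alpha> * m (Jet id 0 0 z)))"
  using evaluable_single[of "{#}" Z "Poly_Mapping.single (Jet id 0 0 z) \<alpha>" 1] by (auto simp: mon_def)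

lemma evaluable_add:
  assumes "evaluable Z f" "evaluable Z g"
  shows "evaluable Z (\<lambda>m. f m + g m)"
proof -
  obtain F G where F: "functional_on Z F" "\<And>m. ev m F = f m" and G: "functional_on Z G" "\<And>m. ev m G = g m"
    using assms unfolding evaluable_def by blast
  have "functional_on Z (F + G)"
    using F(1) G(1) Poly_Mapping.keys_add[of F G] unfolding functional_on_def by blast
  then show ?thesis unfolding evaluable_def using F(2) G(2) by (metis ev_add)
qed

lemma evaluable_mult:
  assumes "evaluable Z f" "evaluable Z g"
  shows "evaluable Z (\<lambda>m. f m * g m)"
proof -
  obtain F G where F: "functional_on Z F" "\<And>m. ev m F = f m" and G: "functional_on Z G" "\<And>m. ev m G = g m"
    using assms unfolding evaluable_def by blast
  have "functional_on Z (F * G)"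
    unfolding functional_on_def
  proof
    fix r assume "r \<in> Poly_Mapping.keys (F * G)"
    then obtain p q where r: "r = p + q" and pq: "p \<in> Poly_Mapping.keys F" "q \<in> Poly_Mapping.keys G"
      using keys_mult[of F G] by blast
    show "(\<forall>g\<in>#fst r. \<exists>j k z. z \<in> Z \<and> g = Jet id j k z) \<and> (\<forall>g\<in>Poly_Mapping.keys (snd r). \<exists>z\<in>Z. g = Jet id 0 0 z)"
    proof (intro conjI ballI)
      fix g assume "g \<in># fst r"
      then have "g \<in># fst p \<or> g \<in># fst q" by (simp add: r)
      then show "\<exists>j k z. z \<in> Z \<and> g = Jet id j k z" using F(1) G(1) pq unfolding functional_on_def by blast
    next
      fix g assume "g \<in> Poly_Mapping.keys (snd r)"
      then have "g \<in> Poly_Mapping.keys (snd p) \<or> g \<in> Poly_Mapping.keys (snd q)"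
        using Poly_Mapping.keys_add[of "snd p" "snd q"] by (auto simp: r)
      then show "\<exists>z\<in>Z. g = Jet id 0 0 z" using F(1) G(1) pq unfolding functional_on_def by blast
    qed
  qed
  then show ?thesis unfolding evaluable_def using F(2) G(2) by (metis ev_mult)
qed

lemma evaluable_sum_list: "(\<And>k. k \<in> set ks \<Longrightarrow> evaluable Z (f k)) \<Longrightarrow> evaluable Z (\<lambda>m. \<Sum>k\<leftarrow>ks. f k m)"
  by (induction ks) (auto intro: evaluable_const evaluable_add)

lemma evaluable_sum: "finite A \<Longrightarrow> (\<And>k. k \<in> A \<Longrightarrow> evaluable Z (f k)) \<Longrightarrow> evaluable Z (\<lambda>m. \<Sum>k\<in>A. f k m)"
  by (induction A rule: finite_induct) (auto intro: evaluable_const evaluable_add)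

lemma evaluable_lin: "(\<And>k. k \<in> Poly_Mapping.keys \<gamma> \<Longrightarrow> evaluable Z (f k)) \<Longrightarrow> evaluable Z (\<lambda>m. lin \<gamma> (\<lambda>k. f k m))"
  unfolding lin_def by (intro evaluable_sum evaluable_mult evaluable_const) auto

text \<open>The mean of a label carrying an exponent must be a field value plus a constant, since
  functionals contain Wick exponentials of the field itself only, not of its derivatives.\<close>

lemma evaluable_gm:
  assumes M: "\<And>p. p \<in> set xs \<union> Poly_Mapping.keys \<gamma> \<Longrightarrow> evaluable Z (\<lambda>m. M m p)"
    and e: "\<And>p. p \<in> Poly_Mapping.keys \<gamma> \<Longrightarrow> \<exists>z\<in>Z. \<exists>c. \<forall>m. M m p = m (Jet id 0 0 z) + c"
  shows "evaluable Z (\<lambda>m. gm Q (M m) \<gamma> xs)"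
  using M
proof (induction xs rule: gm_induct)
  case Nil
  have "evaluable Z (\<lambda>m. exp (\<Sum>p\<in>A. Poly_Mapping.lookup \<gamma> p * M m p))" if "finite A" "A \<subseteq> Poly_Mapping.keys \<gamma>" for A
    using that
  proof (induction A rule: finite_induct)
    case (insert p A)
    then obtain z c where z: "z \<in> Z" "\<And>m. M m p = m (Jet id 0 0 z) + c" using e by blast
    have "evaluable Z (\<lambda>m. exp (Poly_Mapping.lookup \<gamma> p * m (Jet id 0 0 z)) * exp (Poly_Mapping.lookup \<gamma> p * c) *
       exp (\<Sum>p\<in>A. Poly_Mapping.lookup \<gamma> p * M m p))"
      using insert by (intro evaluable_mult evaluable_exp evaluable_const z) auto
    then show ?case using insert by (simp add: z(2) exp_add distrib_left)
  qed (simp add: evaluable_const)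
  then have "evaluable Z (\<lambda>m. exp (lin \<gamma> (M m)) * exp (lin \<gamma> (\<lambda>x. lin \<gamma> (Q x)) / 2))"
    unfolding lin_def by (intro evaluable_mult evaluable_const) auto
  then show ?case by (simp add: gm.simps(1) gexp_def exp_add)
next
  case (Cons x xs)
  have IH: "evaluable Z (\<lambda>m. gm Q (M m) \<gamma> (snd p))" if "p \<in> set (picks xs)" for p
    using Cons(2)[of "fst p" "snd p"] picks_set[of "fst p" "snd p" xs] that Cons.prems by auto
  show ?case unfolding gm_Cons case_prod_unfold
    using Cons.prems by (intro evaluable_add evaluable_mult evaluable_const evaluable_sum_list IH Cons(1)) auto
qed

lemma evaluable_dg:
  assumes V: "\<And>p. p \<in> set xs \<union> Poly_Mapping.keys \<gamma> \<Longrightarrow> evaluable Z (\<lambda>m. V m p)"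
  shows "evaluable Z (\<lambda>m. dg Q (V m) \<gamma> xs)"
proof (cases xs)
  case Nil
  then show ?thesis using V by (auto intro!: evaluable_add evaluable_const evaluable_lin)
next
  case (Cons x ys)
  show ?thesis
  proof (cases ys)
    case Nil
    then show ?thesis using V Cons by (auto intro!: evaluable_add evaluable_const)
  next
    case (Cons y zs)
    then show ?thesis using \<open>xs = x # ys\<close> by (cases zs) (auto intro!: evaluable_const)
  qed
qed

lemma dg_shift:
  assumes sym: "\<And>x y. Q x y = Q y x" and 0: "lin \<delta> m = 0" "lin \<delta> (\<lambda>x. lin \<delta> (Q x)) = 0"
  shows "dg Q m (\<delta> + \<gamma>) xs = dg Q (\<lambda>x. m x + lin \<delta> (Q x)) \<gamma> xs"
proof -
  have "(\<lambda>x. Q x y) = Q y" for y using sym by auto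
  then have swap: "lin \<delta> (\<lambda>x. lin \<gamma> (Q x)) = lin \<gamma> (\<lambda>x. lin \<delta> (Q x))"
    using lin_swap[where \<gamma> = \<delta> and \<delta> = \<gamma> and f = Q] by simp
  show ?thesis
    by (cases "(Q, m, \<gamma>, xs)" rule: dg.cases) (auto simp: lin_add lin_fun_add 0 swap field_simps)
qed

lemma dg_reindex:
  assumes "\<And>f. lin \<gamma>' f = lin \<gamma> (f \<circ> \<pi>)"
  shows "dg (\<lambda>x y. Q (\<pi> x) (\<pi> y)) (m \<circ> \<pi>) \<gamma> xs = dg Q m \<gamma>' (map \<pi> xs)"
  by (cases "(\<lambda>x y. Q (\<pi> x) (\<pi> y), m \<circ> \<pi>, \<gamma>, xs)" rule: dg.cases) (auto simp: assms o_def)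

lemma splits_map: "splits (map f xs) = map (\<lambda>(a, b). (map f a, map f b)) (splits xs)"
  by (induction xs) (auto simp: case_prod_unfold)

text \<open>An exponential \<open>\<delta>\<close> with neither mean nor variance has weight 1; it
  only shifts the mean of the other variables, in the moments and in their variation alike.\<close>

lemma conv_shift_reindex:
  fixes Q :: "'j \<Rightarrow> 'j \<Rightarrow> complex" and \<pi> :: "'i \<Rightarrow> 'j"
  assumes Q: "\<And>x y. Q x y = Q y x" "lin \<delta> m = 0" "lin \<delta> (\<lambda>x. lin \<delta> (Q x)) = 0"
    and P: "\<And>x y. P x y = P y x" "lin \<delta> v = 0" "lin \<delta> (\<lambda>x. lin \<delta> (P x)) = 0"
  shows "gm Q m (\<delta> + push \<pi> \<gamma>) (map \<pi> xs) = gm (\<lambda>x y. Q (\<pi> x) (\<pi> y)) (\<lambda>x. m (\<pi> x) + lin \<delta> (Q (\<pi> x))) \<gamma> xs"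
    and "conv (dg P v) (gm Q m) (\<delta> + push \<pi> \<gamma>) (map \<pi> xs) =
      conv (dg (\<lambda>x y. P (\<pi> x) (\<pi> y)) (\<lambda>x. v (\<pi> x) + lin \<delta> (P (\<pi> x))))
        (gm (\<lambda>x y. Q (\<pi> x) (\<pi> y)) (\<lambda>x. m (\<pi> x) + lin \<delta> (Q (\<pi> x)))) \<gamma> xs"
proof -
  have l: "lin (push \<pi> \<gamma>) f = lin \<gamma> (f \<circ> \<pi>)" for f by (simp add: lin_push o_def)
  have g: "gm Q m (\<delta> + push \<pi> \<gamma>) (map \<pi> xs) = gm (\<lambda>x y. Q (\<pi> x) (\<pi> y)) (\<lambda>x. m (\<pi> x) + lin \<delta> (Q (\<pi> x))) \<gamma> xs" for xs
    using gm_reindex[OF l, where Q = Q and m = "\<lambda>x. m x + lin \<delta> (Q x)" and xs = xs] gm_shift[where Q = Q and m = m and \<delta> = \<delta> and \<gamma> = "push \<pi> \<gamma>" and xs = "map \<pi> xs", OF Q(1)]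
    by (simp add: gexp_def Q(2,3) o_def)
  have d: "dg P v (\<delta> + push \<pi> \<gamma>) (map \<pi> xs) = dg (\<lambda>x y. P (\<pi> x) (\<pi> y)) (\<lambda>x. v (\<pi> x) + lin \<delta> (P (\<pi> x))) \<gamma> xs" for xs
    using dg_reindex[OF l, where Q = P and m = "\<lambda>x. v x + lin \<delta> (P x)" and xs = xs] dg_shift[where Q = P and m = v and \<delta> = \<delta> and \<gamma> = "push \<pi> \<gamma>" and xs = "map \<pi> xs", OF P]
    by (simp add: o_def)
  show "gm Q m (\<delta> + push \<pi> \<gamma>) (map \<pi> xs) = gm (\<lambda>x y. Q (\<pi> x) (\<pi> y)) (\<lambda>x. m (\<pi> x) + lin \<delta> (Q (\<pi> x))) \<gamma> xs" by (rule g)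
  show "conv (dg P v) (gm Q m) (\<delta> + push \<pi> \<gamma>) (map \<pi> xs) =
      conv (dg (\<lambda>x y. P (\<pi> x) (\<pi> y)) (\<lambda>x. v (\<pi> x) + lin \<delta> (P (\<pi> x))))
        (gm (\<lambda>x y. Q (\<pi> x) (\<pi> y)) (\<lambda>x. m (\<pi> x) + lin \<delta> (Q (\<pi> x)))) \<gamma> xs"
    unfolding conv_def splits_map by (simp add: o_def case_prod_unfold g d)
qed

fun node :: "gvar \<Rightarrow> complex" where "node (Jet h l m y) = y" | "node (Bdry r) = of_real r"
fun order_of :: "gvar \<Rightarrow> nat \<times> nat" where "order_of (Jet h l m y) = (l, m)" | "order_of (Bdry r) = (0, 0)"

locale field_product = conformal_affine w c
  for w c +
  fixes \<xi> b :: real and n :: nat and X :: "nat \<Rightarrow> field" and z :: "nat \<Rightarrow> complex" and T :: "nat \<Rightarrow> terms"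
  assumes z_upper: "j < n \<Longrightarrow> z j \<in> \<H>" and z_inj: "inj_on z {..<n}"
    and good: "j < n \<Longrightarrow> good \<xi> w b (X j) (T j)"
begin

abbreviation nodes where "nodes \<equiv> z ` {..<n}"

definition outer :: "gvar set" where
  "outer = {g. \<exists>l m y. g = Jet id l m y \<and> y \<in> \<H> - nodes}"

text \<open>Coincident points have the regular part only. Outside the domain of the flow the value
  is 0, which keeps the covariance symmetric for every t.\<close>

definition Qf :: "real \<Rightarrow> nat \<times> nat \<times> nat \<Rightarrow> nat \<times> nat \<times> nat \<Rightarrow> complex" where
  "Qf t p q = (let x = z (fst p); y = z (fst q) in
     if x \<in> fdom \<xi> t \<and> y \<in> fdom \<xi> t
     then 2 * ej \<xi> er (snd p) (snd q) (t, x, y) + (if x = y then 0 else 2 * ej \<xi> el (snd p) (snd q) (t, x, y)) else 0)"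

definition Mf :: "real \<Rightarrow> nat \<times> nat \<times> nat \<Rightarrow> complex" where
  "Mf t p = Mj \<xi> b t (z (fst p)) (snd p)"

definition sr :: "real \<Rightarrow> nat \<times> nat \<times> nat \<Rightarrow> gvar \<Rightarrow> complex" where
  "sr t p g = 2 * ej \<xi> esrc (snd p) (order_of g) (t, z (fst p), node g)"

definition expansion :: "((nat \<times> nat \<times> nat \<Rightarrow>\<^sub>0 complex) \<Rightarrow> (nat \<times> nat \<times> nat) list \<Rightarrow> complex) \<Rightarrow> complex" where
  "expansion \<Phi> = (\<Sum>(d, \<gamma>, zs)\<leftarrow>choices T [0..<n]. d * \<Phi> \<gamma> zs)"

lemma expansion_cong:
  assumes "\<And>\<gamma> zs. fst ` (Poly_Mapping.keys \<gamma> \<union> set zs) \<subseteq> {..<n} \<Longrightarrow> \<Phi> \<gamma> zs = \<Psi> \<gamma> zs"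
  shows "expansion \<Phi> = expansion \<Psi>"
  unfolding expansion_def
proof (intro arg_cong[where f = sum_list] map_cong refl, clarify)
  fix d \<gamma> zs assume "(d, \<gamma>, zs) \<in> set (choices T [0..<n])"
  from choices_subset[OF this] have "\<Phi> \<gamma> zs = \<Psi> \<gamma> zs" by (intro assms) auto
  then show "d * \<Phi> \<gamma> zs = d * \<Psi> \<gamma> zs" by simp
qed

lemma el_sym: "x \<noteq> y \<Longrightarrow> ej \<xi> el d e (t, x, y) = ej \<xi> el e d (t, y, x)"
proof -
  assume ne: "x \<noteq> y"
  have v: "valid \<xi> (swp el) \<omega>" if "\<omega> \<in> offd" for \<omega> using that by (auto simp: el_def)
  have "ej \<xi> el d e (t, x, y) = ej \<xi> (swp el) e d (t, y, x)"
    by (rule ej_swap[OF sopen_offd v]) (use ne in auto)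
  also have "\<dots> = ej \<xi> el e d (t, y, x)"
  proof (rule ej_cong[OF sopen_offd])
    show "eqv \<xi> offd (swp el) el"
      unfolding eqv_def using v by (auto simp: el_def norm_minus_commute valid_el[unfolded el_def])
  qed (use ne in auto)
  finally show ?thesis .
qed

lemma Qf_sym: "Qf t p q = Qf t q p"
  unfolding Qf_def Let_def using er_symmetric[of "z (fst p)" \<xi> t "z (fst q)" "snd p" "snd q"] el_sym[of "z (fst p)" "z (fst q)" "snd p" "snd q" t]
  by auto

lemma ev_fields:
  assumes ch: "flow_chart \<xi> w t ch" and dom: "\<And>j. j < n \<Longrightarrow> z j \<in> chart_dom ch"
    and m: "\<And>i. i < n \<Longrightarrow> m (Jet id 0 0 (chart_par ch (z i))) = m (cjet ch (z i) (0, 0))"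
      "\<And>i. i < n \<Longrightarrow> adm (\<lambda>a. m (cjet ch (z i) a))"
  shows "ev m (fprod_list (map (\<lambda>j. field_at (X j) ch (z j)) [0..<n])) =
    expansion (gm (Qf t) (\<lambda>p. m (cjet ch (z (fst p)) (snd p)) + Mf t p))"
proof -
  define jet where "jet i = cjet ch (z i)" for i
  define nd where "nd i = Jet id 0 0 (chart_par ch (z i))" for i
  define R where "R i a b = (if i < n then Rj \<xi> t (z i) a b else 0)" for i a b
  define \<mu> where "\<mu> i = Mj \<xi> b t (z i)" for i
  define x where "x i = X i ch (z i)" for i
  have f: "z i \<in> fdom \<xi> t" if "i < n" for i using c_fdom[OF ch dom[OF that]] .
  have ne: "z i \<noteq> z k" if "i < k" "k < n" for i k using inj_onD[OF z_inj, of i k] that by auto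
  interpret C: correlation jet nd R \<mu> x T "{..<n}"
  proof
    show "R i a b = R i b a" for i a b using f Rj_sym by (simp add: R_def)
    show "represents (R i) (\<mu> i) (x i) (T i)" if "i \<in> {..<n}" for i
      using good[of i] ch dom[of i] that unfolding good_def R_def[abs_def] \<mu>_def x_def by auto
    fix i k a b assume ik: "i \<in> {..<n}" "k \<in> {..<n}" "i < k"
    then show "adm (\<lambda>a. pair_exp (jet i a) (jet k b))" "adm (\<lambda>b. pair_exp (jet i a) (jet k b))"
      using adm_flow[OF ch dom dom ne, of i k] by (auto simp: jet_def)
  qed (simp_all add: nd_def jet_def pair_exp_node)
  have "fprod_list (map (\<lambda>j. field_at (X j) ch (z j)) [0..<n]) =
     foldr (\<star>) (map (\<lambda>i. field_functional (jet i) (nd i) (x i)) [0..<n]) 1"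
    by (simp add: fprod_list_def field_at_eq jet_def nd_def x_def)
  also have "ev m \<dots> = (\<Sum>(d, \<gamma>, zs)\<leftarrow>choices T [0..<n]. d * gm C.Qc (C.Mc m) \<gamma> zs)"
    by (rule C.ev_product) (use m in \<open>auto simp: nd_def jet_def\<close>)
  also have "\<dots> = expansion (gm C.Qc (C.Mc m))" by (simp add: expansion_def)
  also have "\<dots> = expansion (gm (Qf t) (\<lambda>p. m (cjet ch (z (fst p)) (snd p)) + Mf t p))"
  proof (rule expansion_cong, rule gm_cong)
    fix \<gamma> :: "nat \<times> nat \<times> nat \<Rightarrow>\<^sub>0 complex" and zs and p q :: "nat \<times> nat \<times> nat" assume sub: "fst ` (Poly_Mapping.keys \<gamma> \<union> set zs) \<subseteq> {..<n}"
    assume p: "p \<in> set zs \<union> Poly_Mapping.keys \<gamma>"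
    then have pn: "fst p < n" using sub by auto
    show "C.Mc m p = m (cjet ch (z (fst p)) (snd p)) + Mf t p"
      by (cases p) (simp add: C.Mc_def jet_def \<mu>_def Mf_def)
    assume "q \<in> set zs \<union> Poly_Mapping.keys \<gamma>"
    then have qn: "fst q < n" using sub by auto
    obtain i a where pp: "p = (i, a)" by (rule prod.exhaust)
    obtain k d where qq: "q = (k, d)" by (rule prod.exhaust)
    have ik: "i < n" "k < n" using pn qn by (simp_all add: pp qq)
    have pe: "pair_exp (jet i a) (jet k d) = 2 * (ej \<xi> er a d (t, z i, z k) + ej \<xi> el a d (t, z i, z k))"
      if "i < k" "k < n" for i k a d
      unfolding jet_def using pair_exp_flow[OF ch dom dom ne[OF that]] that by simp
    show "C.Qc p q = Qf t p q"
    proof (cases i k rule: linorder_cases)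
      case less
      then show ?thesis using pe[OF less ik(2)] f ik ne[OF less ik(2)] by (simp add: pp qq Qf_def Let_def)
    next
      case equal
      then show ?thesis using f ik by (simp add: pp qq Qf_def Let_def R_def Rj_def)
    next
      case greater
      then show ?thesis using pe[OF greater ik(1)] f ik ne[OF greater ik(1)]
        by (simp add: pp qq Qf_def Let_def er_symmetric[of "z k" \<xi> t "z i"] el_sym[of "z k" "z i" d a])
    qed
  qed
  finally show ?thesis .
qed

text \<open>
  The fields together with Gaussian variables \<open>g\<close> at other nodes. The latter have neither mean nor
  covariance among themselves, so an exponential of them only shifts the mean of the fields.
\<close>

fun Qe :: "(nat \<times> nat \<times> nat \<Rightarrow> nat \<times> nat \<times> nat \<Rightarrow> complex) \<Rightarrow> (nat \<times> nat \<times> nat \<Rightarrow> gvar \<Rightarrow> complex) \<Rightarrow>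
    (nat \<times> nat \<times> nat) + gvar \<Rightarrow> (nat \<times> nat \<times> nat) + gvar \<Rightarrow> complex" where
  "Qe Q s (Inl p) (Inl q) = Q p q"
| "Qe Q s (Inl p) (Inr g) = s p g"
| "Qe Q s (Inr g) (Inl p) = s p g"
| "Qe Q s (Inr g) (Inr h) = 0"

definition Me :: "(nat \<times> nat \<times> nat \<Rightarrow> complex) \<Rightarrow> (nat \<times> nat \<times> nat) + gvar \<Rightarrow> complex" where
  "Me m = case_sum m (\<lambda>g. 0)"

lemma Me_simps [simp]: "Me m (Inl p) = m p" "Me m (Inr g) = 0" by (simp_all add: Me_def)

lemma Qe_sym: "(\<And>p q. Q p q = Q q p) \<Longrightarrow> Qe Q s x y = Qe Q s y x"
  by (cases x; cases y) auto

text \<open>The correlation of the fields with a test monomial: labels \<open>Inr\<close> are the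
  variables of the test functional, labels \<open>Inl\<close> the jets at the nodes.\<close>

definition joint :: "(((nat \<times> nat \<times> nat) + gvar \<Rightarrow>\<^sub>0 complex) \<Rightarrow> ((nat \<times> nat \<times> nat) + gvar) list \<Rightarrow> complex) \<Rightarrow>
    (gvar \<Rightarrow>\<^sub>0 complex) \<Rightarrow> gvar list \<Rightarrow> complex" where
  "joint \<Phi> \<delta> ys = expansion (\<lambda>\<gamma> zs. \<Phi> (push Inr \<delta> + push Inl \<gamma>) (map Inr ys @ map Inl zs))"

lemma coh_joint:
  assumes "coh \<Phi>"
  shows "coh (joint \<Phi>)"
  unfolding coh_def joint_def expansion_def
proof (intro allI)
  fix \<delta> :: "gvar \<Rightarrow>\<^sub>0 complex" and g :: gvar and ys :: "gvar list"
  have 1: "push Inr (\<delta> + Poly_Mapping.single g s) + push Inl \<gamma> = (push Inr \<delta> + push Inl \<gamma>) + Poly_Mapping.single (Inr g) s"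
    for s and \<gamma> :: "nat \<times> nat \<times> nat \<Rightarrow>\<^sub>0 complex"
    by (simp add: push_add_single algebra_simps)
  show "((\<lambda>s. \<Sum>(d, \<gamma>, zs)\<leftarrow>choices T [0..<n]. d * \<Phi> (push Inr (\<delta> + Poly_Mapping.single g s) + push Inl \<gamma>) (map Inr ys @ map Inl zs))
     has_field_derivative (\<Sum>(d, \<gamma>, zs)\<leftarrow>choices T [0..<n]. d * \<Phi> (push Inr \<delta> + push Inl \<gamma>) (map Inr (g # ys) @ map Inl zs))) (at 0)"
    unfolding 1 case_prod_unfold list.map append.simps
    by (intro DERIV_sum_list DERIV_cmult) (use assms in \<open>auto simp: coh_def\<close>)
qed

lemma joint_Nil:
  assumes "\<And>p q. Q p q = Q q p" "\<And>p q. P p q = P q p"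
  shows "joint (gm (Qe Q s) (Me m)) \<delta> [] = expansion (gm Q (\<lambda>p. m p + lin \<delta> (s p)))"
    and "joint (conv (dg (Qe P s') (Me v)) (gm (Qe Q s) (Me m))) \<delta> [] =
      expansion (conv (dg P (\<lambda>p. v p + lin \<delta> (s' p))) (gm Q (\<lambda>p. m p + lin \<delta> (s p))))"
proof -
  have z: "lin (push Inr \<delta>) (Me m) = 0" "lin (push Inr \<delta>) (\<lambda>x. lin (push Inr \<delta>) (Qe Q s x)) = 0"
    "lin (push Inr \<delta>) (Qe Q s (Inl p)) = lin \<delta> (s p)" for m Q s p
    by (simp_all add: lin_push)
  note sh = conv_shift_reindex[of "Qe Q s" "push Inr \<delta>" "Me m" "Qe P s'" "Me v" Inl, OF Qe_sym[OF assms(1)] z(1,2) Qe_sym[OF assms(2)] z(1,2)]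
  show "joint (gm (Qe Q s) (Me m)) \<delta> [] = expansion (gm Q (\<lambda>p. m p + lin \<delta> (s p)))"
    "joint (conv (dg (Qe P s') (Me v)) (gm (Qe Q s) (Me m))) \<delta> [] =
      expansion (conv (dg P (\<lambda>p. v p + lin \<delta> (s' p))) (gm Q (\<lambda>p. m p + lin \<delta> (s p))))"
    unfolding joint_def list.map append.simps sh by (simp_all add: z)
qed

lemma coh_expect: "coh (\<lambda>\<delta> ys. expect (F \<star> Poly_Mapping.single (mset ys, \<delta>) 1))"
  unfolding coh_def expect_eq_ev using ev_right_deriv by simp

text \<open>Both sides satisfy \<open>coh\<close> in the parameters of the test functional, so
  exponentials over B suffice. Restricting to B makes it possible to keep the test nodes away from
  the moved nodes.\<close>

lemma expect_joint:
  assumes \<Phi>: "coh \<Phi>"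
    and base: "\<And>\<delta>. Poly_Mapping.keys \<delta> \<subseteq> B \<Longrightarrow> ev (\<lambda>g. lin \<delta> (pair_exp g)) F = joint \<Phi> \<delta> []"
    and "set ys \<subseteq> B" "Poly_Mapping.keys \<delta> \<subseteq> B"
  shows "expect (F \<star> Poly_Mapping.single (mset ys, \<delta>) 1) = joint \<Phi> \<delta> ys"
proof -
  have "(\<lambda>\<delta> ys. expect (F \<star> Poly_Mapping.single (mset ys, \<delta>) 1)) \<delta> (ys @ []) = joint \<Phi> \<delta> (ys @ [])"
  proof (rule coh_unique[OF coh_expect coh_joint[OF \<Phi>], where B = B and \<gamma>\<^sub>0 = 0])
    fix \<delta> :: "gvar \<Rightarrow>\<^sub>0 complex" assume "Poly_Mapping.keys (\<delta> - 0) \<subseteq> B"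
    then show "expect (F \<star> Poly_Mapping.single (mset [], \<delta>) 1) = joint \<Phi> \<delta> []"
      using base[of \<delta>] by (simp add: expect_exp_right)
  qed (use assms in auto)
  then show ?thesis by simp
qed

lemma expect_fields:
  assumes ch: "flow_chart \<xi> w t ch" and dom: "\<And>j. j < n \<Longrightarrow> z j \<in> chart_dom ch"
    and B: "B \<subseteq> outer" "\<And>g j. g \<in> B \<Longrightarrow> j < n \<Longrightarrow> node g \<noteq> chart_par ch (z j)"
    and ys: "set ys \<subseteq> B" "Poly_Mapping.keys \<delta> \<subseteq> B"
  shows "expect (fprod_list (map (\<lambda>j. field_at (X j) ch (z j)) [0..<n]) \<star> Poly_Mapping.single (mset ys, \<delta>) 1) =
    joint (gm (Qe (Qf t) (sr t)) (Me (Mf t))) \<delta> ys"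
proof (rule expect_joint[OF _ _ ys])
  show "coh (gm (Qe (Qf t) (sr t)) (Me (Mf t)))" by (rule coh_gm) (rule Qe_sym[OF Qf_sym])
  fix \<delta> :: "gvar \<Rightarrow>\<^sub>0 complex" assume \<delta>: "Poly_Mapping.keys \<delta> \<subseteq> B"
  have g: "pair_exp (cjet ch (z i) a) g = sr t (i, a) g" "adm (\<lambda>a. pair_exp (cjet ch (z i) a) g)"
    if ig: "i < n" "g \<in> Poly_Mapping.keys \<delta>" for i a g
  proof -
    obtain l m y where y: "g = Jet id l m y" "Im y > 0" using ig(2) \<delta> B(1) unfolding outer_def upper_half_plane_def by auto
    have "y \<noteq> chart_par ch (z i)" using B(2)[of g i] that \<delta> by (auto simp: y(1))
    then show "pair_exp (cjet ch (z i) a) g = sr t (i, a) g" "adm (\<lambda>a. pair_exp (cjet ch (z i) a) g)"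
      using pair_exp_source[OF ch dom[OF that(1)] y(2)] adm_source[OF ch dom[OF that(1)] y(2)] by (simp_all add: y(1) sr_def)
  qed
  have "ev (\<lambda>g. lin \<delta> (pair_exp g)) (fprod_list (map (\<lambda>j. field_at (X j) ch (z j)) [0..<n])) =
    expansion (gm (Qf t) (\<lambda>p. lin \<delta> (pair_exp (cjet ch (z (fst p)) (snd p))) + Mf t p))"
  proof (rule ev_fields[OF ch dom])
    show "lin \<delta> (pair_exp (Jet id 0 0 (chart_par ch (z i)))) = lin \<delta> (pair_exp (cjet ch (z i) (0, 0)))" for i
      by (rule lin_cong) (rule pair_exp_node)
    show "adm (\<lambda>a. lin \<delta> (pair_exp (cjet ch (z i) a)))" if "i < n" for i
      using adm_lin[of \<delta> "\<lambda>a g. pair_exp (cjet ch (z i) a) g"] g(2)[OF that] by blast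
  qed
  also have "\<dots> = expansion (gm (Qf t) (\<lambda>p. Mf t p + lin \<delta> (sr t p)))"
  proof (rule expansion_cong, rule gm_cong)
    fix \<gamma> zs and p :: "nat \<times> nat \<times> nat" assume "fst ` (Poly_Mapping.keys \<gamma> \<union> set zs) \<subseteq> {..<n}" "p \<in> set zs \<union> Poly_Mapping.keys \<gamma>"
    then have "fst p < n" by auto
    then have "lin \<delta> (pair_exp (cjet ch (z (fst p)) (snd p))) = lin \<delta> (sr t p)" by (intro lin_cong) (simp add: g)
    then show "lin \<delta> (pair_exp (cjet ch (z (fst p)) (snd p))) + Mf t p = Mf t p + lin \<delta> (sr t p)" by simp
  qed simp
  also have "\<dots> = joint (gm (Qe (Qf t) (sr t)) (Me (Mf t))) \<delta> []"
    by (rule joint_Nil(1)[OF Qf_sym Qf_sym, symmetric])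
  finally show "ev (\<lambda>g. lin \<delta> (pair_exp g)) (fprod_list (map (\<lambda>j. field_at (X j) ch (z j)) [0..<n])) = joint (gm (Qe (Qf t) (sr t)) (Me (Mf t))) \<delta> []" .
qed

end

lemma conv_dg_gm_cong:
  assumes S: "set xs \<union> Poly_Mapping.keys \<gamma> \<subseteq> S"
    and "\<And>x y. x \<in> S \<Longrightarrow> y \<in> S \<Longrightarrow> P x y = P' x y" "\<And>x. x \<in> S \<Longrightarrow> v x = v' x"
    and "\<And>x y. x \<in> S \<Longrightarrow> y \<in> S \<Longrightarrow> Q x y = Q' x y" "\<And>x. x \<in> S \<Longrightarrow> m x = m' x"
  shows "conv (dg P v) (gm Q m) \<gamma> xs = conv (dg P' v') (gm Q' m') \<gamma> xs"
  unfolding conv_def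
proof (intro arg_cong[where f = sum_list] map_cong refl, clarify)
  fix a b assume "(a, b) \<in> set (splits xs)"
  from splits_set[OF this] have "set a \<union> Poly_Mapping.keys \<gamma> \<subseteq> S" "set b \<union> Poly_Mapping.keys \<gamma> \<subseteq> S" using S by auto
  then have "x \<in> set a \<union> Poly_Mapping.keys \<gamma> \<Longrightarrow> x \<in> S" "x \<in> set b \<union> Poly_Mapping.keys \<gamma> \<Longrightarrow> x \<in> S" for x by blast+
  then have "dg P v \<gamma> a = dg P' v' \<gamma> a" "gm Q m \<gamma> b = gm Q' m' \<gamma> b"
    by (intro dg_cong gm_cong assms(2-); blast)+
  then show "dg P v \<gamma> a * gm Q m \<gamma> b = dg P' v' \<gamma> a * gm Q' m' \<gamma> b" by simp
qed

lemma vact_lin: "lin \<delta> (\<lambda>g. vact \<xi> x (\<lambda>a. f a g) d) = vact \<xi> x (\<lambda>a. lin \<delta> (f a)) d"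
  by (cases d) (simp add: vval_def case_prod_unfold lin_fun_sum_list lin_fun_scale)

lemma vact_scale: "r * vact \<xi> x m d = vact \<xi> x (\<lambda>a. r * m a) d"
  by (cases d) (simp add: vval_def case_prod_unfold sum_list_const_mult[symmetric] mult_ac)

lemma choices_keys: "l \<in> set (choices T js) \<Longrightarrow> p \<in> Poly_Mapping.keys (fst (snd l)) \<Longrightarrow> snd p = (0, 0)"
proof (induction js arbitrary: l)
  case (Cons j js)
  then obtain k l' where "fst (snd l) = Poly_Mapping.single (j, 0, 0) (snd (snd k)) + fst (snd l')" "l' \<in> set (choices T js)"
    by (auto simp: case_prod_unfold)
  moreover from this have "p \<in> Poly_Mapping.keys (Poly_Mapping.single (j, 0 :: nat, 0 :: nat) (snd (snd k))) \<union> Poly_Mapping.keys (fst (snd l'))"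
    using Cons.prems(2) Poly_Mapping.keys_add by fastforce
  ultimately consider "p \<in> Poly_Mapping.keys (Poly_Mapping.single (j, 0 :: nat, 0 :: nat) (snd (snd k)))"
    | "l' \<in> set (choices T js)" "p \<in> Poly_Mapping.keys (fst (snd l'))" by blast
  then show ?case
  proof cases
    case 1
    then show ?thesis by (auto split: if_splits)
  next
    case 2
    then show ?thesis by (rule Cons.IH)
  qed
qed simp

lemma eventually_fdom:
  assumes "x \<in> \<H>"
  shows "\<forall>\<^sub>F t in nhds 0. x \<in> fdom \<xi> t"
proof -
  have "((\<lambda>t. 2 * complex_of_real t - (x - of_real \<xi>)\<^sup>2) \<longlongrightarrow> 2 * of_real 0 - (x - of_real \<xi>)\<^sup>2) (nhds 0)"
    by (intro tendsto_intros filterlim_ident)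
  moreover have "open (- \<real>\<^sub>\<le>\<^sub>0 :: complex set)" by (simp add: open_Compl)
  moreover have "x \<in> fdom \<xi> 0" using assms by (simp add: fdom_0)
  ultimately have "\<forall>\<^sub>F t in nhds 0. 2 * complex_of_real t - (x - of_real \<xi>)\<^sup>2 \<in> - \<real>\<^sub>\<le>\<^sub>0"
    by (intro topological_tendstoD) (auto simp: fdom_def)
  then show ?thesis by eventually_elim (use assms in \<open>simp add: fdom_def upper_half_plane_def\<close>)
qed

locale heat = field_product w c \<xi> b n X z T
  for w c \<xi> b n X z T +
  fixes a :: real
  assumes a: "a > 0" "2 * a * (a + b) = 1"
begin

text \<open>\<open>dQ\<close>, \<open>dM\<close> and \<open>ds\<close> are the derivatives at t = 0
  of \<open>Qf\<close>, \<open>Mf\<close> and \<open>sr\<close>; the first is already written in the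
  factorized form of \<open>flow_er_derivative\<close>.\<close>

definition dQ where
  "dQ p q = of_real (1 / a\<^sup>2) * u1 \<xi> a (z (fst p)) (snd p) * u1 \<xi> a (z (fst q)) (snd q)"
definition dM :: "nat \<times> nat \<times> nat \<Rightarrow> complex" where
  "dM p = - 2 * of_real b * ej \<xi> (der Dt emu) (snd p) (0, 0) (0, z (fst p), 0)"
definition ds :: "nat \<times> nat \<times> nat \<Rightarrow> gvar \<Rightarrow> complex" where
  "ds p g = 2 * ej \<xi> (der Dt esrc) (snd p) (order_of g) (0, z (fst p), node g)"

definition idx :: "((nat \<times> nat \<times> nat) + gvar) set" where
  "idx = Inl ` {p. fst p < n} \<union> Inr ` outer"

lemma dQ_sym: "dQ p q = dQ q p" by (simp add: dQ_def mult_ac)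

lemma fdom_node: "i < n \<Longrightarrow> z i \<in> fdom \<xi> 0" using z_upper by (simp add: fdom_0)

lemma outer_node:
  assumes "g \<in> outer" "i < n"
  shows "Im (node g) > 0" "node g \<in> \<H>" "z i \<noteq> node g" "node g \<noteq> of_real \<xi> + flow_root 0 (z i - of_real \<xi>)"
  using assms flow_root_0'[OF z_upper[OF assms(2)], of \<xi>] by (auto simp: outer_def upper_half_plane_def)

lemma Qf_derivative:
  assumes "fst p < n" "fst q < n"
  shows "((\<lambda>t. Qf t p q) has_derivative (\<lambda>h. of_real h * dQ p q)) (at 0)"
proof -
  let ?x = "z (fst p)" and ?y = "z (fst q)"
  \<comment> \<open>The singular part is the same for all t, so it enters as a constant and drops
    out of the derivative.\<close>
  let ?k = "if ?x = ?y then 0 else 2 * ej \<xi> el (snd p) (snd q) (0, ?x - ?y, 0)"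
  have "((\<lambda>t. 2 * ej \<xi> er (snd p) (snd q) (t, ?x, ?y) + ?k) has_derivative
      (\<lambda>h. 2 * (ej \<xi> (der Dt er) (snd p) (snd q) (0, ?x, ?y) * of_real h) + 0)) (at 0)"
    by (intro has_derivative_add has_derivative_mult_right ej_has_derivative_t valid_er has_derivative_const fdom_node assms)
  then have "((\<lambda>t. 2 * ej \<xi> er (snd p) (snd q) (t, ?x, ?y) + ?k) has_derivative (\<lambda>h. of_real h * dQ p q)) (at 0)"
    unfolding dQ_def flow_er_derivative[OF a(1) z_upper[OF assms(1)] z_upper[OF assms(2)], symmetric] by (simp add: mult_ac)
  then show ?thesis
  proof (rule has_derivative_cong_nhds)
    show "\<forall>\<^sub>F t in nhds 0. 2 * ej \<xi> er (snd p) (snd q) (t, ?x, ?y) + ?k = Qf t p q"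
      using eventually_fdom[OF z_upper[OF assms(1)], of \<xi>] eventually_fdom[OF z_upper[OF assms(2)], of \<xi>]
    proof eventually_elim
      case (elim t)
      then show ?case using ej_el_shift[of ?x ?y \<xi> "snd p" "snd q" t] by (simp add: Qf_def Let_def)
    qed
  qed
qed

lemma sr_derivative:
  assumes "fst p < n" "g \<in> outer"
  shows "((\<lambda>t. sr t p g) has_derivative (\<lambda>h. of_real h * ds p g)) (at 0)"
proof -
  have "((\<lambda>t. sr t p g) has_derivative (\<lambda>h. 2 * (ej \<xi> (der Dt esrc) (snd p) (order_of g) (0, z (fst p), node g) * of_real h))) (at 0)"
    unfolding sr_def by (intro has_derivative_mult_right ej_has_derivative_t valid_esrc fdom_node outer_node(1)[OF assms(2,1)] outer_node(4)[OF assms(2,1)] assms)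
  then show ?thesis by (simp add: ds_def mult_ac)
qed

lemma Mf_derivative:
  assumes "fst p < n"
  shows "((\<lambda>t. Mf t p) has_derivative (\<lambda>h. of_real h * dM p)) (at 0)"
proof -
  have "((\<lambda>t. Mf t p) has_derivative (\<lambda>h. - 2 * of_real b * (ej \<xi> (der Dt emu) (snd p) (0, 0) (0, z (fst p), 0) * of_real h))) (at 0)"
    unfolding Mf_def Mj_def by (intro has_derivative_mult_right ej_has_derivative_t valid_emu fdom_node assms)
  then show ?thesis by (simp add: dM_def mult_ac)
qed

definition DJ :: "((nat \<times> nat \<times> nat) + gvar \<Rightarrow>\<^sub>0 complex) \<Rightarrow> ((nat \<times> nat \<times> nat) + gvar) list \<Rightarrow> complex" where
  "DJ = conv (dg (Qe dQ ds) (Me dM)) (gm (Qe (Qf 0) (sr 0)) (Me (Mf 0)))"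

lemma gm_flow_derivative:
  assumes "set xs \<subseteq> idx" "Poly_Mapping.keys \<gamma> \<subseteq> idx"
  shows "((\<lambda>t. gm (Qe (Qf t) (sr t)) (Me (Mf t)) \<gamma> xs) has_derivative (\<lambda>h. of_real h * DJ \<gamma> xs)) (at 0)"
proof -
  have "((\<lambda>t. gm (Qe (Qf t) (sr t)) (Me (Mf t)) \<gamma> xs) has_derivative
    (\<lambda>h. conv (dg (\<lambda>x y. of_real h * Qe dQ ds x y) (\<lambda>x. of_real h * Me dM x)) (gm (Qe (Qf 0) (sr 0)) (Me (Mf 0))) \<gamma> xs)) (at 0)"
  proof (rule gm_has_derivative[OF _ _ _ assms])
    fix x y assume "x \<in> idx" "y \<in> idx"
    then show "((\<lambda>t. Qe (Qf t) (sr t) x y) has_derivative (\<lambda>h. of_real h * Qe dQ ds x y)) (at 0)"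
      by (cases x; cases y) (auto simp: idx_def intro: Qf_derivative sr_derivative)
  next
    fix x assume "x \<in> idx"
    then show "((\<lambda>t. Me (Mf t) x) has_derivative (\<lambda>h. of_real h * Me dM x)) (at 0)"
      by (cases x) (auto simp: idx_def intro: Mf_derivative)
  next
    show "Qe (Qf t) (sr t) x y = Qe (Qf t) (sr t) y x" for t x y by (rule Qe_sym[OF Qf_sym])
  qed
  moreover have "conv (dg (\<lambda>x y. of_real h * Qe dQ ds x y) (\<lambda>x. of_real h * Me dM x)) (gm (Qe (Qf 0) (sr 0)) (Me (Mf 0))) \<gamma> xs =
     of_real h * DJ \<gamma> xs" for h :: real
    unfolding DJ_def conv_def dg_scale by (simp add: case_prod_unfold sum_list_const_mult[symmetric] mult.assoc)
  ultimately show ?thesis by simp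
qed

lemma joint_derivative:
  assumes ys: "set ys \<subseteq> outer" "Poly_Mapping.keys \<delta> \<subseteq> outer"
  shows "((\<lambda>t. joint (gm (Qe (Qf t) (sr t)) (Me (Mf t))) \<delta> ys) has_vector_derivative joint DJ \<delta> ys) (at 0)"
proof -
  have push_keys: "Poly_Mapping.keys (push f \<gamma>) \<subseteq> f ` Poly_Mapping.keys \<gamma>" for f :: "'x \<Rightarrow> 'y" and \<gamma>
  proof -
    have "Poly_Mapping.keys (push f \<gamma>) \<subseteq> (\<Union>k\<in>Poly_Mapping.keys \<gamma>. Poly_Mapping.keys (Poly_Mapping.single (f k) (Poly_Mapping.lookup \<gamma> k)))"
      unfolding push_def by (rule Poly_Mapping.keys_sum)
    also have "\<dots> \<subseteq> f ` Poly_Mapping.keys \<gamma>" by auto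
    finally show ?thesis .
  qed
  have "((\<lambda>t. \<Sum>l\<leftarrow>choices T [0..<n]. fst l * gm (Qe (Qf t) (sr t)) (Me (Mf t)) (push Inr \<delta> + push Inl (fst (snd l))) (map Inr ys @ map Inl (snd (snd l)))) has_derivative
     (\<lambda>h. \<Sum>l\<leftarrow>choices T [0..<n]. fst l * (of_real h * DJ (push Inr \<delta> + push Inl (fst (snd l))) (map Inr ys @ map Inl (snd (snd l)))))) (at 0)"
  proof (intro has_derivative_sum_list has_derivative_mult_right gm_flow_derivative)
    fix l assume l: "l \<in> set (choices T [0..<n])"
    then have sub: "fst ` (Poly_Mapping.keys (fst (snd l)) \<union> set (snd (snd l))) \<subseteq> {..<n}"
      using choices_subset[of "fst l" "fst (snd l)" "snd (snd l)" T "[0..<n]"] by auto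
    show "set (map Inr ys @ map Inl (snd (snd l))) \<subseteq> idx" using ys sub by (auto simp: idx_def)
    have "Poly_Mapping.keys (push Inr \<delta> + push Inl (fst (snd l))) \<subseteq> Inr ` Poly_Mapping.keys \<delta> \<union> Inl ` Poly_Mapping.keys (fst (snd l))"
      using Poly_Mapping.keys_add[of "push Inr \<delta>" "push Inl (fst (snd l))"] push_keys[of Inr \<delta>] push_keys[of Inl "fst (snd l)"] by blast
    moreover have "Inr ` Poly_Mapping.keys \<delta> \<subseteq> idx" "Inl ` Poly_Mapping.keys (fst (snd l)) \<subseteq> idx" using ys sub by (auto simp: idx_def)
    ultimately show "Poly_Mapping.keys (push Inr \<delta> + push Inl (fst (snd l))) \<subseteq> idx" by blast
  qed
  then show ?thesis
    unfolding has_vector_derivative_def joint_def expansion_def case_prod_unfold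
    by (simp add: scaleR_conv_of_real sum_list_const_mult[symmetric] mult.left_commute)
qed

definition jt :: "nat \<times> nat \<times> nat \<Rightarrow> gvar" where
  "jt p = Jet id (fst (snd p)) (snd (snd p)) (z (fst p))"

text \<open>A mean m given in the half-plane is transported along v, because the charts move the
  nodes; \<open>dM\<close> is the change of the mean of the field itself.\<close>

definition lie_mean :: "(gvar \<Rightarrow> complex) \<Rightarrow> nat \<times> nat \<times> nat \<Rightarrow> complex" where
  "lie_mean m p = vact \<xi> (z (fst p)) (\<lambda>d. m (jt (fst p, d))) (snd p) + dM p"

text \<open>The value that the Lie derivative must have when the field is shifted by m.\<close>

definition \<Lambda> :: "(gvar \<Rightarrow> complex) \<Rightarrow> complex" where
  "\<Lambda> m = expansion (conv (dg dQ (lie_mean m)) (gm (Qf 0) (\<lambda>p. m (jt p) + Mf 0 p)))"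

text \<open>\<open>\<Lambda>\<close> depends on m through finitely many jets at the nodes,
  polynomially and through exponentials of field values, so it is the evaluation of a functional.
  This gives the existence of the Lie derivative.\<close>

lemma evaluable_\<Lambda>: "evaluable nodes \<Lambda>"
proof -
  have "evaluable nodes (\<lambda>m. \<Sum>l\<leftarrow>choices T [0..<n]. fst l *
     (\<Sum>s\<leftarrow>splits (snd (snd l)). dg dQ (lie_mean m) (fst (snd l)) (fst s) * gm (Qf 0) (\<lambda>p. m (jt p) + Mf 0 p) (fst (snd l)) (snd s)))"
  proof (intro evaluable_sum_list evaluable_mult evaluable_const)
    fix l s assume l: "l \<in> set (choices T [0..<n])" and s: "s \<in> set (splits (snd (snd l)))"
    have sub: "fst ` (Poly_Mapping.keys (fst (snd l)) \<union> set (snd (snd l))) \<subseteq> {..<n}"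
      using l choices_subset[of "fst l" "fst (snd l)" "snd (snd l)" T "[0..<n]"] by auto
    have s': "set (fst s) \<subseteq> set (snd (snd l))" "set (snd s) \<subseteq> set (snd (snd l))"
      using splits_set[of "fst s" "snd s"] s by auto
    have v: "evaluable nodes (\<lambda>m. m (jt p))" if "fst p < n" for p
      unfolding jt_def by (rule evaluable_var) (use that in auto)
    show "evaluable nodes (\<lambda>m. dg dQ (lie_mean m) (fst (snd l)) (fst s))"
    proof (rule evaluable_dg)
      fix p assume "p \<in> set (fst s) \<union> Poly_Mapping.keys (fst (snd l))"
      then have "fst p < n" using sub s' by auto
      then show "evaluable nodes (\<lambda>m. lie_mean m p)"
        unfolding lie_mean_def
        by (cases "snd p") (auto simp: vval_def case_prod_unfold intro!: evaluable_add evaluable_const evaluable_sum_list evaluable_mult v)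
    qed
    show "evaluable nodes (\<lambda>m. gm (Qf 0) (\<lambda>p. m (jt p) + Mf 0 p) (fst (snd l)) (snd s))"
    proof (rule evaluable_gm)
      fix p assume "p \<in> set (snd s) \<union> Poly_Mapping.keys (fst (snd l))"
      then have "fst p < n" using sub s' by auto
      then show "evaluable nodes (\<lambda>m. m (jt p) + Mf 0 p)" by (intro evaluable_add evaluable_const v)
    next
      fix p assume p: "p \<in> Poly_Mapping.keys (fst (snd l))"
      then have "fst p < n" "snd p = (0, 0)" using sub choices_keys[OF l] by auto
      then show "\<exists>y\<in>nodes. \<exists>r. \<forall>m. m (jt p) + Mf 0 p = m (Jet id 0 0 y) + r" by (auto simp: jt_def)
    qed
  qed
  then show ?thesis by (simp add: \<Lambda>_def[abs_def] expansion_def conv_def case_prod_unfold)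
qed

lemma pair_exp_jt:
  assumes "fst p < n" "g \<in> outer"
  shows "pair_exp (jt p) g = sr 0 p g"
proof -
  obtain l m y where g: "g = Jet id l m y" "y \<in> \<H>" "y \<notin> nodes" using assms(2) by (auto simp: outer_def)
  have "z (fst p) \<in> chart_dom (id_chart w)" using z_upper assms by (simp add: id_chart_def)
  from pair_exp_source[OF flow_chart_id this, of y "snd p" l m \<xi>]
  show ?thesis using g assms by (auto simp: sr_def jt_def cjet_def id_chart_def case_prod_unfold upper_half_plane_def)
qed

text \<open>For sources, the change of the pair expectations under the flow is the transport of the
  mean that they produce, by \<open>vact_source\<close>.\<close>

lemma \<Lambda>_joint:
  assumes \<delta>: "Poly_Mapping.keys \<delta> \<subseteq> outer"
  shows "\<Lambda> (\<lambda>g. lin \<delta> (pair_exp g)) = joint DJ \<delta> []"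
proof -
  have "joint DJ \<delta> [] = expansion (conv (dg dQ (\<lambda>p. dM p + lin \<delta> (ds p))) (gm (Qf 0) (\<lambda>p. Mf 0 p + lin \<delta> (sr 0 p))))"
    unfolding DJ_def by (rule joint_Nil(2)[OF Qf_sym dQ_sym])
  also have "\<dots> = \<Lambda> (\<lambda>g. lin \<delta> (pair_exp g))"
    unfolding \<Lambda>_def
  proof (rule expansion_cong, rule conv_dg_gm_cong[where S = "{p. fst p < n}"])
    fix p :: "nat \<times> nat \<times> nat" assume p: "p \<in> {p. fst p < n}"
    then have l: "lin \<delta> (pair_exp (jt (fst p, d))) = lin \<delta> (sr 0 (fst p, d))" for d
      using \<delta> by (intro lin_cong pair_exp_jt) auto
    from l[of "snd p"] show "Mf 0 p + lin \<delta> (sr 0 p) = lin \<delta> (pair_exp (jt p)) + Mf 0 p" by simp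
    have "lin \<delta> (ds p) = lin \<delta> (\<lambda>g. vact \<xi> (z (fst p)) (\<lambda>d. sr 0 (fst p, d) g) (snd p))"
    proof (rule lin_cong)
      fix g assume "g \<in> Poly_Mapping.keys \<delta>"
      then have "g \<in> outer" using \<delta> by auto
      then have "z (fst p) \<in> \<H>" "node g \<in> \<H>" "z (fst p) \<noteq> node g" using p z_upper outer_node by auto
      from vact_source[OF this, of \<xi> "snd p" "order_of g"]
      show "ds p g = vact \<xi> (z (fst p)) (\<lambda>d. sr 0 (fst p, d) g) (snd p)"
        unfolding ds_def sr_def by (simp add: vact_scale)
    qed
    also have "\<dots> = vact \<xi> (z (fst p)) (\<lambda>d. lin \<delta> (pair_exp (jt (fst p, d)))) (snd p)"
      unfolding vact_lin l ..
    finally show "dM p + lin \<delta> (ds p) = lie_mean (\<lambda>g. lin \<delta> (pair_exp g)) p" by (simp add: lie_mean_def)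
  qed auto
  finally show ?thesis by simp
qed

end

lemma ev_cong:
  assumes "\<And>p g. p \<in> Poly_Mapping.keys F \<Longrightarrow> g \<in># fst p \<or> g \<in> Poly_Mapping.keys (snd p) \<Longrightarrow> m g = m' g"
  shows "ev m F = ev m' F"
  unfolding ev_def
proof (rule lin_cong)
  fix p assume p: "p \<in> Poly_Mapping.keys F"
  have "image_mset m (fst p) = image_mset m' (fst p)" using assms[OF p] by (intro image_mset_cong) auto
  moreover have "lin (snd p) m = lin (snd p) m'" using assms[OF p] by (intro lin_cong) auto
  ultimately show "mon m p = mon m' p" by (simp add: mon_def)
qed

lemma dg_mean_has_derivative:
  fixes u :: "real \<Rightarrow> 'i \<Rightarrow> complex"
  assumes u: "\<And>p. p \<in> S \<Longrightarrow> ((\<lambda>x. u x p) has_derivative (\<lambda>h. u' h p)) F" and S: "set xs \<subseteq> S" "Poly_Mapping.keys \<gamma> \<subseteq> S"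
  shows "((\<lambda>x. dg (\<lambda>_ _. 0) (u x) \<gamma> xs) has_derivative (\<lambda>h. dg (\<lambda>_ _. 0) (u' h) \<gamma> xs)) F"
proof -
  have l: "((\<lambda>x. lin \<gamma> (u x)) has_derivative (\<lambda>h. lin \<gamma> (u' h))) F"
    by (rule has_derivative_lin) (use u S in auto)
  consider "xs = []" | p where "xs = [p]" | p q where "xs = [p, q]" | p q r ys where "xs = p # q # r # ys"
    by (metis list.exhaust)
  then show ?thesis
    by cases (use l u S in auto)
qed

lemma hw_real: "hw f A B (of_real r) \<Longrightarrow> ((\<lambda>r. f (of_real r)) has_derivative (\<lambda>h. of_real h * (A + B))) (at r)"
proof -
  assume "hw f A B (of_real r)"
  then have "(f has_derivative (\<lambda>h. A * h + B * cnj h)) (at (of_real r))" by (simp add: hw_def)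
  from has_derivative_compose[OF bounded_linear.has_derivative[OF bounded_linear_of_real has_derivative_ident] this]
  show ?thesis by (simp add: algebra_simps)
qed

lemma flow_root_tendsto:
  assumes x: "x \<in> \<H>"
  shows "((\<lambda>t. of_real \<xi> + flow_root t (x - of_real \<xi>)) \<longlongrightarrow> x) (nhds 0)"
proof -
  have "valid \<xi> PX (0, x, 0)" using x fdom_0[of \<xi>] by (simp add: fdom_def set_eq_iff upper_half_plane_def) blast
  from has_derivative_continuous[OF val_has_derivative_t[OF this]]
  have "isCont (\<lambda>t. flow_root t (x - of_real \<xi>)) 0" by simp
  then have "((\<lambda>t. flow_root t (x - of_real \<xi>)) \<longlongrightarrow> flow_root 0 (x - of_real \<xi>)) (nhds 0)"
    unfolding isCont_def using tendsto_at_iff_tendsto_nhds[of "\<lambda>t. flow_root t (x - of_real \<xi>)" 0] by (simp only:)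
  from tendsto_add[OF tendsto_const[of "of_real \<xi>"] this] show ?thesis by (simp add: flow_root_0'[OF x])
qed

context heat
begin

abbreviation moved where
  "moved N \<psi> t \<equiv> fprod_list (map (\<lambda>j. field_at (X j) (push_chart w N (\<psi> t) (id_chart w)) (z j)) [0..<n])"

text \<open>A test monomial has finitely many nodes, so for small t the nodes stay inside the pushed
  charts and their images off the test nodes.\<close>

lemma expect_moved:
  assumes flow: "local_flow (\<lambda>y. 1 / (complex_of_real \<xi> - y)) N \<epsilon> \<psi>" and N: "nodes \<subseteq> N"
    and ys: "set ys \<subseteq> outer" "Poly_Mapping.keys \<delta> \<subseteq> outer"
  shows "\<forall>\<^sub>F t in nhds 0. expect (moved N \<psi> t \<star> Poly_Mapping.single (mset ys, \<delta>) 1) = joint (gm (Qe (Qf t) (sr t)) (Me (Mf t))) \<delta> ys"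
proof -
  define B where "B = set ys \<union> Poly_Mapping.keys \<delta>"
  have B: "finite B" "B \<subseteq> outer" using ys by (auto simp: B_def)
  have "\<forall>\<^sub>F t in nhds 0. \<bar>t\<bar> < \<epsilon>"
    using eventually_nhds_in_open[of "{-\<epsilon><..<\<epsilon>}" 0] flow by (auto simp: local_flow_def elim!: eventually_mono)
  moreover have "\<forall>\<^sub>F t in nhds 0. \<forall>j\<in>{..<n}. z j \<in> chart_dom (push_chart w N (\<psi> t) (id_chart w))"
    by (rule eventually_ball_finite) (use N in \<open>auto intro!: eventually_push_dom[OF flow]\<close>)
  moreover have "\<forall>\<^sub>F t in nhds 0. \<forall>q\<in>B \<times> {..<n}. of_real \<xi> + flow_root t (z (snd q) - of_real \<xi>) \<in> - {node (fst q)}"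
  proof (rule eventually_ball_finite)
    show "\<forall>q\<in>B \<times> {..<n}. \<forall>\<^sub>F t in nhds 0. of_real \<xi> + flow_root t (z (snd q) - of_real \<xi>) \<in> - {node (fst q)}"
    proof
      fix q assume q: "q \<in> B \<times> {..<n}"
      then have "z (snd q) \<in> \<H>" "z (snd q) \<noteq> node (fst q)" using z_upper outer_node(3)[of "fst q" "snd q"] B by auto
      then show "\<forall>\<^sub>F t in nhds 0. of_real \<xi> + flow_root t (z (snd q) - of_real \<xi>) \<in> - {node (fst q)}"
        by (intro topological_tendstoD[OF flow_root_tendsto]) auto
    qed
  qed (use B in simp)
  ultimately show ?thesis
  proof eventually_elim
    case (elim t)
    note ch = flow_chart_push(1)[OF flow elim(1)]
    show ?case
    proof (rule expect_fields[OF ch _ B(2)])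
      show dom: "z j \<in> chart_dom (push_chart w N (\<psi> t) (id_chart w))" if "j < n" for j using elim(2) that by simp
      show "node g \<noteq> chart_par (push_chart w N (\<psi> t) (id_chart w)) (z j)" if "g \<in> B" "j < n" for g j
        unfolding c_par[OF ch dom[OF that(2)]] using elim(3) that by fastforce
    qed (auto simp: B_def)
  qed
qed

lemma coh_DJ: "coh DJ"
  unfolding DJ_def by (intro coh_conv coh_dg coh_gm Qe_sym Qf_sym dQ_sym)

lemma expect_lie:
  assumes L: "\<And>m. ev m L = \<Lambda> m" and ys: "set ys \<subseteq> outer" "Poly_Mapping.keys \<delta> \<subseteq> outer"
  shows "expect (L \<star> Poly_Mapping.single (mset ys, \<delta>) 1) = joint DJ \<delta> ys"
  by (rule expect_joint[OF coh_DJ _ ys]) (simp add: L \<Lambda>_joint)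

lemma moved_derivative:
  assumes L: "\<And>m. ev m L = \<Lambda> m" and flow: "local_flow (\<lambda>y. 1 / (complex_of_real \<xi> - y)) N \<epsilon> \<psi>" and N: "nodes \<subseteq> N"
    and \<Y>: "functional_on (\<H> - nodes) \<Y>"
  shows "((\<lambda>t. expect (moved N \<psi> t \<star> \<Y>)) has_vector_derivative expect (L \<star> \<Y>)) (at 0)"
proof -
  have "((\<lambda>t. expect (moved N \<psi> t \<star> Poly_Mapping.single q 1)) has_derivative (\<lambda>h. h *\<^sub>R expect (L \<star> Poly_Mapping.single q 1))) (at 0)"
    if q: "q \<in> Poly_Mapping.keys \<Y>" for q
  proof -
    obtain ys where ys: "mset ys = fst q" using ex_mset by blast
    have "g \<in># fst q \<or> g \<in> Poly_Mapping.keys (snd q) \<Longrightarrow> g \<in> outer" for g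
      using \<Y> q unfolding functional_on_def outer_def by blast
    then have o: "set ys \<subseteq> outer" "Poly_Mapping.keys (snd q) \<subseteq> outer" by (auto simp flip: ys)
    have "((\<lambda>t. expect (moved N \<psi> t \<star> Poly_Mapping.single (mset ys, snd q) 1)) has_derivative (\<lambda>h. h *\<^sub>R joint DJ (snd q) ys)) (at 0)"
      using joint_derivative[OF o] unfolding has_vector_derivative_def
      by (rule has_derivative_cong_nhds) (use expect_moved[OF flow N o] in eventually_elim, simp)
    then show ?thesis unfolding expect_lie[OF L o, symmetric] by (simp add: ys)
  qed
  then have "((\<lambda>t. lin \<Y> (\<lambda>q. expect (moved N \<psi> t \<star> Poly_Mapping.single q 1))) has_derivative
      (\<lambda>h. lin \<Y> (\<lambda>q. h *\<^sub>R expect (L \<star> Poly_Mapping.single q 1)))) (at 0)"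
    by (rule has_derivative_lin)
  then show ?thesis
    unfolding has_vector_derivative_def expect_eq_ev ev_fprod_right[of _ _ \<Y>] by (simp add: scaleR_conv_of_real lin_fun_scale)
qed

lemma exists_lie:
  assumes L: "\<And>m. ev m L = \<Lambda> m" "functional_on nodes L"
  shows "is_Lie_derivative w (\<lambda>y. 1 / (complex_of_real \<xi> - y)) n X (\<lambda>_. id_chart w) z L"
proof -
  obtain N \<epsilon> \<psi> where flow: "local_flow (\<lambda>y. 1 / (complex_of_real \<xi> - y)) N \<epsilon> \<psi>" and N: "nodes \<subseteq> N"
    using local_flow_exists[of nodes \<xi>] z_upper by blast
  have nd: "(\<lambda>j. chart_par (id_chart w) (z j)) ` {..<n} = nodes" by (simp add: id_chart_def)
  show ?thesis
    unfolding is_Lie_derivative_def Let_def nd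
    by (intro conjI exI[of _ N] exI[of _ \<epsilon>] exI[of _ \<psi>] allI impI L(2) flow N moved_derivative[OF L(1) flow N])
qed

text \<open>A Lie derivative is determined only in correlations with functionals in the half-plane,
  and the boundary insertion is not one of them. Its mean is admissible, however, so
  \<open>matching\<close> imitates it by sources on the finitely many jets that occur in L and
  L'.\<close>

lemma lie_unique:
  assumes L: "\<And>m. ev m L = \<Lambda> m" "functional_on nodes L"
    and L': "is_Lie_derivative w (\<lambda>y. 1 / (complex_of_real \<xi> - y)) n X (\<lambda>_. id_chart w) z L'"
    and m: "\<And>i. i < n \<Longrightarrow> adm (\<lambda>d. m (jt (i, d)))"
  shows "ev m L' = \<Lambda> m"
proof -
  have nd: "(\<lambda>j. chart_par (id_chart w) (z j)) ` {..<n} = nodes" by (simp add: id_chart_def)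
  obtain N \<epsilon> \<psi> where fL': "functional_on nodes L'" and flow: "local_flow (\<lambda>y. 1 / (complex_of_real \<xi> - y)) N \<epsilon> \<psi>" and N: "nodes \<subseteq> N"
    and der: "\<And>\<Y>. functional_on (\<H> - nodes) \<Y> \<Longrightarrow> ((\<lambda>t. expect (moved N \<psi> t \<star> \<Y>)) has_vector_derivative expect (L' \<star> \<Y>)) (at 0)"
    using L' unfolding is_Lie_derivative_def Let_def nd by blast
  define supp where "supp = (\<Union>p\<in>Poly_Mapping.keys L \<union> Poly_Mapping.keys L'. set_mset (fst p) \<union> Poly_Mapping.keys (snd p))"
  define A where "A = {d \<in> order_of ` supp. fst d = 0 \<or> snd d = 0}"
  have fin: "finite A" by (auto simp: A_def supp_def)
  have "nodes \<subseteq> chart_dom (id_chart w)" using z_upper by (auto simp: id_chart_def)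
  then have "\<exists>\<delta>. (\<forall>g\<in>Poly_Mapping.keys \<delta>. \<exists>y \<in> \<H> - chart_par (id_chart w) ` nodes. g = Jet id 0 0 y) \<and>
    (\<forall>\<zeta>\<in>nodes. \<forall>d\<in>A. lin \<delta> (pair_exp (cjet (id_chart w) \<zeta> d)) = m (Jet id (fst d) (snd d) \<zeta>))"
    by (intro matching[OF flow_chart_id[of \<xi>]] fin) (auto simp: A_def)
  then obtain \<delta> where d: "\<forall>g\<in>Poly_Mapping.keys \<delta>. \<exists>y \<in> \<H> - chart_par (id_chart w) ` nodes. g = Jet id 0 0 y"
    "\<forall>\<zeta>\<in>nodes. \<forall>d\<in>A. lin \<delta> (pair_exp (cjet (id_chart w) \<zeta> d)) = m (Jet id (fst d) (snd d) \<zeta>)" by (elim exE conjE)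
  have cj: "cjet (id_chart w) \<zeta> d = Jet id (fst d) (snd d) \<zeta>" "chart_par (id_chart w) ` S = S" for \<zeta> d S
    by (simp_all add: cjet_def id_chart_def case_prod_unfold)
  note \<delta> = d[unfolded cj]
  have out: "Poly_Mapping.keys \<delta> \<subseteq> outer" using \<delta>(1) by (auto simp: outer_def)
  have eq: "lin \<delta> (pair_exp g) = m g" if g: "g \<in> supp" for g
  proof -
    obtain i j k where g': "g = Jet id j k (z i)" "i < n"
    proof -
      obtain p where p: "p \<in> Poly_Mapping.keys L \<union> Poly_Mapping.keys L'" "g \<in># fst p \<or> g \<in> Poly_Mapping.keys (snd p)"
        using g unfolding supp_def by auto
      have "(\<forall>g\<in>#fst p. \<exists>j k y. y \<in> nodes \<and> g = Jet id j k y) \<and> (\<forall>g\<in>Poly_Mapping.keys (snd p). \<exists>y\<in>nodes. g = Jet id 0 0 y)"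
        using p(1) bspec[OF L(2)[unfolded functional_on_def], of p] bspec[OF fL'[unfolded functional_on_def], of p] by (elim UnE) simp_all
      then have "\<exists>j k y. y \<in> nodes \<and> g = Jet id j k y" using p(2) by blast
      then obtain j k y where "y \<in> nodes" "g = Jet id j k y" by blast
      then show thesis using that by auto
    qed
    show ?thesis
    proof (cases "j = 0 \<or> k = 0")
      case True
      then have "(j, k) \<in> A" using g g' by (force simp: A_def)
      then show ?thesis using \<delta>(2)[rule_format, of "z i" "(j, k)"] g' by simp
    next
      case False
      then obtain j' k' where jk: "j = Suc j'" "k = Suc k'" by (metis not0_implies_Suc)
      have "adm (\<lambda>d. lin \<delta> (\<lambda>h. pair_exp (jt (i, d)) h))"
      proof (rule adm_lin)
        fix h assume "h \<in> Poly_Mapping.keys \<delta>"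
        then obtain y where y: "h = Jet id 0 0 y" "y \<in> \<H>" "y \<notin> nodes" using \<delta>(1) by blast
        have "z i \<in> chart_dom (id_chart w)" using z_upper g' by (simp add: id_chart_def)
        moreover have "y \<noteq> z i" using y g' by auto
        ultimately show "adm (\<lambda>d. pair_exp (jt (i, d)) h)"
          using adm_source[OF flow_chart_id[of \<xi>], of "z i" y 0 0] y g'
          by (simp add: jt_def cj upper_half_plane_def del: pair_exp.simps) (simp add: id_chart_def)
      qed
      then show ?thesis using m[OF g'(2)] by (simp add: adm_def jt_def g' jk)
    qed
  qed
  have "functional_on (\<H> - nodes) (Poly_Mapping.single ({#}, \<delta>) 1)"
    using \<delta>(1) by (auto simp: functional_on_def)
  from vector_derivative_unique_at[OF der[OF this] moved_derivative[OF L(1) flow N this]]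
  have "ev (\<lambda>g. lin \<delta> (pair_exp g)) L' = ev (\<lambda>g. lin \<delta> (pair_exp g)) L" unfolding expect_exp_right .
  moreover have "ev (\<lambda>g. lin \<delta> (pair_exp g)) F = ev m F" if "F = L \<or> F = L'" for F
  proof (rule ev_cong, rule eq)
    fix p g assume "p \<in> Poly_Mapping.keys F" "g \<in># fst p \<or> g \<in> Poly_Mapping.keys (snd p)"
    then show "g \<in> supp" using that unfolding supp_def by blast
  qed
  ultimately show ?thesis using L(1) by metis
qed

text \<open>The insertion point x varies here, while \<xi> still fixes the flow. \<open>eins\<close>
  contains only the difference of its two points, so at x = \<xi> these are \<open>u0\<close>,
  \<open>u1\<close> and \<open>u2\<close>.\<close>

definition U0 where "U0 x p = 2 * of_real a * ej \<xi> eins (snd p) (0, 0) (0, z (fst p), of_real x)"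
definition U1 where "U1 x p = 2 * of_real a * (ej \<xi> eins (snd p) (1, 0) (0, z (fst p), of_real x) + ej \<xi> eins (snd p) (0, 1) (0, z (fst p), of_real x))"
definition U2 where "U2 x p = 2 * of_real a * (ej \<xi> eins (snd p) (2, 0) (0, z (fst p), of_real x) +
  2 * ej \<xi> eins (snd p) (1, 1) (0, z (fst p), of_real x) + ej \<xi> eins (snd p) (0, 2) (0, z (fst p), of_real x))"

lemma U_derivative:
  assumes "fst p < n"
  shows "((\<lambda>x. U0 x p) has_derivative (\<lambda>h. of_real h * U1 x p)) (at x)"
    and "((\<lambda>x. U1 x p) has_derivative (\<lambda>h. of_real h * U2 x p)) (at x)"
proof -
  have hw: "hw (\<lambda>y. ej \<xi> eins (snd p) (j, k) (0, z (fst p), y)) (ej \<xi> eins (snd p) (Suc j, k) (0, z (fst p), of_real x))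
      (ej \<xi> eins (snd p) (j, Suc k) (0, z (fst p), of_real x)) (of_real x)" for j k
    by (rule ej_hw_y[OF valid_eins_real[OF z_upper[OF assms]]])
  show "((\<lambda>x. U0 x p) has_derivative (\<lambda>h. of_real h * U1 x p)) (at x)"
    using hw_real[OF hw_scale[OF hw[of 0 0], of "2 * of_real a"]] by (simp add: U0_def U1_def distrib_left)
  show "((\<lambda>x. U1 x p) has_derivative (\<lambda>h. of_real h * U2 x p)) (at x)"
    using hw_real[OF hw_scale[OF hw_add[OF hw[of 1 0] hw[of 0 1]], of "2 * of_real a"]]
    by (simp add: U1_def U2_def numeral_2_eq_2 algebra_simps)
qed

abbreviation Gx where "Gx x \<equiv> gm (Qf 0) (\<lambda>p. U0 x p + Mf 0 p)"

lemma insertion_moments: "insertion_expect a x (fprod_list (map (\<lambda>j. field_at (X j) (id_chart w) (z j)) [0..<n])) = expansion (Gx x)"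
proof -
  let ?m = "\<lambda>g. \<i> * complex_of_real a * pair_exp (Bdry x) g"
  have j: "?m (cjet (id_chart w) (z i) d) = U0 x (i, d)" if "i < n" for i d
    using insertion_jet[OF z_upper[OF that], of a x "fst d" "snd d" \<xi>]
    by (simp add: cjet_def id_chart_def case_prod_unfold U0_def)
  have "ev ?m (fprod_list (map (\<lambda>j. field_at (X j) (id_chart w) (z j)) [0..<n])) =
    expansion (gm (Qf 0) (\<lambda>p. ?m (cjet (id_chart w) (z (fst p)) (snd p)) + Mf 0 p))"
  proof (rule ev_fields[OF flow_chart_id])
    show "z j \<in> chart_dom (id_chart w)" if "j < n" for j using z_upper that by (simp add: id_chart_def)
    show "adm (\<lambda>d. ?m (cjet (id_chart w) (z i) d))" if "i < n" for i
      unfolding j[OF that] U0_def fst_conv snd_conv by (intro adm_scale insertion_adm z_upper that)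
  qed (simp add: cjet_def id_chart_def)
  also have "\<dots> = expansion (Gx x)"
    by (rule expansion_cong, rule gm_cong) (use j in \<open>fastforce+\<close>)
  finally show ?thesis by (simp add: insertion_expect_eq_ev)
qed

text \<open>Only the mean depends on x, so each differentiation brings in a first-order variation
  with \<open>U1\<close>. Two of them combine to the covariance 2 \<open>U1\<close>
  \<open>U1\<close> by \<open>conv_dg_dg\<close>, and differentiating \<open>U1\<close> itself gives
  the mean \<open>U2\<close>.\<close>

lemma Gx_derivative:
  assumes "fst ` (Poly_Mapping.keys \<gamma> \<union> set zs) \<subseteq> {..<n}"
  shows "((\<lambda>x. Gx x \<gamma> zs) has_derivative (\<lambda>h. of_real h * conv (dg (\<lambda>_ _. 0) (U1 x)) (Gx x) \<gamma> zs)) (at x)"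
    and "((\<lambda>x. conv (dg (\<lambda>_ _. 0) (U1 x)) (Gx x) \<gamma> zs) has_derivative
      (\<lambda>h. of_real h * conv (dg (\<lambda>p q. 2 * U1 x p * U1 x q) (U2 x)) (Gx x) \<gamma> zs)) (at x)"
proof -
  have S: "set zs \<subseteq> {p. fst p < n}" "Poly_Mapping.keys \<gamma> \<subseteq> {p. fst p < n}" using assms by auto
  have dz: "dg (\<lambda>_ _. 0) (\<lambda>p. of_real h * u p) \<gamma> b = of_real h * dg (\<lambda>_ _. 0) u \<gamma> b" for h :: real and u b
    using dg_scale[of "of_real h" "\<lambda>_ _. 0" u \<gamma> b] by simp
  have d1: "((\<lambda>x. Gx x \<gamma> b) has_derivative (\<lambda>h. of_real h * conv (dg (\<lambda>_ _. 0) (U1 x)) (Gx x) \<gamma> b)) (at x)"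
    if b: "set b \<subseteq> {p. fst p < n}" for b
  proof -
    have "((\<lambda>x. Gx x \<gamma> b) has_derivative (\<lambda>h. conv (dg (\<lambda>_ _. 0) (\<lambda>p. of_real h * U1 x p)) (Gx x) \<gamma> b)) (at x)"
    proof (rule gm_has_derivative[OF _ _ _ b S(2)])
      fix p :: "nat \<times> nat \<times> nat" assume "p \<in> {p. fst p < n}"
      then show "((\<lambda>x. U0 x p + Mf 0 p) has_derivative (\<lambda>h. of_real h * U1 x p)) (at x)"
        using has_derivative_add[OF U_derivative(1)[of p x] has_derivative_const[of "Mf 0 p"]] by simp
    qed (auto intro: Qf_sym)
    then show ?thesis unfolding conv_def dz by (simp add: case_prod_unfold sum_list_const_mult[symmetric] mult.assoc)
  qed
  then show "((\<lambda>x. Gx x \<gamma> zs) has_derivative (\<lambda>h. of_real h * conv (dg (\<lambda>_ _. 0) (U1 x)) (Gx x) \<gamma> zs)) (at x)"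
    using S by blast
  have "((\<lambda>x. \<Sum>s\<leftarrow>splits zs. dg (\<lambda>_ _. 0) (U1 x) \<gamma> (fst s) * Gx x \<gamma> (snd s)) has_derivative
    (\<lambda>h. \<Sum>s\<leftarrow>splits zs. dg (\<lambda>_ _. 0) (U1 x) \<gamma> (fst s) * (of_real h * conv (dg (\<lambda>_ _. 0) (U1 x)) (Gx x) \<gamma> (snd s)) +
       dg (\<lambda>_ _. 0) (\<lambda>p. of_real h * U2 x p) \<gamma> (fst s) * Gx x \<gamma> (snd s))) (at x)"
  proof (intro has_derivative_sum_list has_derivative_mult)
    fix s assume "s \<in> set (splits zs)"
    then have s: "set (fst s) \<subseteq> {p. fst p < n}" "set (snd s) \<subseteq> {p. fst p < n}"
      using splits_set[of "fst s" "snd s" zs] S by auto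
    show "((\<lambda>x. dg (\<lambda>_ _. 0) (U1 x) \<gamma> (fst s)) has_derivative (\<lambda>h. dg (\<lambda>_ _. 0) (\<lambda>p. of_real h * U2 x p) \<gamma> (fst s))) (at x)"
      by (rule dg_mean_has_derivative[OF _ s(1) S(2)]) (simp add: U_derivative(2))
    show "((\<lambda>x. Gx x \<gamma> (snd s)) has_derivative (\<lambda>h. of_real h * conv (dg (\<lambda>_ _. 0) (U1 x)) (Gx x) \<gamma> (snd s))) (at x)"
      by (rule d1[OF s(2)])
  qed
  moreover have "(\<Sum>s\<leftarrow>splits zs. dg (\<lambda>_ _. 0) (U1 x) \<gamma> (fst s) * (of_real h * conv (dg (\<lambda>_ _. 0) (U1 x)) (Gx x) \<gamma> (snd s)) +
       dg (\<lambda>_ _. 0) (\<lambda>p. of_real h * U2 x p) \<gamma> (fst s) * Gx x \<gamma> (snd s)) =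
       of_real h * conv (dg (\<lambda>p q. 2 * U1 x p * U1 x q) (U2 x)) (Gx x) \<gamma> zs" for h :: real
  proof -
    have coh: "coh (dg (\<lambda>_ _. 0) (U1 x))" "coh (Gx x)" by (intro coh_dg coh_gm Qf_sym; simp)+
    have "conv (dg (\<lambda>p q. 2 * U1 x p * U1 x q) (U2 x)) (Gx x) \<gamma> zs =
      conv (dg (\<lambda>p q. 2 * U1 x p * U1 x q) (\<lambda>_. 0)) (Gx x) \<gamma> zs + conv (dg (\<lambda>_ _. 0) (U2 x)) (Gx x) \<gamma> zs"
      using dg_add[of "\<lambda>p q. 2 * U1 x p * U1 x q" "\<lambda>_ _. 0" "\<lambda>_. 0" "U2 x" \<gamma>]
      by (simp add: conv_def case_prod_unfold distrib_right sum_list_addf)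
    also have "conv (dg (\<lambda>p q. 2 * U1 x p * U1 x q) (\<lambda>_. 0)) (Gx x) \<gamma> zs =
      conv (conv (dg (\<lambda>_ _. 0) (U1 x)) (dg (\<lambda>_ _. 0) (U1 x))) (Gx x) \<gamma> zs"
      by (simp add: conv_def[of "dg (\<lambda>p q. 2 * U1 x p * U1 x q) (\<lambda>_. 0)"] conv_def[of "conv (dg (\<lambda>_ _. 0) (U1 x)) (dg (\<lambda>_ _. 0) (U1 x))"] conv_dg_dg)
    also have "\<dots> = conv (dg (\<lambda>_ _. 0) (U1 x)) (conv (dg (\<lambda>_ _. 0) (U1 x)) (Gx x)) \<gamma> zs"
      by (rule conv_assoc[OF coh(1) coh])
    finally show ?thesis
      unfolding dz by (simp add: conv_def[of _ "conv (dg (\<lambda>_ _. 0) (U1 x)) (Gx x)"] conv_def[of "dg (\<lambda>_ _. 0) (U2 x)"]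
        case_prod_unfold sum_list_addf distrib_left sum_list_const_mult[symmetric] mult_ac)
  qed
  ultimately show "((\<lambda>x. conv (dg (\<lambda>_ _. 0) (U1 x)) (Gx x) \<gamma> zs) has_derivative
      (\<lambda>h. of_real h * conv (dg (\<lambda>p q. 2 * U1 x p * U1 x q) (U2 x)) (Gx x) \<gamma> zs)) (at x)"
    by (simp add: conv_def[of "dg (\<lambda>_ _. 0) (U1 _)"] case_prod_unfold)
qed

lemma expansion_derivative:
  assumes "\<And>\<gamma> zs. fst ` (Poly_Mapping.keys \<gamma> \<union> set zs) \<subseteq> {..<n} \<Longrightarrow> ((\<lambda>x. \<Phi> x \<gamma> zs) has_derivative (\<lambda>h. of_real h * \<Phi>' \<gamma> zs)) (at x)"
  shows "((\<lambda>x. expansion (\<Phi> x)) has_vector_derivative expansion \<Phi>') (at x)"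
proof -
  have "((\<lambda>x. \<Sum>l\<leftarrow>choices T [0..<n]. fst l * \<Phi> x (fst (snd l)) (snd (snd l))) has_derivative
     (\<lambda>h. \<Sum>l\<leftarrow>choices T [0..<n]. fst l * (of_real h * \<Phi>' (fst (snd l)) (snd (snd l))))) (at x)"
  proof (intro has_derivative_sum_list has_derivative_mult_right assms)
    fix l assume "l \<in> set (choices T [0..<n])"
    then show "fst ` (Poly_Mapping.keys (fst (snd l)) \<union> set (snd (snd l))) \<subseteq> {..<n}"
      using choices_subset[of "fst l" "fst (snd l)" "snd (snd l)" T "[0..<n]"] by auto
  qed
  then show ?thesis
    unfolding has_vector_derivative_def expansion_def case_prod_unfold
    by (simp add: scaleR_conv_of_real sum_list_const_mult[symmetric] mult.left_commute)
qed

text \<open>The factor 1 / (2 a^2) passes into the variations of covariance and mean. The first then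
  is \<open>dQ\<close> by definition, and the second is the transported mean by
  \<open>vact_insertion\<close>.\<close>

lemma heat_equation:
  "of_real (1 / (2 * a\<^sup>2)) * expansion (conv (dg (\<lambda>p q. 2 * U1 \<xi> p * U1 \<xi> q) (U2 \<xi>)) (Gx \<xi>)) =
    \<Lambda> (\<lambda>g. \<i> * complex_of_real a * pair_exp (Bdry \<xi>) g)"
proof -
  let ?c = "of_real (1 / (2 * a\<^sup>2)) :: complex"
  have "?c * expansion (conv (dg (\<lambda>p q. 2 * U1 \<xi> p * U1 \<xi> q) (U2 \<xi>)) (Gx \<xi>)) =
    expansion (conv (dg (\<lambda>p q. ?c * (2 * U1 \<xi> p * U1 \<xi> q)) (\<lambda>p. ?c * U2 \<xi> p)) (Gx \<xi>))"
    unfolding conv_def dg_scale expansion_def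
    by (simp add: case_prod_unfold sum_list_const_mult[symmetric] mult_ac)
  also have "\<dots> = \<Lambda> (\<lambda>g. \<i> * complex_of_real a * pair_exp (Bdry \<xi>) g)"
    unfolding \<Lambda>_def
  proof (rule expansion_cong, rule conv_dg_gm_cong[where S = "{p. fst p < n}"])
    fix p :: "nat \<times> nat \<times> nat" assume "p \<in> {p. fst p < n}"
    then have p: "fst p < n" by simp
    have j: "\<i> * complex_of_real a * pair_exp (Bdry \<xi>) (jt (fst p, d)) = u0 \<xi> a (z (fst p)) d" for d
      using insertion_jet[OF z_upper[OF p], of a \<xi> "fst d" "snd d" \<xi>] by (simp add: jt_def u0_def)
    show "?c * U2 \<xi> p = lie_mean (\<lambda>g. \<i> * complex_of_real a * pair_exp (Bdry \<xi>) g) p"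
      unfolding lie_mean_def j dM_def vact_insertion[OF a z_upper[OF p]] by (simp add: U2_def u2_def)
    show "U0 \<xi> p + Mf 0 p = \<i> * complex_of_real a * pair_exp (Bdry \<xi>) (jt p) + Mf 0 p"
      using j[of "snd p"] unfolding U0_def u0_def prod.collapse by (simp only:)
    fix q
    show "?c * (2 * U1 \<xi> p * U1 \<xi> q) = dQ p q"
      using a(1) by (simp add: dQ_def U1_def u1_def)
  qed auto
  finally show ?thesis .
qed

lemma main:
  "(\<exists>L. is_Lie_derivative w (\<lambda>y. 1 / (complex_of_real \<xi> - y)) n X (\<lambda>_. id_chart w) z L) \<and>
    (\<forall>L. is_Lie_derivative w (\<lambda>y. 1 / (complex_of_real \<xi> - y)) n X (\<lambda>_. id_chart w) z L \<longrightarrow>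
      (\<exists>D D2. (\<forall>x. ((\<lambda>x. insertion_expect a x (fprod_list (map (\<lambda>j. field_at (X j) (id_chart w) (z j)) [0..<n])))
                 has_vector_derivative D x) (at x)) \<and>
              (D has_vector_derivative D2) (at \<xi>) \<and>
              complex_of_real (1 / (2 * a\<^sup>2)) * D2 = insertion_expect a \<xi> L))"
proof -
  obtain L where L: "functional_on nodes L" "\<And>m. ev m L = \<Lambda> m" using evaluable_\<Lambda> unfolding evaluable_def by blast
  have "is_Lie_derivative w (\<lambda>y. 1 / (complex_of_real \<xi> - y)) n X (\<lambda>_. id_chart w) z L" by (rule exists_lie[OF L(2,1)])
  moreover have "\<exists>D D2. (\<forall>x. ((\<lambda>x. insertion_expect a x (fprod_list (map (\<lambda>j. field_at (X j) (id_chart w) (z j)) [0..<n])))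
                 has_vector_derivative D x) (at x)) \<and>
              (D has_vector_derivative D2) (at \<xi>) \<and>
              complex_of_real (1 / (2 * a\<^sup>2)) * D2 = insertion_expect a \<xi> L'"
    if L': "is_Lie_derivative w (\<lambda>y. 1 / (complex_of_real \<xi> - y)) n X (\<lambda>_. id_chart w) z L'" for L'
  proof (intro exI conjI allI)
    show "((\<lambda>x. insertion_expect a x (fprod_list (map (\<lambda>j. field_at (X j) (id_chart w) (z j)) [0..<n])))
       has_vector_derivative expansion (conv (dg (\<lambda>_ _. 0) (U1 x)) (Gx x))) (at x)" for x
      unfolding insertion_moments by (rule expansion_derivative) (rule Gx_derivative(1))
    show "((\<lambda>x. expansion (conv (dg (\<lambda>_ _. 0) (U1 x)) (Gx x))) has_vector_derivative
       expansion (conv (dg (\<lambda>p q. 2 * U1 \<xi> p * U1 \<xi> q) (U2 \<xi>)) (Gx \<xi>))) (at \<xi>)"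
      by (rule expansion_derivative) (rule Gx_derivative(2))
    have "ev (\<lambda>g. \<i> * complex_of_real a * pair_exp (Bdry \<xi>) g) L' = \<Lambda> (\<lambda>g. \<i> * complex_of_real a * pair_exp (Bdry \<xi>) g)"
    proof (rule lie_unique[OF L(2,1) L'])
      fix i assume i: "i < n"
      have "\<i> * complex_of_real a * pair_exp (Bdry \<xi>) (jt (i, d)) = 2 * of_real a * ej \<xi> eins d (0, 0) (0, z i, of_real \<xi>)" for d
        using insertion_jet[OF z_upper[OF i], of a \<xi> "fst d" "snd d" \<xi>] by (simp add: jt_def)
      then show "adm (\<lambda>d. \<i> * complex_of_real a * pair_exp (Bdry \<xi>) (jt (i, d)))"
        by (simp only:) (intro adm_scale insertion_adm z_upper i)
    qed
    then show "of_real (1 / (2 * a\<^sup>2)) * expansion (conv (dg (\<lambda>p q. 2 * U1 \<xi> p * U1 \<xi> q) (U2 \<xi>)) (Gx \<xi>)) = insertion_expect a \<xi> L'"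
      unfolding heat_equation insertion_expect_eq_ev by simp
  qed
  ultimately show ?thesis by blast
qed

end

theorem proposition14p2:
  fixes a b :: real and w :: "complex \<Rightarrow> complex" and n :: nat
    and X :: "nat \<Rightarrow> field" and z :: "nat \<Rightarrow> complex" and \<xi> :: real
  assumes "a > 0" and "2 * a * (a + b) = 1"
    and "conformal_fixing_infinity w"
    and "\<And>j. j < n \<Longrightarrow> X j \<in> ope_family w b"
    and "\<And>j. j < n \<Longrightarrow> z j \<in> \<H>"
    and "inj_on z {..<n}"
  defines "v \<equiv> (\<lambda>y. 1 / (complex_of_real \<xi> - y))"
    and "XX \<equiv> fprod_list (map (\<lambda>j. field_at (X j) (id_chart w) (z j)) [0..<n])"
  shows "(\<exists>L. is_Lie_derivative w v n X (\<lambda>_. id_chart w) z L) \<and>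
    (\<forall>L. is_Lie_derivative w v n X (\<lambda>_. id_chart w) z L \<longrightarrow>
      (\<exists>D D2. (\<forall>x. ((\<lambda>x. insertion_expect a x XX) has_vector_derivative D x) (at x)) \<and>
              (D has_vector_derivative D2) (at \<xi>) \<and>
              complex_of_real (1 / (2 * a\<^sup>2)) * D2 = insertion_expect a \<xi> L))"
proof -
  obtain c where c: "c > 0" "\<And>z. z \<in> \<H> \<Longrightarrow> (w has_field_derivative of_real c) (at z)"
    using affine_of_conformal[OF assms(3)] by blast
  have "\<forall>j. \<exists>T. j < n \<longrightarrow> good \<xi> w b (X j) T" using good_family[OF assms(4)] by blast
  then obtain T where T: "\<And>j. j < n \<Longrightarrow> good \<xi> w b (X j) (T j)" by metis
  interpret heat w c \<xi> b n X z T a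
    by unfold_locales (use c T assms in auto)
  show ?thesis unfolding v_def XX_def by (rule main)
qed

end
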